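(* Let $-\infty<a<b<\infty$, let $H:(a,b)\to\mathbb C^{2n\times 2n}$ be measurable, $H\ge0$ a.e., $H\in L^1(a,b)$, $H$ definite on $(a,b)$; let $\alpha,\beta\in\mathbb C^{n\times 2n}$ with $\alpha\alpha^*=I=\beta\beta^*$, $\alpha J\alpha^*=0=\beta J\beta^*$, and $\mathcal S^{\alpha,\beta}=\{(f,g)\in\mathcal T:\alpha f_0(a)=0=\beta f_0(b)\}$. Let $u,v$ be the matrix solutions of $Ju'=-zHu$ with $u(a,z)=-J\alpha^*$, $v(a,z)=\alpha^*$, let $m(z)=-(\beta u(b,z))^{-1}\beta v(b,z)$ (a Herglotz function on $\mathbb C^+$), and let $$m(z)=A+Bz+\int_{-\infty}^\infty\Big(\frac1{t-z}-\frac{t}{t^2+1}\Big)d\rho(t)$$ be its Herglotz representation ($A=A^*$, $B\ge0$, $\rho$ a nonnegative $n\times n$ matrix-valued Borel measure with $\int\frac{d\rho(t)}{1+t^2}<\infty$). Define $(Uh)(t)=\int_a^b u(x,t)^*H(x)h(x)\,dx$ for $h\in L_H^2(a,b)$. Then $U:L_H^2(a,b)\to L^2(\rho)$ is a spectral representation of $\mathcal S^{\alpha,\beta}$. Moreover, if $t_j$ is an eigenvalue of $\mathcal S^{\alpha,\beta}$ of multiplicity $M(j)$ and $\varphi_{jk}$, $k=1,\dots,M(j)$, are orthonormal eigenvectors for $t_j$, chosen to be solutions of $J\varphi'=-t_jH\varphi$ and written as $\varphi_{jk}(x)=u(x,t_j)c_{jk}$ with $c_{jk}\in\mathbb C^n$,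 then $\rho(\{t_j\})=\sum_{k=1}^{M(j)}c_{jk}c_{jk}^*$.
   Context: $J=\begin{pmatrix}0&-I_n\\ I_n&0\end{pmatrix}$. $H$ definite: $H(x)v=0$ a.e. implies $v=0$. $L_H^2(a,b)$: measurable $f$ with $\int_a^b f^*Hf<\infty$ modulo null functions. Maximal relation $\mathcal T=\{(f,g)\in L_H^2(a,b)^2: f$ has an absolutely continuous representative $f_0$ with $Jf_0'=-Hg$ a.e.$\}$. $\mathcal S^{\alpha,\beta}$ is self-adjoint; its multivalued part is $\mathcal S^{\alpha,\beta}(0)=\{g:(0,g)\in\mathcal S^{\alpha,\beta}\}$ and its operator part is the self-adjoint operator in $\overline{D(\mathcal S^{\alpha,\beta})}$ with graph $\mathcal S^{\alpha,\beta}\cap(\overline{D}\oplus\overline{D})$. $L^2(\rho)$ for a matrix measure $\rho$ is the space of Borel $F:\mathbb R\to\mathbb C^n$ with $\int F^*d\rho F<\infty$ modulo null functions. A spectral representation of a self-adjoint relation $\mathcal S$ in $\mathcal H$ is a linear map $U:\mathcal H\to L^2(\rho)$ mapping $\overline{D(\mathcal S)}$ isometrically onto $L^2(\rho)$, with $\ker U=\mathcal S(0)$ and $U\mathcal SU^*=M_t$ (multiplication by the variable $t$). *)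

theory Defs
  imports "HOL-Analysis.Analysis"
begin

text \<open>C^n is complex^'n, C^(2n) is complex^('n+'n): the left summand indexes the first
  block of coordinates, the right summand the second block.\<close>

definition Jmat :: "complex^('n::finite + 'n)^('n + 'n)" where
  "Jmat = (\<chi> i j. case (i, j) of
              (Inl p, Inr q) \<Rightarrow> (if p = q then -1 else 0)
            | (Inr p, Inl q) \<Rightarrow> (if p = q then 1 else 0)
            | _ \<Rightarrow> 0)"

definition adjm :: "complex^'m^'k \<Rightarrow> complex^'k^'m" where
  "adjm A = (\<chi> i j. cnj (A $ j $ i))"

definition cdot :: "complex^'m \<Rightarrow> complex^'m \<Rightarrow> complex" where
  "cdot y x = (\<Sum>i\<in>UNIV. cnj (y $ i) * x $ i)"

definition hform :: "complex^'m \<Rightarrow> complex^'m^'m \<Rightarrow> complex^'m \<Rightarrow> complex" where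
  "hform y M x = cdot y (M *v x)"

text \<open>M \<ge> 0 (positive semidefinite; over C this includes hermiticity)\<close>
definition psd :: "complex^'m^'m \<Rightarrow> bool" where
  "psd M \<longleftrightarrow> (\<forall>x. Im (hform x M x) = 0 \<and> Re (hform x M x) \<ge> 0)"

definition smat :: "complex \<Rightarrow> complex^'m^'k \<Rightarrow> complex^'m^'k" (infixr "*sm" 75) where
  "c *sm M = (\<chi> i j. c * M $ i $ j)"

definition outer :: "complex^'m \<Rightarrow> complex^'m^'m" where
  "outer c = (\<chi> i j. c $ i * cnj (c $ j))"

definition AC_on :: "real \<Rightarrow> real \<Rightarrow> (real \<Rightarrow> 'v::real_normed_vector) \<Rightarrow> bool" where
  "AC_on a b f \<longleftrightarrow>
    (\<forall>\<epsilon>>0. \<exists>\<delta>>0. \<forall>(N::nat) (s::nat \<Rightarrow> real) (t::nat \<Rightarrow> real).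
       (\<forall>k<N. a \<le> s k \<and> s k \<le> t k \<and> t k \<le> b) \<and>
       (\<forall>k<N. \<forall>l<N. k \<noteq> l \<longrightarrow> t k \<le> s l \<or> t l \<le> s k) \<and>
       (\<Sum>k<N. t k - s k) < \<delta>
       \<longrightarrow> (\<Sum>k<N. norm (f (t k) - f (s k))) < \<epsilon>)"

definition L2H :: "real \<Rightarrow> real \<Rightarrow> (real \<Rightarrow> complex^'m^'m) \<Rightarrow> (real \<Rightarrow> complex^'m) set" where
  "L2H a b H = {f. set_borel_measurable lebesgue {a<..<b} f \<and>
                   set_integrable lebesgue {a<..<b} (\<lambda>x. hform (f x) (H x) (f x))}"

definition ipH :: "real \<Rightarrow> real \<Rightarrow> (real \<Rightarrow> complex^'m^'m) \<Rightarrow> (real \<Rightarrow> complex^'m) \<Rightarrow> (real \<Rightarrow> complex^'m) \<Rightarrow> complex" where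
  "ipH a b H f g = (LINT x:{a<..<b}|lebesgue. hform (g x) (H x) (f x))"

definition nullH :: "real \<Rightarrow> real \<Rightarrow> (real \<Rightarrow> complex^'m^'m) \<Rightarrow> (real \<Rightarrow> complex^'m) \<Rightarrow> bool" where
  "nullH a b H f \<longleftrightarrow> f \<in> L2H a b H \<and> ipH a b H f f = 0"

definition acrep :: "real \<Rightarrow> real \<Rightarrow> (real \<Rightarrow> complex^('n::finite+'n)^('n+'n))
   \<Rightarrow> (real \<Rightarrow> complex^('n+'n)) \<Rightarrow> (real \<Rightarrow> complex^('n+'n)) \<Rightarrow> (real \<Rightarrow> complex^('n+'n)) \<Rightarrow> bool" where
  "acrep a b H f g f0 \<longleftrightarrow> AC_on a b f0 \<and> nullH a b H (\<lambda>x. f x - f0 x) \<and>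
     (AE x in lebesgue. x \<in> {a<..<b} \<longrightarrow>
        (\<exists>D. (f0 has_vector_derivative D) (at x) \<and> Jmat *v D = - (H x *v g x)))"

definition maxrel :: "real \<Rightarrow> real \<Rightarrow> (real \<Rightarrow> complex^('n::finite+'n)^('n+'n))
   \<Rightarrow> ((real \<Rightarrow> complex^('n+'n)) \<times> (real \<Rightarrow> complex^('n+'n))) set" where
  "maxrel a b H = {(f, g). f \<in> L2H a b H \<and> g \<in> L2H a b H \<and> (\<exists>f0. acrep a b H f g f0)}"

definition Srel :: "real \<Rightarrow> real \<Rightarrow> (real \<Rightarrow> complex^('n::finite+'n)^('n+'n))
   \<Rightarrow> complex^('n+'n)^'n \<Rightarrow> complex^('n+'n)^'n
   \<Rightarrow> ((real \<Rightarrow> complex^('n+'n)) \<times> (real \<Rightarrow> complex^('n+'n))) set" where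
  "Srel a b H \<alpha> \<beta> = {(f, g). (f, g) \<in> maxrel a b H \<and>
      (\<exists>f0. acrep a b H f g f0 \<and> \<alpha> *v f0 a = 0 \<and> \<beta> *v f0 b = 0)}"

text \<open>A nonnegative n x n matrix measure rho is represented as rho = W mu, where mu is a
  measure on the Borel sets of R and W a Borel measurable psd-matrix-valued density;
  so rho(D) = int_D W dmu and int F^* d rho F = int F^* W F dmu.\<close>

definition rho_mat :: "real measure \<Rightarrow> (real \<Rightarrow> complex^'m^'m) \<Rightarrow> real set \<Rightarrow> complex^'m^'m" where
  "rho_mat \<mu> W \<Delta> = (\<chi> i j. LINT t:\<Delta>|\<mu>. W t $ i $ j)"

definition L2rho :: "real measure \<Rightarrow> (real \<Rightarrow> complex^'m^'m) \<Rightarrow> (real \<Rightarrow> complex^'m) set" where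
  "L2rho \<mu> W = {F. F \<in> borel_measurable borel \<and> integrable \<mu> (\<lambda>t. hform (F t) (W t) (F t))}"

definition ipR :: "real measure \<Rightarrow> (real \<Rightarrow> complex^'m^'m) \<Rightarrow> (real \<Rightarrow> complex^'m) \<Rightarrow> (real \<Rightarrow> complex^'m) \<Rightarrow> complex" where
  "ipR \<mu> W F G = (\<integral>t. hform (G t) (W t) (F t) \<partial>\<mu>)"

definition nullR :: "real measure \<Rightarrow> (real \<Rightarrow> complex^'m^'m) \<Rightarrow> (real \<Rightarrow> complex^'m) \<Rightarrow> bool" where
  "nullR \<mu> W F \<longleftrightarrow> F \<in> L2rho \<mu> W \<and> ipR \<mu> W F F = 0"

definition eqR :: "real measure \<Rightarrow> (real \<Rightarrow> complex^'m^'m) \<Rightarrow> (real \<Rightarrow> complex^'m) \<Rightarrow> (real \<Rightarrow> complex^'m) \<Rightarrow> bool" where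
  "eqR \<mu> W F G \<longleftrightarrow> nullR \<mu> W (\<lambda>t. F t - G t)"

definition herg_int :: "real measure \<Rightarrow> (real \<Rightarrow> complex^'m^'m) \<Rightarrow> complex \<Rightarrow> complex^'m^'m" where
  "herg_int \<mu> W z = (\<chi> i j. \<integral>t. (1 / (complex_of_real t - z) - complex_of_real (t / (t\<^sup>2 + 1))) * W t $ i $ j \<partial>\<mu>)"

definition closD :: "real \<Rightarrow> real \<Rightarrow> (real \<Rightarrow> complex^'m^'m)
    \<Rightarrow> ((real \<Rightarrow> complex^'m) \<times> (real \<Rightarrow> complex^'m)) set \<Rightarrow> (real \<Rightarrow> complex^'m) set" where
  "closD a b H S = {h \<in> L2H a b H. \<forall>\<epsilon>>0. \<exists>f g. (f, g) \<in> S \<and>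
       sqrt (Re (ipH a b H (\<lambda>x. h x - f x) (\<lambda>x. h x - f x))) < \<epsilon>}"

definition adjrel :: "real \<Rightarrow> real \<Rightarrow> (real \<Rightarrow> complex^'m^'m) \<Rightarrow> real measure \<Rightarrow> (real \<Rightarrow> complex^'k^'k)
    \<Rightarrow> ((real \<Rightarrow> complex^'m) \<Rightarrow> (real \<Rightarrow> complex^'k)) \<Rightarrow> (real \<Rightarrow> complex^'k) \<Rightarrow> (real \<Rightarrow> complex^'m) \<Rightarrow> bool" where
  "adjrel a b H \<mu> W U F h \<longleftrightarrow> h \<in> L2H a b H \<and> (\<forall>k \<in> L2H a b H. ipH a b H h k = ipR \<mu> W F (U k))"

text \<open>U is a spectral representation of the self-adjoint relation S in L^2_H(a,b):
  U is a well-defined linear map L^2_H \<rightarrow> L^2(rho), isometric on the closure of D(S)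
  and onto L^2(rho) from there, ker U = S(0), and U S U^* = M_t (as relations in L^2(rho)).\<close>
definition spectral_rep :: "real \<Rightarrow> real \<Rightarrow> (real \<Rightarrow> complex^'m^'m)
    \<Rightarrow> ((real \<Rightarrow> complex^'m) \<times> (real \<Rightarrow> complex^'m)) set
    \<Rightarrow> real measure \<Rightarrow> (real \<Rightarrow> complex^'k^'k) \<Rightarrow> ((real \<Rightarrow> complex^'m) \<Rightarrow> (real \<Rightarrow> complex^'k)) \<Rightarrow> bool" where
  "spectral_rep a b H S \<mu> W U \<longleftrightarrow>
     (\<forall>h \<in> L2H a b H. U h \<in> L2rho \<mu> W) \<and>
     (\<forall>h \<in> L2H a b H. \<forall>h' \<in> L2H a b H. nullH a b H (\<lambda>x. h x - h' x) \<longrightarrow> eqR \<mu> W (U h) (U h')) \<and>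
     (\<forall>h \<in> L2H a b H. \<forall>k \<in> L2H a b H. \<forall>c. eqR \<mu> W (U (\<lambda>x. c *s h x + k x)) (\<lambda>t. c *s U h t + U k t)) \<and>
     (\<forall>h \<in> closD a b H S. ipR \<mu> W (U h) (U h) = ipH a b H h h) \<and>
     (\<forall>F \<in> L2rho \<mu> W. \<exists>h \<in> closD a b H S. eqR \<mu> W (U h) F) \<and>
     (\<forall>h \<in> L2H a b H. nullR \<mu> W (U h) \<longleftrightarrow> ((\<lambda>x. 0), h) \<in> S) \<and>
     (\<forall>F \<in> L2rho \<mu> W. \<forall>G \<in> L2rho \<mu> W.
        (\<exists>h g. adjrel a b H \<mu> W U F h \<and> (h, g) \<in> S \<and> eqR \<mu> W (U g) G)
        \<longleftrightarrow> eqR \<mu> W G (\<lambda>t. complex_of_real t *s F t))"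

definition Uop :: "real \<Rightarrow> real \<Rightarrow> (real \<Rightarrow> complex^'m^'m) \<Rightarrow> (real \<Rightarrow> complex \<Rightarrow> complex^'k^'m)
    \<Rightarrow> (real \<Rightarrow> complex^'m) \<Rightarrow> (real \<Rightarrow> complex^'k)" where
  "Uop a b H u h = (\<lambda>t. LINT x:{a<..<b}|lebesgue. adjm (u x (complex_of_real t)) *v (H x *v h x))"

end

theory Submission
  imports Defs
begin

text \<open>
  Write \<open>P(z) = \<beta> u(b,z)\<close> and \<open>\<psi>(w) = v(w) + u(w) m(w)\<close>, so that \<open>\<beta> \<psi>(b,w) = 0\<close>.

  The measure \<open>\<rho>\<close> lives on the zeros of \<open>P\<close>, in the sense that \<open>d\<rho> P\<^sup>* = 0\<close>: \<open>P m\<close> is regular and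
  \<open>P(z) m(z) P(z)\<^sup>*\<close> is hermitian on the real line, and a Poisson kernel estimate turns this into an
  \<open>O(y\<^sup>2)\<close> bound for \<open>P d\<rho> P\<^sup>*\<close> on intervals of length \<open>y\<close>. Modulo functions of the form \<open>P\<^sup>* e\<close>, Lagrange's identity gives
  \<open>U g = t U f\<close> for \<open>(f, g)\<close> in the relation, and \<open>U \<psi>(w) c = c / (t - w)\<close>. The Herglotz
  representation then says that \<open>U\<close> preserves inner products of Weyl solutions up to the form of
  \<open>B\<close>, which cancels in differences \<open>\<psi>(w) c - \<psi>(\<i>) c\<close>. These differences span a dense
  subspace of the closed domain: a function orthogonal to all Weyl solutions lies in a subspace
  on which the inverse relation acts as a symmetric Volterra operator, and a
  symmetric quasinilpotent operator vanishes. The images \<open>c / (t - w) - c / (t - \<i>)\<close> span a dense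
  subspace of \<open>L\<^sup>2(\<rho>)\<close>, because \<open>\<rho>\<close> is carried by the countably many eigenvalues and its atoms
  are reached by letting \<open>w\<close> tend to them.
\<close>

section \<open>Linear algebra over the complex numbers\<close>

text \<open>Since \<open>H x\<close> may be singular, functions are handled through a seminorm and
  through \<open>H x *v f x\<close>, never through classes, and completeness has to be shown for
  this seminorm. \<open>m\<close> is at hand only for \<open>Im z > 0\<close>, and only Lipschitz
  dependence of \<open>P\<close> and \<open>Q\<close> on \<open>z\<close> enters, so real points are
  reached as limits from above. The \<open>O(y\<^sup>2)\<close> bound arises at
  \<open>z = s + \<i> y\<close>: from \<open>s\<close> to \<open>s + y\<close> the Poisson kernel is
  at least \<open>1 / (2 y)\<close>, while \<open>P m P\<^sup>* = - Q P\<^sup>*\<close> has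
  imaginary part \<open>O(y)\<close>; replacing \<open>P t\<close> by \<open>P z\<close> costs
  another \<open>O(y\<^sup>2)\<close>. An additive interval function of this size vanishes by
  subdivision. The form of \<open>B\<close> records the component of a Weyl solution in the
  multivalued part of \<open>S\<close>: the transform kills that component, and it depends on
  \<open>c\<close> only, because a difference with equal \<open>c\<close> lies in the domain. The
  quasinilpotent step plays two rates against each other: symmetry makes the squared norms of
  iterates log-convex, so they decay at most geometrically unless they vanish, whereas the Volterra
  structure makes them decay faster than any geometric sequence.\<close>

lemma cdot_add_right: "cdot x (y + z) = cdot x y + cdot x z"
  by (simp add: cdot_def algebra_simps sum.distrib)

lemma cdot_add_left: "cdot (x + y) z = cdot x z + cdot y z"
  by (simp add: cdot_def algebra_simps sum.distrib)

lemma cdot_scale_right: "cdot x (c *s y) = c * cdot x y"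
  by (simp add: cdot_def sum_distrib_left algebra_simps)

lemma cdot_scale_left: "cdot (c *s x) y = cnj c * cdot x y"
  by (simp add: cdot_def sum_distrib_left algebra_simps)

lemma scaleR_eq_scale: "r *\<^sub>R (x :: complex^'m) = complex_of_real r *s x"
  by (simp add: vec_eq_iff complex_eq_iff)

lemma scaleR_matrix_vector: "(r *\<^sub>R (A :: complex^'m^'k)) *v x = r *\<^sub>R (A *v x)"
  by (simp add: vec_eq_iff matrix_vector_mult_def scaleR_sum_right)

lemma cdot_zero_right [simp]: "cdot x 0 = 0" and cdot_zero_left [simp]: "cdot 0 x = 0"
  by (simp_all add: cdot_def)

lemma cdot_minus_right: "cdot x (- y) = - cdot x y"
  by (simp add: cdot_def sum_negf)

lemma cdot_minus_left: "cdot (- x) y = - cdot x y"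
  by (simp add: cdot_def sum_negf)

lemma cdot_diff_right: "cdot x (y - z) = cdot x y - cdot x z"
  by (simp add: cdot_def algebra_simps sum_subtractf)

lemma cdot_diff_left: "cdot (x - y) z = cdot x z - cdot y z"
  by (simp add: cdot_def algebra_simps sum_subtractf)

lemmas cdot_simps = cdot_add_right cdot_add_left cdot_scale_right cdot_scale_left
  cdot_minus_right cdot_minus_left cdot_diff_right cdot_diff_left

lemma cnj_cdot: "cnj (cdot x y) = cdot y x"
  by (simp add: cdot_def algebra_simps)

lemma cdot_self: "cdot x x = complex_of_real ((norm x)\<^sup>2)"
proof -
  have "cdot x x = (\<Sum>i\<in>UNIV. complex_of_real ((norm (x $ i))\<^sup>2))"
    unfolding cdot_def
    by (intro sum.cong refl) (metis complex_norm_square mult.commute of_real_power)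
  also have "\<dots> = complex_of_real (\<Sum>i\<in>UNIV. (norm (x $ i))\<^sup>2)"
    by simp
  also have "(\<Sum>i\<in>UNIV. (norm (x $ i))\<^sup>2) = (norm x)\<^sup>2"
    unfolding norm_vec_def L2_set_def by (simp add: sum_nonneg)
  finally show ?thesis .
qed

lemma cmod_cdot_self: "cmod (cdot x x) = (norm x)\<^sup>2"
  unfolding cdot_self norm_of_real by simp

lemma norm_cdot_le: "norm (cdot x y) \<le> norm x * norm y"
proof -
  have "norm (cdot x y) \<le> (\<Sum>i\<in>UNIV. \<bar>norm (x $ i)\<bar> * \<bar>norm (y $ i)\<bar>)"
    unfolding cdot_def by (rule order_trans[OF norm_sum]) (simp add: norm_mult)
  also have "\<dots> \<le> L2_set (\<lambda>i. norm (x $ i)) UNIV * L2_set (\<lambda>i. norm (y $ i)) UNIV"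
    by (rule L2_set_mult_ineq)
  finally show ?thesis by (simp add: norm_vec_def)
qed

lemma cdot_axis_left: "cdot (axis i 1) x = x $ i"
  unfolding cdot_def by (subst sum.cong[where h="\<lambda>j. if j = i then x $ i else 0"])
    (auto simp: axis_def)

lemma cdot_eq_zero_iff: "(\<forall>c. cdot c x = 0) \<longleftrightarrow> x = 0"
  by (metis cdot_axis_left cdot_zero_right vec_eq_iff zero_index)

lemma cdot_eqI: "(\<And>c. cdot c x = cdot c y) \<Longrightarrow> x = y"
  by (metis cdot_axis_left vec_eq_iff)

lemma bounded_bilinear_cdot: "bounded_bilinear cdot"
proof
  fix r :: real and x y :: "complex^'m"
  show "cdot (r *\<^sub>R x) y = r *\<^sub>R cdot x y" "cdot x (r *\<^sub>R y) = r *\<^sub>R cdot x y"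
    unfolding scaleR_eq_scale cdot_simps by (simp_all add: scaleR_conv_of_real)
  show "\<exists>K. \<forall>(a :: complex^'m) b. norm (cdot a b) \<le> norm a * norm b * K"
    by (metis mult.right_neutral norm_cdot_le)
qed (simp_all add: cdot_simps)

lemma norm_matrix_vector_le: "norm ((A :: complex^'m^'k) *v x) \<le> norm A * norm x"
proof -
  have *: "(A *v x) $ i = cdot (map_vec_cnj) x" if "map_vec_cnj = (\<chi> j. cnj (A $ i $ j))" for i map_vec_cnj
    by (simp add: that cdot_def matrix_vector_mult_def)
  have n: "norm (\<chi> j. cnj (A $ i $ j)) = norm (A $ i)" for i
    by (simp add: norm_vec_def)
  have "norm ((A *v x) $ i) \<le> norm (A $ i) * norm x" for i
    unfolding *[OF refl] using norm_cdot_le[of "\<chi> j. cnj (A $ i $ j)" x] n by simp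
  hence "norm (A *v x) \<le> L2_set (\<lambda>i. norm (A $ i) * norm x) UNIV"
    unfolding norm_vec_def by (intro L2_set_mono) (auto simp: norm_vec_def)
  also have "\<dots> = norm A * norm x"
    by (simp add: L2_set_left_distrib[symmetric] norm_vec_def)
  finally show ?thesis .
qed

lemma bounded_bilinear_matrix_vector: "bounded_bilinear ((*v) :: complex^'m^'k \<Rightarrow> _)"
proof
  fix r :: real and A :: "complex^'m^'k" and x :: "complex^'m"
  show "r *\<^sub>R A *v x = r *\<^sub>R (A *v x)" by (rule scaleR_matrix_vector)
  show "A *v (r *\<^sub>R x) = r *\<^sub>R (A *v x)"
    by (simp add: vec_eq_iff matrix_vector_mult_def scaleR_sum_right)
  show "\<exists>K. \<forall>(a::complex^'m^'k) b. norm (a *v b) \<le> norm a * norm b * K"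
    by (metis mult.right_neutral norm_matrix_vector_le)
qed (simp_all add: matrix_vector_mult_add_rdistrib matrix_vector_right_distrib)

lemma matrix_vector_scale: "(A :: complex^'m^'k) *v (c *s x) = c *s (A *v x)"
  by (simp add: vec_eq_iff matrix_vector_mult_def sum_distrib_left algebra_simps)

lemma matrix_vector_minus: "(A :: complex^'m^'k) *v (- x) = - (A *v x)"
  by (simp add: vec_eq_iff matrix_vector_mult_def sum_negf)

lemma minus_matrix_vector: "(- (A :: complex^'m^'k)) *v x = - (A *v x)"
  by (simp add: vec_eq_iff matrix_vector_mult_def sum_negf)

lemma smat_vector: "(c *sm A) *v x = c *s (A *v x)"
  by (simp add: vec_eq_iff matrix_vector_mult_def smat_def sum_distrib_left algebra_simps)

lemma matrix_vector_sum: "(A :: complex^'m^'k) *v (\<Sum>i\<in>I. x i) = (\<Sum>i\<in>I. A *v x i)"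
  by (induction I rule: infinite_finite_induct) (simp_all add: matrix_vector_right_distrib)

lemmas mv_simps = matrix_vector_scale matrix_vector_minus minus_matrix_vector smat_vector
  matrix_vector_right_distrib matrix_vector_mult_add_rdistrib
  matrix_vector_mult_diff_rdistrib matrix_vector_mult_diff_distrib

lemma adjm_adjm [simp]: "adjm (adjm A) = A"
  by (simp add: adjm_def vec_eq_iff)

lemma adjm_mult: "adjm (A ** B) = adjm B ** adjm A"
  by (simp add: adjm_def vec_eq_iff matrix_matrix_mult_def mult.commute)

lemma adjm_mat_1 [simp]: "adjm (mat 1) = mat 1"
  by (simp add: adjm_def vec_eq_iff mat_def)

lemma cdot_adjm: "cdot x (A *v y) = cdot (adjm A *v x) y"
  unfolding cdot_def matrix_vector_mult_def adjm_def
  by (simp add: sum_distrib_left sum_distrib_right mult_ac) (rule sum.swap)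

lemma cdot_adjm': "cdot (A *v x) y = cdot x (adjm A *v y)"
  by (simp add: cdot_adjm)

lemma norm_adjm_le: "norm (adjm A *v x) \<le> norm A * norm x"
proof -
  have "(norm (adjm A *v x))\<^sup>2 = norm (cdot (adjm A *v x) (adjm A *v x))"
    by (simp add: cmod_cdot_self)
  also have "\<dots> = norm (cdot x (A *v (adjm A *v x)))"
    by (simp add: cdot_adjm)
  also have "\<dots> \<le> norm x * (norm A * norm (adjm A *v x))"
    by (meson mult_left_mono norm_cdot_le norm_ge_zero norm_matrix_vector_le order_trans)
  finally have "norm (adjm A *v x) * norm (adjm A *v x) \<le> (norm A * norm x) * norm (adjm A *v x)"
    by (simp add: power2_eq_square mult_ac)
  thus ?thesis
    by (metis mult_le_cancel_right mult_nonneg_nonneg norm_ge_zero not_less order_le_less)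
qed

lemma norm_matrix_le_entries: "norm (A :: complex^'m^'k) \<le> (\<Sum>i\<in>UNIV. \<Sum>j\<in>UNIV. norm (A $ i $ j))"
proof -
  have "norm A \<le> (\<Sum>i\<in>UNIV. norm (A $ i))" by (simp add: norm_vec_def L2_set_le_sum)
  also have "\<dots> \<le> (\<Sum>i\<in>UNIV. \<Sum>j\<in>UNIV. norm (A $ i $ j))"
    by (intro sum_mono) (simp add: norm_vec_def L2_set_le_sum)
  finally show ?thesis .
qed

lemma norm_matrix_le_columns:
  "norm (A :: complex^'m^'k) \<le> (\<Sum>j\<in>UNIV. real CARD('k) * norm (A *v axis j 1))"
proof -
  have e: "(A *v axis j 1) $ i = A $ i $ j" for i j
    unfolding matrix_vector_mult_def axis_def by (simp add: if_distrib cong: if_cong)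
  note norm_matrix_le_entries[of A]
  also have "(\<Sum>i\<in>UNIV. \<Sum>j\<in>UNIV. norm (A $ i $ j)) = (\<Sum>j\<in>UNIV. \<Sum>i\<in>UNIV. norm ((A *v axis j 1) $ i))"
    by (subst sum.swap) (simp add: e)
  also have "\<dots> \<le> (\<Sum>j\<in>UNIV. \<Sum>(i::'k)\<in>UNIV. norm (A *v axis j 1))"
    by (intro sum_mono) (rule Finite_Cartesian_Product.norm_nth_le)
  finally show ?thesis by simp
qed

section \<open>The symplectic matrix J\<close>

lemma UNIV_sum_Plus: "(\<Sum>i\<in>(UNIV :: ('a::finite + 'b::finite) set). f i) = (\<Sum>i\<in>UNIV. f (Inl i)) + (\<Sum>i\<in>UNIV. f (Inr i))"
  by (simp add: UNIV_Plus_UNIV[symmetric] sum.Plus del: UNIV_Plus_UNIV)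

lemma Jmat_Inl: "(Jmat *v x) $ Inl p = - x $ Inr p" and Jmat_Inr: "(Jmat *v x) $ Inr p = x $ Inl p"
  unfolding matrix_vector_mult_def Jmat_def UNIV_sum_Plus
  by (simp_all add: if_distrib[where f="\<lambda>c. c * _"] cong: if_cong)

lemma Jmat_Jmat: "Jmat *v (Jmat *v x) = - x"
proof (subst vec_eq_iff, rule allI)
  fix i show "(Jmat *v (Jmat *v x)) $ i = (- x) $ i"
    by (cases i) (simp_all add: Jmat_Inl Jmat_Inr)
qed

lemma adjm_Jmat: "adjm Jmat = - Jmat"
  unfolding adjm_def Jmat_def by (auto simp: vec_eq_iff split: sum.split)

lemma Jmat_eq_iff: "Jmat *v d = - y \<longleftrightarrow> d = Jmat *v y"
proof
  assume "Jmat *v d = - y"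
  hence "Jmat *v (Jmat *v d) = Jmat *v (- y)" by simp
  thus "d = Jmat *v y" by (simp add: Jmat_Jmat mv_simps)
qed (simp add: Jmat_Jmat)

lemma cdot_Jmat: "cdot x (Jmat *v y) = - cdot (Jmat *v x) y"
  by (simp add: cdot_adjm adjm_Jmat minus_matrix_vector cdot_simps)

lemma norm_Jmat: "norm (Jmat *v x) = norm x"
proof -
  have "cdot (Jmat *v x) (Jmat *v x) = cdot x x"
    by (simp add: cdot_Jmat Jmat_Jmat cdot_simps)
  hence "(norm (Jmat *v x))\<^sup>2 = (norm x)\<^sup>2"
    unfolding cdot_self by (simp only: of_real_eq_iff)
  thus ?thesis by simp
qed

text \<open>The rows of \<open>\<gamma>\<close> together with those of \<open>\<gamma> J\<close> form a square matrix with orthonormal rows,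
  hence with orthonormal columns.\<close>
lemma lagrangian_decomposition:
  fixes \<gamma> :: "complex^('n::finite + 'n)^'n"
  assumes 1: "\<gamma> ** adjm \<gamma> = mat 1" and 2: "\<gamma> ** Jmat ** adjm \<gamma> = 0"
  shows "x = adjm \<gamma> *v (\<gamma> *v x) - Jmat *v (adjm \<gamma> *v (\<gamma> *v (Jmat *v x)))"
proof -
  define T :: "complex^('n + 'n)^('n + 'n)" where
    "T = (\<chi> i. case i of Inl p \<Rightarrow> \<gamma> $ p | Inr p \<Rightarrow> (\<gamma> ** Jmat) $ p)"
  have r: "(A ** adjm B) $ p $ q = cdot (B $ q) (A $ p)" for A B :: "complex^('n + 'n)^'n" and p q
    by (simp add: matrix_matrix_mult_def adjm_def cdot_def mult.commute)
  have rT: "(T ** adjm T) $ i $ j = cdot (T $ j) (T $ i)" for i j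
    by (simp add: matrix_matrix_mult_def adjm_def cdot_def mult.commute)
  have A1: "(\<gamma> ** Jmat) ** adjm (\<gamma> ** Jmat) = mat 1"
  proof -
    have "(\<gamma> ** Jmat) ** adjm (\<gamma> ** Jmat) = \<gamma> ** (Jmat ** adjm Jmat) ** adjm \<gamma>"
      by (simp add: adjm_mult matrix_mul_assoc)
    also have "Jmat ** adjm Jmat = (mat 1 :: complex^('n + 'n)^('n + 'n))"
      by (simp add: matrix_eq matrix_vector_mul_assoc[symmetric] adjm_Jmat mv_simps Jmat_Jmat)
    finally show ?thesis using 1 by simp
  qed
  have A2: "\<gamma> ** adjm (\<gamma> ** Jmat) = 0"
  proof -
    have "\<gamma> ** adjm (\<gamma> ** Jmat) = \<gamma> ** (- Jmat ** adjm \<gamma>)"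
      by (simp add: adjm_mult adjm_Jmat)
    also have "\<dots> = - (\<gamma> ** Jmat ** adjm \<gamma>)"
      by (simp add: matrix_eq matrix_vector_mul_assoc[symmetric] mv_simps)
    finally show ?thesis using 2 by simp
  qed
  have A3: "(\<gamma> ** Jmat) ** adjm \<gamma> = 0" using 2 by simp
  have TT: "T ** adjm T = mat 1"
  proof -
    have "(T ** adjm T) $ i $ j = (mat 1 :: complex^('n+'n)^('n+'n)) $ i $ j" for i j
    proof (cases i; cases j)
      fix p q assume "i = Inl p" "j = Inl q"
      thus ?thesis using r[of \<gamma> \<gamma> p q] 1 unfolding rT by (simp add: T_def mat_def)
    next
      fix p q assume "i = Inl p" "j = Inr q"
      thus ?thesis using r[of \<gamma> "\<gamma> ** Jmat" p q] A2 unfolding rT by (simp add: T_def mat_def)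
    next
      fix p q assume "i = Inr p" "j = Inl q"
      thus ?thesis using r[of "\<gamma> ** Jmat" \<gamma> p q] A3 unfolding rT by (simp add: T_def mat_def)
    next
      fix p q assume "i = Inr p" "j = Inr q"
      thus ?thesis using r[of "\<gamma> ** Jmat" "\<gamma> ** Jmat" p q] A1 unfolding rT by (simp add: T_def mat_def)
    qed
    thus ?thesis by (simp add: vec_eq_iff)
  qed
  hence TT': "adjm T ** T = mat 1" by (rule matrix_left_right_inverse1)
  have "cdot y x = cdot y (adjm \<gamma> *v (\<gamma> *v x) - Jmat *v (adjm \<gamma> *v (\<gamma> *v (Jmat *v x))))" for y
  proof -
    have "cdot y x = cdot y ((adjm T ** T) *v x)" by (simp add: TT')
    also have "\<dots> = cdot (T *v y) (T *v x)"
      by (simp add: matrix_vector_mul_assoc[symmetric] cdot_adjm)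
    also have "\<dots> = cdot (\<gamma> *v y) (\<gamma> *v x) + cdot ((\<gamma> ** Jmat) *v y) ((\<gamma> ** Jmat) *v x)"
      by (simp add: cdot_def UNIV_sum_Plus T_def matrix_vector_mult_def)
    also have "\<dots> = cdot y (adjm \<gamma> *v (\<gamma> *v x) - Jmat *v (adjm \<gamma> *v (\<gamma> *v (Jmat *v x))))"
      by (simp add: matrix_vector_mul_assoc[symmetric] cdot_simps cdot_Jmat cdot_adjm[of _ "adjm \<gamma>"])
    finally show ?thesis .
  qed
  thus ?thesis by (rule cdot_eqI)
qed

section \<open>Positive semidefinite matrices\<close>

definition qf :: "complex^'m^'m \<Rightarrow> complex^'m \<Rightarrow> real" where
  "qf A x = Re (hform x A x)"

text \<open>Polarization: reality of the form at \<open>x + y\<close> fixes the imaginary part, and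
  at \<open>x + \<i> *s y\<close> the real part, of the difference between
  \<open>cdot x (A *v y)\<close> and the conjugate of \<open>cdot y (A *v x)\<close>.\<close>

lemma psd_herm: assumes "psd A" shows "cdot x (A *v y) = cdot (A *v x) y"
proof -
  let ?h = "\<lambda>x y. cdot x (A *v y)"
  have im: "Im (?h z z) = 0" for z using assms by (simp add: psd_def hform_def)
  have "Im (?h (x + y) (x + y)) = 0" "Im (?h (x + \<i> *s y) (x + \<i> *s y)) = 0" by (rule im)+
  hence "Im (?h x y) + Im (?h y x) = 0" "Re (?h x y) - Re (?h y x) = 0"
    using im[of x] im[of y] by (simp_all add: mv_simps cdot_simps algebra_simps)
  hence "?h x y = cnj (?h y x)" by (simp add: complex_eq_iff)
  thus ?thesis by (simp add: cnj_cdot)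
qed

lemma hform_qf: "psd A \<Longrightarrow> hform x A x = complex_of_real (qf A x)"
  by (simp add: psd_def qf_def complex_eq_iff)

lemma qf_nonneg: "psd A \<Longrightarrow> qf A x \<ge> 0"
  by (simp add: psd_def qf_def)

lemma hform_add_left: "hform (x + y) A z = hform x A z + hform y A z"
  and hform_add_right: "hform x A (y + z) = hform x A y + hform x A z"
  and hform_diff_left: "hform (x - y) A z = hform x A z - hform y A z"
  and hform_diff_right: "hform x A (y - z) = hform x A y - hform x A z"
  and hform_scale_left: "hform (c *s x) A z = cnj c * hform x A z"
  and hform_scale_right: "hform x A (c *s z) = c * hform x A z"
  and hform_zero_left: "hform 0 A z = 0" and hform_zero_right: "hform x A 0 = 0"
  by (simp_all add: hform_def mv_simps cdot_simps)

lemmas hform_simps = hform_add_left hform_add_right hform_diff_left hform_diff_right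
  hform_scale_left hform_scale_right hform_zero_left hform_zero_right

lemma hform_cnj: "psd A \<Longrightarrow> cnj (hform x A y) = hform y A x"
  by (simp add: hform_def cnj_cdot psd_herm)

lemma qf_scale: "qf A (c *s x) = (cmod c)\<^sup>2 * qf A x"
proof -
  have "hform (c *s x) A (c *s x) = complex_of_real ((cmod c)\<^sup>2) * hform x A x"
    by (simp add: hform_simps complex_norm_square mult_ac del: of_real_power)
  thus ?thesis by (simp add: qf_def del: of_real_power)
qed

lemma qf_zero [simp]: "qf A 0 = 0" by (simp add: qf_def hform_simps)

lemma qf_parallelogram: "qf A (x + y) + qf A (x - y) = 2 * qf A x + 2 * qf A y"
  by (simp add: qf_def hform_simps)

lemma qf_add_le: "psd A \<Longrightarrow> qf A (x + y) \<le> 2 * qf A x + 2 * qf A y"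
  using qf_parallelogram[of A x y] qf_nonneg[of A "x - y"] by simp

text \<open>Only scalars occur, so that one discriminant argument serves the pointwise form of a
  matrix, the integrated form, and the approximate minimization below, where \<open>A\<close> is an
  error tending to zero.\<close>

lemma quadratic_discriminant_bound:
  fixes h :: complex
  assumes pos: "\<And>c :: complex. 0 \<le> A - 2 * Re (cnj c * h) + (cmod c)\<^sup>2 * B" and B: "B \<ge> 0"
  shows "(cmod h)\<^sup>2 \<le> A * B"
proof -
  have p: "0 \<le> A - 2 * s * (cmod h)\<^sup>2 + s\<^sup>2 * (cmod h)\<^sup>2 * B" for s :: real
  proof -
    have "cnj (complex_of_real s * h) * h = complex_of_real (s * (cmod h)\<^sup>2)"
      by (simp add: complex_norm_square mult_ac del: of_real_power)
    hence "Re (cnj (complex_of_real s * h) * h) = s * (cmod h)\<^sup>2" by (simp only: Re_complex_of_real)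
    thus ?thesis using pos[of "complex_of_real s * h"]
      by (simp add: norm_mult power_mult_distrib mult_ac)
  qed
  have A: "A \<ge> 0" using pos[of 0] by simp
  show ?thesis
  proof (cases "B = 0")
    case True
    have "h = 0"
    proof (rule ccontr)
      assume "h \<noteq> 0"
      hence ne: "(cmod h)\<^sup>2 > 0" by simp
      \<comment> \<open>With \<open>B = 0\<close> the expression is affine in \<open>s\<close>; this
        \<open>s\<close> makes it \<open>- A - 2\<close>, which is negative.\<close>
      have "0 \<le> A - 2 * ((A + 1) / (cmod h)\<^sup>2) * (cmod h)\<^sup>2"
        using p[of "(A + 1) / (cmod h)\<^sup>2"] True by simp
      hence "0 \<le> A - 2 * (A + 1)" using ne by (simp only: mult.assoc) simp
      thus False using A by simp
    qed
    thus ?thesis using True by simp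
  next
    case False
    hence "0 \<le> A - (cmod h)\<^sup>2 / B"
      using p[of "1 / B"] B by (simp add: field_simps power2_eq_square)
    thus ?thesis using False B by (simp add: field_simps)
  qed
qed

lemma psd_cauchy_schwarz:
  assumes A: "psd A" shows "(cmod (hform x A y))\<^sup>2 \<le> qf A x * qf A y"
proof -
  have yx: "hform y A x = cnj (hform x A y)" using hform_cnj[OF A, of x y] by simp
  have "(cmod (hform y A x))\<^sup>2 \<le> qf A x * qf A y"
  proof (rule quadratic_discriminant_bound[OF _ qf_nonneg[OF A]])
    fix c
    have "hform (x - c *s y) A (x - c *s y)
        = hform x A x - cnj c * hform y A x - cnj (cnj c * hform y A x) + (c * cnj c) * hform y A y"
      by (simp add: hform_simps yx algebra_simps)
    also have "c * cnj c = complex_of_real ((cmod c)\<^sup>2)" by (simp only: complex_norm_square)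
    finally have "qf A (x - c *s y) = qf A x - 2 * Re (cnj c * hform y A x) + (cmod c)\<^sup>2 * qf A y"
      by (simp add: qf_def del: of_real_power)
    thus "0 \<le> qf A x - 2 * Re (cnj c * hform y A x) + (cmod c)\<^sup>2 * qf A y"
      using qf_nonneg[OF A, of "x - c *s y"] by simp
  qed
  thus ?thesis by (simp add: yx)
qed

lemma qf_le_norm: "qf A x \<le> norm A * (norm x)\<^sup>2"
proof -
  have "qf A x \<le> cmod (hform x A x)" unfolding qf_def by (rule complex_Re_le_cmod)
  also have "\<dots> \<le> norm x * (norm A * norm x)"
    unfolding hform_def
    by (meson mult_left_mono norm_cdot_le norm_ge_zero norm_matrix_vector_le order_trans)
  finally show ?thesis by (simp add: power2_eq_square mult_ac)
qed

text \<open>Cauchy-Schwarz for the pair \<open>A *v x\<close>, \<open>x\<close> puts the fourth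
  power of \<open>norm (A *v x)\<close> on the left, and one square cancels. Thus the seminorm
  controls the vector \<open>A *v x\<close>, which is all that a weighted space sees of
  \<open>x\<close>.\<close>

lemma psd_norm_mult_le:
  assumes "psd A" shows "(norm (A *v x))\<^sup>2 \<le> norm A * qf A x"
proof -
  let ?n = "(norm (A *v x))\<^sup>2"
  have "?n\<^sup>2 = (cmod (hform (A *v x) A x))\<^sup>2"
    by (simp add: hform_def cmod_cdot_self)
  also have "\<dots> \<le> qf A (A *v x) * qf A x" by (rule psd_cauchy_schwarz[OF assms])
  also have "\<dots> \<le> (norm A * ?n) * qf A x"
    by (rule mult_right_mono[OF qf_le_norm qf_nonneg[OF assms]])
  finally have "?n * ?n \<le> (norm A * qf A x) * ?n" by (simp add: power2_eq_square mult_ac)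
  thus ?thesis
    by (metis assms mult_le_cancel_right mult_nonneg_nonneg norm_ge_zero not_less
        order_le_less qf_nonneg zero_le_power2)
qed

lemma qf_eq_0_iff: "psd A \<Longrightarrow> qf A x = 0 \<longleftrightarrow> A *v x = 0"
  using psd_norm_mult_le[of A x] by (auto simp: qf_def hform_def)

text \<open>The sum replaces the geometric mean so that the right-hand side is integrable as soon as
  \<open>norm A\<close> and \<open>qf A x\<close> are.\<close>

lemma psd_norm_mult_le2:
  assumes "psd A" shows "norm (A *v x) \<le> norm A + qf A x"
proof -
  have "(norm (A *v x))\<^sup>2 \<le> norm A * qf A x" by (rule psd_norm_mult_le[OF assms])
  also have "\<dots> \<le> (norm A + qf A x)\<^sup>2"
    using qf_nonneg[OF assms, of x] by (simp add: power2_eq_square algebra_simps)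
  finally show ?thesis
    by (rule power2_le_imp_le) (simp add: qf_nonneg[OF assms])
qed

lemma cmod_hform_le: assumes "psd A" shows "cmod (hform x A y) \<le> qf A x + qf A y"
proof -
  have "(cmod (hform x A y))\<^sup>2 \<le> qf A x * qf A y" by (rule psd_cauchy_schwarz[OF assms])
  also have "\<dots> \<le> (qf A x + qf A y)\<^sup>2"
    using qf_nonneg[OF assms, of x] qf_nonneg[OF assms, of y] by (simp add: power2_eq_square algebra_simps)
  finally show ?thesis
    by (rule power2_le_imp_le) (simp add: qf_nonneg[OF assms])
qed

section \<open>Absolutely continuous functions\<close>

text \<open>The condition for one pair \<open>\<epsilon>\<close>, \<open>\<delta>\<close> is named
  so that a chosen \<open>\<delta>\<close> can be carried through a proof.\<close>

definition AC_modulus :: "real \<Rightarrow> real \<Rightarrow> (real \<Rightarrow> 'v::real_normed_vector) \<Rightarrow> real \<Rightarrow> real \<Rightarrow> bool" where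
  "AC_modulus a b f \<epsilon> \<delta> \<longleftrightarrow> (\<forall>(N::nat) (s::nat \<Rightarrow> real) (t::nat \<Rightarrow> real).
       (\<forall>k<N. a \<le> s k \<and> s k \<le> t k \<and> t k \<le> b) \<and>
       (\<forall>k<N. \<forall>l<N. k \<noteq> l \<longrightarrow> t k \<le> s l \<or> t l \<le> s k) \<and>
       (\<Sum>k<N. t k - s k) < \<delta>
       \<longrightarrow> (\<Sum>k<N. norm (f (t k) - f (s k))) < \<epsilon>)"

lemma AC_on_iff_modulus: "AC_on a b f \<longleftrightarrow> (\<forall>\<epsilon>>0. \<exists>\<delta>>0. AC_modulus a b f \<epsilon> \<delta>)"
  by (simp add: AC_on_def AC_modulus_def)

lemma AC_modulusD:
  fixes N :: nat and s t :: "nat \<Rightarrow> real"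
  assumes "AC_modulus a b f \<epsilon> \<delta>" "\<forall>k<N. a \<le> s k \<and> s k \<le> t k \<and> t k \<le> b"
    "\<forall>k<N. \<forall>l<N. k \<noteq> l \<longrightarrow> t k \<le> s l \<or> t l \<le> s k" "(\<Sum>k<N. t k - s k) < \<delta>"
  shows "(\<Sum>k<N. norm (f (t k) - f (s k))) < \<epsilon>"
  by (rule assms(1)[unfolded AC_modulus_def, THEN spec[of _ N], THEN spec[of _ s], THEN spec[of _ t], THEN mp]) (intro conjI assms)

text \<open>Divisions of an interval come as finite sets of tagged intervals rather than as
  sequences; a bijection with an initial segment of the naturals bridges the two.\<close>

lemma AC_modulus_finite:
  assumes "AC_modulus a b f \<epsilon> \<delta>" and I: "finite I" "\<And>i. i \<in> I \<Longrightarrow> a \<le> s i \<and> s i \<le> t i \<and> t i \<le> b"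
      "\<And>i j. i \<in> I \<Longrightarrow> j \<in> I \<Longrightarrow> i \<noteq> j \<Longrightarrow> t i \<le> s j \<or> t j \<le> s i"
      "(\<Sum>i\<in>I. t i - s i) < \<delta>"
  shows "(\<Sum>i\<in>I. norm (f (t i) - f (s i))) < \<epsilon>"
proof -
  obtain h where h: "bij_betw h {..<card I} I"
    using ex_bij_betw_nat_finite[OF I(1)] by (auto simp: lessThan_atLeast0)
  have hI: "h k \<in> I" if "k < card I" for k using h that by (auto simp: bij_betw_def)
  have inj: "h k \<noteq> h l" if "k < card I" "l < card I" "k \<noteq> l" for k l
    using h that by (auto simp: bij_betw_def inj_on_def)
  have "(\<Sum>k<card I. norm (f (t (h k)) - f (s (h k)))) < \<epsilon>"
  proof (rule AC_modulusD[OF assms(1)])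
    show "(\<Sum>k<card I. t (h k) - s (h k)) < \<delta>"
      using I(4) sum.reindex_bij_betw[OF h, of "\<lambda>i. t i - s i"] by simp
  qed (use I(2,3) hI inj in auto)
  thus ?thesis
    using sum.reindex_bij_betw[OF h, of "\<lambda>i. norm (f (t i) - f (s i))"] by simp
qed

lemma AC_on_subinterval:
  assumes "AC_on a b f" "a \<le> c" "d \<le> b" shows "AC_on c d f"
  unfolding AC_on_iff_modulus
proof (intro allI impI)
  fix \<epsilon> :: real assume "\<epsilon> > 0"
  with assms(1) obtain \<delta> where d: "\<delta> > 0" and *: "AC_modulus a b f \<epsilon> \<delta>"
    unfolding AC_on_iff_modulus by blast
  show "\<exists>\<delta>>0. AC_modulus c d f \<epsilon> \<delta>"
    unfolding AC_modulus_def
  proof (intro exI[of _ \<delta>] conjI d allI impI)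
    fix N :: nat and s t :: "nat \<Rightarrow> real"
    assume H: "(\<forall>k<N. c \<le> s k \<and> s k \<le> t k \<and> t k \<le> d) \<and>
       (\<forall>k<N. \<forall>l<N. k \<noteq> l \<longrightarrow> t k \<le> s l \<or> t l \<le> s k) \<and> (\<Sum>k<N. t k - s k) < \<delta>"
    hence "\<forall>k<N. a \<le> s k \<and> s k \<le> t k \<and> t k \<le> b" using assms(2,3) by (meson order_trans)
    thus "(\<Sum>k<N. norm (f (t k) - f (s k))) < \<epsilon>" using H by (intro AC_modulusD[OF *]) auto
  qed
qed

lemma AC_on_continuous:
  assumes "AC_on a b f" shows "continuous_on {a..b} f"
  unfolding continuous_on_iff
proof (intro ballI allI impI)
  fix x \<epsilon> :: real assume x: "x \<in> {a..b}" and "\<epsilon> > 0"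
  with assms obtain \<delta> where d: "\<delta> > 0" "AC_modulus a b f \<epsilon> \<delta>"
    unfolding AC_on_iff_modulus by blast
  have "dist (f y) (f x) < \<epsilon>" if "y \<in> {a..b}" "dist y x < \<delta>" for y
    using AC_modulus_finite[OF d(2), of "{()}" "\<lambda>_. min x y" "\<lambda>_. max x y"] x that
    by (cases "x \<le> y") (auto simp: dist_norm norm_minus_commute)
  thus "\<exists>d>0. \<forall>x'\<in>{a..b}. dist x' x < d \<longrightarrow> dist (f x') (f x) < \<epsilon>"
    using d(1) by blast
qed

lemma AC_on_bounded:
  fixes f :: "real \<Rightarrow> 'v::real_normed_vector"
  assumes "AC_on a b f"
  obtains C where "C > 0" "\<And>x. x \<in> {a..b} \<Longrightarrow> norm (f x) \<le> C"
proof -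
  have "bounded (f ` {a..b})"
    using AC_on_continuous[OF assms] by (intro compact_imp_bounded compact_continuous_image) auto
  thus ?thesis using that by (auto simp: bounded_pos)
qed

text \<open>Sums, bilinear expressions and Lipschitz images all satisfy such an increment estimate,
  which reduces closure of absolute continuity to arithmetic.\<close>

lemma AC_on_dominated:
  fixes f :: "real \<Rightarrow> 'u::real_normed_vector" and g :: "real \<Rightarrow> 'v::real_normed_vector"
    and F :: "real \<Rightarrow> 'w::real_normed_vector"
  assumes f: "AC_on a b f" and g: "AC_on a b g" and C: "C \<ge> 0"
    and le: "\<And>x y. x \<in> {a..b} \<Longrightarrow> y \<in> {a..b} \<Longrightarrow> norm (F x - F y) \<le> C * norm (f x - f y) + C * norm (g x - g y)"
  shows "AC_on a b F"
  unfolding AC_on_iff_modulus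
proof (intro allI impI)
  fix \<epsilon> :: real assume e: "\<epsilon> > 0"
  \<comment> \<open>\<open>C + 1\<close> in the denominator covers \<open>C = 0\<close> and keeps
    the final inequality strict.\<close>
  define e' where "e' = \<epsilon> / (2 * (C + 1))"
  have e': "e' > 0" using e C by (simp add: e'_def)
  obtain d1 where d1: "d1 > 0" "AC_modulus a b f e' d1"
    using f e' unfolding AC_on_iff_modulus by blast
  obtain d2 where d2: "d2 > 0" "AC_modulus a b g e' d2"
    using g e' unfolding AC_on_iff_modulus by blast
  show "\<exists>\<delta>>0. AC_modulus a b F \<epsilon> \<delta>"
    unfolding AC_modulus_def
  proof (intro exI[of _ "min d1 d2"] conjI allI impI)
    fix N :: nat and s t :: "nat \<Rightarrow> real"
    assume H: "(\<forall>k<N. a \<le> s k \<and> s k \<le> t k \<and> t k \<le> b) \<and>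
       (\<forall>k<N. \<forall>l<N. k \<noteq> l \<longrightarrow> t k \<le> s l \<or> t l \<le> s k) \<and> (\<Sum>k<N. t k - s k) < min d1 d2"
    have "(\<Sum>k<N. norm (F (t k) - F (s k)))
      \<le> (\<Sum>k<N. C * norm (f (t k) - f (s k)) + C * norm (g (t k) - g (s k)))"
      using H by (intro sum_mono le) force+
    also have "\<dots> = C * ((\<Sum>k<N. norm (f (t k) - f (s k))) + (\<Sum>k<N. norm (g (t k) - g (s k))))"
      by (simp add: sum.distrib sum_distrib_left algebra_simps)
    also have "\<dots> \<le> C * (e' + e')"
      using H C by (intro mult_left_mono add_mono less_imp_le[OF AC_modulusD[OF d1(2)]] less_imp_le[OF AC_modulusD[OF d2(2)]]) auto
    also have "\<dots> < \<epsilon>" using e C by (simp add: e'_def add_pos_nonneg divide_simps)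
    finally show "(\<Sum>k<N. norm (F (t k) - F (s k))) < \<epsilon>" .
  qed (use d1 d2 in auto)
qed

lemma AC_on_lipschitz:
  fixes f :: "real \<Rightarrow> 'u::real_normed_vector" and F :: "real \<Rightarrow> 'w::real_normed_vector"
  assumes f: "AC_on a b f" and C: "C \<ge> 0"
    and le: "\<And>x y. x \<in> {a..b} \<Longrightarrow> y \<in> {a..b} \<Longrightarrow> norm (F x - F y) \<le> C * norm (f x - f y)"
  shows "AC_on a b F"
  proof (rule AC_on_dominated[OF f f C])
  fix x y assume "x \<in> {a..b}" "y \<in> {a..b}"
  thus "norm (F x - F y) \<le> C * norm (f x - f y) + C * norm (f x - f y)"
    using le[of x y] mult_nonneg_nonneg[OF C norm_ge_zero[of "f x - f y"]] by linarith
qed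

lemma AC_on_bilinear:
  assumes B: "bounded_bilinear B" and f: "AC_on a b f" and g: "AC_on a b g"
  shows "AC_on a b (\<lambda>x. B (f x) (g x))"
proof -
  interpret bounded_bilinear B by fact
  obtain K where K: "K \<ge> 0" "\<forall>x y. norm (B x y) \<le> norm x * norm y * K"
    using nonneg_bounded by blast
  obtain C1 where C1: "C1 > 0" "\<And>x. x \<in> {a..b} \<Longrightarrow> norm (f x) \<le> C1" using AC_on_bounded[OF f] by blast
  obtain C2 where C2: "C2 > 0" "\<And>x. x \<in> {a..b} \<Longrightarrow> norm (g x) \<le> C2" using AC_on_bounded[OF g] by blast
  show ?thesis
  proof (rule AC_on_dominated[OF f g])
    show "0 \<le> (C1 + C2) * K" using C1 C2 K by simp
    fix x y assume xy: "x \<in> {a..b}" "y \<in> {a..b}"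
    have "B (f x) (g x) - B (f y) (g y) = B (f x - f y) (g x) + B (f y) (g x - g y)"
      by (simp add: diff_left diff_right)
    hence "norm (B (f x) (g x) - B (f y) (g y)) \<le> norm (f x - f y) * norm (g x) * K + norm (f y) * norm (g x - g y) * K"
      using K(2) by (auto intro!: norm_triangle_mono)
    also have "\<dots> \<le> norm (f x - f y) * (C1 + C2) * K + (C1 + C2) * norm (g x - g y) * K"
      using C1(1) C2(1) C1(2)[OF xy(2)] C2(2)[OF xy(1)] K(1)
      by (intro add_mono mult_right_mono mult_left_mono) auto
    finally show "norm (B (f x) (g x) - B (f y) (g y)) \<le> (C1 + C2) * K * norm (f x - f y) + (C1 + C2) * K * norm (g x - g y)"
      by (simp add: mult_ac)
  qed
qed

lemma AC_on_add: "AC_on a b f \<Longrightarrow> AC_on a b g \<Longrightarrow> AC_on a b (\<lambda>x. f x + g x)"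
  by (rule AC_on_dominated[of a b f g 1]) (simp_all add: norm_diff_triangle_ineq)

lemma AC_on_const: "AC_on a b (\<lambda>x. c)"
  unfolding AC_on_def by (auto intro!: exI[of _ 1])

lemma AC_on_exp: assumes "AC_on a b (f :: real \<Rightarrow> real)" shows "AC_on a b (\<lambda>x. exp (f x))"
proof -
  obtain C where C: "C > 0" "\<And>x. x \<in> {a..b} \<Longrightarrow> norm (f x) \<le> C" using AC_on_bounded[OF assms] by blast
  \<comment> \<open>The tangent inequality \<open>1 + x \<le> exp x\<close> at
    \<open>x = u - v\<close> takes the place of the mean value theorem.\<close>
  have *: "exp v - exp u \<le> exp C * (v - u)" if "u \<le> v" "v \<le> C" for u v :: real
  proof -
    have "exp v * (1 + (u - v)) \<le> exp v * exp (u - v)"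
      by (intro mult_left_mono exp_ge_add_one_self) auto
    hence "exp v - exp u \<le> exp v * (v - u)" by (simp add: algebra_simps flip: exp_add)
    also have "\<dots> \<le> exp C * (v - u)" using that by (intro mult_right_mono) auto
    finally show ?thesis .
  qed
  show ?thesis
  proof (rule AC_on_lipschitz[OF assms, of "exp C"])
    fix x y assume xy: "x \<in> {a..b}" "y \<in> {a..b}"
    show "norm (exp (f x) - exp (f y)) \<le> exp C * norm (f x - f y)"
      using C(2)[OF xy(1)] C(2)[OF xy(2)] *[of "f x" "f y"] *[of "f y" "f x"]
      by (cases "f x \<le> f y") (auto simp: abs_le_iff)
  qed simp
qed

text \<open>Henstock's argument: the gauge at the exceptional points is a small open neighbourhood of the
  exceptional null set, where absolute continuity controls the increments.\<close>
theorem AC_on_fundamental_theorem: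
  fixes F :: "real \<Rightarrow> 'a::real_normed_vector"
  assumes ab: "a \<le> b" and AC: "AC_on a b F"
    and der: "AE x in lebesgue. x \<in> {a<..<b} \<longrightarrow> (F has_vector_derivative F' x) (at x)"
  shows "(F' has_integral F b - F a) {a..b}"
proof -
  obtain N0 where N0: "{x \<in> space lebesgue. \<not> (x \<in> {a<..<b} \<longrightarrow> (F has_vector_derivative F' x) (at x))} \<subseteq> N0"
      "emeasure lebesgue N0 = 0" "N0 \<in> sets lebesgue"
    using der by (elim AE_E) blast
  define N where "N = N0 \<union> {a, b}"
  have Nn: "N \<in> null_sets lebesgue"
  proof -
    have "negligible N0" using N0 by (simp add: negligible_iff_null_sets null_sets_def)
    thus ?thesis unfolding N_def negligible_iff_null_sets[symmetric]
      by (intro negligible_Un[OF \<open>negligible N0\<close>] negligible_finite) auto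
  qed
  have negl: "negligible N" using Nn by (simp add: negligible_iff_null_sets)
  \<comment> \<open>On \<open>N\<close> the value 0 is harmless for the integral and leaves only the
    increment of \<open>F\<close> in the Riemann sum.\<close>
  define f0 where "f0 x = (if x \<in> N then 0 else F' x)" for x
  have "(f0 has_integral F b - F a) {a..b}"
    unfolding has_integral_real
  proof (intro allI impI)
    fix e :: real assume e: "e > 0"
    \<comment> \<open>The errors at regular tags then add up to at most \<open>e / 2\<close> over
      the whole interval; the exceptional tags get the other half.\<close>
    define eps where "eps = e / (2 * (b - a + 1))"
    have eps: "eps > 0" using e ab by (simp add: eps_def)
    obtain \<delta> where d: "\<delta> > 0" "AC_modulus a b F (e / 2) \<delta>"
      using AC e unfolding AC_on_iff_modulus by (meson half_gt_zero)
    obtain T where T: "open T" "N \<subseteq> T" "emeasure lebesgue (T - N) < ennreal \<delta>"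
      using sets_lebesgue_outer_open[OF _ d(1), of N] Nn by blast
    have "emeasure lebesgue T \<le> emeasure lebesgue (T - N) + emeasure lebesgue N"
      using T Nn by (intro order_trans[OF emeasure_mono emeasure_subadditive]) auto
    hence emT: "emeasure lebesgue T < ennreal \<delta>" using T(3) Nn by (simp add: null_sets_def)
    hence Tm: "T \<in> lmeasurable" using T(1) by (intro fmeasurableI) (auto simp: less_top[symmetric] top_unique)
    have mT: "measure lebesgue T < \<delta>"
      using emT Tm d(1) by (simp add: emeasure_eq_measure2 ennreal_less_iff)
    have "\<exists>d>0. x \<in> {a..b} - N \<longrightarrow> (\<forall>y. norm (y - x) < d \<longrightarrow> norm (F y - F x - (y - x) *\<^sub>R F' x) \<le> eps * norm (y - x))" for x
    proof (cases "x \<in> {a..b} - N")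
      case True
      hence "(F has_vector_derivative F' x) (at x)" using N0(1) by (auto simp: N_def less_le subset_iff)
      thus ?thesis unfolding has_vector_derivative_def has_derivative_at_alt using eps by blast
    qed (auto intro: exI[of _ 1])
    then obtain dd where dd: "\<And>x. dd x > 0"
      "\<And>x y. x \<in> {a..b} - N \<Longrightarrow> norm (y - x) < dd x \<Longrightarrow> norm (F y - F x - (y - x) *\<^sub>R F' x) \<le> eps * norm (y - x)"
      by metis
    define \<gamma> where "\<gamma> x = (if x \<in> N then T else ball x (dd x))" for x
    have g: "gauge \<gamma>" using T dd(1) by (auto simp: gauge_def \<gamma>_def)
    show "\<exists>\<gamma>. gauge \<gamma> \<and> (\<forall>\<D>. \<D> tagged_division_of {a..b} \<and> \<gamma> fine \<D> \<longrightarrow>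
            norm ((\<Sum>(x, k)\<in>\<D>. measure lborel k *\<^sub>R f0 x) - (F b - F a)) < e)"
    proof (intro exI[of _ \<gamma>] conjI g allI impI)
      fix \<D> assume D: "\<D> tagged_division_of {a..b} \<and> \<gamma> fine \<D>"
      hence Dt: "\<D> tagged_division_of {a..b}" and fine: "\<gamma> fine \<D>" by auto
      note tD = tagged_division_ofD[OF Dt]
      have shape: "\<exists>s t. k = {s..t} \<and> s \<le> x \<and> x \<le> t \<and> a \<le> s \<and> t \<le> b \<and> Inf k = s \<and> Sup k = t \<and> measure lborel k = t - s"
        if xk: "(x, k) \<in> \<D>" for x k
      proof -
        obtain s t where st: "k = cbox s t" using tD(4)[OF xk] by blast
        have "x \<in> k" using tD(2)[OF xk] .
        hence le: "s \<le> x" "x \<le> t" using st by auto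
        have "k \<subseteq> {a..b}" using tD(3)[OF xk] .
        hence "a \<le> s" "t \<le> b" using st le by auto
        thus ?thesis using st le by auto
      qed
      define L where "L k = Sup k - Inf k" for k :: "real set"
      have L0: "L k \<ge> 0" if "(x,k) \<in> \<D>" for x k using shape[OF that] by (auto simp: L_def)
      \<comment> \<open>Degenerate intervals are left out: they carry no increment, and a single
        point inside another interval would violate the ordering demanded by
        \<open>AC_modulus\<close>.\<close>
      define A where "A = {p \<in> \<D>. fst p \<in> N \<and> Inf (snd p) < Sup (snd p)}"
      have finA: "finite A" using tD(1) by (simp add: A_def)
      have finD: "finite \<D>" using tD(1) .
      have disj: "Sup (snd p) \<le> Inf (snd q) \<or> Sup (snd q) \<le> Inf (snd p)" if pq: "p \<in> A" "q \<in> A" "p \<noteq> q" for p q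
      proof -
        obtain x k y l where e: "p = (x,k)" "q = (y,l)" by (cases p, cases q)
        have "interior k \<inter> interior l = {}" using tD(5)[of x k y l] pq e by (auto simp: A_def)
        moreover obtain s t where "k = {s..t}" "Inf k = s" "Sup k = t" "s < t"
          using shape[of x k] pq e by (force simp: A_def)
        moreover obtain s' t' where "l = {s'..t'}" "Inf l = s'" "Sup l = t'" "s' < t'"
          using shape[of y l] pq e by (force simp: A_def)
        ultimately have "{s<..<t} \<inter> {s'<..<t'} = {}" "s < t" "s' < t'"
          and eq: "Sup (snd p) = t" "Inf (snd q) = s'" "Sup (snd q) = t'" "Inf (snd p) = s"
          using e by (auto simp: interior_atLeastAtMost_real)
        hence "t \<le> s' \<or> t' \<le> s"
        proof -
          \<comment> \<open>If neither interval precedes the other, this is the midpoint of their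
            overlap.\<close>
          have "(max s s' + min t t') / 2 \<notin> {s<..<t} \<inter> {s'<..<t'}"
            using \<open>{s<..<t} \<inter> {s'<..<t'} = {}\<close> by blast
          thus ?thesis using \<open>s < t\<close> \<open>s' < t'\<close>
            by (auto simp: max_def min_def field_simps split: if_splits)
        qed
        thus ?thesis using eq by simp
      qed
      have sumA: "(\<Sum>p\<in>A. Sup (snd p) - Inf (snd p)) < \<delta>"
      proof -
        have sh: "\<exists>s t. snd p = {s..t} \<and> Inf (snd p) = s \<and> Sup (snd p) = t \<and> s < t" if "p \<in> A" for p
          using shape[of "fst p" "snd p"] that by (force simp: A_def)
        have "(\<Sum>p\<in>A. Sup (snd p) - Inf (snd p)) = (\<Sum>p\<in>A. measure lebesgue (snd p))"
        proof (intro sum.cong refl)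
          fix p assume "p \<in> A"
          then obtain s t where "snd p = {s..t}" "s < t" using sh by blast
          thus "Sup (snd p) - Inf (snd p) = measure lebesgue (snd p)" by simp
        qed
        also have "\<dots> = measure lebesgue (\<Union>(snd ` A))"
        proof (rule measure_negligible_finite_Union_image[symmetric, OF finA])
          show "snd p \<in> lmeasurable" if "p \<in> A" for p using sh[OF that] lmeasurable_cbox by (metis box_real(2))
          show "pairwise (\<lambda>x y. negligible (snd x \<inter> snd y)) A"
            unfolding pairwise_def
          proof (intro ballI impI)
            fix p q assume pq: "p \<in> A" "q \<in> A" "p \<noteq> q"
            obtain s t where 1: "snd p = {s..t}" "Inf (snd p) = s" "Sup (snd p) = t" using sh[OF pq(1)] by blast
            obtain s' t' where 2: "snd q = {s'..t'}" "Inf (snd q) = s'" "Sup (snd q) = t'" using sh[OF pq(2)] by blast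
            have "snd p \<inter> snd q \<subseteq> {Sup (snd p), Sup (snd q)}"
              using disj[OF pq] 1(2,3) 2(2,3) unfolding 1(1) 2(1) by auto
            thus "negligible (snd p \<inter> snd q)" by (meson finite.emptyI finite.insertI finite_subset negligible_finite)
          qed
        qed
        also have "\<dots> \<le> measure lebesgue T"
        proof (rule measure_mono_fmeasurable[OF _ _ Tm])
          show "\<Union>(snd ` A) \<subseteq> T" using fine by (force simp: A_def fine_def \<gamma>_def split: if_splits)
          show "\<Union>(snd ` A) \<in> sets lebesgue" using finA sh by (intro sets.finite_Union) (auto, metis box_real(2) lmeasurable_cbox fmeasurableD)
        qed
        finally show ?thesis using mT by simp
      qed
      have sumA': "(\<Sum>p\<in>A. norm (F (Sup (snd p)) - F (Inf (snd p)))) < e / 2"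
      proof (rule AC_modulus_finite[OF d(2) finA _ _ sumA])
        show "a \<le> Inf (snd p) \<and> Inf (snd p) \<le> Sup (snd p) \<and> Sup (snd p) \<le> b" if "p \<in> A" for p
          using shape[of "fst p" "snd p"] that by (force simp: A_def)
      qed (use disj in blast)
      define r where "r p = measure lborel (snd p) *\<^sub>R f0 (fst p) - (F (Sup (snd p)) - F (Inf (snd p)))" for p
      have r1: "norm (r p) \<le> eps * measure lborel (snd p)" if p: "p \<in> \<D>" "fst p \<notin> N" for p
      proof -
        obtain x k where pk: "p = (x,k)" by (cases p)
        obtain s t where st: "k = {s..t}" "s \<le> x" "x \<le> t" "a \<le> s" "t \<le> b" "Inf k = s" "Sup k = t" "measure lborel k = t - s"
          using shape[of x k] p pk by blast
        have xN: "x \<in> {a..b} - N" using st p pk by auto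
        have "k \<subseteq> ball x (dd x)" using fine p pk by (force simp: fine_def \<gamma>_def)
        hence "s \<in> ball x (dd x)" "t \<in> ball x (dd x)" using st(1,2,3) by (meson atLeastAtMost_iff order_refl order_trans subsetD)+
        hence "norm (F t - F x - (t - x) *\<^sub>R F' x) \<le> eps * norm (t - x)"
          "norm (F s - F x - (s - x) *\<^sub>R F' x) \<le> eps * norm (s - x)"
          using dd(2)[OF xN, of t] dd(2)[OF xN, of s] by (auto simp: dist_norm norm_minus_commute)
        \<comment> \<open>The increment is split at the tag \<open>x\<close>, because the derivative
          estimate is anchored there.\<close>
        moreover have "r p = (F s - F x - (s - x) *\<^sub>R F' x) - (F t - F x - (t - x) *\<^sub>R F' x)"
          using xN order_trans[OF st(2,3)] by (simp add: r_def pk st f0_def algebra_simps)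
        ultimately have "norm (r p) \<le> eps * norm (s - x) + eps * norm (t - x)"
          by (metis add_mono norm_triangle_le_diff)
        also have "\<dots> = eps * measure lborel (snd p)" using st pk by (simp add: algebra_simps)
        finally show ?thesis .
      qed
      have r2: "norm (r p) \<le> (if p \<in> A then norm (F (Sup (snd p)) - F (Inf (snd p))) else 0)" if p: "p \<in> \<D>" "fst p \<in> N" for p
      proof -
        have "Inf (snd p) \<le> Sup (snd p)" using shape[of "fst p" "snd p"] p by force
        thus ?thesis using p by (auto simp: r_def f0_def A_def norm_minus_commute)
      qed
      have "(\<Sum>(x, k)\<in>\<D>. measure lborel k *\<^sub>R f0 x) - (F b - F a) = (\<Sum>p\<in>\<D>. r p)"
        using additive_tagged_division_1[OF ab Dt, of F]
        by (simp add: r_def sum_subtractf split_beta)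
      also have "norm \<dots> \<le> (\<Sum>p\<in>\<D>. norm (r p))" by (rule norm_sum)
      also have "\<dots> \<le> (\<Sum>p\<in>\<D>. eps * measure lborel (snd p) + (if p \<in> A then norm (F (Sup (snd p)) - F (Inf (snd p))) else 0))"
      proof (rule sum_mono)
        fix p assume p: "p \<in> \<D>"
        have "eps * measure lborel (snd p) \<ge> 0" using eps by (intro mult_nonneg_nonneg) (auto simp: content_pos_le)
        thus "norm (r p) \<le> eps * measure lborel (snd p) + (if p \<in> A then norm (F (Sup (snd p)) - F (Inf (snd p))) else 0)"
          using r1[OF p] r2[OF p] by (cases "fst p \<in> N") (auto intro: order_trans simp: A_def)
      qed
      also have "\<dots> = eps * (\<Sum>p\<in>\<D>. measure lborel (snd p)) + (\<Sum>p\<in>A. norm (F (Sup (snd p)) - F (Inf (snd p))))"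
      proof -
        have "(\<Sum>p\<in>\<D>. if p \<in> A then norm (F (Sup (snd p)) - F (Inf (snd p))) else 0) = (\<Sum>p\<in>A. norm (F (Sup (snd p)) - F (Inf (snd p))))"
          using finD by (subst sum.inter_restrict[symmetric]) (auto simp: A_def intro!: sum.cong)
        thus ?thesis by (simp add: sum.distrib sum_distrib_left)
      qed
      also have "(\<Sum>p\<in>\<D>. measure lborel (snd p)) = b - a"
        using additive_content_tagged_division[of \<D> a b] Dt ab by (simp add: split_beta)
      also have "eps * (b - a) + (\<Sum>p\<in>A. norm (F (Sup (snd p)) - F (Inf (snd p)))) < e / 2 + e / 2"
        using sumA' e ab eps by (intro add_le_less_mono) (auto simp: eps_def field_simps)
      finally show "norm ((\<Sum>(x, k)\<in>\<D>. measure lborel k *\<^sub>R f0 x) - (F b - F a)) < e" by simp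
    qed
  qed
  thus ?thesis using has_integral_spike[OF negl, of "{a..b}" F' f0] by (simp add: f0_def)
qed

section \<open>Indefinite integrals of integrable functions\<close>

lemma sum_integral_disjoint_le:
  fixes r :: "real \<Rightarrow> real"
  assumes r: "r integrable_on {a..b}" and r0: "\<And>x. r x \<ge> 0" and I: "finite I"
    "\<And>i. i \<in> I \<Longrightarrow> a \<le> s i \<and> s i \<le> t i \<and> t i \<le> b"
    "\<And>i j. i \<in> I \<Longrightarrow> j \<in> I \<Longrightarrow> i \<noteq> j \<Longrightarrow> t i \<le> s j \<or> t j \<le> s i"
  shows "(\<Sum>i\<in>I. integral {s i..t i} r) \<le> integral {a..b} r"
proof -
  have int: "((\<lambda>x. indicator {s i<..<t i} x * r x) has_integral integral {s i..t i} r) {a..b}" if "i \<in> I" for i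
  proof -
    have "r integrable_on {s i..t i}"
      using r I(2)[OF that] by (meson atLeastatMost_subset_iff integrable_on_subinterval)
    hence "(r has_integral integral {s i..t i} r) {s i..t i}" by (rule integrable_integral)
    \<comment> \<open>Closed neighbours may share an endpoint, where their indicators would add up
      to 2; for the open intervals the sum is at most 1.\<close>
    hence "(r has_integral integral {s i..t i} r) {s i<..<t i}" by (simp add: has_integral_Icc_iff_Ioo)
    hence "((\<lambda>x. if x \<in> {s i<..<t i} then r x else 0) has_integral integral {s i..t i} r) {a..b}"
      using I(2)[OF that] by (subst has_integral_restrict) auto
    moreover have "(\<lambda>x. if x \<in> {s i<..<t i} then r x else 0) = (\<lambda>x. indicator {s i<..<t i} x * r x)"
      by (auto simp: indicator_def)
    ultimately show ?thesis by simp
  qed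
  have "(\<Sum>i\<in>I. indicator {s i<..<t i} x :: real) \<le> 1" for x
  proof -
    have "disjoint_family_on (\<lambda>i. {s i<..<t i}) I"
      unfolding disjoint_family_on_def using I(3) by (force simp: disjoint_iff)
    hence "(\<Sum>i\<in>I. indicator {s i<..<t i} x) = (indicator (\<Union>i\<in>I. {s i<..<t i}) x :: real)"
      by (simp add: indicator_UN_disjoint[OF I(1)])
    thus ?thesis by (simp add: indicator_def)
  qed
  hence le: "(\<Sum>i\<in>I. indicator {s i<..<t i} x * r x) \<le> r x" for x
    using mult_right_mono[OF _ r0[of x], of "\<Sum>i\<in>I. indicator {s i<..<t i} x" 1]
    by (simp add: sum_distrib_right)
  have "((\<lambda>x. \<Sum>i\<in>I. indicator {s i<..<t i} x * r x) has_integral (\<Sum>i\<in>I. integral {s i..t i} r)) {a..b}"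
    using int I(1) by (intro has_integral_sum) auto
  thus ?thesis by (rule has_integral_le[OF _ integrable_integral[OF r]]) (rule le)
qed

text \<open>The excess of \<open>norm p\<close> over the height \<open>n\<close> is dominated by
  \<open>norm p\<close> and tends to zero pointwise, so its integral becomes small.\<close>

lemma absolutely_integrable_truncation:
  fixes p :: "real \<Rightarrow> 'b::euclidean_space"
  assumes p: "p absolutely_integrable_on {a..b}" and e: "\<epsilon> > 0"
  obtains n :: nat where "(\<lambda>x. max 0 (norm (p x) - n)) integrable_on {a..b}"
    "integral {a..b} (\<lambda>x. max 0 (norm (p x) - n)) < \<epsilon>"
proof -
  have np: "(\<lambda>x. norm (p x)) absolutely_integrable_on {a..b}"
    using p by (simp add: absolutely_integrable_on_def)
  have i: "(\<lambda>x. max 0 (norm (p x) - real n)) integrable_on {a..b}" for n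
  proof -
    have "(\<lambda>x. max (0::real) (norm (p x) - real n)) absolutely_integrable_on {a..b}"
      by (intro absolutely_integrable_max_1 set_integral_diff np) 
        (auto simp: absolutely_integrable_on_def)
    thus ?thesis by (simp add: absolutely_integrable_on_def)
  qed
  have lim: "(\<lambda>n. max 0 (norm (p x) - real n)) \<longlonglongrightarrow> 0" for x
  proof (rule tendsto_eventually)
    obtain m :: nat where "norm (p x) \<le> real m" using real_arch_simple by blast
    thus "\<forall>\<^sub>F n in sequentially. max 0 (norm (p x) - real n) = 0"
      by (auto simp: eventually_sequentially max_def intro!: exI[of _ m])
  qed
  have "(\<lambda>n. integral {a..b} (\<lambda>x. max 0 (norm (p x) - real n))) \<longlonglongrightarrow> integral {a..b} (\<lambda>x. 0::real)"
    using np by (intro dominated_convergence(2)[of _ _ "\<lambda>x. norm (p x)"] i lim)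
      (auto simp: absolutely_integrable_on_def)
  hence "\<forall>\<^sub>F n in sequentially. integral {a..b} (\<lambda>x. max 0 (norm (p x) - real n)) < \<epsilon>"
    using e by (intro order_tendstoD) auto
  thus ?thesis using that i by (auto simp: eventually_sequentially)
qed

lemma indefinite_integral_diff:
  fixes p :: "real \<Rightarrow> 'b::euclidean_space"
  assumes p: "p integrable_on {a..b}" and "a \<le> s" "s \<le> t" "t \<le> b"
  shows "integral {a..t} p - integral {a..s} p = integral {s..t} p"
proof -
  have "p integrable_on {a..t}" using p assms by (meson atLeastatMost_subset_iff integrable_on_subinterval order_refl)
  thus ?thesis using Henstock_Kurzweil_Integration.integral_combine[of a s t p] assms by (simp add: algebra_simps)
qed

text \<open>After truncation at height \<open>n\<close>, intervals of total length below
  \<open>\<delta>\<close> contribute at most \<open>n * \<delta>\<close> from the bounded part, and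
  from the excess at most its full integral.\<close>

lemma AC_on_indefinite_integral:
  fixes p :: "real \<Rightarrow> 'b::euclidean_space"
  assumes p: "p absolutely_integrable_on {a..b}"
  shows "AC_on a b (\<lambda>x. c + integral {a..x} p)"
  unfolding AC_on_iff_modulus
proof (intro allI impI)
  fix \<epsilon> :: real assume e: "\<epsilon> > 0"
  obtain n :: nat where n: "(\<lambda>x. max 0 (norm (p x) - n)) integrable_on {a..b}"
    "integral {a..b} (\<lambda>x. max 0 (norm (p x) - n)) < \<epsilon> / 2"
    using absolutely_integrable_truncation[OF p] e half_gt_zero by metis
  define r where "r x = max 0 (norm (p x) - n)" for x
  define \<delta> where "\<delta> = \<epsilon> / (2 * (real n + 1))"
  have pi: "p integrable_on {a..b}" and npi: "(\<lambda>x. norm (p x)) integrable_on {a..b}"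
    using p by (auto simp: absolutely_integrable_on_def)
  show "\<exists>\<delta>>0. AC_modulus a b (\<lambda>x. c + integral {a..x} p) \<epsilon> \<delta>"
    unfolding AC_modulus_def
  proof (intro exI[of _ \<delta>] conjI allI impI)
    show "\<delta> > 0" using e by (simp add: \<delta>_def)
    fix N :: nat and s t :: "nat \<Rightarrow> real"
    assume H: "(\<forall>k<N. a \<le> s k \<and> s k \<le> t k \<and> t k \<le> b) \<and>
       (\<forall>k<N. \<forall>l<N. k \<noteq> l \<longrightarrow> t k \<le> s l \<or> t l \<le> s k) \<and> (\<Sum>k<N. t k - s k) < \<delta>"
    have le: "norm ((c + integral {a..t k} p) - (c + integral {a..s k} p)) \<le> n * (t k - s k) + integral {s k..t k} r"
      if "k < N" for k
    proof -
      have k: "a \<le> s k" "s k \<le> t k" "t k \<le> b" using H that by auto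
      have sub: "{s k..t k} \<subseteq> {a..b}" using k by auto
      have "norm ((c + integral {a..t k} p) - (c + integral {a..s k} p)) = norm (integral {s k..t k} p)"
        using indefinite_integral_diff[OF pi k] by simp
      also have "\<dots> \<le> integral {s k..t k} (\<lambda>x. norm (p x))"
        using pi npi sub by (intro integral_norm_bound_integral integrable_on_subinterval[OF _ sub]) auto
      also have "\<dots> \<le> integral {s k..t k} (\<lambda>x. n + r x)"
        using npi n(1) sub by (intro integral_le integrable_add integrable_on_subinterval[OF _ sub])
          (auto simp: r_def[abs_def])
      also have "\<dots> = n * (t k - s k) + integral {s k..t k} r"
        using n(1) sub k by (subst integral_add) (auto intro: integrable_on_subinterval[OF _ sub] simp: r_def[abs_def])
      finally show ?thesis .
    qed
    have "(\<Sum>k<N. norm ((c + integral {a..t k} p) - (c + integral {a..s k} p)))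
        \<le> (\<Sum>k<N. n * (t k - s k) + integral {s k..t k} r)"
      using le by (intro sum_mono) auto
    also have "\<dots> = n * (\<Sum>k<N. t k - s k) + (\<Sum>k<N. integral {s k..t k} r)"
      by (simp add: sum.distrib sum_distrib_left)
    also have "(\<Sum>k<N. integral {s k..t k} r) \<le> integral {a..b} r"
      using n(1) H by (intro sum_integral_disjoint_le) (auto simp: r_def[abs_def])
    also have "n * (\<Sum>k<N. t k - s k) + integral {a..b} r < \<epsilon> / 2 + \<epsilon> / 2"
    proof (rule add_le_less_mono)
      have "n * (\<Sum>k<N. t k - s k) \<le> n * \<delta>" using H by (intro mult_left_mono) auto
      also have "\<dots> \<le> \<epsilon> / 2" using e by (simp add: \<delta>_def field_simps)
      finally show "n * (\<Sum>k<N. t k - s k) \<le> \<epsilon> / 2" .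
      show "integral {a..b} r < \<epsilon> / 2" using n(2) by (simp add: r_def[abs_def])
    qed
    finally show "(\<Sum>k<N. norm ((c + integral {a..t k} p) - (c + integral {a..s k} p))) < \<epsilon>" by simp
  qed
qed

lemma AE_iff_negligible: "(AE x in lebesgue. P x) \<longleftrightarrow> (\<exists>N. negligible N \<and> (\<forall>x. x \<notin> N \<longrightarrow> P x))"
proof
  assume "AE x in lebesgue. P x"
  then obtain N where "{x \<in> space lebesgue. \<not> P x} \<subseteq> N" "emeasure lebesgue N = 0" "N \<in> sets lebesgue"
    by (elim AE_E) blast
  thus "\<exists>N. negligible N \<and> (\<forall>x. x \<notin> N \<longrightarrow> P x)"
    by (intro exI[of _ N]) (auto simp: negligible_iff_null_sets null_sets_def)
next
  assume "\<exists>N. negligible N \<and> (\<forall>x. x \<notin> N \<longrightarrow> P x)"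
  thus "AE x in lebesgue. P x"
    by (auto simp: negligible_iff_null_sets intro: AE_I')
qed

text \<open>The averages in \<open>integrable_ccontinuous_explicit\<close> run over intervals that
  start at \<open>x\<close>, so they yield the derivative from the right. Reflection supplies the
  left one in the next theorem.\<close>

lemma right_lebesgue_differentiation:
  fixes p :: "real \<Rightarrow> 'b::euclidean_space"
  assumes "\<And>a b. p integrable_on {a..b}"
  obtains N where "negligible N"
    "\<And>x e. x \<notin> N \<Longrightarrow> 0 < e \<Longrightarrow> \<exists>d>0. \<forall>y. x \<le> y \<and> y < x + d \<longrightarrow>
       norm (integral {x..y} p - (y - x) *\<^sub>R p x) \<le> e * (y - x)"
proof -
  obtain N where N: "negligible N" "\<And>x e. x \<notin> N \<Longrightarrow> 0 < e \<Longrightarrow> \<exists>d>0. \<forall>h. 0 < h \<and> h < d \<longrightarrow>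
       norm (integral (cbox x (x + h *\<^sub>R One)) p /\<^sub>R h ^ DIM(real) - p x) < e"
    using integrable_ccontinuous_explicit[of p] assms by (metis box_real(2))
  show ?thesis
  proof (rule that[OF N(1)])
    fix x e :: real assume xe: "x \<notin> N" "0 < e"
    then obtain d where d: "d > 0" "\<And>h. 0 < h \<Longrightarrow> h < d \<Longrightarrow> norm (integral {x..x+h} p /\<^sub>R h - p x) < e"
      using N(2)[OF xe] by auto
    have "norm (integral {x..y} p - (y - x) *\<^sub>R p x) \<le> e * (y - x)" if y: "x \<le> y" "y < x + d" for y
    proof (cases "y = x")
      case False
      hence h: "0 < y - x" "y - x < d" using y by auto
      have "integral {x..y} p - (y - x) *\<^sub>R p x = (y - x) *\<^sub>R (integral {x..x+(y-x)} p /\<^sub>R (y - x) - p x)"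
        using h by (simp add: scaleR_diff_right)
      hence "norm (integral {x..y} p - (y - x) *\<^sub>R p x) = (y - x) * norm (integral {x..x+(y-x)} p /\<^sub>R (y - x) - p x)"
        using h by simp
      also have "\<dots> \<le> (y - x) * e" using d(2)[OF h] h by (intro mult_left_mono) auto
      finally show ?thesis by (simp add: mult.commute)
    qed simp
    thus "\<exists>d>0. \<forall>y. x \<le> y \<and> y < x + d \<longrightarrow>
       norm (integral {x..y} p - (y - x) *\<^sub>R p x) \<le> e * (y - x)"
      using d(1) by blast
  qed
qed

theorem indefinite_integral_has_vector_derivative_AE:
  fixes p :: "real \<Rightarrow> 'b::euclidean_space"
  assumes p: "p absolutely_integrable_on {a..b}"
  shows "AE x in lebesgue. x \<in> {a<..<b} \<longrightarrow>
     ((\<lambda>x. c + integral {a..x} p) has_vector_derivative p x) (at x)"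
proof -
  \<comment> \<open>Extension by zero makes the function integrable on every interval, as
    differentiation on the whole line demands.\<close>
  define q where "q x = (if x \<in> {a..b} then p x else 0)" for x
  have pi: "p integrable_on {a..b}" using p by (auto simp: absolutely_integrable_on_def)
  have qU: "q integrable_on UNIV" using pi unfolding q_def[abs_def] integrable_restrict_UNIV .
  have q: "q integrable_on {u..v}" for u v
    using qU by (rule integrable_on_subinterval) simp
  \<comment> \<open>Right derivatives for the reflected function are left derivatives for the
    original one.\<close>
  have q': "(\<lambda>x. q (- x)) integrable_on {u..v}" for u v
    using q[of "-v" "-u"] Henstock_Kurzweil_Integration.integrable_reflect_real[of q "-u" "-v"] by simp
  obtain N1 where N1: "negligible N1" "\<And>x e. x \<notin> N1 \<Longrightarrow> 0 < e \<Longrightarrow> \<exists>d>0. \<forall>y. x \<le> y \<and> y < x + d \<longrightarrow>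
       norm (integral {x..y} q - (y - x) *\<^sub>R q x) \<le> e * (y - x)"
    using right_lebesgue_differentiation[OF q] by blast
  obtain N2 where N2: "negligible N2" "\<And>x e. x \<notin> N2 \<Longrightarrow> 0 < e \<Longrightarrow> \<exists>d>0. \<forall>y. x \<le> y \<and> y < x + d \<longrightarrow>
       norm (integral {x..y} (\<lambda>x. q (- x)) - (y - x) *\<^sub>R q (- x)) \<le> e * (y - x)"
    using right_lebesgue_differentiation[OF q'] by blast
  have N3: "negligible (uminus ` N2)"
    by (rule negligible_locally_Lipschitz_image[OF _ N2(1)])
      (auto intro!: exI[of _ UNIV] exI[of _ "1::real"])
  have "((\<lambda>x. c + integral {a..x} p) has_vector_derivative p x) (at x)"
    if x: "x \<in> {a<..<b}" "x \<notin> N1 \<union> uminus ` N2" for x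
    unfolding has_vector_derivative_def has_derivative_at_alt
  proof (intro conjI allI impI)
    show "bounded_linear (\<lambda>h. h *\<^sub>R p x)" by (rule bounded_linear_scaleR_left)
    fix e :: real assume e: "e > 0"
    have "- x \<notin> N2" using x(2) by force
    obtain d1 where d1: "d1 > 0" "\<forall>y. x \<le> y \<and> y < x + d1 \<longrightarrow>
       norm (integral {x..y} q - (y - x) *\<^sub>R q x) \<le> e * (y - x)"
      using N1(2)[of x e] x e by blast
    obtain d2 where d2: "d2 > 0" "\<forall>y. - x \<le> y \<and> y < - x + d2 \<longrightarrow>
       norm (integral {- x..y} (\<lambda>x. q (- x)) - (y - (- x)) *\<^sub>R q (- (- x))) \<le> e * (y - (- x))"
      using N2(2)[OF \<open>- x \<notin> N2\<close> e] by blast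
    define d where "d = min (min d1 d2) (min (x - a) (b - x))"
    have "norm ((c + integral {a..y} p) - (c + integral {a..x} p) - (y - x) *\<^sub>R p x) \<le> e * norm (y - x)"
      if y: "norm (y - x) < d" for y
    proof (cases "x \<le> y")
      case True
      have yy: "y < x + d1" "y \<le> b" using y by (auto simp: d_def)
      have "integral {x..y} q = integral {x..y} p"
        using yy x by (intro integral_cong) (auto simp: q_def)
      moreover have "integral {a..y} p - integral {a..x} p = integral {x..y} p"
        using indefinite_integral_diff[OF pi, of x y] x yy True by auto
      moreover have "q x = p x" using x by (auto simp: q_def)
      ultimately show ?thesis using d1(2)[rule_format, of y] True yy by simp
    next
      case False
      have yy: "- y < - x + d2" "a \<le> y" "y \<le> x" using y False by (auto simp: d_def)
      have "integral {- x..- y} (\<lambda>x. q (- x)) = integral {y..x} q"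
        by (rule Henstock_Kurzweil_Integration.integral_reflect_real)
      also have "\<dots> = integral {y..x} p"
        using yy x by (intro integral_cong) (auto simp: q_def)
      also have "\<dots> = integral {a..x} p - integral {a..y} p"
        using indefinite_integral_diff[OF pi, of y x] x yy by auto
      finally have i: "integral {- x..- y} (\<lambda>x. q (- x)) = integral {a..x} p - integral {a..y} p" .
      have "q x = p x" using x by (auto simp: q_def)
      hence "norm (integral {a..x} p - integral {a..y} p - (x - y) *\<^sub>R p x) \<le> e * (x - y)"
        using d2(2)[rule_format, of "- y"] i yy by simp
      moreover have "(c + integral {a..y} p) - (c + integral {a..x} p) - (y - x) *\<^sub>R p x
         = - (integral {a..x} p - integral {a..y} p - (x - y) *\<^sub>R p x)" by (simp add: algebra_simps)
      ultimately show ?thesis using yy by (simp only: norm_minus_cancel) simp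
    qed
    moreover have "d > 0" using d1 d2 x by (auto simp: d_def)
    ultimately show "\<exists>d>0. \<forall>y. norm (y - x) < d \<longrightarrow>
      norm ((c + integral {a..y} p) - (c + integral {a..x} p) - (y - x) *\<^sub>R p x) \<le> e * norm (y - x)"
      by blast
  qed
  thus ?thesis unfolding AE_iff_negligible
    by (intro exI[of _ "N1 \<union> uminus ` N2"]) (use N1 N3 in auto)
qed

section \<open>Monotonicity, Gronwall's inequality and exponential weights\<close>

lemma AC_on_constI:
  fixes F :: "real \<Rightarrow> 'a::real_normed_vector"
  assumes AC: "AC_on a b F" and der: "AE x in lebesgue. x \<in> {a<..<b} \<longrightarrow> (F has_vector_derivative 0) (at x)"
    and x: "x \<in> {a..b}"
  shows "F x = F a"
proof -
  have "((\<lambda>x. 0) has_integral F x - F a) {a..x}"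
  proof (rule AC_on_fundamental_theorem)
    show "AC_on a x F" using AC x by (auto intro: AC_on_subinterval)
    show "AE y in lebesgue. y \<in> {a<..<x} \<longrightarrow> (F has_vector_derivative 0) (at y)"
      using der by eventually_elim (use x in auto)
  qed (use x in auto)
  thus ?thesis by simp
qed

lemma AC_on_decreasing:
  fixes f :: "real \<Rightarrow> real"
  assumes AC: "AC_on a b f" and der: "AE x in lebesgue. x \<in> {a<..<b} \<longrightarrow> (f has_vector_derivative f' x) (at x) \<and> f' x \<le> 0"
    and xy: "a \<le> x" "x \<le> y" "y \<le> b"
  shows "f y \<le> f x"
proof -
  \<comment> \<open>The sign of \<open>f'\<close> is known almost everywhere only; the cut makes it
    hold everywhere and changes nothing where it was known.\<close>
  define g where "g x = min 0 (f' x)" for x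
  have "(g has_integral f y - f x) {x..y}"
  proof (rule AC_on_fundamental_theorem[OF xy(2)])
    show "AC_on x y f" using AC xy by (auto intro: AC_on_subinterval)
    show "AE z in lebesgue. z \<in> {x<..<y} \<longrightarrow> (f has_vector_derivative g z) (at z)"
      using der by eventually_elim (use xy in \<open>auto simp: g_def min_def\<close>)
  qed
  hence "f y - f x \<le> 0" by (rule has_integral_le[OF _ has_integral_0]) (auto simp: g_def)
  thus ?thesis by simp
qed

text \<open>With \<open>\<Lambda>\<close> the indefinite integral of \<open>h\<close>, the two-sided
  bound on the derivative makes \<open>\<phi> * exp (- \<Lambda>)\<close> decrease and
  \<open>\<phi> * exp \<Lambda>\<close> increase. So \<open>x\<close> may lie on either side of
  \<open>y\<close>, and both endpoints will serve as \<open>y\<close>.\<close>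

lemma AC_gronwall:
  fixes \<phi> h :: "real \<Rightarrow> real"
  assumes AC: "AC_on a b \<phi>" and h: "h absolutely_integrable_on {a..b}" and h0: "\<And>x. h x \<ge> 0"
    and pos: "\<And>x. x \<in> {a..b} \<Longrightarrow> \<phi> x \<ge> 0"
    and der: "AE x in lebesgue. x \<in> {a<..<b} \<longrightarrow> (\<exists>D. (\<phi> has_vector_derivative D) (at x) \<and> \<bar>D\<bar> \<le> h x * \<phi> x)"
    and xy: "x \<in> {a..b}" "y \<in> {a..b}"
  shows "\<phi> x \<le> \<phi> y * exp (integral {a..b} h)"
proof -
  define \<Lambda> where "\<Lambda> x = 0 + integral {a..x} h" for x
  have AL: "AC_on a b \<Lambda>" unfolding \<Lambda>_def[abs_def] by (rule AC_on_indefinite_integral[OF h])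
  have dL: "AE x in lebesgue. x \<in> {a<..<b} \<longrightarrow> (\<Lambda> has_vector_derivative h x) (at x)"
    unfolding \<Lambda>_def[abs_def] by (rule indefinite_integral_has_vector_derivative_AE[OF h])
  have hi: "h integrable_on {a..b}" using h by (simp add: absolutely_integrable_on_def)
  have L: "\<Lambda> t - \<Lambda> s \<le> integral {a..b} h" if "a \<le> s" "s \<le> t" "t \<le> b" for s t
  proof -
    have "\<Lambda> t - \<Lambda> s = integral {s..t} h" unfolding \<Lambda>_def using indefinite_integral_diff[OF hi that] by simp
    also have "\<dots> \<le> integral {a..b} h"
      using that h0 hi by (intro integral_subset_le) (auto intro: integrable_on_subinterval)
    finally show ?thesis .
  qed
  obtain D where D: "AE x in lebesgue. x \<in> {a<..<b} \<longrightarrow> (\<phi> has_vector_derivative D x) (at x) \<and> \<bar>D x\<bar> \<le> h x * \<phi> x"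
  proof -
    define D where "D x = (SOME D. (\<phi> has_vector_derivative D) (at x) \<and> \<bar>D\<bar> \<le> h x * \<phi> x)" for x
    have "AE x in lebesgue. x \<in> {a<..<b} \<longrightarrow> (\<phi> has_vector_derivative D x) (at x) \<and> \<bar>D x\<bar> \<le> h x * \<phi> x"
      using der
    proof eventually_elim
      case (elim x)
      show ?case unfolding D_def using someI_ex[OF elim[rule_format]] by blast
    qed
    thus ?thesis by (rule that)
  qed
  have eAC: "AC_on a b (\<lambda>x. exp (c * \<Lambda> x))" for c
    by (intro AC_on_exp AC_on_bilinear[OF bounded_bilinear_mult] AC_on_const AL)
  have pAC: "AC_on a b (\<lambda>x. \<phi> x * exp (c * \<Lambda> x))" for c
    by (intro AC_on_bilinear[OF bounded_bilinear_mult] AC eAC)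
  have d: "((\<lambda>x. \<phi> x * exp (c * \<Lambda> x)) has_vector_derivative (D x + c * h x * \<phi> x) * exp (c * \<Lambda> x)) (at x)"
    if "(\<phi> has_vector_derivative D x) (at x)" "(\<Lambda> has_vector_derivative h x) (at x)" for x c
    using that unfolding has_real_derivative_iff_has_vector_derivative[symmetric]
    by (auto intro!: derivative_eq_intros simp: algebra_simps)
  show ?thesis
  proof (cases "y \<le> x")
    case True
    have "\<phi> x * exp (-1 * \<Lambda> x) \<le> \<phi> y * exp (-1 * \<Lambda> y)"
    proof (rule AC_on_decreasing[OF pAC, where f'="\<lambda>x. (D x + (-1) * h x * \<phi> x) * exp (-1 * \<Lambda> x)"])
      show "AE x in lebesgue. x \<in> {a<..<b} \<longrightarrow> ((\<lambda>x. \<phi> x * exp (-1 * \<Lambda> x)) has_vector_derivative (D x + (-1) * h x * \<phi> x) * exp (-1 * \<Lambda> x)) (at x)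
          \<and> (D x + (-1) * h x * \<phi> x) * exp (-1 * \<Lambda> x) \<le> 0"
        using D dL
      proof eventually_elim
        case (elim x)
        show ?case
        proof
          assume "x \<in> {a<..<b}"
          hence e: "(\<phi> has_vector_derivative D x) (at x)" "\<bar>D x\<bar> \<le> h x * \<phi> x" "(\<Lambda> has_vector_derivative h x) (at x)"
            using elim by auto
          show "((\<lambda>x. \<phi> x * exp (-1 * \<Lambda> x)) has_vector_derivative (D x + (-1) * h x * \<phi> x) * exp (-1 * \<Lambda> x)) (at x)
          \<and> (D x + (-1) * h x * \<phi> x) * exp (-1 * \<Lambda> x) \<le> 0"
            using d[OF e(1,3), of "-1"] e(2) by (auto simp: mult_le_0_iff)
        qed
      qed
    qed (use xy True in auto)
    hence "\<phi> x \<le> \<phi> y * exp (\<Lambda> x - \<Lambda> y)"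
      by (simp add: exp_minus exp_diff field_simps)
    also have "\<dots> \<le> \<phi> y * exp (integral {a..b} h)"
      using L[of y x] xy True pos by (intro mult_left_mono) auto
    finally show ?thesis .
  next
    case False
    have "- (\<phi> y * exp (1 * \<Lambda> y)) \<le> - (\<phi> x * exp (1 * \<Lambda> x))"
    proof (rule AC_on_decreasing[where f="\<lambda>x. - (\<phi> x * exp (1 * \<Lambda> x))" and f'="\<lambda>x. - ((D x + 1 * h x * \<phi> x) * exp (1 * \<Lambda> x))"])
      show "AC_on a b (\<lambda>x. - (\<phi> x * exp (1 * \<Lambda> x)))"
        by (rule AC_on_lipschitz[OF pAC[of 1], of 1]) (auto simp: abs_minus_commute)
      show "AE x in lebesgue. x \<in> {a<..<b} \<longrightarrow> ((\<lambda>x. - (\<phi> x * exp (1 * \<Lambda> x))) has_vector_derivative - ((D x + 1 * h x * \<phi> x) * exp (1 * \<Lambda> x))) (at x)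
          \<and> - ((D x + 1 * h x * \<phi> x) * exp (1 * \<Lambda> x)) \<le> 0"
        using D dL
      proof eventually_elim
        case (elim x)
        show ?case
        proof
          assume "x \<in> {a<..<b}"
          hence e: "(\<phi> has_vector_derivative D x) (at x)" "\<bar>D x\<bar> \<le> h x * \<phi> x" "(\<Lambda> has_vector_derivative h x) (at x)"
            using elim by auto
          show "((\<lambda>x. - (\<phi> x * exp (1 * \<Lambda> x))) has_vector_derivative - ((D x + 1 * h x * \<phi> x) * exp (1 * \<Lambda> x))) (at x)
          \<and> - ((D x + 1 * h x * \<phi> x) * exp (1 * \<Lambda> x)) \<le> 0"
            using has_vector_derivative_minus[OF d[OF e(1,3), of 1]] e(2) by (auto simp: zero_le_mult_iff)
        qed
      qed
    qed (use xy False in auto)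
    hence "\<phi> x \<le> \<phi> y * exp (\<Lambda> y - \<Lambda> x)"
      by (simp add: exp_diff field_simps)
    also have "\<dots> \<le> \<phi> y * exp (integral {a..b} h)"
      using L[of x y] xy False pos by (intro mult_left_mono) auto
    finally show ?thesis .
  qed
qed

text \<open>Integration against \<open>h\<close> gains a factor \<open>1 / s\<close> on the
  exponential weight, for every \<open>s\<close>; iterating this gives the decay of Volterra
  iterates.\<close>

lemma has_integral_exp_weight:
  fixes h :: "real \<Rightarrow> real"
  assumes h: "h absolutely_integrable_on {a..b}" and s: "s > 0" and x: "x \<in> {a..b}"
  shows "((\<lambda>y. h y * exp (s * integral {a..y} h)) has_integral (exp (s * integral {a..x} h) - 1) / s) {a..x}"
proof -
  define \<Lambda> where "\<Lambda> x = 0 + integral {a..x} h" for x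
  have AL: "AC_on a b \<Lambda>" unfolding \<Lambda>_def[abs_def] by (rule AC_on_indefinite_integral[OF h])
  have dL: "AE x in lebesgue. x \<in> {a<..<b} \<longrightarrow> (\<Lambda> has_vector_derivative h x) (at x)"
    unfolding \<Lambda>_def[abs_def] by (rule indefinite_integral_has_vector_derivative_AE[OF h])
  have "((\<lambda>y. h y * exp (s * \<Lambda> y)) has_integral (1 / s) * exp (s * \<Lambda> x) - (1 / s) * exp (s * \<Lambda> a)) {a..x}"
  proof (rule AC_on_fundamental_theorem)
    have "AC_on a b (\<lambda>x. (1 / s) * exp (s * \<Lambda> x))"
      by (intro AC_on_exp AC_on_bilinear[OF bounded_bilinear_mult] AC_on_const AL)
    thus "AC_on a x (\<lambda>x. (1 / s) * exp (s * \<Lambda> x))" using x by (auto intro: AC_on_subinterval)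
    show "AE z in lebesgue. z \<in> {a<..<x} \<longrightarrow> ((\<lambda>x. (1 / s) * exp (s * \<Lambda> x)) has_vector_derivative h z * exp (s * \<Lambda> z)) (at z)"
      using dL
    proof eventually_elim
      case (elim z)
      show ?case
      proof
        assume "z \<in> {a<..<x}"
        hence "(\<Lambda> has_vector_derivative h z) (at z)" using elim x by auto
        thus "((\<lambda>x. (1 / s) * exp (s * \<Lambda> x)) has_vector_derivative h z * exp (s * \<Lambda> z)) (at z)"
          using s unfolding has_real_derivative_iff_has_vector_derivative[symmetric]
          by (auto intro!: derivative_eq_intros simp: algebra_simps)
      qed
    qed
  qed (use x in auto)
  thus ?thesis by (simp add: \<Lambda>_def diff_divide_distrib)
qed

section \<open>Measurability of matrix operations\<close>

lemma borel_measurable_bilinear: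
  fixes f :: "'a \<Rightarrow> 'b::euclidean_space" and g :: "'a \<Rightarrow> 'c::euclidean_space"
    and B :: "'b \<Rightarrow> 'c \<Rightarrow> 'd::euclidean_space"
  assumes "bounded_bilinear B" "f \<in> borel_measurable M" "g \<in> borel_measurable M"
  shows "(\<lambda>x. B (f x) (g x)) \<in> borel_measurable M"
proof (rule borel_measurable_continuous_Pair[OF assms(2,3)])
  show "continuous_on UNIV (\<lambda>x. B (fst x) (snd x))"
    by (intro bounded_bilinear.continuous_on[OF assms(1)] continuous_intros)
qed

lemma borel_measurable_mv:
  fixes W :: "'a \<Rightarrow> complex^'m^'k"
  assumes "W \<in> borel_measurable M" "f \<in> borel_measurable M"
  shows "(\<lambda>x. W x *v f x) \<in> borel_measurable M"
  by (rule borel_measurable_bilinear[OF bounded_bilinear_matrix_vector assms])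

lemma borel_measurable_hform:
  assumes "W \<in> borel_measurable M" "f \<in> borel_measurable M" "g \<in> borel_measurable M"
  shows "(\<lambda>x. hform (g x) (W x) (f x)) \<in> borel_measurable M"
  unfolding hform_def
  by (intro borel_measurable_bilinear[OF bounded_bilinear_cdot] borel_measurable_mv assms)

lemma borel_measurable_qf:
  assumes "W \<in> borel_measurable M" "f \<in> borel_measurable M"
  shows "(\<lambda>x. qf (W x) (f x)) \<in> borel_measurable M"
  unfolding qf_def
  by (rule measurable_compose[OF borel_measurable_hform[OF assms(1,2,2)] borel_measurable_continuous_onI])
    (intro continuous_intros)

lemma borel_measurable_component:
  fixes f :: "'a \<Rightarrow> ('b::euclidean_space)^'m"
  assumes "f \<in> borel_measurable M" shows "(\<lambda>x. f x $ i) \<in> borel_measurable M"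
  by (rule measurable_compose[OF assms borel_measurable_continuous_onI]) (intro continuous_intros)

lemma borel_measurable_vec_lambda:
  fixes g :: "'m::finite \<Rightarrow> 'a \<Rightarrow> 'b::euclidean_space"
  assumes "\<And>k. g k \<in> borel_measurable M" shows "(\<lambda>x. \<chi> k. g k x) \<in> borel_measurable M"
proof (subst borel_measurable_euclidean_space, rule ballI)
  fix e :: "'b^'m" assume "e \<in> Basis"
  then obtain i b where e: "e = axis i b" by (auto simp: Basis_vec_def)
  show "(\<lambda>x. (\<chi> k. g k x) \<bullet> e) \<in> borel_measurable M"
    unfolding e inner_axis using assms by simp
qed

lemma borel_measurable_scale:
  fixes f :: "'a \<Rightarrow> complex^'m"
  assumes "c \<in> borel_measurable M" "f \<in> borel_measurable M"
  shows "(\<lambda>x. c x *s f x) \<in> borel_measurable M"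
proof -
  have "(\<lambda>x. \<chi> k. c x * f x $ k) \<in> borel_measurable M"
    by (intro borel_measurable_vec_lambda borel_measurable_times borel_measurable_component assms)
  thus ?thesis by (simp add: vector_scalar_mult_def)
qed

lemma borel_measurable_det:
  fixes A :: "'a \<Rightarrow> complex^'m^'m"
  assumes "\<And>i j. (\<lambda>x. A x $ i $ j) \<in> borel_measurable M"
  shows "(\<lambda>x. det (A x)) \<in> borel_measurable M"
  unfolding det_def by (intro borel_measurable_sum borel_measurable_times borel_measurable_prod assms) auto

section \<open>The projection onto the range of a positive semidefinite matrix\<close>

definition reg_eps :: "nat \<Rightarrow> real" where
  "reg_eps j = inverse (real (Suc j))"

lemma reg_eps_pos [simp]: "reg_eps j > 0"
  by (simp add: reg_eps_def)

lemma reg_eps_nonneg [simp]: "reg_eps j \<ge> 0"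
  by (simp add: reg_eps_def)

lemma reg_eps_tendsto: "reg_eps \<longlonglongrightarrow> 0"
  unfolding reg_eps_def[abs_def] by (rule LIMSEQ_inverse_real_of_nat)

definition regularized :: "complex^'m^'m \<Rightarrow> nat \<Rightarrow> complex^'m^'m" where
  "regularized A j = A + mat (complex_of_real (reg_eps j))"

text \<open>Being a rational function of the entries, this solution of a linear system depends
  measurably on the matrix.\<close>

definition cramer_solution :: "complex^'m^'m \<Rightarrow> complex^'m \<Rightarrow> complex^'m" where
  "cramer_solution A b = (\<chi> k. det (\<chi> i j. if j = k then b $ i else A $ i $ j) / det A)"

text \<open>For psd \<open>A\<close> this is the orthogonal projection onto the range of
  \<open>A\<close>, as the limit of the inverse of \<open>A + \<epsilon>\<close> applied to
  \<open>A *v y\<close>. The limit of Cramer quotients is chosen because it is measurable in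
  \<open>A\<close>.\<close>

definition range_proj :: "complex^'m^'m \<Rightarrow> complex^'m \<Rightarrow> complex^'m" where
  "range_proj A y = lim (\<lambda>j. cramer_solution (regularized A j) (A *v y))"

lemma mat_vector_mult: "mat c *v (x :: complex^'m) = c *s x"
  unfolding matrix_vector_mult_def mat_def
  by (simp add: vec_eq_iff if_distrib[where f="\<lambda>c. c * _"] cong: if_cong)

lemma regularized_vector:
  "regularized A j *v x = A *v x + complex_of_real (reg_eps j) *s x"
  by (simp only: regularized_def matrix_vector_mult_add_rdistrib mat_vector_mult)

lemma regularized_form:
  assumes "psd A"
  shows "Re (cdot x (regularized A j *v x)) = qf A x + reg_eps j * (norm x)\<^sup>2"
  unfolding regularized_vector cdot_simps cdot_self
  by (simp add: qf_def hform_def del: of_real_power flip: of_real_mult)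

lemma det_regularized: assumes "psd A" shows "det (regularized A j) \<noteq> 0"
proof -
  have "x = 0" if "regularized A j *v x = 0" for x
  proof -
    have "qf A x + reg_eps j * (norm x)\<^sup>2 = 0"
      using regularized_form[OF assms, of x j] that by simp
    moreover have "reg_eps j * (norm x)\<^sup>2 \<ge> 0" by simp
    ultimately have "reg_eps j * (norm x)\<^sup>2 = 0"
      using qf_nonneg[OF assms, of x] by linarith
    thus ?thesis using reg_eps_pos[of j] by (auto simp del: reg_eps_pos)
  qed
  hence "\<exists>B. B ** regularized A j = mat 1" by (simp add: matrix_left_invertible_ker)
  thus ?thesis by (simp add: invertible_left_inverse[symmetric] invertible_det_nz)
qed

lemma cramer_solution_regularized:
  "psd A \<Longrightarrow> regularized A j *v cramer_solution (regularized A j) b = b"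
  using cramer[OF det_regularized, of A j "cramer_solution (regularized A j) b" b]
  by (simp add: cramer_solution_def)

text \<open>Write \<open>y = v + w\<close> with \<open>v\<close> in the range of \<open>A\<close>
  and \<open>w\<close> orthogonal to it. Then \<open>w\<close> is orthogonal to
  \<open>A *v (A *v w)\<close>, which for hermitian \<open>A\<close> says that
  \<open>A *v w = 0\<close>.\<close>

lemma psd_range_square: assumes "psd A" obtains z where "A *v (A *v z) = A *v y"
proof -
  have sub: "subspace (range ((*v) A))"
    by (intro linear_subspace_image subspace_UNIV bounded_linear.linear
        bounded_bilinear.bounded_linear_right[OF bounded_bilinear_matrix_vector])
  obtain v w where vw: "v \<in> span (range ((*v) A))" "\<And>u. u \<in> span (range ((*v) A)) \<Longrightarrow> orthogonal w u" "y = v + w"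
    using orthogonal_subspace_decomp_exists[of "range ((*v) A)" y] by metis
  obtain z where z: "v = A *v z" using vw(1)[unfolded span_eq_iff[THEN iffD2, OF sub]] by blast
  have inner: "x \<bullet> x' = Re (cdot x x')" for x x' :: "complex^'m"
    by (simp add: inner_vec_def cdot_def inner_complex_def)
  have "orthogonal w (A *v (A *v w))" using vw(2) by (auto intro: span_base)
  hence "Re (cdot w (A *v (A *v w))) = 0" by (simp add: orthogonal_def inner)
  hence "Re (cdot (A *v w) (A *v w)) = 0" by (simp add: psd_herm[OF assms])
  hence "A *v w = 0" by (simp add: cdot_self flip: of_real_power)
  thus ?thesis using that[of z] vw(3) z by (simp add: mv_simps)
qed

lemma range_proj_tendsto:
  assumes A: "psd A"
  obtains z where "range_proj A y = A *v z" "A *v (A *v z) = A *v y"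
    "(\<lambda>j. cramer_solution (regularized A j) (A *v y)) \<longlonglongrightarrow> A *v z"
proof -
  obtain z where z: "A *v (A *v z) = A *v y" by (rule psd_range_square[OF A])
  define x where "x j = cramer_solution (regularized A j) (A *v y)" for j
  have x: "A *v x j + complex_of_real (reg_eps j) *s x j = A *v y" for j
    using cramer_solution_regularized[OF A, of j "A *v y"]
    by (simp only: x_def regularized_vector)
  have bnd: "norm (x j - A *v z) \<le> 2 * norm z * reg_eps j" for j
  proof -
    define e where "e = x j - A *v z"
    \<comment> \<open>The shift pushes the residual to second order: with
      \<open>\<epsilon> = reg_eps j\<close>,
      \<open>(A + \<epsilon>) e' = \<epsilon>\<^sup>2 z\<close>. Pairing with \<open>e'\<close> and
      dropping the psd term gives \<open>norm e' \<le> \<epsilon> * norm z\<close>.\<close>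
    define e' where "e' = e + complex_of_real (reg_eps j) *s z"
    have "regularized A j *v e' = complex_of_real (reg_eps j) *s (complex_of_real (reg_eps j) *s z)"
    proof -
      have "A *v e' + complex_of_real (reg_eps j) *s e' = (A *v x j + complex_of_real (reg_eps j) *s x j) - A *v (A *v z) +
         complex_of_real (reg_eps j) *s (complex_of_real (reg_eps j) *s z)"
        by (simp add: e'_def e_def mv_simps vec.scale_right_diff_distrib vec.scale_right_distrib)
      thus ?thesis using z x by (simp only: regularized_vector) simp
    qed
    hence "qf A e' + reg_eps j * (norm e')\<^sup>2 = (reg_eps j)\<^sup>2 * Re (cdot e' z)"
      using regularized_form[OF A, of e' j] by (simp add: cdot_simps power2_eq_square)
    moreover have "Re (cdot e' z) \<le> norm e' * norm z"
      by (rule order_trans[OF complex_Re_le_cmod norm_cdot_le])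
    ultimately have "reg_eps j * (norm e')\<^sup>2 \<le> (reg_eps j)\<^sup>2 * (norm e' * norm z)"
      using qf_nonneg[OF A, of e'] mult_left_mono[of "Re (cdot e' z)" "norm e' * norm z" "(reg_eps j)\<^sup>2"] by simp
    hence "(reg_eps j * norm e') * norm e' \<le> (reg_eps j * norm e') * (reg_eps j * norm z)"
      by (simp add: power2_eq_square mult_ac)
    hence "norm e' \<le> reg_eps j * norm z"
      using reg_eps_pos[of j] by (cases "e' = 0") (simp_all add: mult_le_cancel_left)
    moreover have "norm e \<le> norm e' + norm (complex_of_real (reg_eps j) *s z)"
      unfolding e'_def by (metis add_diff_cancel_right' norm_triangle_ineq4)
    moreover have "norm (complex_of_real (reg_eps j) *s z) = reg_eps j * norm z"
      using reg_eps_pos[of j] by (simp add: scaleR_eq_scale[symmetric])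
    ultimately show ?thesis by (simp add: e_def algebra_simps)
  qed
  have "(\<lambda>j. x j - A *v z) \<longlonglongrightarrow> 0"
  proof (rule Lim_null_comparison)
    show "\<forall>\<^sub>F j in sequentially. norm (x j - A *v z) \<le> 2 * norm z * reg_eps j" using bnd by simp
    show "(\<lambda>j. 2 * norm z * reg_eps j) \<longlonglongrightarrow> 0" by (rule tendsto_mult_right_zero[OF reg_eps_tendsto])
  qed
  hence lim: "x \<longlonglongrightarrow> A *v z" by (simp add: LIM_zero_iff)
  hence "range_proj A y = A *v z" unfolding range_proj_def x_def[abs_def] by (rule limI)
  thus ?thesis using that z lim unfolding x_def[abs_def] by blast
qed

lemma borel_measurable_range_proj:
  assumes W: "W \<in> borel_measurable M" and f: "f \<in> borel_measurable M"
  shows "(\<lambda>x. range_proj (W x) (f x)) \<in> borel_measurable M"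
proof -
  have c: "(\<lambda>x. W x $ i $ j) \<in> borel_measurable M" for i j
    by (intro borel_measurable_component W)
  have r: "(\<lambda>x. regularized (W x) n $ i $ j) \<in> borel_measurable M" for n i j
    unfolding regularized_def mat_def by (simp add: borel_measurable_add[OF c])
  have Wf: "(\<lambda>x. (W x *v f x) $ i) \<in> borel_measurable M" for i
    by (intro borel_measurable_component borel_measurable_mv W f)
  have "(\<lambda>x. cramer_solution (regularized (W x) n) (W x *v f x)) \<in> borel_measurable M" for n
    unfolding cramer_solution_def
  proof (intro borel_measurable_vec_lambda borel_measurable_divide borel_measurable_det r)
    fix i j k
    show "(\<lambda>x. (\<chi> i j. if j = k then (W x *v f x) $ i else regularized (W x) n $ i $ j) $ i $ j) \<in> borel_measurable M"
      using r[of n i j] Wf[of i] by (cases "j = k") auto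
  qed
  thus ?thesis unfolding range_proj_def by (rule borel_measurable_lim_metric)
qed

text \<open>A hermitian matrix is injective on its range, hence bounded below there. The constant
  depends on the matrix, which is enough for convergence at a fixed point.\<close>

lemma psd_range_lower_bound:
  assumes A: "psd A" obtains C where "C > 0" "\<And>z. norm (A *v z) \<le> C * norm (A *v (A *v z))"
proof -
  have bl: "bounded_linear ((*v) A)"
    by (rule bounded_bilinear.bounded_linear_right[OF bounded_bilinear_matrix_vector])
  have sub: "subspace (range ((*v) A))"
    by (intro linear_subspace_image subspace_UNIV bounded_linear.linear bl)
  have inj: "x = 0" if x: "x \<in> range ((*v) A)" "A *v x = 0" for x
  proof -
    obtain z where z: "x = A *v z" using x by auto
    have "cdot x x = cdot z (A *v x)" by (simp add: z psd_herm[OF A])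
    hence "cdot x x = 0" using x by simp
    thus ?thesis by (simp add: cdot_self)
  qed
  obtain e where e: "e > 0" "\<forall>x\<in>range ((*v) A). norm (A *v x) \<ge> e * norm x"
    using injective_imp_isometric[OF closed_subspace[OF sub] sub bl] inj by blast
  show ?thesis
  proof (rule that[of "1 / e"])
    fix z show "norm (A *v z) \<le> 1 / e * norm (A *v (A *v z))"
      using e(1) e(2)[rule_format, of "A *v z"] by (simp add: field_simps)
  qed (use e in simp)
qed

section \<open>Weighted square integrable vector functions\<close>

definition L2w :: "'a measure \<Rightarrow> ('a \<Rightarrow> complex^'m^'m) \<Rightarrow> ('a \<Rightarrow> complex^'m) set" where
  "L2w M W = {f \<in> borel_measurable M. integrable M (\<lambda>x. hform (f x) (W x) (f x))}"

definition ipw :: "'a measure \<Rightarrow> ('a \<Rightarrow> complex^'m^'m) \<Rightarrow> ('a \<Rightarrow> complex^'m) \<Rightarrow> ('a \<Rightarrow> complex^'m) \<Rightarrow> complex" where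
  "ipw M W f g = (\<integral>x. hform (g x) (W x) (f x) \<partial>M)"

lemma borel_measurable_complex_of_real:
  "f \<in> borel_measurable M \<Longrightarrow> (\<lambda>x. complex_of_real (f x)) \<in> borel_measurable M"
  by (rule measurable_compose[OF _ borel_measurable_continuous_onI]) (auto intro!: continuous_intros)

text \<open>One theory for two spaces: the weight \<open>H\<close> over Lebesgue measure on the open
  interval, and the density \<open>W\<close> over \<open>\<mu>\<close>.\<close>

locale weighted_L2 =
  fixes M :: "'a measure" and W :: "'a \<Rightarrow> complex^'m^'m"
  assumes W_measurable: "W \<in> borel_measurable M" and W_psd: "AE x in M. psd (W x)"
begin

abbreviation "L2 \<equiv> L2w M W"
abbreviation "ip \<equiv> ipw M W"

text \<open>The seminorm is kept squared to avoid roots, at the price of a factor 2 in the triangle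
  inequality.\<close>

definition N2 :: "('a \<Rightarrow> complex^'m) \<Rightarrow> real" where
  "N2 f = Re (ip f f)"

lemma L2_measurable: "f \<in> L2 \<Longrightarrow> f \<in> borel_measurable M"
  by (simp add: L2w_def)

lemma L2_iff: "f \<in> L2 \<longleftrightarrow> f \<in> borel_measurable M \<and> integrable M (\<lambda>x. qf (W x) (f x))"
proof -
  have "integrable M (\<lambda>x. hform (f x) (W x) (f x)) \<longleftrightarrow> integrable M (\<lambda>x. qf (W x) (f x))" if f: "f \<in> borel_measurable M"
  proof
    assume "integrable M (\<lambda>x. hform (f x) (W x) (f x))"
    thus "integrable M (\<lambda>x. qf (W x) (f x))" unfolding qf_def by (rule integrable_Re)
  next
    assume "integrable M (\<lambda>x. qf (W x) (f x))"
    hence i: "integrable M (\<lambda>x. complex_of_real (qf (W x) (f x)))" by (rule integrable_of_real)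
    have e: "AE x in M. complex_of_real (qf (W x) (f x)) = hform (f x) (W x) (f x)"
      using W_psd by eventually_elim (simp add: hform_qf)
    show "integrable M (\<lambda>x. hform (f x) (W x) (f x))"
      by (rule integrable_cong_AE_imp[OF i borel_measurable_hform[OF W_measurable f f] e])
  qed
  thus ?thesis by (auto simp: L2w_def)
qed

lemma integrable_qf: "f \<in> L2 \<Longrightarrow> integrable M (\<lambda>x. qf (W x) (f x))"
  by (simp add: L2_iff)

lemma L2_dominated:
  assumes "integrable M g" "f \<in> borel_measurable M" "AE x in M. qf (W x) (f x) \<le> g x"
  shows "f \<in> L2"
  unfolding L2_iff
proof (intro conjI Bochner_Integration.integrable_bound[OF assms(1)])
  show "AE x in M. norm (qf (W x) (f x)) \<le> norm (g x)"
    using assms(3) W_psd by eventually_elim (use qf_nonneg in force)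
qed (intro borel_measurable_qf W_measurable assms)+

lemma N2_eq: assumes "f \<in> L2" shows "ip f f = complex_of_real (N2 f)" "N2 f = (\<integral>x. qf (W x) (f x) \<partial>M)"
proof -
  have "ip f f = (\<integral>x. complex_of_real (qf (W x) (f x)) \<partial>M)"
    unfolding ipw_def
  proof (rule integral_cong_AE)
    show "AE x in M. hform (f x) (W x) (f x) = complex_of_real (qf (W x) (f x))"
      using W_psd by eventually_elim (simp add: hform_qf)
  qed (intro borel_measurable_hform borel_measurable_complex_of_real borel_measurable_qf W_measurable L2_measurable assms)+
  hence *: "ip f f = complex_of_real (\<integral>x. qf (W x) (f x) \<partial>M)" by simp
  thus "N2 f = (\<integral>x. qf (W x) (f x) \<partial>M)" by (simp add: N2_def)
  with * show "ip f f = complex_of_real (N2 f)" by simp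
qed

lemma N2_nonneg: "f \<in> L2 \<Longrightarrow> N2 f \<ge> 0"
proof -
  assume f: "f \<in> L2"
  show ?thesis unfolding N2_eq(2)[OF f]
    by (rule integral_nonneg_AE) (use W_psd in eventually_elim, simp add: qf_nonneg)
qed

lemma L2_zero [simp]: "(\<lambda>x. 0) \<in> L2"
  by (simp add: L2_iff)

lemma L2_add: assumes "f \<in> L2" "g \<in> L2" shows "(\<lambda>x. f x + g x) \<in> L2"
proof (rule L2_dominated)
  show "integrable M (\<lambda>x. 2 * qf (W x) (f x) + 2 * qf (W x) (g x))"
    using assms by (intro Bochner_Integration.integrable_add integrable_mult_right integrable_qf)
  show "AE x in M. qf (W x) (f x + g x) \<le> 2 * qf (W x) (f x) + 2 * qf (W x) (g x)"
    using W_psd by eventually_elim (rule qf_add_le)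
qed (intro borel_measurable_add L2_measurable assms)

lemma L2_scale: assumes "f \<in> L2" shows "(\<lambda>x. c *s f x) \<in> L2"
  unfolding L2_iff qf_scale
  using assms by (intro conjI integrable_mult_right integrable_qf borel_measurable_scale L2_measurable) auto

lemma L2_diff: assumes "f \<in> L2" "g \<in> L2" shows "(\<lambda>x. f x - g x) \<in> L2"
  using L2_add[OF assms(1) L2_scale[OF assms(2), of "-1"]] by simp

lemma L2_sum: "(\<And>i. i \<in> I \<Longrightarrow> f i \<in> L2) \<Longrightarrow> (\<lambda>x. \<Sum>i\<in>I. f i x) \<in> L2"
  by (induction I rule: infinite_finite_induct) (auto intro: L2_add)

lemma integrable_hform:
  assumes "f \<in> L2" "g \<in> L2" shows "integrable M (\<lambda>x. hform (g x) (W x) (f x))"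
proof (rule Bochner_Integration.integrable_bound)
  show "integrable M (\<lambda>x. qf (W x) (g x) + qf (W x) (f x))"
    using assms by (intro Bochner_Integration.integrable_add integrable_qf)
  show "AE x in M. norm (hform (g x) (W x) (f x)) \<le> norm (qf (W x) (g x) + qf (W x) (f x))"
    using W_psd
  proof eventually_elim
    case (elim x)
    show ?case using cmod_hform_le[OF elim, of "g x" "f x"] by simp
  qed
qed (intro borel_measurable_hform W_measurable L2_measurable assms)

lemma ip_add_left: "f \<in> L2 \<Longrightarrow> g \<in> L2 \<Longrightarrow> h \<in> L2 \<Longrightarrow> ip (\<lambda>x. f x + g x) h = ip f h + ip g h"
  and ip_add_right: "f \<in> L2 \<Longrightarrow> g \<in> L2 \<Longrightarrow> h \<in> L2 \<Longrightarrow> ip h (\<lambda>x. f x + g x) = ip h f + ip h g"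
  and ip_diff_left: "f \<in> L2 \<Longrightarrow> g \<in> L2 \<Longrightarrow> h \<in> L2 \<Longrightarrow> ip (\<lambda>x. f x - g x) h = ip f h - ip g h"
  and ip_diff_right: "f \<in> L2 \<Longrightarrow> g \<in> L2 \<Longrightarrow> h \<in> L2 \<Longrightarrow> ip h (\<lambda>x. f x - g x) = ip h f - ip h g"
  by (simp_all add: ipw_def hform_simps integrable_hform)

lemma ip_scale_left: "ip (\<lambda>x. c *s f x) h = c * ip f h"
  and ip_scale_right: "ip h (\<lambda>x. c *s f x) = cnj c * ip h f"
  by (simp_all add: ipw_def hform_simps)

lemma ip_zero_left [simp]: "ip (\<lambda>x. 0) f = 0" and ip_zero_right [simp]: "ip f (\<lambda>x. 0) = 0"
  by (simp_all add: ipw_def hform_simps)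

lemma ip_sum_left:
  "(\<And>i. i \<in> I \<Longrightarrow> f i \<in> L2) \<Longrightarrow> h \<in> L2 \<Longrightarrow> ip (\<lambda>x. \<Sum>i\<in>I. f i x) h = (\<Sum>i\<in>I. ip (f i) h)"
  by (induction I rule: infinite_finite_induct) (auto simp: ip_add_left L2_sum)

lemma ip_sum_right:
  "(\<And>i. i \<in> I \<Longrightarrow> f i \<in> L2) \<Longrightarrow> h \<in> L2 \<Longrightarrow> ip h (\<lambda>x. \<Sum>i\<in>I. f i x) = (\<Sum>i\<in>I. ip h (f i))"
  by (induction I rule: infinite_finite_induct) (auto simp: ip_add_right L2_sum)

lemma ip_cnj: assumes "f \<in> L2" "g \<in> L2" shows "cnj (ip f g) = ip g f"
proof -
  have "cnj (ip f g) = (\<integral>x. cnj (hform (g x) (W x) (f x)) \<partial>M)"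
    unfolding ipw_def by simp
  also have "\<dots> = ip g f" unfolding ipw_def
  proof (rule integral_cong_AE)
    show "AE x in M. cnj (hform (g x) (W x) (f x)) = hform (f x) (W x) (g x)"
      using W_psd by eventually_elim (rule hform_cnj)
    show "(\<lambda>x. cnj (hform (g x) (W x) (f x))) \<in> borel_measurable M"
      by (rule measurable_compose[OF borel_measurable_hform[OF W_measurable L2_measurable L2_measurable]
            borel_measurable_continuous_onI]) (intro assms continuous_intros)+
  qed (intro borel_measurable_hform W_measurable L2_measurable assms)
  finally show ?thesis .
qed

lemma N2_diff_scale:
  assumes "f \<in> L2" "g \<in> L2"
  shows "N2 (\<lambda>x. f x - c *s g x) = N2 f - 2 * Re (cnj c * ip f g) + (cmod c)\<^sup>2 * N2 g"
proof -
  have "ip (\<lambda>x. f x - c *s g x) (\<lambda>x. f x - c *s g x)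
      = ip f f - cnj c * ip f g - c * ip g f + (c * cnj c) * ip g g"
    using assms by (simp add: ip_diff_left ip_diff_right ip_scale_left ip_scale_right L2_scale L2_diff algebra_simps)
  also have "c * ip g f = cnj (cnj c * ip f g)" using ip_cnj[OF assms] by simp
  also have "c * cnj c = complex_of_real ((cmod c)\<^sup>2)" by (simp only: complex_norm_square)
  finally show ?thesis by (simp add: N2_def del: of_real_power)
qed

lemma ip_cauchy_schwarz:
  assumes "f \<in> L2" "g \<in> L2" shows "(cmod (ip f g))\<^sup>2 \<le> N2 f * N2 g"
proof (rule quadratic_discriminant_bound)
  fix c show "0 \<le> N2 f - 2 * Re (cnj c * ip f g) + (cmod c)\<^sup>2 * N2 g"
    using N2_nonneg[OF L2_diff[OF assms(1) L2_scale[OF assms(2)]], of c] by (simp add: N2_diff_scale[OF assms])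
qed (rule N2_nonneg[OF assms(2)])

lemma N2_scale: "N2 (\<lambda>x. c *s f x) = (cmod c)\<^sup>2 * N2 f"
proof -
  have "ip (\<lambda>x. c *s f x) (\<lambda>x. c *s f x) = complex_of_real ((cmod c)\<^sup>2) * ip f f"
    by (simp only: ip_scale_left ip_scale_right complex_norm_square mult_ac)
  thus ?thesis by (simp add: N2_def del: of_real_power)
qed

lemma N2_parallelogram:
  assumes "f \<in> L2" "g \<in> L2"
  shows "N2 (\<lambda>x. f x + g x) + N2 (\<lambda>x. f x - g x) = 2 * N2 f + 2 * N2 g"
  using assms by (simp add: N2_def ip_add_left ip_add_right ip_diff_left ip_diff_right L2_add L2_diff)

lemma N2_add_le:
  assumes "f \<in> L2" "g \<in> L2" shows "N2 (\<lambda>x. f x + g x) \<le> 2 * N2 f + 2 * N2 g"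
  using N2_parallelogram[OF assms] N2_nonneg[OF L2_diff[OF assms]] by simp

lemma N2_diff_commute: "N2 (\<lambda>x. f x - g x) = N2 (\<lambda>x. g x - f x)"
  using N2_scale[of "-1" "\<lambda>x. f x - g x"] by simp

lemma N2_triangle:
  assumes "f \<in> L2" "g \<in> L2" "h \<in> L2"
  shows "N2 (\<lambda>x. f x - h x) \<le> 2 * N2 (\<lambda>x. f x - g x) + 2 * N2 (\<lambda>x. g x - h x)"
  using N2_add_le[OF L2_diff[OF assms(1,2)] L2_diff[OF assms(2,3)]] by simp

lemma N2_eq_0_iff: assumes "f \<in> L2" shows "N2 f = 0 \<longleftrightarrow> (AE x in M. W x *v f x = 0)"
proof -
  have "N2 f = 0 \<longleftrightarrow> (AE x in M. qf (W x) (f x) = 0)"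
    unfolding N2_eq(2)[OF assms]
    by (rule integral_nonneg_eq_0_iff_AE[OF integrable_qf[OF assms]])
      (use W_psd in eventually_elim, simp add: qf_nonneg)
  also have "\<dots> \<longleftrightarrow> (AE x in M. W x *v f x = 0)"
  proof
    assume "AE x in M. qf (W x) (f x) = 0"
    thus "AE x in M. W x *v f x = 0" using W_psd by eventually_elim (simp add: qf_eq_0_iff)
  next
    assume "AE x in M. W x *v f x = 0"
    thus "AE x in M. qf (W x) (f x) = 0" using W_psd by eventually_elim (simp add: qf_eq_0_iff)
  qed
  finally show ?thesis .
qed

text \<open>The integrand sees its right factor through \<open>W x\<close> directly, and its left
  factor after \<open>W x\<close> is moved over by hermiticity.\<close>

lemma ip_cong_AE:
  assumes "f \<in> L2" "f' \<in> L2" "g \<in> L2" "g' \<in> L2" and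
    "AE x in M. W x *v f x = W x *v f' x" "AE x in M. W x *v g x = W x *v g' x"
  shows "ip f g = ip f' g'"
  unfolding ipw_def
proof (rule integral_cong_AE)
  show "AE x in M. hform (g x) (W x) (f x) = hform (g' x) (W x) (f' x)"
    using assms(5,6) W_psd
  proof eventually_elim
    case (elim x)
    have "hform (g x) (W x) (f x) = cdot (W x *v g x) (f' x)"
      unfolding hform_def elim(1) by (rule psd_herm[OF elim(3)])
    thus ?case unfolding elim(2) hform_def by (simp add: psd_herm[OF elim(3)])
  qed
qed (intro borel_measurable_hform W_measurable L2_measurable assms)+

lemma ip_null_left: assumes "f \<in> L2" "g \<in> L2" "N2 f = 0" shows "ip f g = 0"
  using ip_cauchy_schwarz[OF assms(1,2)] assms(3) by simp

lemma ip_null_right: assumes "f \<in> L2" "g \<in> L2" "N2 g = 0" shows "ip f g = 0"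
  using ip_cauchy_schwarz[OF assms(1,2)] assms(3) by simp

section \<open>Convergence, completeness and projections in the seminorm\<close>

definition L2_Cauchy :: "(nat \<Rightarrow> 'a \<Rightarrow> complex^'m) \<Rightarrow> bool" where
  "L2_Cauchy s \<longleftrightarrow> (\<forall>n. s n \<in> L2) \<and> (\<forall>e>0. \<exists>N. \<forall>m\<ge>N. \<forall>n\<ge>N. N2 (\<lambda>x. s m x - s n x) < e)"

lemma L2_CauchyD: "L2_Cauchy s \<Longrightarrow> e > 0 \<Longrightarrow> \<exists>N. \<forall>m\<ge>N. \<forall>n\<ge>N. N2 (\<lambda>x. s m x - s n x) < e"
  by (simp add: L2_Cauchy_def)

definition L2_lim :: "(nat \<Rightarrow> 'a \<Rightarrow> complex^'m) \<Rightarrow> ('a \<Rightarrow> complex^'m) \<Rightarrow> bool" where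
  "L2_lim s p \<longleftrightarrow> (\<forall>n. s n \<in> L2) \<and> p \<in> L2 \<and> (\<lambda>n. N2 (\<lambda>x. s n x - p x)) \<longlonglongrightarrow> 0"

lemma L2_lim_Cauchy: assumes "L2_lim s p" shows "L2_Cauchy s"
  unfolding L2_Cauchy_def
proof (intro conjI allI impI)
  show L: "s n \<in> L2" for n using assms by (simp add: L2_lim_def)
  have p: "p \<in> L2" using assms by (simp add: L2_lim_def)
  fix e :: real assume "e > 0"
  hence "\<forall>\<^sub>F n in sequentially. N2 (\<lambda>x. s n x - p x) < e / 4"
    using assms unfolding L2_lim_def by (intro order_tendstoD) auto
  then obtain N where N: "\<And>n. n \<ge> N \<Longrightarrow> N2 (\<lambda>x. s n x - p x) < e / 4"
    by (auto simp: eventually_sequentially)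
  have "N2 (\<lambda>x. s m x - s n x) < e" if "m \<ge> N" "n \<ge> N" for m n
    using N2_triangle[OF L[of m] p L[of n]] N[OF that(1)] N[OF that(2)] N2_diff_commute[of p "s n"] by simp
  thus "\<exists>N. \<forall>m\<ge>N. \<forall>n\<ge>N. N2 (\<lambda>x. s m x - s n x) < e" by blast
qed

lemma L2_lim_ip_left:
  assumes "L2_lim s p" "x \<in> L2" shows "(\<lambda>n. ip (s n) x) \<longlonglongrightarrow> ip p x"
proof -
  have s: "s n \<in> L2" and p: "p \<in> L2" for n using assms by (simp_all add: L2_lim_def)
  have "(\<lambda>n. (cmod (ip (s n) x - ip p x))\<^sup>2) \<longlonglongrightarrow> 0"
  proof (rule Lim_null_comparison)
    show "\<forall>\<^sub>F n in sequentially. norm ((cmod (ip (s n) x - ip p x))\<^sup>2) \<le> N2 (\<lambda>y. s n y - p y) * N2 x"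
      using ip_cauchy_schwarz[OF L2_diff[OF s p] assms(2)] by (simp add: ip_diff_left[OF s p assms(2)])
    show "(\<lambda>n. N2 (\<lambda>y. s n y - p y) * N2 x) \<longlonglongrightarrow> 0"
      using assms(1) by (intro tendsto_mult_left_zero) (simp add: L2_lim_def)
  qed
  hence "(\<lambda>n. cmod (ip (s n) x - ip p x)) \<longlonglongrightarrow> 0"
    using tendsto_real_sqrt[of "\<lambda>n. (cmod (ip (s n) x - ip p x))\<^sup>2" 0 sequentially] by simp
  thus ?thesis using LIM_zero_iff tendsto_norm_zero_iff by blast
qed

text \<open>Fatou's lemma in the second index: the distance of \<open>s n\<close> from
  \<open>F\<close> is at most the lower limit of its distances from \<open>s m\<close>. This serves
  completeness, and later identifies limits of transforms, whose pointwise limits are known.\<close>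

lemma L2_lim_fatou:
  assumes C: "L2_Cauchy s" and F: "F \<in> borel_measurable M" and lim: "AE x in M. (\<lambda>n. s n x) \<longlonglongrightarrow> F x"
  shows "L2_lim s F"
proof -
  have s: "s n \<in> L2" for n using C by (simp add: L2_Cauchy_def)
  have key: "(\<integral>\<^sup>+x. ennreal (qf (W x) (s n x - F x)) \<partial>M) \<le> ennreal e"
    if N: "\<forall>m\<ge>N. N2 (\<lambda>x. s n x - s m x) < e" for n N e
  proof -
    have meas: "(\<lambda>x. ennreal (qf (W x) (s n x - s m x))) \<in> borel_measurable M" for m
      by (intro measurable_compose[OF _ measurable_ennreal] borel_measurable_qf W_measurable L2_measurable L2_diff s)
    have "(\<integral>\<^sup>+x. ennreal (qf (W x) (s n x - F x)) \<partial>M) \<le> (\<integral>\<^sup>+x. liminf (\<lambda>m. ennreal (qf (W x) (s n x - s m x))) \<partial>M)"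
    proof (rule nn_integral_mono_AE)
      show "AE x in M. ennreal (qf (W x) (s n x - F x)) \<le> liminf (\<lambda>m. ennreal (qf (W x) (s n x - s m x)))"
        using lim
      proof eventually_elim
        case (elim x)
        have "(\<lambda>m. qf (W x) (s n x - s m x)) \<longlonglongrightarrow> qf (W x) (s n x - F x)"
          unfolding qf_def hform_def
          by (intro tendsto_intros elim bounded_bilinear.tendsto[OF bounded_bilinear_cdot]
              bounded_bilinear.tendsto[OF bounded_bilinear_matrix_vector])
        hence "(\<lambda>m. ennreal (qf (W x) (s n x - s m x))) \<longlonglongrightarrow> ennreal (qf (W x) (s n x - F x))"
          by (rule tendsto_ennrealI)
        thus ?case by (simp add: lim_imp_Liminf)
      qed
    qed
    also have "\<dots> \<le> liminf (\<lambda>m. \<integral>\<^sup>+x. ennreal (qf (W x) (s n x - s m x)) \<partial>M)"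
      by (rule nn_integral_liminf[OF meas])
    also have "\<dots> \<le> ennreal e"
    proof (rule order_trans[OF Liminf_le_Limsup Limsup_bounded])
      show "\<forall>\<^sub>F m in sequentially. (\<integral>\<^sup>+x. ennreal (qf (W x) (s n x - s m x)) \<partial>M) \<le> ennreal e"
        unfolding eventually_sequentially
      proof (intro exI[of _ N] allI impI)
        fix m assume "m \<ge> N"
        have "(\<integral>\<^sup>+x. ennreal (qf (W x) (s n x - s m x)) \<partial>M) = ennreal (N2 (\<lambda>x. s n x - s m x))"
          unfolding N2_eq(2)[OF L2_diff[OF s s]]
          by (rule nn_integral_eq_integral[OF integrable_qf[OF L2_diff[OF s s]]])
            (use W_psd in eventually_elim, simp add: qf_nonneg)
        also have "\<dots> \<le> ennreal e" using N \<open>m \<ge> N\<close> by (intro ennreal_leI) (simp add: less_imp_le)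
        finally show "(\<integral>\<^sup>+x. ennreal (qf (W x) (s n x - s m x)) \<partial>M) \<le> ennreal e" .
      qed
    qed simp
    finally show ?thesis .
  qed
  have key2: "(\<lambda>x. s n x - F x) \<in> L2 \<and> N2 (\<lambda>x. s n x - F x) \<le> e"
    if N: "\<forall>m\<ge>N. N2 (\<lambda>x. s n x - s m x) < e" and e: "e > 0" for n N e
  proof -
    have m: "(\<lambda>x. s n x - F x) \<in> borel_measurable M" by (intro borel_measurable_diff L2_measurable s F)
    have nn: "AE x in M. 0 \<le> qf (W x) (s n x - F x)"
      using W_psd by eventually_elim (simp add: qf_nonneg)
    have i: "integrable M (\<lambda>x. qf (W x) (s n x - F x))"
      by (rule integrableI_nonneg[OF borel_measurable_qf[OF W_measurable m] nn])
        (use key[OF N] in \<open>auto simp: top.not_eq_extremum intro: le_less_trans\<close>)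
    hence L: "(\<lambda>x. s n x - F x) \<in> L2" using m by (simp add: L2_iff)
    have "ennreal (N2 (\<lambda>x. s n x - F x)) \<le> ennreal e"
      unfolding N2_eq(2)[OF L] nn_integral_eq_integral[OF i nn, symmetric] by (rule key[OF N])
    thus ?thesis using L e by (simp add: ennreal_le_iff)
  qed
  have ex: "\<exists>N. \<forall>n\<ge>N. (\<lambda>x. s n x - F x) \<in> L2 \<and> N2 (\<lambda>x. s n x - F x) \<le> e" if e: "e > 0" for e
  proof -
    obtain N where "\<forall>m\<ge>N. \<forall>n\<ge>N. N2 (\<lambda>x. s m x - s n x) < e"
      using L2_CauchyD[OF C e] by blast
    thus ?thesis using key2[of N _ e] e by blast
  qed
  obtain n where "(\<lambda>x. s n x - F x) \<in> L2" using ex[of 1] by auto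
  hence FL: "F \<in> L2" using L2_diff[OF s[of n]] by fastforce
  have "(\<lambda>n. N2 (\<lambda>x. s n x - F x)) \<longlonglongrightarrow> 0"
  proof (rule LIMSEQ_I)
    fix r :: real assume r: "r > 0"
    obtain N where "\<forall>n\<ge>N. N2 (\<lambda>x. s n x - F x) \<le> r / 2" using ex[of "r/2"] r by auto
    hence "norm (N2 (\<lambda>x. s n x - F x) - 0) < r" if "n \<ge> N" for n
      using N2_nonneg[OF L2_diff[OF s[of n] FL]] that r by force
    thus "\<exists>no. \<forall>n\<ge>no. norm (N2 (\<lambda>x. s n x - F x) - 0) < r" by blast
  qed
  thus ?thesis using s FL by (simp add: L2_lim_def)
qed

text \<open>The weights \<open>2 ^ k\<close> against \<open>(1/4) ^ k\<close> still leave a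
  convergent series of integrals. So the weighted series is finite almost everywhere and bounds each
  of its terms.\<close>

lemma fast_subsequence_summable:
  assumes L: "\<And>k. d k \<in> L2" and N: "\<And>k. N2 (d k) \<le> (1/4) ^ k"
  shows "AE x in M. \<exists>C. \<forall>k. qf (W x) (d k x) \<le> C * (1/2) ^ k"
proof -
  have nn: "AE x in M. 0 \<le> 2 ^ k * qf (W x) (d k x)" for k
    using W_psd by eventually_elim (simp add: qf_nonneg)
  have i: "integrable M (\<lambda>x. 2 ^ k * qf (W x) (d k x))" for k
    by (intro integrable_mult_right integrable_qf L)
  have meas: "(\<lambda>x. ennreal (2 ^ k * qf (W x) (d k x))) \<in> borel_measurable M" for k
    using i[of k] by (intro measurable_compose[OF _ measurable_ennreal]) auto
  have "(\<integral>\<^sup>+x. (\<Sum>k. ennreal (2 ^ k * qf (W x) (d k x))) \<partial>M) = (\<Sum>k. \<integral>\<^sup>+x. ennreal (2 ^ k * qf (W x) (d k x)) \<partial>M)"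
    by (rule nn_integral_suminf[OF meas])
  also have "\<dots> \<le> (\<Sum>k. ennreal ((1/2) ^ k))"
  proof (intro suminf_le allI summableI)
    fix k
    have "(\<integral>\<^sup>+x. ennreal (2 ^ k * qf (W x) (d k x)) \<partial>M) = ennreal (2 ^ k * N2 (d k))"
      using nn_integral_eq_integral[OF i nn, of k] by (simp add: N2_eq(2)[OF L])
    also have "\<dots> \<le> ennreal (2 ^ k * (1/4) ^ k)"
      by (intro ennreal_leI mult_left_mono N) auto
    also have "(2::real) ^ k * (1/4) ^ k = (1/2) ^ k" by (simp flip: power_mult_distrib)
    finally show "(\<integral>\<^sup>+x. ennreal (2 ^ k * qf (W x) (d k x)) \<partial>M) \<le> ennreal ((1/2) ^ k)" .
  qed
  also have "\<dots> < \<infinity>"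
    by (subst suminf_ennreal2) (auto simp: summable_geometric)
  finally have "AE x in M. (\<Sum>k. ennreal (2 ^ k * qf (W x) (d k x))) \<noteq> \<infinity>"
    by (intro nn_integral_PInf_AE) (use meas in \<open>auto simp: top.not_eq_extremum\<close>)
  thus ?thesis using W_psd
  proof eventually_elim
    case (elim x)
    then obtain C where C: "C \<ge> 0" "(\<Sum>k. ennreal (2 ^ k * qf (W x) (d k x))) = ennreal C"
      by (cases "\<Sum>k. ennreal (2 ^ k * qf (W x) (d k x))" rule: ennreal_cases) auto
    have "qf (W x) (d k x) \<le> C * (1/2) ^ k" for k
    proof -
      have "ennreal (2 ^ k * qf (W x) (d k x)) \<le> (\<Sum>k. ennreal (2 ^ k * qf (W x) (d k x)))"
        using sum_le_suminf[OF summableI, of "{k}" "\<lambda>k. ennreal (2 ^ k * qf (W x) (d k x))"] by simp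
      hence "2 ^ k * qf (W x) (d k x) \<le> C" using C by (simp add: ennreal_le_iff)
      thus ?thesis by (simp add: field_simps power_one_over)
    qed
    thus ?case by blast
  qed
qed

text \<open>Representatives with values in the range of \<open>W\<close> converge pointwise along a fast subsequence,
  because the seminorm of \<open>W x\<close> is a norm there.\<close>
theorem L2_complete:
  assumes C: "L2_Cauchy s" obtains p where "L2_lim s p"
proof -
  have s: "s n \<in> L2" for n using C by (simp add: L2_Cauchy_def)
  have "\<exists>N. \<forall>m\<ge>N. \<forall>n\<ge>N. N2 (\<lambda>x. s m x - s n x) < (1/4) ^ k" for k
    using L2_CauchyD[OF C] by simp
  then obtain K where K: "\<And>k m n. m \<ge> K k \<Longrightarrow> n \<ge> K k \<Longrightarrow> N2 (\<lambda>x. s m x - s n x) < (1/4) ^ k" by metis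
  \<comment> \<open>The partial sums make the index nondecreasing and at least \<open>K k\<close>;
    the summand \<open>k\<close> makes it tend to infinity.\<close>
  define r where "r k = k + (\<Sum>j\<le>k. K j)" for k
  have rK: "r k \<ge> K k" for k
    unfolding r_def using member_le_sum[of k "{..k}" K] by simp
  have rmono: "r k \<le> r (Suc k)" for k by (simp add: r_def)
  have rk: "r k \<ge> k" for k by (simp add: r_def)
  define d where "d k = (\<lambda>x. s (r (Suc k)) x - s (r k) x)" for k
  have dL: "d k \<in> L2" for k unfolding d_def by (intro L2_diff s)
  have dN: "N2 (d k) \<le> (1/4) ^ k" for k
    unfolding d_def using K[of k "r (Suc k)" "r k"] rK[of k] rmono[of k] by (simp add: less_imp_le)
  define s' where "s' k = (\<lambda>x. range_proj (W x) (s (r k) x))" for k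
  have s'm: "s' k \<in> borel_measurable M" for k
    unfolding s'_def by (intro borel_measurable_range_proj W_measurable L2_measurable s)
  have Ws': "AE x in M. \<forall>k. W x *v s' k x = W x *v s (r k) x"
    using W_psd unfolding s'_def by eventually_elim (metis range_proj_tendsto)
  have s'L: "s' k \<in> L2" for k
  proof (rule L2_dominated[OF integrable_qf[OF s[of "r k"]] s'm])
    show "AE x in M. qf (W x) (s' k x) \<le> qf (W x) (s (r k) x)"
      using Ws' W_psd
    proof eventually_elim
      case (elim x)
      have "hform (s' k x) (W x) (s' k x) = hform (s (r k) x) (W x) (s (r k) x)"
        using elim by (simp add: hform_def) (simp add: psd_herm)
      thus ?case by (simp add: qf_def)
    qed
  qed
  have null: "N2 (\<lambda>x. s' k x - s (r k) x) = 0" for k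
    using Ws' by (subst N2_eq_0_iff[OF L2_diff[OF s'L s]]) (auto simp: mv_simps)
  have conv: "AE x in M. convergent (\<lambda>k. s' k x)"
    using fast_subsequence_summable[OF dL dN] Ws' W_psd
  proof eventually_elim
    case (elim x)
    then obtain C where C: "\<And>k. qf (W x) (d k x) \<le> C * (1/2) ^ k" by blast
    obtain D where D: "D > 0" "\<And>z. norm (W x *v z) \<le> D * norm (W x *v (W x *v z))"
      using psd_range_lower_bound[OF elim(3)] by blast
    have C0: "C \<ge> 0" using order_trans[OF qf_nonneg[OF elim(3)] C[of 0]] by simp
    \<comment> \<open>The forms decay like \<open>(1/2) ^ k\<close>, hence the norms like powers of
      this root.\<close>
    define q :: real where "q = sqrt (1/2)"
    have q: "0 \<le> q" "q < 1" by (auto simp: q_def real_sqrt_lt_1_iff)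
    have qk: "(q ^ k)\<^sup>2 = (1/2) ^ k" for k
    proof -
      have "(q ^ k)\<^sup>2 = (q\<^sup>2) ^ k" by (metis mult.commute power_mult)
      thus ?thesis by (simp add: q_def)
    qed
    have b: "norm (s' (Suc k) x - s' k x) \<le> D * sqrt (norm (W x) * C) * q ^ k" for k
    proof -
      obtain z1 where z1: "s' (Suc k) x = W x *v z1" unfolding s'_def using range_proj_tendsto[OF elim(3)] by metis
      obtain z2 where z2: "s' k x = W x *v z2" unfolding s'_def using range_proj_tendsto[OF elim(3)] by metis
      have e: "s' (Suc k) x - s' k x = W x *v (z1 - z2)" by (simp add: z1 z2 mv_simps)
      have "W x *v (s' (Suc k) x - s' k x) = W x *v d k x"
        using elim(2) by (simp add: d_def mv_simps)
      hence "norm (s' (Suc k) x - s' k x) \<le> D * norm (W x *v d k x)" using D(2)[of "z1 - z2"] e by simp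
      moreover have "norm (W x *v d k x) \<le> sqrt (norm (W x) * C) * q ^ k"
      proof (rule power2_le_imp_le)
        have "(norm (W x *v d k x))\<^sup>2 \<le> norm (W x) * (C * (1/2) ^ k)"
          by (rule order_trans[OF psd_norm_mult_le[OF elim(3)] mult_left_mono[OF C]]) simp
        also have "\<dots> = (sqrt (norm (W x) * C) * q ^ k)\<^sup>2"
          using C0 qk by (simp add: power_mult_distrib)
        finally show "(norm (W x *v d k x))\<^sup>2 \<le> (sqrt (norm (W x) * C) * q ^ k)\<^sup>2" .
      qed (use C0 q in auto)
      ultimately show ?thesis
        using D(1) by (smt (verit) mult.assoc mult_left_mono)
    qed
    have "summable (\<lambda>k. s' (Suc k) x - s' k x)"
      by (rule summable_comparison_test[OF _ summable_mult[OF summable_geometric]]) (use b q in auto)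
    hence "convergent (\<lambda>n. \<Sum>k<n. s' (Suc k) x - s' k x)" by (simp add: summable_iff_convergent)
    hence "convergent (\<lambda>n. s' n x - s' 0 x)" by (simp add: sum_lessThan_telescope[of "\<lambda>n. s' n x"])
    then obtain l where "(\<lambda>n. s' n x - s' 0 x) \<longlonglongrightarrow> l" by (auto simp: convergent_def)
    from tendsto_add[OF this tendsto_const[of "s' 0 x"]] show ?case by (auto simp: convergent_def)
  qed
  define p where "p x = lim (\<lambda>k. s' k x)" for x
  have pm: "p \<in> borel_measurable M" unfolding p_def by (rule borel_measurable_lim_metric[OF s'm])
  have N2': "N2 (\<lambda>x. s' m x - s' n x) = N2 (\<lambda>x. s (r m) x - s (r n) x)" for m n
  proof -
    have "ip (\<lambda>x. s' m x - s' n x) (\<lambda>x. s' m x - s' n x) = ip (\<lambda>x. s (r m) x - s (r n) x) (\<lambda>x. s (r m) x - s (r n) x)"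
      using Ws' by (intro ip_cong_AE L2_diff s s'L) (auto simp: mv_simps)
    thus ?thesis by (simp add: N2_def)
  qed
  have C': "L2_Cauchy s'"
    unfolding L2_Cauchy_def N2'
  proof (intro conjI allI impI s'L)
    fix e :: real assume "e > 0"
    then obtain N where "\<forall>m\<ge>N. \<forall>n\<ge>N. N2 (\<lambda>x. s m x - s n x) < e" using L2_CauchyD[OF C] by blast
    thus "\<exists>N. \<forall>m\<ge>N. \<forall>n\<ge>N. N2 (\<lambda>x. s (r m) x - s (r n) x) < e"
      using rk by (meson order_trans)
  qed
  have lim': "L2_lim s' p"
    by (rule L2_lim_fatou[OF C' pm]) (use conv in eventually_elim, simp add: p_def convergent_LIMSEQ_iff)
  have pL: "p \<in> L2" using lim' by (simp add: L2_lim_def)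
  have "(\<lambda>n. N2 (\<lambda>x. s n x - p x)) \<longlonglongrightarrow> 0"
  proof (rule LIMSEQ_I)
    fix e :: real assume e: "e > 0"
    obtain N where N: "\<forall>m\<ge>N. \<forall>n\<ge>N. N2 (\<lambda>x. s m x - s n x) < e / 4"
      using L2_CauchyD[OF C, of "e/4"] e by auto
    have "\<forall>\<^sub>F k in sequentially. N2 (\<lambda>x. s' k x - p x) < e / 8"
      using lim' e unfolding L2_lim_def by (intro order_tendstoD) auto
    then obtain k where k: "k \<ge> N" "N2 (\<lambda>x. s' k x - p x) < e / 8"
      by (auto simp: eventually_sequentially) (meson nle_le)
    have "N2 (\<lambda>x. s n x - p x) < e" if n: "n \<ge> N" for n
    proof -
      have "N2 (\<lambda>x. s (r k) x - p x) \<le> 2 * N2 (\<lambda>x. s (r k) x - s' k x) + 2 * N2 (\<lambda>x. s' k x - p x)"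
        by (rule N2_triangle[OF s s'L pL])
      hence "N2 (\<lambda>x. s (r k) x - p x) < e / 4" using k(2) null[of k] N2_diff_commute[of "s' k" "s (r k)"] by simp
      moreover have "N2 (\<lambda>x. s n x - s (r k) x) < e / 4" using N n k(1) rk[of k] by auto
      ultimately show ?thesis using N2_triangle[OF s[of n] s[of "r k"] pL] by simp
    qed
    hence "norm (N2 (\<lambda>x. s n x - p x) - 0) < e" if "n \<ge> N" for n
      using that N2_nonneg[OF L2_diff[OF s[of n] pL]] by simp
    thus "\<exists>no. \<forall>n\<ge>no. norm (N2 (\<lambda>x. s n x - p x) - 0) < e" by blast
  qed
  hence "L2_lim s p" using s pL by (simp add: L2_lim_def)
  thus ?thesis by (rule that)
qed

text \<open>The projection theorem for a subspace that need not be closed: the parallelogram law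
  makes a minimizing sequence Cauchy, and orthogonality is claimed for every limit it may have.
  Existence of a limit is kept separate, because for the transformed subspace it is obtained through
  preimages.\<close>

lemma minimizing_sequence:
  assumes X: "X \<subseteq> L2" and X0: "(\<lambda>x. 0) \<in> X"
    and Xadd: "\<And>f g. f \<in> X \<Longrightarrow> g \<in> X \<Longrightarrow> (\<lambda>x. f x + g x) \<in> X"
    and Xscale: "\<And>c f. f \<in> X \<Longrightarrow> (\<lambda>x. c *s f x) \<in> X" and h: "h \<in> L2"
  obtains s where "\<And>n. s n \<in> X" "L2_Cauchy s"
    "\<And>p x. L2_lim s p \<Longrightarrow> x \<in> X \<Longrightarrow> ip (\<lambda>y. h y - p y) x = 0"
proof -
  define D where "D = (\<lambda>f. N2 (\<lambda>x. h x - f x)) ` X"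
  define d where "d = Inf D"
  have L: "f \<in> L2" if "f \<in> X" for f using that X by auto
  have D0: "bdd_below D" "D \<noteq> {}"
    using X0 N2_nonneg[OF L2_diff[OF h L]] by (auto simp: D_def intro!: bdd_belowI[of _ 0])
  have dle: "d \<le> N2 (\<lambda>x. h x - f x)" if "f \<in> X" for f
    unfolding d_def using that D0 by (intro cInf_lower) (auto simp: D_def)
  have "\<exists>f\<in>X. N2 (\<lambda>x. h x - f x) < d + inverse (real (Suc n))" for n
  proof -
    have "Inf D < d + inverse (real (Suc n))" by (simp add: d_def)
    thus ?thesis using cInf_less_iff[OF D0(2,1)] by (auto simp: D_def)
  qed
  then obtain s where s: "\<And>n. s n \<in> X" "\<And>n. N2 (\<lambda>x. h x - s n x) < d + inverse (real (Suc n))" by metis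
  note sL = L[OF s(1)]
  have par: "N2 (\<lambda>x. s m x - s n x) < 2 * inverse (real (Suc m)) + 2 * inverse (real (Suc n))" for m n
  proof -
    let ?u = "\<lambda>x. h x - s m x" and ?v = "\<lambda>x. h x - s n x"
    have mid: "(\<lambda>x. (1/2) *s (s m x + s n x)) \<in> X" by (intro Xscale Xadd s)
    have "(\<lambda>x. ?u x + ?v x) = (\<lambda>x. 2 *s (h x - (1/2) *s (s m x + s n x)))"
      by (auto simp: vec.scale_right_diff_distrib vec.scale_right_distrib vec_eq_iff)
    hence "N2 (\<lambda>x. ?u x + ?v x) = 4 * N2 (\<lambda>x. h x - (1/2) *s (s m x + s n x))"
      by (simp only: N2_scale) simp
    hence "N2 (\<lambda>x. ?u x + ?v x) \<ge> 4 * d" using dle[OF mid] by simp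
    moreover have "N2 (\<lambda>x. ?u x - ?v x) = N2 (\<lambda>x. s m x - s n x)"
      using N2_diff_commute[of "s m" "s n"] by simp
    moreover have "N2 (\<lambda>x. ?u x + ?v x) + N2 (\<lambda>x. ?u x - ?v x) = 2 * N2 ?u + 2 * N2 ?v"
      by (rule N2_parallelogram) (intro L2_diff h sL)+
    ultimately show ?thesis using s(2)[of m] s(2)[of n] by linarith
  qed
  have C: "L2_Cauchy s"
    unfolding L2_Cauchy_def
  proof (intro conjI allI impI sL)
    fix e :: real assume "e > 0"
    then obtain N where N: "inverse (real (Suc N)) < e / 4" using reals_Archimedean[of "e/4"] by auto
    have "N2 (\<lambda>x. s m x - s n x) < e" if "m \<ge> N" "n \<ge> N" for m n
    proof -
      have "inverse (real (Suc m)) \<le> inverse (real (Suc N))" "inverse (real (Suc n)) \<le> inverse (real (Suc N))"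
        using that by (auto intro!: le_imp_inverse_le)
      thus ?thesis using par[of m n] N by linarith
    qed
    thus "\<exists>N. \<forall>m\<ge>N. \<forall>n\<ge>N. N2 (\<lambda>x. s m x - s n x) < e" by blast
  qed
  have orth: "ip (\<lambda>y. h y - p y) x = 0" if p: "L2_lim s p" and x: "x \<in> X" for p x
  proof -
    have pL: "p \<in> L2" using p by (simp add: L2_lim_def)
    \<comment> \<open>\<open>s n\<close> misses the infimum by less than \<open>1 / (n + 1)\<close>,
      so perturbing it by a multiple of \<open>x\<close> cannot lower the squared distance by more
      than that.\<close>
    have b: "(cmod (ip (\<lambda>y. h y - s n y) x))\<^sup>2 \<le> inverse (real (Suc n)) * N2 x" for n
    proof (rule quadratic_discriminant_bound[OF _ N2_nonneg[OF L[OF x]]])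
      fix c
      have "(\<lambda>y. s n y + c *s x y) \<in> X" by (intro Xadd Xscale s x)
      from dle[OF this] have "d \<le> N2 (\<lambda>y. (h y - s n y) - c *s x y)" by (simp add: algebra_simps)
      also have "\<dots> = N2 (\<lambda>y. h y - s n y) - 2 * Re (cnj c * ip (\<lambda>y. h y - s n y) x) + (cmod c)\<^sup>2 * N2 x"
        by (rule N2_diff_scale[OF L2_diff[OF h sL] L[OF x]])
      finally show "0 \<le> inverse (real (Suc n)) - 2 * Re (cnj c * ip (\<lambda>y. h y - s n y) x) + (cmod c)\<^sup>2 * N2 x"
        using s(2)[of n] by linarith
    qed
    have "(\<lambda>n. (cmod (ip (\<lambda>y. h y - s n y) x))\<^sup>2) \<longlonglongrightarrow> 0"
    proof (rule Lim_null_comparison)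
      show "(\<lambda>n. inverse (real (Suc n)) * N2 x) \<longlonglongrightarrow> 0"
        by (rule tendsto_mult_left_zero[OF LIMSEQ_inverse_real_of_nat])
    qed (use b in simp)
    moreover have "(\<lambda>n. ip (\<lambda>y. h y - s n y) x) \<longlonglongrightarrow> ip h x - ip p x"
      unfolding ip_diff_left[OF h sL L[OF x]] by (intro tendsto_intros L2_lim_ip_left p L x)
    hence "(\<lambda>n. (cmod (ip (\<lambda>y. h y - s n y) x))\<^sup>2) \<longlonglongrightarrow> (cmod (ip h x - ip p x))\<^sup>2"
      by (intro tendsto_intros)
    ultimately have "(cmod (ip h x - ip p x))\<^sup>2 = 0" using LIMSEQ_unique by blast
    thus ?thesis by (simp add: ip_diff_left[OF h pL L[OF x]])
  qed
  show ?thesis by (rule that[OF s(1) C orth])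
qed

lemma bessel_inequality:
  assumes T: "finite T" and e: "\<And>t. t \<in> T \<Longrightarrow> e t \<in> L2" and h: "h \<in> L2"
    and orth: "\<And>s t. s \<in> T \<Longrightarrow> t \<in> T \<Longrightarrow> s \<noteq> t \<Longrightarrow> ip (e s) (e t) = 0"
    and pos: "\<And>t. t \<in> T \<Longrightarrow> N2 (e t) > 0"
  shows "(\<Sum>t\<in>T. (cmod (ip h (e t)))\<^sup>2 / N2 (e t)) \<le> N2 h"
proof -
  define c where "c t = ip h (e t) / complex_of_real (N2 (e t))" for t
  define g where "g = (\<lambda>x. \<Sum>t\<in>T. c t *s e t x)"
  have gL: "g \<in> L2" unfolding g_def by (intro L2_sum L2_scale e)
  have ge: "ip g (e t) = ip h (e t)" if t: "t \<in> T" for t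
  proof -
    have "ip g (e t) = (\<Sum>s\<in>T. c s * ip (e s) (e t))"
      unfolding g_def by (subst ip_sum_left) (auto intro: L2_scale e t simp: ip_scale_left)
    also have "\<dots> = (\<Sum>s\<in>T. if s = t then c t * ip (e t) (e t) else 0)"
      using orth t by (intro sum.cong) auto
    also have "\<dots> = c t * ip (e t) (e t)" using t T by simp
    also have "\<dots> = ip h (e t)" using pos[OF t] by (simp add: N2_eq(1)[OF e[OF t]] c_def)
    finally show ?thesis .
  qed
  have sum: "ip k g = (\<Sum>t\<in>T. cnj (c t) * ip k (e t))" if "k \<in> L2" for k
    unfolding g_def using that by (subst ip_sum_right) (auto intro: L2_scale e simp: ip_scale_right)
  \<comment> \<open>\<open>g\<close> is the projection of \<open>h\<close> onto the span of the
    \<open>e t\<close>.\<close>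
  have hg: "ip h g = ip g g" using sum[OF h] sum[OF gL] ge by simp
  have coeff: "cnj (c t) * ip h (e t) = complex_of_real ((cmod (ip h (e t)))\<^sup>2 / N2 (e t))" if "t \<in> T" for t
    by (simp add: c_def complex_norm_square mult.commute del: of_real_power)
  have "ip h g = complex_of_real (\<Sum>t\<in>T. (cmod (ip h (e t)))\<^sup>2 / N2 (e t))"
    unfolding sum[OF h] of_real_sum using coeff by (intro sum.cong) auto
  hence "Re (ip h g) = (\<Sum>t\<in>T. (cmod (ip h (e t)))\<^sup>2 / N2 (e t))" by (simp only: Re_complex_of_real)
  moreover have "0 \<le> N2 h - 2 * Re (ip h g) + N2 g"
    using N2_nonneg[OF L2_diff[OF h gL]] N2_diff_scale[OF h gL, of 1] by simp
  moreover have "N2 g = Re (ip h g)" using hg by (simp add: N2_def)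
  ultimately show ?thesis by simp
qed

end

section \<open>Canonical systems on a compact interval\<close>

lemma cdot_Jmat_Jmat: "cdot (Jmat *v x) (Jmat *v y) = cdot x y"
  by (simp add: cdot_Jmat Jmat_Jmat cdot_simps)

lemma norm_scale: "norm (c *s (x :: complex^'m)) = cmod c * norm x"
  by (simp add: norm_vec_def norm_mult L2_set_right_distrib)

locale canonical_system =
  fixes a b :: real and H :: "real \<Rightarrow> complex^('n::finite + 'n)^('n + 'n)"
  assumes ab: "a < b"
    and H_meas: "set_borel_measurable lebesgue {a<..<b} H"
    and H_nonneg: "AE x in lebesgue. x \<in> {a<..<b} \<longrightarrow> psd (H x)"
    and H_L1: "set_integrable lebesgue {a<..<b} H"
    and H_definite: "\<forall>c. (AE x in lebesgue. x \<in> {a<..<b} \<longrightarrow> H x *v c = 0) \<longrightarrow> c = 0"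
begin

abbreviation "I\<^sub>0 \<equiv> lebesgue_on {a<..<b}"

lemma AE_I0_iff: "(AE x in I\<^sub>0. P x) \<longleftrightarrow> (AE x in lebesgue. x \<in> {a<..<b} \<longrightarrow> P x)"
  by (rule AE_restrict_space_iff) simp

sublocale weighted_L2 "lebesgue_on {a<..<b}" H
proof
  show "H \<in> borel_measurable I\<^sub>0"
    using H_meas by (simp add: set_borel_measurable_def borel_measurable_restrict_space_iff)
  show "AE x in I\<^sub>0. psd (H x)" using H_nonneg by (simp add: AE_I0_iff)
qed

lemma L2H_eq: "L2H a b H = L2"
  unfolding L2H_def L2w_def
  by (simp add: set_borel_measurable_def borel_measurable_restrict_space_iff
      set_integrable_def integrable_restrict_space)

lemma ipH_eq: "ipH a b H = ip"
  unfolding ipH_def ipw_def by (intro ext) (simp add: set_lebesgue_integral_def integral_restrict_space)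

lemma nullH_iff: "nullH a b H f \<longleftrightarrow> f \<in> L2 \<and> N2 f = 0"
  unfolding nullH_def L2H_eq ipH_eq using N2_eq(1)[of f] by (cases "f \<in> L2") simp_all

text \<open>The equation \<open>Jmat *v f' = - p\<close>, solved for \<open>f'\<close>. The argument
  is the inhomogeneity \<open>p\<close>, not a \<open>g\<close> with \<open>p = H g\<close>, so that
  it may be altered on a null set.\<close>

definition acsol :: "(real \<Rightarrow> complex^('n + 'n)) \<Rightarrow> (real \<Rightarrow> complex^('n + 'n)) \<Rightarrow> bool" where
  "acsol f p \<longleftrightarrow> AC_on a b f \<and>
     (AE x in lebesgue. x \<in> {a<..<b} \<longrightarrow> (f has_vector_derivative (Jmat *v p x)) (at x))"

lemma acrep_iff: "acrep a b H f g f0 \<longleftrightarrow>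
    acsol f0 (\<lambda>x. H x *v g x) \<and> (\<lambda>x. f x - f0 x) \<in> L2 \<and> N2 (\<lambda>x. f x - f0 x) = 0"
  unfolding acrep_def acsol_def nullH_iff Jmat_eq_iff by auto

lemma acsol_AC: "acsol f p \<Longrightarrow> AC_on a b f"
  by (simp add: acsol_def)

lemma acsol_cong_AE:
  assumes "acsol f p" "AE x in I\<^sub>0. p x = q x" shows "acsol f q"
  using assms unfolding acsol_def AE_I0_iff by (auto elim: eventually_elim2)

lemma acsol_add: assumes "acsol f p" "acsol g q" shows "acsol (\<lambda>x. f x + g x) (\<lambda>x. p x + q x)"
  unfolding acsol_def
proof
  show "AC_on a b (\<lambda>x. f x + g x)" using assms by (intro AC_on_add) (auto simp: acsol_def)
  have "AE x in lebesgue. x \<in> {a<..<b} \<longrightarrow> (f has_vector_derivative (Jmat *v p x)) (at x)"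
       "AE x in lebesgue. x \<in> {a<..<b} \<longrightarrow> (g has_vector_derivative (Jmat *v q x)) (at x)"
    using assms by (auto simp: acsol_def)
  thus "AE x in lebesgue. x \<in> {a<..<b} \<longrightarrow> ((\<lambda>x. f x + g x) has_vector_derivative (Jmat *v (p x + q x))) (at x)"
    by eventually_elim (auto simp: mv_simps intro: has_vector_derivative_add)
qed

lemma acsol_scale: assumes "acsol f p" shows "acsol (\<lambda>x. c *s f x) (\<lambda>x. c *s p x)"
proof -
  have bl: "bounded_linear (\<lambda>v :: complex^('n + 'n). c *s v)"
    using bounded_bilinear.bounded_linear_right[OF bounded_bilinear_matrix_vector, of "mat c"]
    by (simp add: mat_vector_mult[abs_def])
  have AC: "AC_on a b f" and d: "AE x in lebesgue. x \<in> {a<..<b} \<longrightarrow> (f has_vector_derivative (Jmat *v p x)) (at x)"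
    using assms by (auto simp: acsol_def)
  have "AC_on a b (\<lambda>x. mat c *v f x)"
    by (intro AC_on_bilinear[OF bounded_bilinear_matrix_vector] AC AC_on_const)
  moreover have "AE x in lebesgue. x \<in> {a<..<b} \<longrightarrow> ((\<lambda>x. c *s f x) has_vector_derivative (Jmat *v (c *s p x))) (at x)"
    using d by eventually_elim (simp add: mv_simps bounded_linear.has_vector_derivative[OF bl])
  ultimately show ?thesis by (simp add: acsol_def mat_vector_mult)
qed

lemma acsol_diff: "acsol f p \<Longrightarrow> acsol g q \<Longrightarrow> acsol (\<lambda>x. f x - g x) (\<lambda>x. p x - q x)"
  using acsol_add[of f p "\<lambda>x. (-1) *s g x" "\<lambda>x. (-1) *s q x"] acsol_scale[of g q "-1"] by simp

lemma acsol_zero: "acsol (\<lambda>x. 0) (\<lambda>x. 0)"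
  by (simp add: acsol_def AC_on_const)

text \<open>Extended by zero, since \<open>H\<close> is uncontrolled outside the open interval while
  integrals run over the closed one.\<close>

definition hH :: "real \<Rightarrow> real" where
  "hH x = (if x \<in> {a<..<b} then norm (H x) else 0)"

definition hI :: real where "hI = integral {a..b} hH"

lemma hH_nonneg [simp]: "hH x \<ge> 0" by (simp add: hH_def)

lemma hH_abs_integrable: "hH absolutely_integrable_on {a..b}"
proof -
  have "integrable lebesgue (\<lambda>x. norm (indicator {a<..<b} x *\<^sub>R H x))"
    using H_L1 unfolding set_integrable_def by (rule integrable_norm)
  moreover have "(\<lambda>x. norm (indicator {a<..<b} x *\<^sub>R H x)) = (\<lambda>x. indicator {a..b} x *\<^sub>R hH x)"
    by (auto simp: hH_def indicator_def)
  ultimately show ?thesis by (simp add: set_integrable_def)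
qed

lemma hI_nonneg: "hI \<ge> 0"
  unfolding hI_def by (intro integral_nonneg) (use hH_abs_integrable in \<open>auto simp: absolutely_integrable_on_def\<close>)

lemma norm_H_integrable: "integrable I\<^sub>0 (\<lambda>x. norm (H x))"
  using H_L1 unfolding set_integrable_def by (intro integrable_norm) (simp add: integrable_restrict_space)

lemma AC_measurable: "AC_on a b (f :: real \<Rightarrow> 'v::euclidean_space) \<Longrightarrow> f \<in> borel_measurable I\<^sub>0"
  by (rule continuous_imp_measurable_on_sets_lebesgue)
    (auto intro: continuous_on_subset[OF AC_on_continuous])

lemma bounded_L2:
  assumes m: "f \<in> borel_measurable I\<^sub>0" and C: "\<And>x. x \<in> {a..b} \<Longrightarrow> norm (f x) \<le> C"
  shows "f \<in> L2" "N2 f \<le> C\<^sup>2 * (\<integral>x. norm (H x) \<partial>I\<^sub>0)"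
proof -
  have le: "AE x in I\<^sub>0. qf (H x) (f x) \<le> C\<^sup>2 * norm (H x)"
    unfolding AE_I0_iff
  proof (rule AE_I2, rule impI)
    fix x assume "x \<in> {a<..<b}"
    hence "(norm (f x))\<^sup>2 \<le> C\<^sup>2" using C[of x] by (intro power_mono) auto
    hence "norm (H x) * (norm (f x))\<^sup>2 \<le> norm (H x) * C\<^sup>2" by (intro mult_left_mono) auto
    thus "qf (H x) (f x) \<le> C\<^sup>2 * norm (H x)" using qf_le_norm[of "H x" "f x"] by (simp add: mult.commute)
  qed
  show L: "f \<in> L2"
    by (rule L2_dominated[OF _ m le]) (intro integrable_mult_right norm_H_integrable)
  have "N2 f \<le> (\<integral>x. C\<^sup>2 * norm (H x) \<partial>I\<^sub>0)"
    unfolding N2_eq(2)[OF L]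
    by (rule integral_mono_AE[OF integrable_qf[OF L] _ le]) (intro integrable_mult_right norm_H_integrable)
  thus "N2 f \<le> C\<^sup>2 * (\<integral>x. norm (H x) \<partial>I\<^sub>0)" by simp
qed

lemma AC_L2: assumes "AC_on a b f" shows "f \<in> L2"
proof -
  obtain C where C: "\<And>x. x \<in> {a..b} \<Longrightarrow> norm (f x) \<le> C" using AC_on_bounded[OF assms] by blast
  show ?thesis by (rule bounded_L2(1)[OF AC_measurable[OF assms] C])
qed

lemma acsol_L2: "acsol f p \<Longrightarrow> f \<in> L2"
  by (intro AC_L2 acsol_AC)

text \<open>The majorant is that of \<open>psd_norm_mult_le2\<close>. Integrability lets an
  indefinite integral solve the initial value problem for every right-hand side from
  \<open>L2\<close>.\<close>

lemma H_mult_integrable: assumes "f \<in> L2" shows "integrable I\<^sub>0 (\<lambda>x. H x *v f x)"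
proof (rule Bochner_Integration.integrable_bound)
  show "integrable I\<^sub>0 (\<lambda>x. norm (H x) + qf (H x) (f x))"
    by (intro Bochner_Integration.integrable_add norm_H_integrable integrable_qf assms)
  show "AE x in I\<^sub>0. norm (H x *v f x) \<le> norm (norm (H x) + qf (H x) (f x))"
    using W_psd
  proof eventually_elim
    case (elim x)
    show ?case using psd_norm_mult_le2[OF elim, of "f x"] by simp
  qed
qed (intro borel_measurable_mv W_measurable L2_measurable assms)

lemma lebesgue_integral_I0:
  fixes f :: "real \<Rightarrow> 'v::euclidean_space"
  assumes "integrable I\<^sub>0 f" "(f has_integral I) {a..b}" shows "(\<integral>x. f x \<partial>I\<^sub>0) = I"
proof -
  have "(\<integral>x. f x \<partial>I\<^sub>0) = integral {a<..<b} f"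
    by (rule lebesgue_integral_eq_integral[OF assms(1)]) simp
  also have "\<dots> = I" using assms(2) by (metis integral_unique integral_open_interval_real)
  finally show ?thesis .
qed

lemma integrable_I0_abs:
  fixes p :: "real \<Rightarrow> 'v::euclidean_space"
  assumes "integrable I\<^sub>0 p"
  shows "(\<lambda>x. if x \<in> {a<..<b} then p x else 0) absolutely_integrable_on {a..b}"
proof -
  have "integrable lebesgue (\<lambda>x. indicator {a<..<b} x *\<^sub>R p x)"
    using assms by (simp add: integrable_restrict_space)
  moreover have "(\<lambda>x. indicator {a<..<b} x *\<^sub>R p x) = (\<lambda>x. indicator {a..b} x *\<^sub>R (if x \<in> {a<..<b} then p x else 0))"
    by (auto simp: indicator_def)
  ultimately show ?thesis by (simp add: set_integrable_def)
qed

lemma acsol_exists: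
  assumes "integrable I\<^sub>0 p"
  obtains f where "acsol f p" "f a = c"
proof -
  define q where "q x = (if x \<in> {a<..<b} then Jmat *v p x else 0)" for x
  have "integrable I\<^sub>0 (\<lambda>x. Jmat *v p x)"
    by (rule integrable_bounded_linear[OF bounded_bilinear.bounded_linear_right[OF bounded_bilinear_matrix_vector] assms])
  hence q: "q absolutely_integrable_on {a..b}" unfolding q_def[abs_def] by (rule integrable_I0_abs)
  show ?thesis
  proof (rule that[of "\<lambda>x. c + integral {a..x} q"])
    show "acsol (\<lambda>x. c + integral {a..x} q) p"
      unfolding acsol_def
    proof
      show "AC_on a b (\<lambda>x. c + integral {a..x} q)" by (rule AC_on_indefinite_integral[OF q])
      show "AE x in lebesgue. x \<in> {a<..<b} \<longrightarrow> ((\<lambda>x. c + integral {a..x} q) has_vector_derivative (Jmat *v p x)) (at x)"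
        using indefinite_integral_has_vector_derivative_AE[OF q, of c]
        by eventually_elim (simp add: q_def)
    qed
  qed simp
qed

text \<open>With \<open>f' = J H f1\<close> and \<open>g' = J H g1\<close>, the derivative of
  \<open>g\<^sup>* J f\<close> is \<open>g1\<^sup>* H f - g\<^sup>* H f1\<close>, since
  \<open>J\<close> is unitary with square \<open>-1\<close> and \<open>H\<close> is hermitian.
  Absolute continuity allows integrating it back.\<close>

theorem lagrange_identity:
  assumes f: "acsol f (\<lambda>x. H x *v f1 x)" and g: "acsol g (\<lambda>x. H x *v g1 x)"
    and f1: "f1 \<in> L2" and g1: "g1 \<in> L2"
  shows "cdot (g b) (Jmat *v f b) - cdot (g a) (Jmat *v f a) = ip f g1 - ip f1 g"
proof -
  define F where "F x = cdot (g x) (Jmat *v f x)" for x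
  define F' where "F' x = hform (g1 x) (H x) (f x) - hform (g x) (H x) (f1 x)" for x
  have fL: "f \<in> L2" and gL: "g \<in> L2" using f g by (auto intro: acsol_L2)
  have fAC: "AC_on a b f" and gAC: "AC_on a b g" using f g by (auto intro: acsol_AC)
  have fd: "AE x in lebesgue. x \<in> {a<..<b} \<longrightarrow> (f has_vector_derivative (Jmat *v (H x *v f1 x))) (at x)"
    and gd: "AE x in lebesgue. x \<in> {a<..<b} \<longrightarrow> (g has_vector_derivative (Jmat *v (H x *v g1 x))) (at x)"
    using f g by (auto simp: acsol_def)
  have blJ: "bounded_linear ((*v) (Jmat :: complex^('n + 'n)^('n + 'n)))"
    by (rule bounded_bilinear.bounded_linear_right[OF bounded_bilinear_matrix_vector])
  have "(F' has_integral F b - F a) {a..b}"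
  proof (rule AC_on_fundamental_theorem)
    show "AC_on a b F" unfolding F_def[abs_def]
      by (intro AC_on_bilinear[OF bounded_bilinear_cdot] AC_on_bilinear[OF bounded_bilinear_matrix_vector] AC_on_const fAC gAC)
    show "AE x in lebesgue. x \<in> {a<..<b} \<longrightarrow> (F has_vector_derivative F' x) (at x)"
      using fd gd H_nonneg
    proof eventually_elim
      case (elim x)
      show ?case
      proof
        assume "x \<in> {a<..<b}"
        hence e: "(f has_vector_derivative (Jmat *v (H x *v f1 x))) (at x)"
          "(g has_vector_derivative (Jmat *v (H x *v g1 x))) (at x)" "psd (H x)" using elim by auto
        have "(F has_vector_derivative (cdot (g x) (Jmat *v (Jmat *v (H x *v f1 x))) + cdot (Jmat *v (H x *v g1 x)) (Jmat *v f x))) (at x)"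
          unfolding F_def[abs_def]
          by (rule bounded_bilinear.has_vector_derivative[OF bounded_bilinear_cdot e(2)
                bounded_linear.has_vector_derivative[OF blJ e(1)]])
        moreover have "cdot (g x) (Jmat *v (Jmat *v (H x *v f1 x))) + cdot (Jmat *v (H x *v g1 x)) (Jmat *v f x) = F' x"
          by (simp add: F'_def hform_def Jmat_Jmat cdot_simps cdot_Jmat_Jmat psd_herm[OF e(3)])
        ultimately show "(F has_vector_derivative F' x) (at x)" by simp
      qed
    qed
  qed (use ab in simp)
  moreover have "integrable I\<^sub>0 F'" unfolding F'_def[abs_def]
    by (intro Bochner_Integration.integrable_diff integrable_hform f1 g1 fL gL)
  ultimately have "(\<integral>x. F' x \<partial>I\<^sub>0) = F b - F a" by (intro lebesgue_integral_I0)
  moreover have "(\<integral>x. F' x \<partial>I\<^sub>0) = ip f g1 - ip f1 g"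
    unfolding F'_def[abs_def] ipw_def
    by (intro Bochner_Integration.integral_diff integrable_hform f1 g1 fL gL)
  ultimately show ?thesis by (simp add: F_def)
qed

lemma acsol_constant:
  assumes "acsol f p" "AE x in I\<^sub>0. p x = 0" "x \<in> {a..b}" shows "f x = f a"
proof (rule AC_on_constI[OF acsol_AC[OF assms(1)] _ assms(3)])
  have "acsol f (\<lambda>x. 0)" by (rule acsol_cong_AE[OF assms(1,2)])
  thus "AE x in lebesgue. x \<in> {a<..<b} \<longrightarrow> (f has_vector_derivative 0) (at x)"
    by (simp add: acsol_def)
qed

text \<open>Here definiteness of \<open>H\<close> enters: \<open>f\<close> is constant, and a
  constant annihilated by \<open>H\<close> almost everywhere is zero. This upgrades equality in the
  seminorm to equality at every point, the endpoints included.\<close>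

lemma acsol_definite:
  assumes f: "acsol f (\<lambda>x. H x *v g x)" and g: "g \<in> L2" "N2 g = 0" and f0: "N2 f = 0" and x: "x \<in> {a..b}"
  shows "f x = 0"
proof -
  have "AE x in I\<^sub>0. H x *v g x = 0" using g by (simp add: N2_eq_0_iff)
  hence c: "f x = f a" if "x \<in> {a..b}" for x using acsol_constant[OF f _ that] by simp
  have "AE x in I\<^sub>0. H x *v f x = 0" using f0 acsol_L2[OF f] by (simp add: N2_eq_0_iff)
  hence "AE x in lebesgue. x \<in> {a<..<b} \<longrightarrow> H x *v f a = 0"
    unfolding AE_I0_iff
  proof eventually_elim
    case (elim x)
    show ?case using elim c[of x] by (metis atLeastAtMost_iff greaterThanLessThan_iff less_imp_le)
  qed
  hence "f a = 0" using H_definite by blast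
  thus ?thesis using c[OF x] by simp
qed

text \<open>\<open>D\<close> bounds an inhomogeneous term. The function
  \<open>(norm f)\<^sup>2 + D\<^sup>2\<close> is differentiable also at zeros of \<open>f\<close>
  and absorbs the cross term \<open>2 * norm f * D\<close>, which accounts for the
  \<open>+ 1\<close> in the exponent.\<close>

lemma acsol_gronwall:
  assumes f: "acsol f p" and L: "L \<ge> 0" and D: "D \<ge> 0"
    and p: "AE x in lebesgue. x \<in> {a<..<b} \<longrightarrow> norm (p x) \<le> norm (H x) * (L * norm (f x) + D)"
    and xy: "x \<in> {a..b}" "y \<in> {a..b}"
  shows "(norm (f x))\<^sup>2 + D\<^sup>2 \<le> ((norm (f y))\<^sup>2 + D\<^sup>2) * exp ((2 * L + 1) * hI)"
proof -
  define \<phi> where "\<phi> x = f x \<bullet> f x + D\<^sup>2" for x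
  have AC: "AC_on a b f" using f by (rule acsol_AC)
  have fd: "AE x in lebesgue. x \<in> {a<..<b} \<longrightarrow> (f has_vector_derivative (Jmat *v p x)) (at x)"
    using f by (simp add: acsol_def)
  have "\<phi> x \<le> \<phi> y * exp (integral {a..b} (\<lambda>x. (2 * L + 1) * hH x))"
  proof (rule AC_gronwall[OF _ _ _ _ _ xy])
    show "AC_on a b \<phi>" unfolding \<phi>_def
      by (intro AC_on_add AC_on_bilinear[OF bounded_bilinear_inner] AC AC_on_const)
    show "(\<lambda>x. (2 * L + 1) * hH x) absolutely_integrable_on {a..b}"
      using hH_abs_integrable by (rule set_integrable_mult_right)
    show "0 \<le> (2 * L + 1) * hH x" for x using L by simp
    show "0 \<le> \<phi> x" for x by (simp add: \<phi>_def)
    show "AE x in lebesgue. x \<in> {a<..<b} \<longrightarrow>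
        (\<exists>D. (\<phi> has_vector_derivative D) (at x) \<and> \<bar>D\<bar> \<le> (2 * L + 1) * hH x * \<phi> x)"
      using fd p
    proof eventually_elim
      case (elim x)
      show ?case
      proof
        assume x: "x \<in> {a<..<b}"
        hence e: "(f has_vector_derivative (Jmat *v p x)) (at x)" "norm (p x) \<le> norm (H x) * (L * norm (f x) + D)"
          using elim by auto
        let ?d = "f x \<bullet> (Jmat *v p x) + (Jmat *v p x) \<bullet> f x"
        have "((\<lambda>x. f x \<bullet> f x + D\<^sup>2) has_vector_derivative ?d + 0) (at x)"
          by (intro has_vector_derivative_add bounded_bilinear.has_vector_derivative[OF bounded_bilinear_inner] e
              has_vector_derivative_const)
        hence d: "(\<phi> has_vector_derivative ?d) (at x)" by (simp add: \<phi>_def[abs_def])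
        have "\<bar>?d\<bar> \<le> 2 * (norm (f x) * norm (p x))"
          using Cauchy_Schwarz_ineq2[of "f x" "Jmat *v p x"] by (simp add: inner_commute norm_Jmat)
        also have "\<dots> \<le> 2 * (norm (f x) * (norm (H x) * (L * norm (f x) + D)))"
          by (intro mult_left_mono e) auto
        also have "\<dots> = norm (H x) * (2 * L * (norm (f x))\<^sup>2 + 2 * norm (f x) * D)"
          by (simp add: power2_eq_square algebra_simps)
        also have "\<dots> \<le> norm (H x) * ((2 * L + 1) * ((norm (f x))\<^sup>2 + D\<^sup>2))"
        proof (rule mult_left_mono)
          have "2 * norm (f x) * D \<le> (norm (f x))\<^sup>2 + D\<^sup>2" by (rule sum_squares_bound)
          moreover have "0 \<le> 2 * L * D\<^sup>2" using L by simp
          ultimately show "2 * L * (norm (f x))\<^sup>2 + 2 * norm (f x) * D \<le> (2 * L + 1) * ((norm (f x))\<^sup>2 + D\<^sup>2)"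
            by (simp add: algebra_simps)
        qed simp
        also have "\<dots> = (2 * L + 1) * hH x * \<phi> x"
          using x by (simp add: hH_def \<phi>_def power2_norm_eq_inner mult_ac)
        finally show "\<exists>D. (\<phi> has_vector_derivative D) (at x) \<and> \<bar>D\<bar> \<le> (2 * L + 1) * hH x * \<phi> x"
          using d by blast
      qed
    qed
  qed
  thus ?thesis by (simp add: \<phi>_def hI_def power2_norm_eq_inner)
qed

text \<open>Any point \<open>y\<close> may carry the data, so a solution that vanishes at one point
  vanishes identically.\<close>

lemma acsol_linear_bound:
  assumes f: "acsol f (\<lambda>x. z *s (H x *v f x))" and xy: "x \<in> {a..b}" "y \<in> {a..b}"
  shows "norm (f x) \<le> norm (f y) * exp ((2 * cmod z + 1) * hI)"
proof -
  have "(norm (f x))\<^sup>2 + 0\<^sup>2 \<le> ((norm (f y))\<^sup>2 + 0\<^sup>2) * exp ((2 * cmod z + 1) * hI)"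
  proof (rule acsol_gronwall[OF f _ _ _ xy])
    have "norm (z *s (H x *v f x)) \<le> norm (H x) * (cmod z * norm (f x) + 0)" for x
      using norm_matrix_vector_le[of "H x" "f x"]
      by (simp add: norm_scale mult_left_mono mult.left_commute)
    thus "AE x in lebesgue. x \<in> {a<..<b} \<longrightarrow> norm (z *s (H x *v f x)) \<le> norm (H x) * (cmod z * norm (f x) + 0)"
      by simp
  qed auto
  also have "\<dots> \<le> (norm (f y) * exp ((2 * cmod z + 1) * hI))\<^sup>2"
  proof -
    have "exp ((2 * cmod z + 1) * hI) \<ge> 1" using hI_nonneg by simp
    hence "exp ((2 * cmod z + 1) * hI) \<le> (exp ((2 * cmod z + 1) * hI))\<^sup>2"
      by (simp add: power2_eq_square)
    thus ?thesis by (simp add: power_mult_distrib mult_left_mono)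
  qed
  finally have "(norm (f x))\<^sup>2 \<le> (norm (f y) * exp ((2 * cmod z + 1) * hI))\<^sup>2"
    unfolding zero_power2 add_0_right .
  thus ?thesis by (rule power2_le_imp_le) simp
qed

end

lemma matrix_inv_right_invertible:
  fixes A :: "complex^'m^'m"
  assumes "\<And>x. A *v x = 0 \<Longrightarrow> x = 0" shows "A ** matrix_inv A = mat 1"
proof -
  have "\<exists>B. B ** A = mat 1" using assms by (simp add: matrix_left_invertible_ker)
  hence "\<exists>B. A ** B = mat 1 \<and> B ** A = mat 1" using matrix_left_right_inverse by blast
  thus ?thesis unfolding matrix_inv_def by (rule someI2_ex) simp
qed

lemma injective_matrix_surj:
  fixes A :: "complex^'m^'m"
  assumes "\<And>x. A *v x = 0 \<Longrightarrow> x = 0" obtains x where "A *v x = y"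
  using that[of "matrix_inv A *v y"] matrix_inv_right_invertible[OF assms]
  by (simp add: matrix_vector_mul_assoc)

lemma bounded_linear_adjm: "bounded_linear (adjm :: complex^'m^'k \<Rightarrow> _)"
  unfolding linear_conv_bounded_linear[symmetric]
  by (rule linearI) (simp_all add: adjm_def vec_eq_iff)

section \<open>Boundary conditions and fundamental solutions\<close>

locale boundary_problem = canonical_system a b H
  for a b :: real and H :: "real \<Rightarrow> complex^('n::finite + 'n)^('n + 'n)" +
  fixes \<alpha> \<beta> :: "complex^('n + 'n)^'n" and u v :: "real \<Rightarrow> complex \<Rightarrow> complex^'n^('n + 'n)"
  assumes \<alpha>_norm: "\<alpha> ** adjm \<alpha> = mat 1" and \<beta>_norm: "\<beta> ** adjm \<beta> = mat 1"
    and \<alpha>_J: "\<alpha> ** Jmat ** adjm \<alpha> = 0" and \<beta>_J: "\<beta> ** Jmat ** adjm \<beta> = 0"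
    and u_sol: "\<forall>z. AC_on a b (\<lambda>x. u x z) \<and>
                  (AE x in lebesgue. x \<in> {a<..<b} \<longrightarrow>
                     (\<exists>D. ((\<lambda>y. u y z) has_vector_derivative D) (at x) \<and>
                          Jmat ** D = - (z *sm (H x ** u x z)))) \<and>
                  u a z = - (Jmat ** adjm \<alpha>)"
    and v_sol: "\<forall>z. AC_on a b (\<lambda>x. v x z) \<and>
                  (AE x in lebesgue. x \<in> {a<..<b} \<longrightarrow>
                     (\<exists>D. ((\<lambda>y. v y z) has_vector_derivative D) (at x) \<and>
                          Jmat ** D = - (z *sm (H x ** v x z)))) \<and>
                  v a z = adjm \<alpha>"
begin

lemma bdry_adjm [simp]: "\<alpha> *v (adjm \<alpha> *v c) = c" "\<beta> *v (adjm \<beta> *v c) = c"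
  by (simp_all add: matrix_vector_mul_assoc \<alpha>_norm \<beta>_norm)

lemma bdry_J_adjm [simp]: "\<alpha> *v (Jmat *v (adjm \<alpha> *v c)) = 0" "\<beta> *v (Jmat *v (adjm \<beta> *v c)) = 0"
  using \<alpha>_J \<beta>_J by (simp_all add: matrix_vector_mul_assoc matrix_mul_assoc)

lemma alpha_kernel: "\<alpha> *v y = 0 \<Longrightarrow> y = - (Jmat *v (adjm \<alpha> *v (\<alpha> *v (Jmat *v y))))"
  using lagrangian_decomposition[OF \<alpha>_norm \<alpha>_J, of y] by simp

lemma beta_kernel: "\<beta> *v y = 0 \<Longrightarrow> y = - (Jmat *v (adjm \<beta> *v (\<beta> *v (Jmat *v y))))"
  using lagrangian_decomposition[OF \<beta>_norm \<beta>_J, of y] by simp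

text \<open>A vector in the kernel of \<open>\<beta>\<close> is \<open>J\<close> applied to a vector
  in the range of \<open>adjm \<beta>\<close>, so the boundary form sees \<open>x\<close> only
  through \<open>\<beta> *v x\<close>. It vanishes when both arguments satisfy the boundary
  condition.\<close>

lemma cdot_beta_kernel:
  assumes "\<beta> *v y = 0" shows "cdot x (Jmat *v y) = cdot (\<beta> *v x) (\<beta> *v (Jmat *v y))"
proof -
  have "cdot x (Jmat *v y) = cdot x (Jmat *v (- (Jmat *v (adjm \<beta> *v (\<beta> *v (Jmat *v y))))))"
    using beta_kernel[OF assms] by simp
  also have "\<dots> = cdot (\<beta> *v x) (\<beta> *v (Jmat *v y))"
    by (simp add: mv_simps Jmat_Jmat cdot_adjm[of x "adjm \<beta>"])
  finally show ?thesis .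
qed

lemma cdot_alpha_kernel:
  assumes "\<alpha> *v y = 0" shows "cdot x (Jmat *v y) = cdot (\<alpha> *v x) (\<alpha> *v (Jmat *v y))"
proof -
  have "cdot x (Jmat *v y) = cdot x (Jmat *v (- (Jmat *v (adjm \<alpha> *v (\<alpha> *v (Jmat *v y))))))"
    using alpha_kernel[OF assms] by simp
  also have "\<dots> = cdot (\<alpha> *v x) (\<alpha> *v (Jmat *v y))"
    by (simp add: mv_simps Jmat_Jmat cdot_adjm[of x "adjm \<alpha>"])
  finally show ?thesis .
qed

lemma matrix_solution_acsol:
  assumes "AC_on a b w" and d: "AE x in lebesgue. x \<in> {a<..<b} \<longrightarrow>
      (\<exists>D. (w has_vector_derivative D) (at x) \<and> Jmat ** D = - (z *sm (H x ** w x)))"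
  shows "acsol (\<lambda>x. w x *v c) (\<lambda>x. H x *v (z *s (w x *v c)))"
  unfolding acsol_def
proof
  show "AC_on a b (\<lambda>x. w x *v c)"
    by (intro AC_on_bilinear[OF bounded_bilinear_matrix_vector] assms AC_on_const)
  show "AE x in lebesgue. x \<in> {a<..<b} \<longrightarrow>
    ((\<lambda>x. w x *v c) has_vector_derivative (Jmat *v (H x *v (z *s (w x *v c))))) (at x)"
    using d
  proof eventually_elim
    case (elim x)
    show ?case
    proof
      assume "x \<in> {a<..<b}"
      then obtain D where D: "(w has_vector_derivative D) (at x)" "Jmat ** D = - (z *sm (H x ** w x))"
        using elim by blast
      have "((\<lambda>x. w x *v c) has_vector_derivative (D *v c)) (at x)"
        by (rule bounded_linear.has_vector_derivative[OF bounded_bilinear.bounded_linear_left[OF bounded_bilinear_matrix_vector] D(1)])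
      moreover have "Jmat *v (D *v c) = - (H x *v (z *s (w x *v c)))"
        using arg_cong[OF D(2), of "\<lambda>A. A *v c"]
        by (simp add: matrix_vector_mul_assoc[symmetric] mv_simps)
      ultimately show "((\<lambda>x. w x *v c) has_vector_derivative (Jmat *v (H x *v (z *s (w x *v c))))) (at x)"
        by (simp add: Jmat_eq_iff)
    qed
  qed
qed

lemma u_acsol: "acsol (\<lambda>x. u x z *v c) (\<lambda>x. H x *v (z *s (u x z *v c)))"
  using u_sol by (intro matrix_solution_acsol) auto

lemma v_acsol: "acsol (\<lambda>x. v x z *v c) (\<lambda>x. H x *v (z *s (v x z *v c)))"
  using v_sol by (intro matrix_solution_acsol) auto

lemma u_a: "u a z *v c = - (Jmat *v (adjm \<alpha> *v c))"
  using u_sol by (simp add: matrix_vector_mul_assoc mv_simps)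

lemma v_a: "v a z *v c = adjm \<alpha> *v c"
  using v_sol by simp

lemma u_L2: "(\<lambda>x. u x z *v c) \<in> L2" and v_L2: "(\<lambda>x. v x z *v c) \<in> L2"
  by (rule acsol_L2[OF u_acsol], rule acsol_L2[OF v_acsol])

lemma cdot_u_a: "cdot (u a z *v c) (Jmat *v y) = - cdot c (\<alpha> *v y)"
  by (simp add: u_a cdot_simps cdot_Jmat_Jmat cdot_adjm'[of "adjm \<alpha>"])

lemma cdot_v_a: "cdot (v a z *v c) (Jmat *v y) = cdot c (\<alpha> *v (Jmat *v y))"
  by (simp add: v_a cdot_adjm)

lemma alpha_u_a: "\<alpha> *v (u a z *v c) = 0"
  by (simp add: u_a mv_simps)

subsection \<open>The self-adjoint relation\<close>

abbreviation "S \<equiv> Srel a b H \<alpha> \<beta>"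

lemma S_iff: "(f, g) \<in> S \<longleftrightarrow> f \<in> L2 \<and> g \<in> L2 \<and> (\<exists>f0. acsol f0 (\<lambda>x. H x *v g x) \<and>
    (\<lambda>x. f x - f0 x) \<in> L2 \<and> N2 (\<lambda>x. f x - f0 x) = 0 \<and> \<alpha> *v f0 a = 0 \<and> \<beta> *v f0 b = 0)"
  unfolding Srel_def maxrel_def L2H_eq acrep_iff by auto

lemma N2_zero: "N2 (\<lambda>x. 0) = 0" by (simp add: N2_def)

lemma S_I: "acsol f (\<lambda>x. H x *v g x) \<Longrightarrow> g \<in> L2 \<Longrightarrow> \<alpha> *v f a = 0 \<Longrightarrow> \<beta> *v f b = 0 \<Longrightarrow> (f, g) \<in> S"
  unfolding S_iff using acsol_L2[of f] by (auto intro!: exI[of _ f] simp: N2_zero)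

lemma S_L2: "(f, g) \<in> S \<Longrightarrow> f \<in> L2" "(f, g) \<in> S \<Longrightarrow> g \<in> L2"
  by (auto simp: S_iff)

lemma N2_null_trans:
  assumes "f \<in> L2" "g \<in> L2" "h \<in> L2" "N2 (\<lambda>x. f x - g x) = 0" "N2 (\<lambda>x. g x - h x) = 0"
  shows "N2 (\<lambda>x. f x - h x) = 0"
  using N2_triangle[OF assms(1-3)] N2_nonneg[OF L2_diff[OF assms(1,3)]] assms(4,5) by simp

lemma null_AE: "f \<in> L2 \<Longrightarrow> g \<in> L2 \<Longrightarrow> N2 (\<lambda>x. f x - g x) = 0 \<longleftrightarrow> (AE x in I\<^sub>0. H x *v f x = H x *v g x)"
  using N2_eq_0_iff[OF L2_diff, of f g] by (simp add: mv_simps)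

lemma S_null:
  assumes S: "(f, g) \<in> S" and f': "f' \<in> L2" "N2 (\<lambda>x. f x - f' x) = 0" and g': "g' \<in> L2" "N2 (\<lambda>x. g x - g' x) = 0"
  shows "(f', g') \<in> S"
proof -
  obtain f0 where f0: "acsol f0 (\<lambda>x. H x *v g x)" "N2 (\<lambda>x. f x - f0 x) = 0" "\<alpha> *v f0 a = 0" "\<beta> *v f0 b = 0"
    using S by (auto simp: S_iff)
  have L: "f \<in> L2" "g \<in> L2" "f0 \<in> L2" using S f0(1) by (auto simp: S_iff intro: acsol_L2)
  have "AE x in I\<^sub>0. H x *v g x = H x *v g' x" using g' L null_AE by blast
  hence "acsol f0 (\<lambda>x. H x *v g' x)" by (rule acsol_cong_AE[OF f0(1)])
  moreover have "N2 (\<lambda>x. f' x - f0 x) = 0"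
    using N2_null_trans[OF f'(1) L(1,3) _ f0(2)] f'(2) N2_diff_commute[of f f'] by simp
  ultimately show ?thesis
    unfolding S_iff using f' g' f0 L(3) L2_diff[OF f'(1) L(3)] by blast
qed

lemma ip_null_cong_left: "f \<in> L2 \<Longrightarrow> f0 \<in> L2 \<Longrightarrow> g \<in> L2 \<Longrightarrow> N2 (\<lambda>x. f x - f0 x) = 0 \<Longrightarrow> ip f g = ip f0 g"
  using ip_null_left[OF L2_diff, of f f0 g] by (simp add: ip_diff_left)

lemma ip_null_cong_right: "f \<in> L2 \<Longrightarrow> f0 \<in> L2 \<Longrightarrow> g \<in> L2 \<Longrightarrow> N2 (\<lambda>x. f x - f0 x) = 0 \<Longrightarrow> ip g f = ip g f0"
  using ip_null_right[OF _ L2_diff, of g f f0] by (simp add: ip_diff_right)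

lemma S_symmetric:
  assumes "(f, g) \<in> S" "(f', g') \<in> S" shows "ip f g' = ip g f'"
proof -
  obtain f0 where f0: "acsol f0 (\<lambda>x. H x *v g x)" "N2 (\<lambda>x. f x - f0 x) = 0" "\<alpha> *v f0 a = 0" "\<beta> *v f0 b = 0"
    using assms(1) by (auto simp: S_iff)
  obtain f1 where f1: "acsol f1 (\<lambda>x. H x *v g' x)" "N2 (\<lambda>x. f' x - f1 x) = 0" "\<alpha> *v f1 a = 0" "\<beta> *v f1 b = 0"
    using assms(2) by (auto simp: S_iff)
  have L: "f \<in> L2" "g \<in> L2" "f' \<in> L2" "g' \<in> L2" using assms by (auto simp: S_iff)
  have L0: "f0 \<in> L2" "f1 \<in> L2" using f0 f1 by (auto intro: acsol_L2)
  have "ip f0 g' - ip g f1 = 0"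
    using lagrange_identity[OF f0(1) f1(1) L(2,4)] cdot_beta_kernel[OF f0(4)] cdot_alpha_kernel[OF f0(3)] f1(3,4)
    by simp
  thus ?thesis using ip_null_cong_left[OF L(1) L0(1) L(4) f0(2)] ip_null_cong_right[OF L(3) L0(2) L(2) f1(2)] by simp
qed

lemma S_add: assumes "(f, g) \<in> S" "(f', g') \<in> S" shows "(\<lambda>x. f x + f' x, \<lambda>x. g x + g' x) \<in> S"
proof -
  obtain f0 where f0: "acsol f0 (\<lambda>x. H x *v g x)" "N2 (\<lambda>x. f x - f0 x) = 0" "\<alpha> *v f0 a = 0" "\<beta> *v f0 b = 0"
    using assms(1) by (auto simp: S_iff)
  obtain f1 where f1: "acsol f1 (\<lambda>x. H x *v g' x)" "N2 (\<lambda>x. f' x - f1 x) = 0" "\<alpha> *v f1 a = 0" "\<beta> *v f1 b = 0"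
    using assms(2) by (auto simp: S_iff)
  have L: "f \<in> L2" "g \<in> L2" "f' \<in> L2" "g' \<in> L2" using assms by (auto simp: S_iff)
  have L0: "f0 \<in> L2" "f1 \<in> L2" using f0 f1 by (auto intro: acsol_L2)
  have A: "acsol (\<lambda>x. f0 x + f1 x) (\<lambda>x. H x *v (g x + g' x))"
    using acsol_add[OF f0(1) f1(1)] by (simp add: mv_simps)
  have "(\<lambda>x. f0 x + f1 x, \<lambda>x. g x + g' x) \<in> S"
    by (rule S_I[OF A L2_add[OF L(2,4)]]) (simp_all add: mv_simps f0 f1)
  moreover have "N2 (\<lambda>x. (f0 x + f1 x) - (f x + f' x)) = 0"
  proof -
    have "N2 (\<lambda>x. (f0 x - f x) + (f1 x - f' x)) \<le> 2 * N2 (\<lambda>x. f0 x - f x) + 2 * N2 (\<lambda>x. f1 x - f' x)"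
      by (intro N2_add_le L2_diff L L0)
    also have "\<dots> = 0" using f0(2) f1(2) N2_diff_commute[of f f0] N2_diff_commute[of f' f1] by simp
    also have "(\<lambda>x. (f0 x - f x) + (f1 x - f' x)) = (\<lambda>x. (f0 x + f1 x) - (f x + f' x))" by auto
    finally show ?thesis using N2_nonneg[OF L2_diff[OF L2_add[OF L0] L2_add[OF L(1,3)]]] by simp
  qed
  ultimately show ?thesis
    by (rule S_null[OF _ L2_add[OF L(1,3)] _ L2_add[OF L(2,4)]]) (simp add: N2_zero)
qed

lemma zero_in_S: "(\<lambda>x. 0, \<lambda>x. 0) \<in> S"
  by (rule S_I) (simp_all add: acsol_zero)

subsection \<open>Weyl solutions\<close>

definition P :: "complex \<Rightarrow> complex^'n^'n" where "P z = \<beta> ** u b z"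
definition Q :: "complex \<Rightarrow> complex^'n^'n" where "Q z = \<beta> ** v b z"
definition m :: "complex \<Rightarrow> complex^'n^'n" where "m z = - (matrix_inv (P z) ** Q z)"
text \<open>The Weyl solution: it has the datum \<open>\<alpha> \<psi>(a) = c\<close> and satisfies
  the condition at \<open>b\<close>, the latter shown for \<open>Im z > 0\<close>, where
  \<open>P z\<close> is invertible.\<close>

definition \<psi> :: "complex \<Rightarrow> complex^'n \<Rightarrow> real \<Rightarrow> complex^('n + 'n)" where
  "\<psi> z c x = v x z *v c + u x z *v (m z *v c)"

text \<open>By definiteness a null solution is zero at \<open>a\<close>, where its value determines
  \<open>c\<close>.\<close>

lemma u_zero: assumes "N2 (\<lambda>x. u x z *v c) = 0" shows "c = 0"
proof -
  have "N2 (\<lambda>x. z *s (u x z *v c)) = 0" by (simp add: N2_scale assms)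
  hence "u a z *v c = 0"
    by (rule acsol_definite[OF u_acsol L2_scale[OF u_L2] _ assms]) (use ab in simp)
  hence "\<alpha> *v (Jmat *v (u a z *v c)) = 0" by simp
  thus ?thesis by (simp add: u_a mv_simps Jmat_Jmat)
qed

lemma P_eigen_S: "P z *v c = 0 \<Longrightarrow> (\<lambda>x. u x z *v c, \<lambda>x. z *s (u x z *v c)) \<in> S"
  by (rule S_I[OF u_acsol L2_scale[OF u_L2]]) (simp_all add: alpha_u_a P_def matrix_vector_mul_assoc[symmetric])

text \<open>A kernel vector yields an eigenfunction of a symmetric relation with a nonreal
  eigenvalue.\<close>

lemma P_injective: assumes z: "Im z > 0" and c: "P z *v c = 0" shows "c = 0"
proof -
  let ?f = "\<lambda>x. u x z *v c"
  have "cnj z * ip ?f ?f = z * ip ?f ?f"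
    using S_symmetric[OF P_eigen_S[OF c] P_eigen_S[OF c]] by (simp add: ip_scale_left ip_scale_right)
  moreover have "cnj z \<noteq> z" using z by (simp add: complex_eq_iff)
  ultimately have "ip ?f ?f = 0" by simp
  thus ?thesis by (intro u_zero[of z]) (simp add: N2_def)
qed

lemma P_m: assumes "Im z > 0" shows "P z *v (m z *v c) = - (Q z *v c)"
proof -
  have "P z *v (m z *v c) = - ((P z ** matrix_inv (P z)) *v (Q z *v c))"
    by (simp add: m_def mv_simps matrix_vector_mul_assoc matrix_mul_assoc)
  thus ?thesis using matrix_inv_right_invertible[OF P_injective[OF assms]] by simp
qed

lemma psi_acsol: "acsol (\<psi> z c) (\<lambda>x. H x *v (z *s \<psi> z c x))"
  using acsol_add[OF v_acsol u_acsol, of z c z "m z *v c"]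
  by (simp add: \<psi>_def[abs_def] mv_simps vec.scale_right_distrib)

lemma psi_L2: "\<psi> z c \<in> L2"
  by (rule acsol_L2[OF psi_acsol])

lemma psi_b: "Im z > 0 \<Longrightarrow> \<beta> *v \<psi> z c b = 0"
  using P_m[of z c] by (simp add: \<psi>_def mv_simps P_def Q_def matrix_vector_mul_assoc[symmetric])

lemma psi_a: "\<alpha> *v \<psi> z c a = c" "\<alpha> *v (Jmat *v \<psi> z c a) = m z *v c"
  by (simp_all add: \<psi>_def mv_simps u_a v_a Jmat_Jmat)

lemma psi_scale: "\<psi> z (s *s c) x = s *s \<psi> z c x"
  by (simp add: \<psi>_def mv_simps vec.scale_right_distrib)

lemma psi_add: "\<psi> z (c + d) x = \<psi> z c x + \<psi> z d x"
  by (simp add: \<psi>_def mv_simps)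

lemma cdot_psi_a: "cdot (\<psi> z c a) (Jmat *v y) = cdot c (\<alpha> *v (Jmat *v y)) - cdot (m z *v c) (\<alpha> *v y)"
  by (simp add: \<psi>_def cdot_simps cdot_u_a cdot_v_a)

text \<open>Lagrange's identity with no contribution from \<open>b\<close>. Divided by
  \<open>w - cnj w'\<close>, the right-hand side is the Nevanlinna kernel of \<open>m\<close>, which
  the integral representation expresses through \<open>\<rho>\<close>.\<close>

lemma ip_psi_psi:
  assumes "Im w > 0" "Im w' > 0"
  shows "(w - cnj w') * ip (\<psi> w c) (\<psi> w' c') = cdot c' (m w *v c) - cdot (m w' *v c') c"
proof -
  have "cdot (\<psi> w' c' b) (Jmat *v \<psi> w c b) = 0"
    using cdot_beta_kernel[OF psi_b[OF assms(1)]] psi_b[OF assms(2)] by simp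
  hence "- (cdot c' (m w *v c) - cdot (m w' *v c') c) =
     ip (\<psi> w c) (\<lambda>x. w' *s \<psi> w' c' x) - ip (\<lambda>x. w *s \<psi> w c x) (\<psi> w' c')"
    using lagrange_identity[OF psi_acsol[of w c] psi_acsol[of w' c'] L2_scale[OF psi_L2] L2_scale[OF psi_L2]]
    by (simp add: cdot_psi_a psi_a)
  thus ?thesis by (simp add: ip_scale_left ip_scale_right algebra_simps)
qed

text \<open>Zero data at \<open>b\<close> force the solution to vanish at \<open>a\<close>, where
  its datum is \<open>c\<close>; so the map is injective. Prescribing data at \<open>b\<close>
  instead of \<open>c\<close> gives bounds uniform in \<open>w\<close>.\<close>

lemma psi_b_surj: assumes "Im w > 0" obtains c where "\<beta> *v (Jmat *v \<psi> w c b) = r"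
proof -
  define E where "E = \<beta> ** Jmat ** (v b w + u b w ** m w)"
  have E: "E *v c = \<beta> *v (Jmat *v \<psi> w c b)" for c
    by (simp add: E_def \<psi>_def matrix_vector_mul_assoc[symmetric] mv_simps)
  have "c = 0" if "E *v c = 0" for c
  proof -
    have "\<psi> w c b = 0" using beta_kernel[OF psi_b[OF assms], of c] that[unfolded E] by simp
    hence "\<psi> w c a = 0"
      using acsol_linear_bound[of "\<psi> w c" w a b] psi_acsol[of w c] ab by (simp add: mv_simps)
    thus ?thesis using psi_a(1)[of w c] by simp
  qed
  thus ?thesis using injective_matrix_surj[of E r] that E by metis
qed

text \<open>The defect of a pair \<open>(p, q)\<close> that is orthogonal to the graph over differences of Weyl
  solutions: correcting the value at \<open>a\<close> of the solution \<open>k\<close> of \<open>J k' = - H q\<close> by \<open>d\<close>, the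
  value \<open>\<beta> k(b)\<close> vanishes, as is seen by letting \<open>w = i y\<close> tend to \<open>0\<close>.\<close>
lemma compatible_pair:
  assumes p: "p \<in> L2" and q: "q \<in> L2"
    and pq: "\<And>w c. Im w > 0 \<Longrightarrow> ip q (\<psi> w c) - ip p (\<lambda>x. w *s \<psi> w c x) = cdot c d"
  obtains k where "acsol k (\<lambda>x. H x *v q x)" "k a = - (Jmat *v (adjm \<alpha> *v d))" "\<beta> *v k b = 0"
    "\<And>w c. Im w > 0 \<Longrightarrow> ip (\<lambda>x. k x - p x) (\<psi> w c) = 0"
proof -
  obtain k where k: "acsol k (\<lambda>x. H x *v q x)" "k a = - (Jmat *v (adjm \<alpha> *v d))"
    using acsol_exists[OF H_mult_integrable[OF q]] by blast
  have kL: "k \<in> L2" using k(1) by (rule acsol_L2)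
  define e where "e = (\<lambda>x. k x - p x)"
  have eL: "e \<in> L2" unfolding e_def by (intro L2_diff kL p)
  \<comment> \<open>Lagrange's identity for \<open>k\<close> and \<open>\<psi> w c\<close>; the term
    at \<open>a\<close> is \<open>cdot c d\<close> and cancels against the hypothesis.\<close>
  have main: "- cdot (\<beta> *v (Jmat *v \<psi> w c b)) (\<beta> *v k b) = cnj w * ip e (\<psi> w c)" if w: "Im w > 0" for w c
  proof -
    have "cdot (\<psi> w c b) (Jmat *v k b) = - cdot (Jmat *v \<psi> w c b) (k b)"
      by (simp add: cdot_Jmat)
    also have "cdot (Jmat *v \<psi> w c b) (k b) = cnj (cdot (k b) (Jmat *v \<psi> w c b))" by (simp add: cnj_cdot)
    also have "cdot (k b) (Jmat *v \<psi> w c b) = cdot (\<beta> *v k b) (\<beta> *v (Jmat *v \<psi> w c b))"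
      by (rule cdot_beta_kernel[OF psi_b[OF w]])
    finally have 1: "cdot (\<psi> w c b) (Jmat *v k b) = - cdot (\<beta> *v (Jmat *v \<psi> w c b)) (\<beta> *v k b)"
      by (simp add: cnj_cdot)
    have 2: "cdot (\<psi> w c a) (Jmat *v k a) = cdot c d"
      unfolding cdot_psi_a k(2) by (simp add: mv_simps Jmat_Jmat)
    have "cdot (\<psi> w c b) (Jmat *v k b) - cdot (\<psi> w c a) (Jmat *v k a) =
       ip k (\<lambda>x. w *s \<psi> w c x) - ip q (\<psi> w c)"
      by (rule lagrange_identity[OF k(1) psi_acsol q L2_scale[OF psi_L2]])
    hence "cdot (\<psi> w c b) (Jmat *v k b) = ip k (\<lambda>x. w *s \<psi> w c x) - ip p (\<lambda>x. w *s \<psi> w c x)"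
      using pq[OF w, of c] 2 by (simp add: algebra_simps)
    also have "\<dots> = cnj w * ip e (\<psi> w c)"
      by (simp add: e_def ip_diff_left[OF kL p psi_L2] ip_scale_right right_diff_distrib)
    finally show ?thesis using 1 by simp
  qed
  define r where "r = \<beta> *v k b"
  define C where "C = norm (Jmat *v (adjm \<beta> *v r)) * exp ((2 * 1 + 1) * hI)"
  have bound: "((norm r)\<^sup>2)\<^sup>2 \<le> y\<^sup>2 * (N2 e * (C\<^sup>2 * (\<integral>x. norm (H x) \<partial>I\<^sub>0)))" if y: "0 < y" "y \<le> 1" for y :: real
  proof -
    let ?w = "\<i> * complex_of_real y"
    have w: "Im ?w > 0" using y by simp
    \<comment> \<open>With this \<open>c\<close> the left side of \<open>main\<close> is
      \<open>norm r\<close> squared up to sign, and the value of the Weyl solution at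
      \<open>b\<close> does not depend on \<open>y\<close>. So its norm stays bounded, and the
      factor \<open>cnj w\<close> forces \<open>r = 0\<close>.\<close>
    obtain c where c: "\<beta> *v (Jmat *v \<psi> ?w c b) = r" using psi_b_surj[OF w] by blast
    have b: "\<psi> ?w c b = - (Jmat *v (adjm \<beta> *v r))" using beta_kernel[OF psi_b[OF w], of c] c by simp
    have "norm (\<psi> ?w c x) \<le> C" if "x \<in> {a..b}" for x
    proof -
      have "norm (\<psi> ?w c x) \<le> norm (\<psi> ?w c b) * exp ((2 * cmod ?w + 1) * hI)"
        using acsol_linear_bound[of "\<psi> ?w c" ?w x b] psi_acsol[of ?w c] ab that by (simp add: mv_simps)
      also have "\<dots> \<le> norm (\<psi> ?w c b) * exp ((2 * 1 + 1) * hI)"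
        using y hI_nonneg by (intro mult_left_mono) (auto simp: norm_mult intro!: mult_right_mono)
      finally show ?thesis by (simp add: C_def b)
    qed
    hence N: "N2 (\<psi> ?w c) \<le> C\<^sup>2 * (\<integral>x. norm (H x) \<partial>I\<^sub>0)"
      by (intro bounded_L2(2) L2_measurable psi_L2)
    have "(norm r)\<^sup>2 = cmod (cdot r r)" by (simp add: cmod_cdot_self)
    also have "\<dots> = cmod (cnj ?w * ip e (\<psi> ?w c))"
      using main[OF w, of c] c by (metis norm_minus_cancel r_def)
    also have "\<dots> = y * cmod (ip e (\<psi> ?w c))" using y by (simp add: norm_mult)
    finally have "((norm r)\<^sup>2)\<^sup>2 = y\<^sup>2 * (cmod (ip e (\<psi> ?w c)))\<^sup>2" by (simp only: power_mult_distrib)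
    also have "\<dots> \<le> y\<^sup>2 * (N2 e * N2 (\<psi> ?w c))"
      by (intro mult_left_mono ip_cauchy_schwarz eL psi_L2) simp
    also have "\<dots> \<le> y\<^sup>2 * (N2 e * (C\<^sup>2 * (\<integral>x. norm (H x) \<partial>I\<^sub>0)))"
      by (intro mult_left_mono N N2_nonneg eL) simp
    finally show ?thesis .
  qed
  have "((norm r)\<^sup>2)\<^sup>2 \<le> 0"
  proof (rule tendsto_le[OF trivial_limit_sequentially])
    let ?K = "N2 e * (C\<^sup>2 * (\<integral>x. norm (H x) \<partial>I\<^sub>0))"
    have "(\<lambda>n. (inverse (real (Suc n)))\<^sup>2 * ?K) \<longlonglongrightarrow> 0\<^sup>2 * ?K"
      by (intro tendsto_intros LIMSEQ_inverse_real_of_nat)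
    thus "(\<lambda>n. (inverse (real (Suc n)))\<^sup>2 * ?K) \<longlonglongrightarrow> 0" by simp
    show "(\<lambda>n. ((norm r)\<^sup>2)\<^sup>2) \<longlonglongrightarrow> ((norm r)\<^sup>2)\<^sup>2" by simp
    show "\<forall>\<^sub>F n in sequentially. ((norm r)\<^sup>2)\<^sup>2 \<le> (inverse (real (Suc n)))\<^sup>2 * ?K"
      by (intro always_eventually allI bound) (auto simp: divide_simps)
  qed
  hence r0: "\<beta> *v k b = 0" by (simp add: r_def)
  show ?thesis
  proof (rule that[OF k r0])
    fix w c assume w: "Im w > 0"
    hence "cnj w * ip e (\<psi> w c) = 0" using main[OF w, of c] r0 by simp
    moreover have "w \<noteq> 0" using w by auto
    ultimately show "ip (\<lambda>x. k x - p x) (\<psi> w c) = 0" by (simp add: e_def)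
  qed
qed

text \<open>On the orthogonal complement of all Weyl solutions, \<open>S\<inverse>\<close> is a symmetric Volterra operator.\<close>
lemma orthogonal_to_psi:
  assumes f: "f \<in> L2" and orth: "\<And>w c. Im w > 0 \<Longrightarrow> ip f (\<psi> w c) = 0"
  shows "(\<lambda>x. 0, f) \<in> S"
proof -
  define good where "good f \<longleftrightarrow> f \<in> L2 \<and> (\<forall>w c. Im w > 0 \<longrightarrow> ip f (\<psi> w c) = 0)" for f
  have step: "\<exists>k. acsol k (\<lambda>x. H x *v f x) \<and> k a = 0 \<and> \<beta> *v k b = 0 \<and> good k" if g: "good f" for f
  proof -
    obtain k where k: "acsol k (\<lambda>x. H x *v f x)" "k a = - (Jmat *v (adjm \<alpha> *v 0))" "\<beta> *v k b = 0"
      "\<And>w c. Im w > 0 \<Longrightarrow> ip (\<lambda>x. k x - 0) (\<psi> w c) = 0"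
      by (rule compatible_pair[of "\<lambda>x. 0" f 0]) (use g in \<open>auto simp: good_def\<close>)
    thus ?thesis using acsol_L2[OF k(1)] by (auto simp: good_def intro!: exI[of _ k])
  qed
  \<comment> \<open>Iterates of the inverse relation; the start value 0 at \<open>a\<close> is what
    makes it a Volterra operator.\<close>
  have "\<exists>K. \<forall>n. (good (K n) \<and> (n = 0 \<longrightarrow> K n = f)) \<and>
     (acsol (K (Suc n)) (\<lambda>x. H x *v K n x) \<and> K (Suc n) a = 0 \<and> \<beta> *v K (Suc n) b = 0)"
  proof (rule dependent_nat_choice)
    show "\<exists>x. good x \<and> (0 = (0::nat) \<longrightarrow> x = f)" using f orth by (auto simp: good_def)
  qed (use step in blast)
  then obtain K where K0: "K 0 = f" and Kg: "\<And>n. good (K n)"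
    and Ks: "\<And>n. acsol (K (Suc n)) (\<lambda>x. H x *v K n x)" "\<And>n. K (Suc n) a = 0" "\<And>n. \<beta> *v K (Suc n) b = 0"
    by blast
  have KL: "K n \<in> L2" for n using Kg by (simp add: good_def)
  have KS: "(K (Suc n), K n) \<in> S" for n by (rule S_I[OF Ks(1) KL]) (simp_all add: Ks)
  \<comment> \<open>Log-convexity of the squared norms, from symmetry and Cauchy-Schwarz.\<close>
  have conv: "(N2 (K (Suc n)))\<^sup>2 \<le> N2 (K n) * N2 (K (Suc (Suc n)))" for n
  proof -
    have "ip (K (Suc n)) (K (Suc n)) = ip (K n) (K (Suc (Suc n)))" by (rule S_symmetric[OF KS KS])
    hence "(cmod (ip (K (Suc n)) (K (Suc n))))\<^sup>2 \<le> N2 (K n) * N2 (K (Suc (Suc n)))"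
      using ip_cauchy_schwarz[OF KL[of n] KL[of "Suc (Suc n)"]] by simp
    thus ?thesis by (simp add: N2_eq(1)[OF KL])
  qed
  obtain C where C: "C > 0" "\<And>x. x \<in> {a..b} \<Longrightarrow> norm (K 1 x) \<le> C"
    using AC_on_bounded[OF acsol_AC[OF Ks(1)[of 0]]] by auto
  \<comment> \<open>Every rate \<open>s\<close> is reached, since each integration against
    \<open>hH\<close> gains \<open>1 / s\<close> on the exponential weight.\<close>
  have decay: "norm (K (Suc n) x) \<le> C / s ^ n * exp (s * integral {a..x} hH)"
    if s: "s > 0" and x: "x \<in> {a..b}" for s n x
    using x
  proof (induction n arbitrary: x)
    case 0
    have "integral {a..x} hH \<ge> 0"
      using 0 hH_abs_integrable
      by (intro integral_nonneg) (auto simp: absolutely_integrable_on_def intro: integrable_on_subinterval)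
    hence "C * 1 \<le> C * exp (s * integral {a..x} hH)" using C s by (intro mult_left_mono) auto
    thus ?case using C(2)[OF 0] by simp
  next
    case (Suc n)
    let ?k = "K (Suc n)"
    define w where "w y = hH y * exp (s * integral {a..y} hH)" for y
    have x: "a \<le> x" "x \<le> b" using Suc.prems by auto
    have der: "AE y in lebesgue. y \<in> {a<..<x} \<longrightarrow> (K (Suc (Suc n)) has_vector_derivative
        (if y \<in> {a<..<b} then Jmat *v (H y *v ?k y) else 0)) (at y)"
      using Ks(1)[of "Suc n"] x unfolding acsol_def by (auto elim!: eventually_mono)
    have "((\<lambda>y. if y \<in> {a<..<b} then Jmat *v (H y *v ?k y) else 0) has_integral K (Suc (Suc n)) x - K (Suc (Suc n)) a) {a..x}"
      by (rule AC_on_fundamental_theorem[OF x(1) AC_on_subinterval[OF acsol_AC[OF Ks(1)]] der]) (use x in auto)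
    moreover have wi: "((\<lambda>y. C / s ^ n * w y) has_integral C / s ^ n * ((exp (s * integral {a..x} hH) - 1) / s)) {a..x}"
      unfolding w_def by (intro has_integral_mult_right has_integral_exp_weight[OF hH_abs_integrable s Suc.prems])
    moreover have "norm (if y \<in> {a<..<b} then Jmat *v (H y *v ?k y) else 0) \<le> C / s ^ n * w y" if "y \<in> {a..x}" for y
    proof (cases "y \<in> {a<..<b}")
      case True
      have "norm (Jmat *v (H y *v ?k y)) \<le> norm (H y) * norm (?k y)"
        by (simp add: norm_Jmat norm_matrix_vector_le)
      also have "\<dots> \<le> norm (H y) * (C / s ^ n * exp (s * integral {a..y} hH))"
        using Suc.IH[of y] True by (intro mult_left_mono) auto
      finally show ?thesis using True by (simp add: w_def hH_def mult_ac)
    next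
      case False
      show ?thesis unfolding if_not_P[OF False] using C(1) s by (simp add: w_def)
    qed
    ultimately have "norm (K (Suc (Suc n)) x - K (Suc (Suc n)) a) \<le> C / s ^ n * ((exp (s * integral {a..x} hH) - 1) / s)"
      by (metis (no_types, lifting) has_integral_integrable integral_norm_bound_integral integral_unique)
    also have "\<dots> \<le> C / s ^ n * (exp (s * integral {a..x} hH) / s)"
      using C s by (intro mult_left_mono divide_right_mono) auto
    finally show ?case by (simp add: Ks(2) field_simps)
  qed
  have Ndecay: "\<exists>D. \<forall>n. N2 (K (Suc n)) \<le> D / (s ^ n)\<^sup>2" if s: "s > 0" for s
  proof (intro exI allI)
    fix n
    have "norm (K (Suc n) x) \<le> C / s ^ n * exp (s * hI)" if x: "x \<in> {a..b}" for x
    proof -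
      have "integral {a..x} hH \<le> hI" unfolding hI_def
        using x hH_abs_integrable
        by (intro integral_subset_le) (auto simp: absolutely_integrable_on_def intro: integrable_on_subinterval)
      hence "C / s ^ n * exp (s * integral {a..x} hH) \<le> C / s ^ n * exp (s * hI)"
        using C s by (intro mult_left_mono) auto
      thus ?thesis using decay[OF s x, of n] by linarith
    qed
    from bounded_L2(2)[OF L2_measurable[OF KL] this]
    have "N2 (K (Suc n)) \<le> (C / s ^ n * exp (s * hI))\<^sup>2 * (\<integral>x. norm (H x) \<partial>I\<^sub>0)" .
    also have "\<dots> = (C * exp (s * hI))\<^sup>2 * (\<integral>x. norm (H x) \<partial>I\<^sub>0) / (s ^ n)\<^sup>2"
      by (simp add: power_mult_distrib power_divide)
    finally show "N2 (K (Suc n)) \<le> (C * exp (s * hI))\<^sup>2 * (\<integral>x. norm (H x) \<partial>I\<^sub>0) / (s ^ n)\<^sup>2" .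
  qed
  have "N2 (K 1) = 0"
  proof (rule ccontr)
    assume "N2 (K 1) \<noteq> 0"
    hence p1: "N2 (K 1) > 0" using N2_nonneg[OF KL[of 1]] by simp
    have p0: "N2 (K 0) > 0"
      using conv[of 0] p1 N2_nonneg[OF KL[of 0]] by (cases "N2 (K 0) = 0") auto
    define \<rho> where "\<rho> = N2 (K 1) / N2 (K 0)"
    have \<rho>: "\<rho> > 0" using p0 p1 by (simp add: \<rho>_def)
    \<comment> \<open>Log-convexity makes the quotients of successive terms nondecreasing, so the
      first one bounds them all from below.\<close>
    have grow: "N2 (K n) > 0 \<and> N2 (K (Suc n)) \<ge> \<rho> * N2 (K n)" for n
    proof (induction n)
      case 0 thus ?case using p0 by (simp add: \<rho>_def)
    next
      case (Suc n)
      hence pos: "N2 (K (Suc n)) > 0" using \<rho> by (meson less_le_trans mult_pos_pos)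
      have "N2 (K n) * (\<rho> * N2 (K (Suc n))) \<le> N2 (K (Suc n)) * N2 (K (Suc n))"
        using mult_right_mono[of "\<rho> * N2 (K n)" "N2 (K (Suc n))" "N2 (K (Suc n))"] Suc pos by (simp add: mult_ac)
      also have "\<dots> \<le> N2 (K n) * N2 (K (Suc (Suc n)))" using conv[of n] by (simp add: power2_eq_square)
      finally show ?case using Suc pos by (simp add: mult_le_cancel_left)
    qed
    have pw: "N2 (K (Suc n)) \<ge> \<rho> ^ n * N2 (K 1)" for n
    proof (induction n)
      case (Suc n)
      have "\<rho> ^ Suc n * N2 (K 1) \<le> \<rho> * N2 (K (Suc n))" using Suc \<rho> by simp
      thus ?case using grow[of "Suc n"] by linarith
    qed simp
    \<comment> \<open>Chosen so that \<open>s\<^sup>2 * \<rho> = 2\<close>: comparing the two rates,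
      \<open>2 ^ n\<close> would have to stay bounded.\<close>
    define s where "s = sqrt (2 / \<rho>)"
    have s: "s > 0" "s\<^sup>2 = 2 / \<rho>" using \<rho> by (auto simp: s_def)
    obtain D where D: "\<And>n. N2 (K (Suc n)) \<le> D / (s ^ n)\<^sup>2" using Ndecay[OF s(1)] by blast
    have "2 ^ n * N2 (K 1) \<le> D" for n
    proof -
      have "(s ^ n)\<^sup>2 = (s\<^sup>2) ^ n" by (metis mult.commute power_mult)
      hence sn: "(s ^ n)\<^sup>2 = 2 ^ n / \<rho> ^ n" by (simp add: s(2) power_divide)
      have "\<rho> ^ n * N2 (K 1) \<le> D / (2 ^ n / \<rho> ^ n)" using order_trans[OF pw[of n] D[of n]] unfolding sn .
      thus ?thesis using \<rho> by (simp add: field_simps)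
    qed
    moreover obtain n where "D / N2 (K 1) < 2 ^ n" using real_arch_pow[of 2 "D / N2 (K 1)"] by auto
    hence "D < 2 ^ n * N2 (K 1)" using p1 by (simp add: field_simps)
    ultimately show False by (meson not_le)
  qed
  moreover have "(K 1, f) \<in> S" using KS[of 0] K0 by simp
  ultimately show ?thesis by (rule_tac S_null) (use f in \<open>auto simp: N2_zero\<close>)
qed

end

context boundary_problem
begin

subsection \<open>Dependence on the spectral parameter\<close>

text \<open>The difference of two solutions satisfies an equation with the extra inhomogeneity
  \<open>(z - w) H y(w)\<close>, which plays the role of \<open>D\<close> in
  \<open>acsol_gronwall\<close>.\<close>

lemma solution_family_lipschitz:
  assumes y: "\<And>z. acsol (y z) (\<lambda>x. H x *v (z *s y z x))" and ya: "\<And>z. y z a = y0"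
    and z: "cmod z \<le> R" and w: "cmod w \<le> R" and x: "x \<in> {a..b}"
    and K: "K = exp ((2 * R + 1) * hI)"
  shows "norm (y z x) \<le> norm y0 * K" "norm (y z x - y w x) \<le> norm y0 * K * K * cmod (z - w)"
proof -
  have R: "R \<ge> 0" using z norm_ge_zero order_trans by blast
  have K1: "K \<ge> 1" using R hI_nonneg by (simp add: K)
  have bound: "norm (y z x) \<le> norm y0 * K" if "cmod z \<le> R" "x \<in> {a..b}" for z x
  proof -
    have "norm (y z x) \<le> norm (y z a) * exp ((2 * cmod z + 1) * hI)"
      using acsol_linear_bound[of "y z" z x a] y[of z] ab that by (simp add: mv_simps)
    also have "\<dots> \<le> norm (y z a) * exp ((2 * R + 1) * hI)"
      using that hI_nonneg by (intro mult_left_mono) (auto intro!: mult_right_mono)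
    finally show ?thesis by (simp add: ya K)
  qed
  show "norm (y z x) \<le> norm y0 * K" by (rule bound[OF z x])
  define D where "D = cmod (z - w) * (norm y0 * K)"
  have D: "D \<ge> 0" using K1 by (simp add: D_def)
  let ?d = "\<lambda>x. y z x - y w x"
  have "(norm (?d x))\<^sup>2 + D\<^sup>2 \<le> ((norm (?d a))\<^sup>2 + D\<^sup>2) * exp ((2 * R + 1) * hI)"
  proof (rule acsol_gronwall[OF acsol_diff[OF y y] R D _ x])
    show "a \<in> {a..b}" using ab by simp
    show "AE x in lebesgue. x \<in> {a<..<b} \<longrightarrow>
        norm (H x *v (z *s y z x) - H x *v (w *s y w x)) \<le> norm (H x) * (R * norm (?d x) + D)"
    proof (rule AE_I2, rule impI)
      fix x assume x: "x \<in> {a<..<b}"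
      have e: "H x *v (z *s y z x) - H x *v (w *s y w x) = H x *v (z *s ?d x + (z - w) *s y w x)"
        by (simp add: mv_simps vec.scale_right_diff_distrib vec.scale_left_diff_distrib)
      have "norm (z *s ?d x + (z - w) *s y w x) \<le> cmod z * norm (?d x) + cmod (z - w) * norm (y w x)"
        by (rule order_trans[OF norm_triangle_ineq]) (simp only: norm_scale order_refl)
      also have "\<dots> \<le> R * norm (?d x) + D"
        unfolding D_def using z R bound[OF w, of x] x by (intro add_mono mult_mono) auto
      finally show "norm (H x *v (z *s y z x) - H x *v (w *s y w x)) \<le> norm (H x) * (R * norm (?d x) + D)"
        unfolding e by (meson mult_left_mono norm_ge_zero norm_matrix_vector_le order_trans)
    qed
  qed
  also have "\<dots> = D\<^sup>2 * K" by (simp add: ya K)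
  also have "\<dots> \<le> D\<^sup>2 * K\<^sup>2" using K1 by (intro mult_left_mono) (auto simp: power2_eq_square)
  finally have "(norm (?d x))\<^sup>2 \<le> (D * K)\<^sup>2" unfolding power_mult_distrib by (smt (verit) zero_le_power2)
  hence "norm (?d x) \<le> D * K" by (rule power2_le_imp_le) (use D K1 in simp)
  thus "norm (y z x - y w x) \<le> norm y0 * K * K * cmod (z - w)" by (simp add: D_def mult_ac)
qed

lemma solution_matrix_lipschitz:
  fixes w :: "real \<Rightarrow> complex \<Rightarrow> complex^'n^('n + 'n)"
  assumes R: "R \<ge> 0" and sol: "\<And>z c. acsol (\<lambda>x. w x z *v c) (\<lambda>x. H x *v (z *s (w x z *v c)))"
    and init: "\<And>z c. w a z *v c = y0 c" "\<And>c. norm (y0 c) \<le> N * norm c" and N: "N \<ge> 0"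
  obtains L where "L \<ge> 0"
    "\<And>z c x. cmod z \<le> R \<Longrightarrow> x \<in> {a..b} \<Longrightarrow> norm (w x z *v c) \<le> L * norm c"
    "\<And>z z' c x. cmod z \<le> R \<Longrightarrow> cmod z' \<le> R \<Longrightarrow> x \<in> {a..b} \<Longrightarrow> norm (w x z *v c - w x z' *v c) \<le> L * cmod (z - z') * norm c"
proof -
  define K where "K = exp ((2 * R + 1) * hI)"
  have K1: "K \<ge> 1" using R hI_nonneg by (simp add: K_def)
  let ?L = "N * K * K"
  have K2: "X * K \<le> X * K * K" if "X \<ge> 0" for X
    using mult_left_mono[OF K1, of "X * K"] K1 that by simp
  show ?thesis
  proof (rule that[of ?L])
    show "?L \<ge> 0" using K1 N by simp
    fix z c x assume z: "cmod z \<le> R" and x: "x \<in> {a..b}"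
    have "norm (w x z *v c) \<le> norm (y0 c) * K"
      by (rule solution_family_lipschitz(1)[of "\<lambda>z x. w x z *v c", OF sol init(1) z z x K_def])
    also have "\<dots> \<le> N * norm c * K" using init(2) K1 by (intro mult_right_mono) auto
    also have "\<dots> \<le> ?L * norm c" using K2[of "N * norm c"] N by (simp add: mult_ac)
    finally show "norm (w x z *v c) \<le> ?L * norm c" .
  next
    fix z z' c x assume z: "cmod z \<le> R" "cmod z' \<le> R" and x: "x \<in> {a..b}"
    have "norm (w x z *v c - w x z' *v c) \<le> norm (y0 c) * K * K * cmod (z - z')"
      by (rule solution_family_lipschitz(2)[of "\<lambda>z x. w x z *v c", OF sol init(1) z x K_def])
    also have "\<dots> \<le> N * norm c * K * K * cmod (z - z')"
      using init(2) K1 by (intro mult_right_mono) auto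
    finally show "norm (w x z *v c - w x z' *v c) \<le> ?L * cmod (z - z') * norm c" by (simp add: mult_ac)
  qed
qed

lemma norm_u_init: "norm (- (Jmat *v (adjm \<alpha> *v c))) \<le> norm \<alpha> * norm c"
  by (simp add: norm_Jmat norm_adjm_le)

lemmas u_lipschitz = solution_matrix_lipschitz[where w=u, OF _ u_acsol u_a norm_u_init norm_ge_zero]
lemmas v_lipschitz = solution_matrix_lipschitz[where w=v, OF _ v_acsol v_a norm_adjm_le norm_ge_zero]

lemma matrix_norm_from_vectors:
  fixes X :: "complex^'k^'l"
  assumes "\<And>c. norm (X *v c) \<le> r * norm c"
  shows "norm X \<le> real CARD('k) * real CARD('l) * r"
proof -
  have n: "norm (axis j 1 :: complex^'k) = 1" for j
    by (simp add: norm_eq_sqrt_inner inner_axis_axis)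
  have "norm X \<le> (\<Sum>j\<in>UNIV. real CARD('l) * norm (X *v axis j 1))" by (rule norm_matrix_le_columns)
  also have "\<dots> \<le> (\<Sum>(j::'k)\<in>UNIV. real CARD('l) * r)"
    using assms n by (intro sum_mono mult_left_mono) (metis mult.right_neutral, simp)
  finally show ?thesis by simp
qed

lemma boundary_matrices_lipschitz:
  assumes R: "R \<ge> 0"
  obtains L where "L \<ge> 0"
    "\<And>z. cmod z \<le> R \<Longrightarrow> norm (P z) \<le> L" "\<And>z w. cmod z \<le> R \<Longrightarrow> cmod w \<le> R \<Longrightarrow> norm (P z - P w) \<le> L * cmod (z - w)"
    "\<And>z. cmod z \<le> R \<Longrightarrow> norm (Q z) \<le> L" "\<And>z w. cmod z \<le> R \<Longrightarrow> cmod w \<le> R \<Longrightarrow> norm (Q z - Q w) \<le> L * cmod (z - w)"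
proof -
  have bb: "b \<in> {a..b}" using ab by simp
  obtain L1 where L1: "L1 \<ge> 0" "\<And>z c x. cmod z \<le> R \<Longrightarrow> x \<in> {a..b} \<Longrightarrow> norm (u x z *v c) \<le> L1 * norm c"
    "\<And>z w c x. cmod z \<le> R \<Longrightarrow> cmod w \<le> R \<Longrightarrow> x \<in> {a..b} \<Longrightarrow> norm (u x z *v c - u x w *v c) \<le> L1 * cmod (z - w) * norm c"
    using u_lipschitz[OF R] by blast
  obtain L2 where L2: "L2 \<ge> 0" "\<And>z c x. cmod z \<le> R \<Longrightarrow> x \<in> {a..b} \<Longrightarrow> norm (v x z *v c) \<le> L2 * norm c"
    "\<And>z w c x. cmod z \<le> R \<Longrightarrow> cmod w \<le> R \<Longrightarrow> x \<in> {a..b} \<Longrightarrow> norm (v x z *v c - v x w *v c) \<le> L2 * cmod (z - w) * norm c"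
    using v_lipschitz[OF R] by blast
  define N where "N = real CARD('n) * real CARD('n)"
  define L where "L = N * (norm \<beta> * (L1 + L2))"
  have N: "N \<ge> 0" by (simp add: N_def)
  have be: "norm (\<beta> *v y) \<le> norm \<beta> * s" if "norm y \<le> s" for y s
    using that by (meson mult_left_mono norm_ge_zero norm_matrix_vector_le order_trans)
  have LL: "N * (norm \<beta> * L1) \<le> L" "N * (norm \<beta> * L2) \<le> L"
    unfolding L_def using L1(1) L2(1) N by (auto intro!: mult_left_mono)
  show ?thesis
  proof (rule that[of L])
    show "L \<ge> 0" using L1(1) L2(1) N by (simp add: L_def)
    fix z assume z: "cmod z \<le> R"
    have "norm (P z *v c) \<le> (norm \<beta> * L1) * norm c" for c
      using be[OF L1(2)[OF z bb, of c]] by (simp add: P_def matrix_vector_mul_assoc[symmetric] mult_ac)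
    thus "norm (P z) \<le> L" using matrix_norm_from_vectors[of "P z" "norm \<beta> * L1"] LL by (simp add: N_def)
    have "norm (Q z *v c) \<le> (norm \<beta> * L2) * norm c" for c
      using be[OF L2(2)[OF z bb, of c]] by (simp add: Q_def matrix_vector_mul_assoc[symmetric] mult_ac)
    thus "norm (Q z) \<le> L" using matrix_norm_from_vectors[of "Q z" "norm \<beta> * L2"] LL by (simp add: N_def)
  next
    fix z w assume zw: "cmod z \<le> R" "cmod w \<le> R"
    have "norm ((P z - P w) *v c) \<le> (norm \<beta> * L1 * cmod (z - w)) * norm c" for c
      using be[OF L1(3)[OF zw bb, of c]] by (simp add: P_def matrix_vector_mul_assoc[symmetric] mult_ac mv_simps)
    hence "norm (P z - P w) \<le> N * (norm \<beta> * L1) * cmod (z - w)"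
      using matrix_norm_from_vectors[of "P z - P w" "norm \<beta> * L1 * cmod (z - w)"] by (simp add: N_def mult_ac)
    thus "norm (P z - P w) \<le> L * cmod (z - w)" using mult_right_mono[OF LL(1), of "cmod (z - w)"] by simp
    have "norm ((Q z - Q w) *v c) \<le> (norm \<beta> * L2 * cmod (z - w)) * norm c" for c
      using be[OF L2(3)[OF zw bb, of c]] by (simp add: Q_def matrix_vector_mul_assoc[symmetric] mult_ac mv_simps)
    hence "norm (Q z - Q w) \<le> N * (norm \<beta> * L2) * cmod (z - w)"
      using matrix_norm_from_vectors[of "Q z - Q w" "norm \<beta> * L2 * cmod (z - w)"] by (simp add: N_def mult_ac)
    thus "norm (Q z - Q w) \<le> L * cmod (z - w)" using mult_right_mono[OF LL(2), of "cmod (z - w)"] by simp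
  qed
qed

lemma P_isCont: "isCont P z"
proof -
  obtain L where L: "L \<ge> 0" "\<And>w z'. cmod w \<le> cmod z + 1 \<Longrightarrow> cmod z' \<le> cmod z + 1 \<Longrightarrow> norm (P w - P z') \<le> L * cmod (w - z')"
    using boundary_matrices_lipschitz[of "cmod z + 1"] by (metis add_nonneg_nonneg norm_ge_zero zero_le_one)
  have "((\<lambda>w. P w - P z) \<longlongrightarrow> 0) (at z)"
  proof (rule Lim_null_comparison)
    show "\<forall>\<^sub>F w in at z. norm (P w - P z) \<le> L * cmod (w - z)"
      unfolding eventually_at
    proof (intro exI[of _ 1] conjI ballI impI)
      fix w assume "w \<noteq> z \<and> dist w z < 1"
      hence "cmod w \<le> cmod z + 1" using norm_triangle_ineq2[of w z] by (simp add: dist_norm)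
      thus "norm (P w - P z) \<le> L * cmod (w - z)" by (intro L) auto
    qed simp
    show "((\<lambda>w. L * cmod (w - z)) \<longlongrightarrow> 0) (at z)" by (auto intro!: tendsto_eq_intros)
  qed
  thus ?thesis by (simp add: isCont_def LIM_zero_iff)
qed

text \<open>A combination that vanishes at \<open>b\<close> vanishes at \<open>a\<close>, where
  \<open>\<alpha>\<close> and \<open>\<alpha> J\<close> read off both coefficient vectors.\<close>

lemma fundamental_matrix_surj: obtains c d where "u b z *v c + v b z *v d = y"
proof -
  define T :: "complex^('n + 'n)^('n + 'n)" where
    "T = (\<chi> i j. case j of Inl p \<Rightarrow> u b z $ i $ p | Inr p \<Rightarrow> v b z $ i $ p)"
  have T: "T *v w = u b z *v (\<chi> p. w $ Inl p) + v b z *v (\<chi> p. w $ Inr p)" for w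
    by (simp add: T_def matrix_vector_mult_def UNIV_sum_Plus vec_eq_iff)
  have "w = 0" if w: "T *v w = 0" for w
  proof -
    define c where "c = (\<chi> p. w $ Inl p)"
    define d where "d = (\<chi> p. w $ Inr p)"
    define f where "f = (\<lambda>x. u x z *v c + v x z *v d)"
    have "acsol f (\<lambda>x. z *s (H x *v f x))"
      using acsol_add[OF u_acsol[of z c] v_acsol[of z d]] by (simp add: f_def mv_simps vec.scale_right_distrib)
    from acsol_linear_bound[OF this, of a b] have "f a = 0" using w ab by (simp add: T c_def d_def f_def)
    hence fa: "u a z *v c + v a z *v d = 0" by (simp add: f_def)
    from arg_cong[OF fa, of "\<lambda>y. \<alpha> *v y"] have d0: "d = 0" by (simp add: u_a v_a mv_simps)
    from arg_cong[OF fa, of "\<lambda>y. \<alpha> *v (Jmat *v y)"] have c0: "c = 0" by (simp add: u_a v_a mv_simps Jmat_Jmat)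
    show "w = 0"
    proof (subst vec_eq_iff, rule allI)
      fix i show "w $ i = 0 $ i"
        using c0 d0 by (cases i) (auto simp: c_def d_def vec_eq_iff)
    qed
  qed
  then obtain w where "T *v w = y" using injective_matrix_surj by blast
  thus ?thesis using that T by metis
qed

text \<open>Take the solution \<open>f\<close> at the real point \<open>t\<close> with
  \<open>f(b) = J \<beta>\<^sup>* e\<close>. Lagrange's identity with \<open>u\<close> and
  \<open>v\<close> identifies \<open>P\<^sup>* e\<close> and \<open>Q\<^sup>* e\<close> with
  \<open>\<alpha> f(a)\<close> and \<open>- \<alpha> J f(a)\<close>. The claim is that
  \<open>f\<^sup>* J f\<close>, equal at both ends, vanishes at \<open>b\<close>.\<close>

lemma QP_hermitian:
  fixes t :: real
  shows "Im (cdot (adjm (Q t) *v e) (adjm (P t) *v e)) = 0"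
proof -
  obtain c d where cd: "u b t *v c + v b t *v d = Jmat *v (adjm \<beta> *v e)" using fundamental_matrix_surj by blast
  define f where "f = (\<lambda>x. u x t *v c + v x t *v d)"
  have f: "acsol f (\<lambda>x. H x *v (complex_of_real t *s f x))"
    using acsol_add[OF u_acsol[of t c] v_acsol[of t d]] by (simp add: f_def mv_simps vec.scale_right_distrib)
  have fL: "f \<in> L2" by (rule acsol_L2[OF f])
  have fa: "\<alpha> *v f a = d" "\<alpha> *v (Jmat *v f a) = c"
    by (simp_all add: f_def mv_simps u_a v_a Jmat_Jmat)
  have fb: "f b = Jmat *v (adjm \<beta> *v e)" using cd by (simp add: f_def)
  have lag: "cdot (g b) (Jmat *v f b) = cdot (g a) (Jmat *v f a)" if g: "acsol g (\<lambda>x. H x *v (complex_of_real t *s g x))" for g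
    using lagrange_identity[OF f g L2_scale[OF fL] L2_scale[OF acsol_L2[OF g]]]
    by (simp add: ip_scale_left ip_scale_right)
  have "cdot k (adjm (P t) *v e) = cdot k d" for k
    using lag[OF u_acsol, of k] 
    by (simp add: cdot_u_a fa fb Jmat_Jmat cdot_simps P_def adjm_mult matrix_vector_mul_assoc[symmetric] cdot_adjm'[of "u b _"])
  hence x: "adjm (P t) *v e = d" by (rule cdot_eqI)
  have "cdot k (adjm (Q t) *v e) = cdot k (- c)" for k
    using lag[OF v_acsol, of k]
    by (simp add: cdot_v_a fa fb Jmat_Jmat cdot_simps Q_def adjm_mult matrix_vector_mul_assoc[symmetric] cdot_adjm'[of "v b _"])
      (metis minus_equation_iff)
  hence y: "adjm (Q t) *v e = - c" by (rule cdot_eqI)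
  have "cdot (f b) (Jmat *v f b) = 0"
    by (simp add: fb Jmat_Jmat cdot_simps cdot_adjm[of _ "adjm \<beta>"])
  hence "cdot (f a) (Jmat *v f a) = 0" using lag[OF f] by simp
  moreover have "cdot (f a) (Jmat *v f a) = - cdot c d + cdot d c"
    using fa by (simp add: f_def cdot_add_left cdot_u_a cdot_v_a)
  ultimately have "cdot d c = cdot c d" by simp
  hence "Im (cdot c d) = 0" using cnj_cdot[of c d] by (metis cnj.simps(2) neg_equal_zero)
  thus ?thesis by (simp add: x y cdot_simps)
qed

text \<open>The quantity vanishes at the real point \<open>Re z\<close> and is Lipschitz in
  \<open>z\<close>.\<close>

lemma QP_im_bound:
  assumes R: "R \<ge> 0"
  obtains C where "C \<ge> 0"
    "\<And>z e. cmod z \<le> R \<Longrightarrow> \<bar>Im (cdot (adjm (Q z) *v e) (adjm (P z) *v e))\<bar> \<le> C * \<bar>Im z\<bar> * (norm e)\<^sup>2"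
proof -
  obtain L where L: "L \<ge> 0" "\<And>z. cmod z \<le> R \<Longrightarrow> norm (P z) \<le> L"
    "\<And>z w. cmod z \<le> R \<Longrightarrow> cmod w \<le> R \<Longrightarrow> norm (P z - P w) \<le> L * cmod (z - w)"
    "\<And>z. cmod z \<le> R \<Longrightarrow> norm (Q z) \<le> L"
    "\<And>z w. cmod z \<le> R \<Longrightarrow> cmod w \<le> R \<Longrightarrow> norm (Q z - Q w) \<le> L * cmod (z - w)"
    using boundary_matrices_lipschitz[OF R] by blast
  have ad: "adjm X *v e - adjm Y *v e = adjm (X - Y) *v e" for X Y :: "complex^'n^'n" and e
    by (simp add: linear_diff[OF bounded_linear.linear[OF bounded_linear_adjm]] mv_simps)
  show ?thesis
  proof (rule that[of "2 * L\<^sup>2"])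
    fix z e assume z: "cmod z \<le> R"
    define \<tau> where "\<tau> = complex_of_real (Re z)"
    have \<tau>: "cmod \<tau> \<le> R" using z abs_Re_le_cmod[of z] by (simp add: \<tau>_def)
    have d: "cmod (z - \<tau>) = \<bar>Im z\<bar>" by (simp add: \<tau>_def cmod_def)
    let ?q = "\<lambda>z. adjm (Q z) *v e" and ?p = "\<lambda>z. adjm (P z) *v e"
    have "cdot (?q z) (?p z) - cdot (?q \<tau>) (?p \<tau>) = cdot (?q z - ?q \<tau>) (?p z) + cdot (?q \<tau>) (?p z - ?p \<tau>)"
      by (simp add: cdot_simps)
    hence "cmod (cdot (?q z) (?p z) - cdot (?q \<tau>) (?p \<tau>)) \<le> norm (?q z - ?q \<tau>) * norm (?p z) + norm (?q \<tau>) * norm (?p z - ?p \<tau>)"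
      using norm_triangle_mono[OF norm_cdot_le norm_cdot_le] by simp
    also have "\<dots> \<le> (L * \<bar>Im z\<bar> * norm e) * (L * norm e) + (L * norm e) * (L * \<bar>Im z\<bar> * norm e)"
    proof (intro add_mono mult_mono)
      show "norm (?q z - ?q \<tau>) \<le> L * \<bar>Im z\<bar> * norm e"
        unfolding ad by (rule order_trans[OF norm_adjm_le mult_right_mono]) (use L(5)[OF z \<tau>] d in auto)
      show "norm (?p z - ?p \<tau>) \<le> L * \<bar>Im z\<bar> * norm e"
        unfolding ad by (rule order_trans[OF norm_adjm_le mult_right_mono]) (use L(3)[OF z \<tau>] d in auto)
      show "norm (?p z) \<le> L * norm e"
        by (rule order_trans[OF norm_adjm_le mult_right_mono]) (use L(2)[OF z] in auto)
      show "norm (?q \<tau>) \<le> L * norm e"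
        by (rule order_trans[OF norm_adjm_le mult_right_mono]) (use L(4)[OF \<tau>] in auto)
    qed (use L(1) in auto)
    also have "\<dots> = 2 * L\<^sup>2 * \<bar>Im z\<bar> * (norm e)\<^sup>2" by (simp add: power2_eq_square)
    finally have "cmod (cdot (?q z) (?p z) - cdot (?q \<tau>) (?p \<tau>)) \<le> 2 * L\<^sup>2 * \<bar>Im z\<bar> * (norm e)\<^sup>2" .
    moreover have "\<bar>Im (cdot (?q z) (?p z) - cdot (?q \<tau>) (?p \<tau>))\<bar> \<le> cmod (cdot (?q z) (?p z) - cdot (?q \<tau>) (?p \<tau>))"
      by (rule abs_Im_le_cmod)
    moreover have "Im (cdot (?q \<tau>) (?p \<tau>)) = 0" unfolding \<tau>_def by (rule QP_hermitian)
    ultimately show "\<bar>Im (cdot (?q z) (?p z))\<bar> \<le> 2 * L\<^sup>2 * \<bar>Im z\<bar> * (norm e)\<^sup>2" by simp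
  qed simp
qed

subsection \<open>The transform\<close>

abbreviation "U \<equiv> Uop a b H u"

text \<open>Pairing with \<open>c\<close> turns the vector integral into an inner product, so
  linearity, null functions and limits are inherited from \<open>ip\<close>.\<close>

lemma U_cdot: assumes h: "h \<in> L2" shows "cdot c (U h t) = ip h (\<lambda>x. u x t *v c)"
proof -
  let ?F = "\<lambda>x. adjm (u x (complex_of_real t)) *v (H x *v h x)"
  have AC: "AC_on a b (\<lambda>x. u x (complex_of_real t))" using u_sol by blast
  obtain C where C: "C > 0" "\<And>x. x \<in> {a..b} \<Longrightarrow> norm (u x (complex_of_real t)) \<le> C"
    using AC_on_bounded[OF AC] by blast
  have am: "(\<lambda>x. adjm (u x (complex_of_real t))) \<in> borel_measurable I\<^sub>0"
    by (rule measurable_compose[OF AC_measurable[OF AC] borel_measurable_continuous_onI[OF linear_continuous_on[OF bounded_linear_adjm]]])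
  have F: "integrable I\<^sub>0 ?F"
  proof (rule Bochner_Integration.integrable_bound)
    show "integrable I\<^sub>0 (\<lambda>x. C * norm (H x *v h x))"
      by (intro integrable_mult_right integrable_norm H_mult_integrable h)
    show "?F \<in> borel_measurable I\<^sub>0"
      by (intro borel_measurable_mv am W_measurable L2_measurable h)
    show "AE x in I\<^sub>0. norm (?F x) \<le> norm (C * norm (H x *v h x))"
      unfolding AE_I0_iff
    proof (rule AE_I2, rule impI)
      fix x assume "x \<in> {a<..<b}"
      hence "norm (?F x) \<le> C * norm (H x *v h x)"
        using C(2)[of x] by (intro order_trans[OF norm_adjm_le mult_right_mono]) auto
      thus "norm (?F x) \<le> norm (C * norm (H x *v h x))" using C(1) by simp
    qed
  qed
  have "U h t = (\<integral>x. ?F x \<partial>I\<^sub>0)"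
    by (simp add: Uop_def set_lebesgue_integral_def integral_restrict_space)
  hence "cdot c (U h t) = (\<integral>x. cdot c (?F x) \<partial>I\<^sub>0)"
    using integral_bounded_linear[OF bounded_bilinear.bounded_linear_right[OF bounded_bilinear_cdot] F] by simp
  also have "\<dots> = ip h (\<lambda>x. u x t *v c)"
    by (simp add: ipw_def hform_def cdot_adjm)
  finally show ?thesis .
qed

lemma U_component: "h \<in> L2 \<Longrightarrow> U h t $ i = ip h (\<lambda>x. u x t *v axis i 1)"
  using U_cdot[of h "axis i 1" t] by (simp add: cdot_axis_left)

lemma U_linear:
  assumes "h \<in> L2" "k \<in> L2" shows "U (\<lambda>x. c *s h x + k x) t = c *s U h t + U k t"
  by (rule cdot_eqI)
    (simp add: U_cdot assms L2_add L2_scale cdot_simps ip_add_left[OF L2_scale] ip_scale_left u_L2)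

lemma U_diff: assumes "h \<in> L2" "k \<in> L2" shows "U (\<lambda>x. h x - k x) t = U h t - U k t"
  by (rule cdot_eqI) (simp add: U_cdot assms L2_diff cdot_simps ip_diff_left u_L2)

lemma U_add: assumes "h \<in> L2" "k \<in> L2" shows "U (\<lambda>x. h x + k x) t = U h t + U k t"
  using U_linear[OF assms, of 1] by simp

lemma U_scale: assumes "h \<in> L2" shows "U (\<lambda>x. c *s h x) t = c *s U h t"
  by (rule cdot_eqI) (simp add: U_cdot assms L2_scale cdot_simps ip_scale_left)

lemma U_null: assumes "h \<in> L2" "N2 h = 0" shows "U h t = 0"
  by (rule cdot_eqI) (simp add: U_cdot assms ip_null_left u_L2)

text \<open>Each value of the transform is a bounded functional of \<open>h\<close>, so convergence
  in the seminorm gives convergence at every \<open>t\<close>.\<close>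

lemma U_lim: assumes "L2_lim s p" shows "(\<lambda>n. U (s n) t) \<longlonglongrightarrow> U p t"
proof (rule vec_tendstoI)
  fix i
  have "s n \<in> L2" "p \<in> L2" for n using assms by (auto simp: L2_lim_def)
  thus "(\<lambda>n. U (s n) t $ i) \<longlonglongrightarrow> U p t $ i"
    using L2_lim_ip_left[OF assms u_L2] by (simp add: U_component)
qed

text \<open>Comes from Lipschitz dependence of \<open>u\<close> on the parameter; it makes
  transforms Borel measurable.\<close>

lemma U_continuous: assumes h: "h \<in> L2" shows "continuous_on UNIV (U h)"
  unfolding continuous_on_eq_continuous_at[OF open_UNIV]
proof (intro ballI)
  fix t :: real
  define K where "K = (\<integral>x. norm (H x) \<partial>I\<^sub>0)"
  obtain L where L: "L \<ge> 0"
    "\<And>z w c x. cmod z \<le> \<bar>t\<bar> + 1 \<Longrightarrow> cmod w \<le> \<bar>t\<bar> + 1 \<Longrightarrow> x \<in> {a..b} \<Longrightarrow> norm (u x z *v c - u x w *v c) \<le> L * cmod (z - w) * norm c"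
    using u_lipschitz[of "\<bar>t\<bar> + 1"] by (metis add_nonneg_nonneg abs_ge_zero zero_le_one)
  have K0: "K \<ge> 0" by (simp add: K_def)
  have "((\<lambda>s. U h s $ i) \<longlongrightarrow> U h t $ i) (at t)" for i
  proof -
    let ?C = "\<lambda>s. L * \<bar>s - t\<bar> * norm (axis i 1 :: complex^'n)"
    have "((\<lambda>s. U h s $ i - U h t $ i) \<longlongrightarrow> 0) (at t)"
    proof (rule Lim_null_comparison)
      show "\<forall>\<^sub>F s in at t. norm (U h s $ i - U h t $ i) \<le> sqrt (N2 h * ((?C s)\<^sup>2 * K))"
        unfolding eventually_at
      proof (intro exI[of _ 1] conjI ballI impI)
        fix s assume "s \<noteq> t \<and> dist s t < 1"
        hence s: "\<bar>s\<bar> \<le> \<bar>t\<bar> + 1" by (auto simp: dist_real_def)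
        let ?g = "\<lambda>x. u x s *v axis i 1 - u x t *v axis i 1"
        have "norm (?g x) \<le> ?C s" if "x \<in> {a..b}" for x
        proof -
          have "cmod (complex_of_real s - complex_of_real t) = \<bar>s - t\<bar>" by (metis norm_of_real of_real_diff)
          thus ?thesis using L(2)[of s t x "axis i 1"] s that by simp
        qed
        hence N: "N2 ?g \<le> (?C s)\<^sup>2 * K" unfolding K_def
          by (intro bounded_L2(2) L2_measurable L2_diff u_L2)
        have "U h s $ i - U h t $ i = ip h ?g"
          by (simp add: U_component h ip_diff_right u_L2)
        hence "(norm (U h s $ i - U h t $ i))\<^sup>2 \<le> N2 h * N2 ?g"
          using ip_cauchy_schwarz[OF h L2_diff[OF u_L2 u_L2]] by simp
        also have "\<dots> \<le> N2 h * ((?C s)\<^sup>2 * K)" by (rule mult_left_mono[OF N N2_nonneg[OF h]])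
        finally show "norm (U h s $ i - U h t $ i) \<le> sqrt (N2 h * ((?C s)\<^sup>2 * K))" by (rule real_le_rsqrt)
      qed simp
      have "((\<lambda>s. sqrt (N2 h * ((?C s)\<^sup>2 * K))) \<longlongrightarrow> sqrt (N2 h * ((L * \<bar>t - t\<bar> * norm (axis i 1 :: complex^'n))\<^sup>2 * K))) (at t)"
        by (intro tendsto_intros)
      thus "((\<lambda>s. sqrt (N2 h * ((?C s)\<^sup>2 * K))) \<longlongrightarrow> 0) (at t)" by simp
    qed
    thus ?thesis by (simp add: LIM_zero_iff)
  qed
  thus "isCont (U h) t" unfolding isCont_def by (rule vec_tendstoI)
qed

lemma U_measurable: "h \<in> L2 \<Longrightarrow> U h \<in> borel_measurable borel"
  by (rule borel_measurable_continuous_onI[OF U_continuous])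

text \<open>Lagrange's identity for \<open>f\<close> and \<open>u\<close> at the real point
  \<open>t\<close>: both satisfy the condition at \<open>a\<close>, and the term at \<open>b\<close>
  is the adjoint of \<open>P t\<close> applied to a vector independent of \<open>t\<close>. Such
  terms will turn out to be invisible to \<open>\<rho>\<close>.\<close>

lemma U_S:
  assumes "(f, g) \<in> S" obtains e where "\<And>t. U g t = complex_of_real t *s U f t - adjm (P t) *v e"
proof -
  obtain f0 where f0: "acsol f0 (\<lambda>x. H x *v g x)" "N2 (\<lambda>x. f x - f0 x) = 0" "\<alpha> *v f0 a = 0" "\<beta> *v f0 b = 0"
    using assms by (auto simp: S_iff)
  have L: "f \<in> L2" "g \<in> L2" "f0 \<in> L2" using assms f0(1) by (auto simp: S_iff intro: acsol_L2)
  let ?e = "\<beta> *v (Jmat *v f0 b)"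
  have "U g t = complex_of_real t *s U f t - adjm (P t) *v ?e" for t
  proof (rule cdot_eqI)
    fix c
    have "cdot (u b t *v c) (Jmat *v f0 b) = cdot (P t *v c) ?e"
      using cdot_beta_kernel[OF f0(4), of "u b t *v c"] by (simp add: P_def matrix_vector_mul_assoc)
    hence "cdot c (adjm (P t) *v ?e) = complex_of_real t * ip f0 (\<lambda>x. u x t *v c) - ip g (\<lambda>x. u x t *v c)"
      using lagrange_identity[OF f0(1) u_acsol L(2) L2_scale[OF u_L2], of t c]
      by (simp add: cdot_u_a f0(3) ip_scale_right cdot_adjm'[of "P _"])
    moreover have "ip f0 (\<lambda>x. u x t *v c) = ip f (\<lambda>x. u x t *v c)"
      using ip_null_cong_left[OF L(1,3) u_L2 f0(2)] by simp
    ultimately show "cdot c (U g t) = cdot c (complex_of_real t *s U f t - adjm (P t) *v ?e)"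
      by (simp add: cdot_simps U_cdot L)
  qed
  thus ?thesis by (rule that)
qed

text \<open>The computation of \<open>U_S\<close>, except that the datum \<open>c\<close> at
  \<open>a\<close> survives.\<close>

lemma U_psi:
  assumes w: "Im w > 0"
  obtains e where "\<And>t. (complex_of_real t - w) *s U (\<psi> w c) t = c + adjm (P t) *v e"
proof -
  let ?e = "\<beta> *v (Jmat *v \<psi> w c b)"
  have "(complex_of_real t - w) *s U (\<psi> w c) t = c + adjm (P t) *v ?e" for t
  proof (rule cdot_eqI)
    fix d
    have "cdot (u b t *v d) (Jmat *v \<psi> w c b) = cdot (P t *v d) ?e"
      using cdot_beta_kernel[OF psi_b[OF w], of "u b t *v d"] by (simp add: P_def matrix_vector_mul_assoc)
    hence "cdot d (adjm (P t) *v ?e) + cdot d c = (complex_of_real t - w) * ip (\<psi> w c) (\<lambda>x. u x t *v d)"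
      using lagrange_identity[OF psi_acsol[of w c] u_acsol[of t d] L2_scale[OF psi_L2] L2_scale[OF u_L2]]
      by (simp add: cdot_u_a psi_a ip_scale_right ip_scale_left cdot_adjm'[of "P _"] algebra_simps)
    thus "cdot d ((complex_of_real t - w) *s U (\<psi> w c) t) = cdot d (c + adjm (P t) *v ?e)"
      by (simp add: cdot_simps U_cdot psi_L2 algebra_simps)
  qed
  thus ?thesis by (rule that)
qed

end

section \<open>The Herglotz measure\<close>

text \<open>Subdivision into \<open>n\<close> equal pieces bounds the total increment by
  \<open>n * C * ((b - a) / n)\<^sup>2\<close>.\<close>

lemma quadratic_increment_constant:
  fixes f :: "real \<Rightarrow> real"
  assumes ab: "a \<le> b" and f: "\<And>s t. a \<le> s \<Longrightarrow> s < t \<Longrightarrow> t \<le> b \<Longrightarrow> \<bar>f t - f s\<bar> \<le> C * (t - s)\<^sup>2"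
  shows "f b = f a"
proof (cases "a = b")
  case False
  hence ab': "a < b" using ab by simp
  have bound: "\<bar>f b - f a\<bar> \<le> C * (b - a)\<^sup>2 * inverse (real (Suc n))" for n
  proof -
    define h where "h = (b - a) / real (Suc n)"
    have h: "h > 0" "real (Suc n) * h = b - a" using ab' by (simp_all add: h_def)
    have "\<bar>f (a + real k * h) - f a\<bar> \<le> real k * (C * h\<^sup>2)" if "k \<le> Suc n" for k
      using that
    proof (induction k)
      case (Suc k)
      have "real (Suc k) * h \<le> real (Suc n) * h" using Suc.prems h(1) by (intro mult_right_mono) auto
      hence "a + real (Suc k) * h \<le> b" using h(2) by simp
      hence "\<bar>f (a + real (Suc k) * h) - f (a + real k * h)\<bar> \<le> C * (a + real (Suc k) * h - (a + real k * h))\<^sup>2"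
        using h(1) by (intro f) (auto simp: algebra_simps)
      moreover have "a + real (Suc k) * h - (a + real k * h) = h" by (simp add: algebra_simps)
      ultimately have "\<bar>f (a + real (Suc k) * h) - f (a + real k * h)\<bar> \<le> C * h\<^sup>2" by simp
      moreover have "\<bar>f (a + real k * h) - f a\<bar> \<le> real k * (C * h\<^sup>2)" using Suc by simp
      moreover have "real (Suc k) * (C * h\<^sup>2) = real k * (C * h\<^sup>2) + C * h\<^sup>2" by (simp add: algebra_simps)
      ultimately show ?case by linarith
    qed simp
    from this[of "Suc n"] have "\<bar>f b - f a\<bar> \<le> real (Suc n) * (C * h\<^sup>2)" using h(2) by simp
    also have "\<dots> = C * (real (Suc n) * h) * h" by (simp add: power2_eq_square mult_ac)
    also have "\<dots> = C * (b - a)\<^sup>2 * inverse (real (Suc n))"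
      unfolding h(2) by (simp add: h_def power2_eq_square divide_inverse mult_ac)
    finally show ?thesis .
  qed
  have "\<bar>f b - f a\<bar> \<le> C * (b - a)\<^sup>2 * 0"
  proof (rule tendsto_le[OF trivial_limit_sequentially])
    show "(\<lambda>n. C * (b - a)\<^sup>2 * inverse (real (Suc n))) \<longlonglongrightarrow> C * (b - a)\<^sup>2 * 0"
      by (intro tendsto_intros LIMSEQ_inverse_real_of_nat)
    show "(\<lambda>n. \<bar>f b - f a\<bar>) \<longlonglongrightarrow> \<bar>f b - f a\<bar>" by simp
  qed (use bound in simp)
  thus ?thesis by simp
qed simp

locale herglotz_problem = boundary_problem a b H \<alpha> \<beta> u v
  for a b :: real and H :: "real \<Rightarrow> complex^('n::finite + 'n)^('n + 'n)"
    and \<alpha> \<beta> :: "complex^('n + 'n)^'n" and u v :: "real \<Rightarrow> complex \<Rightarrow> complex^'n^('n + 'n)" +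
  fixes A B :: "complex^'n^'n" and \<mu> :: "real measure" and W :: "real \<Rightarrow> complex^'n^'n"
  assumes \<mu>_sets: "sets \<mu> = sets borel"
    and W_meas: "W \<in> borel_measurable borel"
    and W_AE_psd: "AE t in \<mu>. psd (W t)"
    and \<rho>_fin: "\<forall>i j. integrable \<mu> (\<lambda>t. W t $ i $ j / complex_of_real (1 + t\<^sup>2))"
    and A_herm: "adjm A = A"
    and B_psd: "psd B"
    and herglotz: "\<And>z. Im z > 0 \<Longrightarrow> m z = A + z *sm B + herg_int \<mu> W z"
begin

lemma mu_measurable: "borel_measurable \<mu> = borel_measurable borel"
  by (rule measurable_cong_sets[OF \<mu>_sets refl])

sublocale rho: weighted_L2 \<mu> W
  by unfold_locales (simp_all add: mu_measurable W_meas W_AE_psd)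

lemma L2rho_eq: "L2rho \<mu> W = rho.L2"
  by (simp add: L2rho_def L2w_def mu_measurable)

lemma ipR_eq: "ipR \<mu> W = rho.ip"
  by (intro ext) (simp add: ipR_def ipw_def)

lemma nullR_iff: "nullR \<mu> W F \<longleftrightarrow> F \<in> rho.L2 \<and> rho.N2 F = 0"
  unfolding nullR_def L2rho_eq ipR_eq using rho.N2_eq(1)[of F] by (cases "F \<in> rho.L2") simp_all

lemma nullR_AE: "nullR \<mu> W F \<longleftrightarrow> F \<in> borel_measurable borel \<and> (AE t in \<mu>. W t *v F t = 0)"
proof
  assume "nullR \<mu> W F"
  thus "F \<in> borel_measurable borel \<and> (AE t in \<mu>. W t *v F t = 0)"
    using rho.L2_measurable[of F] rho.N2_eq_0_iff[of F] by (simp add: nullR_iff mu_measurable)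
next
  assume F: "F \<in> borel_measurable borel \<and> (AE t in \<mu>. W t *v F t = 0)"
  have "F \<in> rho.L2"
  proof (rule rho.L2_dominated[of "\<lambda>t. 0"])
    show "AE t in \<mu>. qf (W t) (F t) \<le> 0"
      using F by (auto simp: qf_def hform_def)
  qed (use F in \<open>auto simp: mu_measurable\<close>)
  thus "nullR \<mu> W F" using F rho.N2_eq_0_iff by (simp add: nullR_iff)
qed

lemma eqR_AE:
  assumes "F \<in> borel_measurable borel" "G \<in> borel_measurable borel"
  shows "eqR \<mu> W F G \<longleftrightarrow> (AE t in \<mu>. W t *v F t = W t *v G t)"
  unfolding eqR_def nullR_AE using assms by (simp add: mv_simps borel_measurable_diff)

section \<open>Integrability of the kernels and the Poisson estimate\<close>

lemma rho_integrable:
  assumes g: "g \<in> borel_measurable borel" and C: "\<And>t. cmod (g t) * (1 + t\<^sup>2) \<le> C"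
  shows "integrable \<mu> (\<lambda>t. g t * W t $ i $ j)"
proof (rule Bochner_Integration.integrable_bound)
  show "integrable \<mu> (\<lambda>t. C * norm (W t $ i $ j / complex_of_real (1 + t\<^sup>2)))"
    using \<rho>_fin by (intro integrable_mult_right integrable_norm) auto
  show "(\<lambda>t. g t * W t $ i $ j) \<in> borel_measurable \<mu>"
    unfolding mu_measurable by (intro borel_measurable_times g borel_measurable_component W_meas)
  show "AE t in \<mu>. norm (g t * W t $ i $ j) \<le> norm (C * norm (W t $ i $ j / complex_of_real (1 + t\<^sup>2)))"
  proof (rule AE_I2)
    fix t :: real
    have p: "1 + t\<^sup>2 > 0" by (simp add: add_pos_nonneg)
    have C0: "C \<ge> 0" using C[of 0] by (simp add: order_trans[OF norm_ge_zero])
    have n: "norm (W t $ i $ j / complex_of_real (1 + t\<^sup>2)) = norm (W t $ i $ j) / (1 + t\<^sup>2)"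
      using p by (simp only: norm_divide norm_of_real)
    have "cmod (g t) \<le> C / (1 + t\<^sup>2)" using C[of t] p by (simp add: field_simps)
    hence "norm (g t * W t $ i $ j) \<le> C / (1 + t\<^sup>2) * norm (W t $ i $ j)"
      unfolding norm_mult by (rule mult_right_mono) simp
    thus "norm (g t * W t $ i $ j) \<le> norm (C * norm (W t $ i $ j / complex_of_real (1 + t\<^sup>2)))"
      unfolding n using C0 p by simp
  qed
qed

lemma cdot_mv_expand: "cdot c' ((X :: complex^'n^'n) *v c) = (\<Sum>i\<in>UNIV. \<Sum>j\<in>UNIV. cnj (c' $ i) * c $ j * X $ i $ j)"
  by (simp add: cdot_def matrix_vector_mult_def sum_distrib_left mult_ac)

lemma rho_integral_form:
  assumes "\<And>i j. integrable \<mu> (\<lambda>t. g t * W t $ i $ j)"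
  shows "integrable \<mu> (\<lambda>t. g t * cdot c' (W t *v c))"
    "(\<integral>t. g t * cdot c' (W t *v c) \<partial>\<mu>) = cdot c' ((\<chi> i j. \<integral>t. g t * W t $ i $ j \<partial>\<mu>) *v c)"
proof -
  have e: "(\<lambda>t. g t * cdot c' (W t *v c)) = (\<lambda>t. \<Sum>i\<in>UNIV. \<Sum>j\<in>UNIV. cnj (c' $ i) * c $ j * (g t * W t $ i $ j))"
    by (simp add: cdot_mv_expand sum_distrib_left mult_ac)
  show "integrable \<mu> (\<lambda>t. g t * cdot c' (W t *v c))"
    unfolding e by (intro Bochner_Integration.integrable_sum integrable_mult_right assms)
  show "(\<integral>t. g t * cdot c' (W t *v c) \<partial>\<mu>) = cdot c' ((\<chi> i j. \<integral>t. g t * W t $ i $ j \<partial>\<mu>) *v c)"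
  proof -
    have i: "integrable \<mu> (\<lambda>t. cnj (c' $ i) * c $ j * (g t * W t $ i $ j))" for i j
      by (intro integrable_mult_right assms)
    have "(\<integral>t. g t * cdot c' (W t *v c) \<partial>\<mu>) = (\<Sum>i\<in>UNIV. \<integral>t. (\<Sum>j\<in>UNIV. cnj (c' $ i) * c $ j * (g t * W t $ i $ j)) \<partial>\<mu>)"
      unfolding e by (rule Bochner_Integration.integral_sum) (intro Bochner_Integration.integrable_sum i)
    also have "\<dots> = (\<Sum>i\<in>UNIV. \<Sum>j\<in>UNIV. \<integral>t. cnj (c' $ i) * c $ j * (g t * W t $ i $ j) \<partial>\<mu>)"
      by (intro sum.cong refl Bochner_Integration.integral_sum i)
    also have "\<dots> = cdot c' ((\<chi> i j. \<integral>t. g t * W t $ i $ j \<partial>\<mu>) *v c)"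
      unfolding cdot_mv_expand by (simp only: integral_mult_right_zero vec_lambda_beta)
    finally show ?thesis .
  qed
qed

lemma pole_nonzero: "Im w \<noteq> 0 \<Longrightarrow> complex_of_real t - w \<noteq> 0"
  by (auto simp: complex_eq_iff)

lemma pole_inverse_le: "Im w \<noteq> 0 \<Longrightarrow> cmod (1 / (complex_of_real t - w)) \<le> 1 / \<bar>Im w\<bar>"
  using abs_Im_le_cmod[of "complex_of_real t - w"] by (simp add: norm_divide frac_le)

text \<open>Multiplied by \<open>1 + t\<^sup>2\<close>, the kernel becomes
  \<open>w + (1 + w\<^sup>2) / (t - w)\<close>, and the pole has distance at least
  \<open>\<bar>Im w\<bar>\<close> from the line.\<close>

lemma herglotz_kernel_bound:
  assumes w: "Im w \<noteq> 0"
  shows "cmod (1 / (complex_of_real t - w) - complex_of_real (t / (t\<^sup>2 + 1))) * (1 + t\<^sup>2) \<le> cmod w + (1 + (cmod w)\<^sup>2) / \<bar>Im w\<bar>"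
proof -
  have p: "1 + t\<^sup>2 > 0" by (simp add: add_pos_nonneg)
  have p': "complex_of_real (t\<^sup>2 + 1) \<noteq> 0" using p by (metis add.commute less_numeral_extra(3) of_real_eq_0_iff)
  let ?d = "complex_of_real t - w"
  have "(1 / ?d - complex_of_real (t / (t\<^sup>2 + 1))) * complex_of_real (1 + t\<^sup>2) = (1 / ?d) * complex_of_real (1 + t\<^sup>2) - complex_of_real t"
    using p p' by (simp add: left_diff_distrib add.commute flip: of_real_mult)
  also have "\<dots> = w + (1 + w\<^sup>2) * (1 / ?d)"
    using pole_nonzero[OF w, of t] by (simp add: field_simps power2_eq_square)
  finally have "cmod (1 / ?d - complex_of_real (t / (t\<^sup>2 + 1))) * cmod (complex_of_real (1 + t\<^sup>2)) = cmod (w + (1 + w\<^sup>2) * (1 / ?d))"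
    by (metis norm_mult)
  also have "\<dots> \<le> cmod w + cmod (1 + w\<^sup>2) * cmod (1 / ?d)"
    by (metis norm_mult norm_triangle_ineq)
  also have "\<dots> \<le> cmod w + (1 + (cmod w)\<^sup>2) * (1 / \<bar>Im w\<bar>)"
  proof (intro add_left_mono mult_mono pole_inverse_le w)
    show "cmod (1 + w\<^sup>2) \<le> 1 + (cmod w)\<^sup>2" using norm_triangle_ineq[of 1 "w\<^sup>2"] by (simp add: norm_power)
  qed auto
  finally show ?thesis using p by (simp only: norm_of_real) simp
qed

text \<open>Both parts of \<open>1 + t\<^sup>2\<close> are compared with the squared distance:
  \<open>t = (t - w) + w\<close>, and constants are bounded through
  \<open>\<bar>Im w\<bar>\<close>.\<close>

lemma pole_weight_bound:
  assumes w: "Im w \<noteq> 0"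
  obtains C where "C > 0" "\<And>t. 1 / (cmod (complex_of_real t - w))\<^sup>2 * (1 + t\<^sup>2) \<le> C"
proof -
  define C where "C = 2 + (1 + cmod w)\<^sup>2 / (Im w)\<^sup>2 * 2"
  have C: "C > 0" by (simp add: C_def add_pos_nonneg)
  show ?thesis
  proof (rule that[OF C])
    fix t :: real
    let ?d = "cmod (complex_of_real t - w)"
    have d: "\<bar>Im w\<bar> \<le> ?d" using abs_Im_le_cmod[of "complex_of_real t - w"] by simp
    hence d2: "(Im w)\<^sup>2 \<le> ?d\<^sup>2" by (metis abs_ge_zero power2_abs power_mono)
    have i: "(Im w)\<^sup>2 > 0" using w by simp
    have "\<bar>t\<bar> \<le> ?d + cmod w" using norm_triangle_ineq[of "complex_of_real t - w" w] by simp
    hence "t\<^sup>2 \<le> (?d + cmod w)\<^sup>2" by (metis abs_ge_zero power2_abs power_mono)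
    also have "\<dots> \<le> 2 * ?d\<^sup>2 + 2 * (cmod w)\<^sup>2" using sum_squares_bound[of ?d "cmod w"] by (simp add: power2_sum)
    finally have "1 + t\<^sup>2 \<le> 2 * ?d\<^sup>2 + (1 + 2 * (cmod w)\<^sup>2)" by simp
    also have "1 + 2 * (cmod w)\<^sup>2 \<le> (1 + cmod w)\<^sup>2 * 2" by (simp add: power2_sum)
    also have "(1 + cmod w)\<^sup>2 * 2 \<le> (1 + cmod w)\<^sup>2 / (Im w)\<^sup>2 * 2 * ?d\<^sup>2"
      using mult_left_mono[OF d2, of "(1 + cmod w)\<^sup>2 / (Im w)\<^sup>2 * 2"] i by simp
    finally have "1 + t\<^sup>2 \<le> C * ?d\<^sup>2" by (simp add: C_def distrib_right)
    moreover have "?d\<^sup>2 > 0" using pole_nonzero[OF w, of t] by simp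
    ultimately show "1 / ?d\<^sup>2 * (1 + t\<^sup>2) \<le> C" by (simp add: field_simps)
  qed
qed

lemma double_pole_bound:
  assumes w: "Im w \<noteq> 0" and w': "Im w' \<noteq> 0"
  obtains C where "\<And>t. cmod (1 / ((complex_of_real t - w) * (complex_of_real t - w'))) * (1 + t\<^sup>2) \<le> C"
proof -
  obtain C1 where C1: "\<And>t. 1 / (cmod (complex_of_real t - w))\<^sup>2 * (1 + t\<^sup>2) \<le> C1" using pole_weight_bound[OF w] by blast
  obtain C2 where C2: "\<And>t. 1 / (cmod (complex_of_real t - w'))\<^sup>2 * (1 + t\<^sup>2) \<le> C2" using pole_weight_bound[OF w'] by blast
  show ?thesis
  proof (rule that[of "C1 + C2"])
    fix t :: real
    define x where "x = 1 / cmod (complex_of_real t - w)"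
    define y where "y = 1 / cmod (complex_of_real t - w')"
    have xy: "x \<ge> 0" "y \<ge> 0" by (auto simp: x_def y_def)
    have "x * y \<le> x\<^sup>2 + y\<^sup>2" using sum_squares_bound[of x y] mult_nonneg_nonneg[OF xy] by linarith
    hence "x * y * (1 + t\<^sup>2) \<le> (x\<^sup>2 + y\<^sup>2) * (1 + t\<^sup>2)" by (intro mult_right_mono) auto
    also have "\<dots> \<le> C1 + C2" using C1[of t] C2[of t] by (simp add: x_def y_def power_divide distrib_right)
    finally show "cmod (1 / ((complex_of_real t - w) * (complex_of_real t - w'))) * (1 + t\<^sup>2) \<le> C1 + C2"
      by (simp add: x_def y_def norm_divide norm_mult)
  qed
qed

lemma borel_measurable_pole: "(\<lambda>t. 1 / (complex_of_real t - w)) \<in> borel_measurable borel"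
  by (intro borel_measurable_divide borel_measurable_diff borel_measurable_complex_of_real) auto

lemma m_form:
  assumes w: "Im w > 0"
  shows "cdot c' (m w *v c) = cdot c' (A *v c) + w * cdot c' (B *v c) +
     (\<integral>t. (1 / (complex_of_real t - w) - complex_of_real (t / (t\<^sup>2 + 1))) * cdot c' (W t *v c) \<partial>\<mu>)"
    "integrable \<mu> (\<lambda>t. (1 / (complex_of_real t - w) - complex_of_real (t / (t\<^sup>2 + 1))) * cdot c' (W t *v c))"
proof -
  have i: "integrable \<mu> (\<lambda>t. (1 / (complex_of_real t - w) - complex_of_real (t / (t\<^sup>2 + 1))) * W t $ i $ j)" for i j
    by (rule rho_integrable[OF _ herglotz_kernel_bound])
      (use w in \<open>auto intro!: borel_measurable_diff borel_measurable_pole borel_measurable_complex_of_real\<close>)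
  show "integrable \<mu> (\<lambda>t. (1 / (complex_of_real t - w) - complex_of_real (t / (t\<^sup>2 + 1))) * cdot c' (W t *v c))"
    by (rule rho_integral_form(1)[OF i])
  show "cdot c' (m w *v c) = cdot c' (A *v c) + w * cdot c' (B *v c) +
     (\<integral>t. (1 / (complex_of_real t - w) - complex_of_real (t / (t\<^sup>2 + 1))) * cdot c' (W t *v c) \<partial>\<mu>)"
    unfolding rho_integral_form(2)[OF i] by (simp add: herglotz[OF w] herg_int_def mv_simps cdot_simps)
qed

text \<open>\<open>A\<close> and the regularizing terms cancel, \<open>B\<close> leaves the factor
  \<open>w - cnj w'\<close>, and partial fractions extract the same factor from the two
  poles.\<close>

lemma m_difference:
  assumes w: "Im w > 0" and w': "Im w' > 0"
  shows "integrable \<mu> (\<lambda>t. 1 / ((complex_of_real t - w) * (complex_of_real t - cnj w')) * cdot c' (W t *v c))"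
    "cdot c' (m w *v c) - cdot (m w' *v c') c = (w - cnj w') * (cdot c' (B *v c) +
       (\<integral>t. 1 / ((complex_of_real t - w) * (complex_of_real t - cnj w')) * cdot c' (W t *v c) \<partial>\<mu>))"
proof -
  have n: "Im w \<noteq> 0" "Im (cnj w') \<noteq> 0" using w w' by auto
  obtain C where C: "\<And>t. cmod (1 / ((complex_of_real t - w) * (complex_of_real t - cnj w'))) * (1 + t\<^sup>2) \<le> C"
    using double_pole_bound[OF n] by blast
  have "integrable \<mu> (\<lambda>t. 1 / ((complex_of_real t - w) * (complex_of_real t - cnj w')) * W t $ i $ j)" for i j
    by (rule rho_integrable[OF _ C])
      (intro borel_measurable_divide borel_measurable_times borel_measurable_diff borel_measurable_complex_of_real; simp)
  thus int: "integrable \<mu> (\<lambda>t. 1 / ((complex_of_real t - w) * (complex_of_real t - cnj w')) * cdot c' (W t *v c))"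
    by (rule rho_integral_form(1))
  let ?k = "\<lambda>w t. 1 / (complex_of_real t - w) - complex_of_real (t / (t\<^sup>2 + 1))"
  have i1: "integrable \<mu> (\<lambda>t. ?k w t * cdot c' (W t *v c))" by (rule m_form(2)[OF w])
  have "cdot (m w' *v c') c = cnj (cdot c (m w' *v c'))" by (simp add: cnj_cdot)
  also have "\<dots> = cnj (cdot c (A *v c')) + cnj w' * cnj (cdot c (B *v c')) + cnj (\<integral>t. ?k w' t * cdot c (W t *v c') \<partial>\<mu>)"
    by (simp add: m_form(1)[OF w'])
  also have "cnj (cdot c (A *v c')) = cdot c' (A *v c)" by (simp add: cnj_cdot cdot_adjm A_herm)
  also have "cnj (cdot c (B *v c')) = cdot c' (B *v c)" by (simp add: cnj_cdot psd_herm[OF B_psd])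
  also have "cnj (\<integral>t. ?k w' t * cdot c (W t *v c') \<partial>\<mu>) = (\<integral>t. cnj (?k w' t * cdot c (W t *v c')) \<partial>\<mu>)"
    by (rule Bochner_Integration.integral_cnj[symmetric])
  also have "\<dots> = (\<integral>t. ?k (cnj w') t * cdot c' (W t *v c) \<partial>\<mu>)"
  proof (rule integral_cong_AE)
    show "AE t in \<mu>. cnj (?k w' t * cdot c (W t *v c')) = ?k (cnj w') t * cdot c' (W t *v c)"
      using W_AE_psd by eventually_elim (simp add: cnj_cdot psd_herm)
    have i2: "integrable \<mu> (\<lambda>t. ?k w' t * cdot c (W t *v c'))" by (rule m_form(2)[OF w'])
    show "(\<lambda>t. cnj (?k w' t * cdot c (W t *v c'))) \<in> borel_measurable \<mu>"
      by (rule borel_measurable_integrable[OF integrable_cnj[OF i2]])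
    show "(\<lambda>t. ?k (cnj w') t * cdot c' (W t *v c)) \<in> borel_measurable \<mu>"
      unfolding mu_measurable
      by (intro borel_measurable_times borel_measurable_diff borel_measurable_pole borel_measurable_complex_of_real
          borel_measurable_bilinear[OF bounded_bilinear_cdot] borel_measurable_mv W_meas) auto
  qed
  finally have e: "cdot (m w' *v c') c = cdot c' (A *v c) + cnj w' * cdot c' (B *v c) + (\<integral>t. ?k (cnj w') t * cdot c' (W t *v c) \<partial>\<mu>)" .
  have pt: "?k w t * X - (w - cnj w') * (1 / ((complex_of_real t - w) * (complex_of_real t - cnj w')) * X) = ?k (cnj w') t * X" for t X
  proof -
    have "1 / (complex_of_real t - w) - 1 / (complex_of_real t - cnj w') = (w - cnj w') * (1 / ((complex_of_real t - w) * (complex_of_real t - cnj w')))"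
      using pole_nonzero[OF n(1), of t] pole_nonzero[OF n(2), of t] by (simp add: diff_frac_eq)
    moreover have "(x - r) * X - d * (k * X) = (y - r) * X" if "x - y = d * k" for x y r d k :: complex
    proof -
      have "d * (k * X) = (x - y) * X" by (simp add: that)
      thus ?thesis by (simp only: left_diff_distrib) simp
    qed
    ultimately show ?thesis by blast
  qed
  have "(\<integral>t. ?k (cnj w') t * cdot c' (W t *v c) \<partial>\<mu>) = (\<integral>t. ?k w t * cdot c' (W t *v c) \<partial>\<mu>) -
     (w - cnj w') * (\<integral>t. 1 / ((complex_of_real t - w) * (complex_of_real t - cnj w')) * cdot c' (W t *v c) \<partial>\<mu>)"
    unfolding pt[symmetric]
    by (subst Bochner_Integration.integral_diff[OF i1 integrable_mult_right[OF int]])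
      (simp only: Bochner_Integration.integral_mult_right_zero)
  thus "cdot c' (m w *v c) - cdot (m w' *v c') c = (w - cnj w') * (cdot c' (B *v c) +
       (\<integral>t. 1 / ((complex_of_real t - w) * (complex_of_real t - cnj w')) * cdot c' (W t *v c) \<partial>\<mu>))"
    unfolding e m_form(1)[OF w] by (simp add: algebra_simps)
qed

text \<open>The case \<open>w' = w\<close>, where the double pole times \<open>Im w\<close> is the
  Poisson kernel; the nonnegative contribution of \<open>B\<close> is dropped.\<close>

lemma poisson_estimate:
  assumes w: "Im w > 0"
  shows "integrable \<mu> (\<lambda>t. Im w / (cmod (complex_of_real t - w))\<^sup>2 * qf (W t) c)"
    "(\<integral>t. Im w / (cmod (complex_of_real t - w))\<^sup>2 * qf (W t) c \<partial>\<mu>) \<le> Im (cdot c (m w *v c))"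
proof -
  let ?g = "\<lambda>t. 1 / ((complex_of_real t - w) * (complex_of_real t - cnj w)) * cdot c (W t *v c)"
  have gi: "integrable \<mu> ?g" by (rule m_difference(1)[OF w w])
  have gr: "Re (?g t) = 1 / (cmod (complex_of_real t - w))\<^sup>2 * qf (W t) c" for t
  proof -
    have "(complex_of_real t - w) * (complex_of_real t - cnj w) = complex_of_real ((cmod (complex_of_real t - w))\<^sup>2)"
      by (simp add: complex_norm_square del: of_real_power)
    hence "?g t = complex_of_real (1 / (cmod (complex_of_real t - w))\<^sup>2) * cdot c (W t *v c)" by simp
    thus ?thesis by (simp add: qf_def hform_def del: of_real_divide)
  qed
  have ri: "integrable \<mu> (\<lambda>t. 1 / (cmod (complex_of_real t - w))\<^sup>2 * qf (W t) c)"
    using integrable_Re[OF gi] unfolding gr .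
  show "integrable \<mu> (\<lambda>t. Im w / (cmod (complex_of_real t - w))\<^sup>2 * qf (W t) c)"
    using integrable_mult_right[OF ri, of "Im w"] by (simp add: mult.assoc)
  have "cdot (m w *v c) c = cnj (cdot c (m w *v c))" by (simp add: cnj_cdot)
  hence "cdot c (m w *v c) - cnj (cdot c (m w *v c)) = (w - cnj w) * (cdot c (B *v c) + (\<integral>t. ?g t \<partial>\<mu>))"
    using m_difference(2)[OF w w, of c c] by simp
  hence "Im (cdot c (m w *v c) - cnj (cdot c (m w *v c))) = 2 * Im w * Re (cdot c (B *v c) + (\<integral>t. ?g t \<partial>\<mu>))"
    by (simp only: times_complex.sel minus_complex.sel cnj.sel) simp
  hence "Im (cdot c (m w *v c)) = Im w * (qf B c + Re (\<integral>t. ?g t \<partial>\<mu>))"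
    by (simp add: qf_def hform_def)
  also have "Re (\<integral>t. ?g t \<partial>\<mu>) = (\<integral>t. 1 / (cmod (complex_of_real t - w))\<^sup>2 * qf (W t) c \<partial>\<mu>)"
    unfolding gr[symmetric] by (rule integral_Re[OF gi, symmetric])
  finally have e: "Im (cdot c (m w *v c)) = Im w * qf B c + (\<integral>t. Im w / (cmod (complex_of_real t - w))\<^sup>2 * qf (W t) c \<partial>\<mu>)"
    by (simp add: distrib_left mult.assoc Bochner_Integration.integral_mult_right_zero[symmetric]
        del: Bochner_Integration.integral_mult_right_zero)
  show "(\<integral>t. Im w / (cmod (complex_of_real t - w))\<^sup>2 * qf (W t) c \<partial>\<mu>) \<le> Im (cdot c (m w *v c))"
    unfolding e using w qf_nonneg[OF B_psd, of c] by simp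
qed

section \<open>Concentration of the measure on the zeros of P\<close>

lemma norm_W_integrable: "integrable \<mu> (\<lambda>t. indicator {-R<..R} t * norm (W t))"
proof (rule Bochner_Integration.integrable_bound)
  let ?w = "\<lambda>t. \<Sum>i\<in>UNIV. \<Sum>j\<in>UNIV. norm (W t $ i $ j / complex_of_real (1 + t\<^sup>2))"
  show "integrable \<mu> (\<lambda>t. (1 + R\<^sup>2) * ?w t)"
    using \<rho>_fin by (intro integrable_mult_right Bochner_Integration.integrable_sum integrable_norm) auto
  show "(\<lambda>t. indicator {-R<..R} t * norm (W t)) \<in> borel_measurable \<mu>"
    unfolding mu_measurable
    by (intro borel_measurable_times measurable_compose[OF W_meas borel_measurable_continuous_onI] continuous_intros) simp
  show "AE t in \<mu>. norm (indicator {-R<..R} t * norm (W t)) \<le> norm ((1 + R\<^sup>2) * ?w t)"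
  proof (rule AE_I2)
    fix t :: real
    have p: "1 + t\<^sup>2 > 0" by (simp add: add_pos_nonneg)
    have n: "norm (W t $ i $ j / complex_of_real (1 + t\<^sup>2)) = norm (W t $ i $ j) / (1 + t\<^sup>2)" for i j
      using p by (simp only: norm_divide norm_of_real)
    have "?w t = (\<Sum>i\<in>UNIV. \<Sum>j\<in>UNIV. norm (W t $ i $ j)) / (1 + t\<^sup>2)"
      unfolding n by (simp add: sum_divide_distrib)
    hence le: "norm (W t) / (1 + t\<^sup>2) \<le> ?w t"
      using norm_matrix_le_entries[of "W t"] p by (simp add: divide_right_mono)
    have w0: "?w t \<ge> 0" by (intro sum_nonneg) auto
    show "norm (indicator {-R<..R} t * norm (W t)) \<le> norm ((1 + R\<^sup>2) * ?w t)"
    proof (cases "t \<in> {-R<..R}")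
      case True
      hence "t\<^sup>2 \<le> R\<^sup>2" by (auto simp: abs_le_square_iff[symmetric])
      hence "norm (W t) / (1 + t\<^sup>2) * (1 + t\<^sup>2) \<le> ?w t * (1 + R\<^sup>2)"
        using le w0 p by (intro mult_mono) auto
      thus ?thesis using True p w0 by (simp add: mult.commute)
    qed simp
  qed
qed

text \<open>The measure \<open>\<rho>\<close> is concentrated on the zeros of \<open>P\<close>: for \<open>q = e\<^sup>* P W P\<^sup>* e\<close>, the
  integral over an interval of length \<open>y\<close> is \<open>O(y\<^sup>2)\<close>, since \<open>P(z) m(z) P(z)\<^sup>* = - Q(z) P(z)\<^sup>*\<close>
  has imaginary part \<open>O(Im z)\<close>.\<close>
lemma qf_P_interval:
  fixes R :: real and e :: "complex^'n"
  assumes R: "R \<ge> 0"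
  defines "q \<equiv> (\<lambda>t::real. qf (W t) (adjm (P t) *v e))"
  shows "\<exists>C. \<forall>s t. -R \<le> s \<longrightarrow> s < t \<longrightarrow> t \<le> R \<longrightarrow>
     integrable \<mu> (\<lambda>\<tau>. indicator {s<..t} \<tau> * q \<tau>) \<and> (\<integral>\<tau>. indicator {s<..t} \<tau> * q \<tau> \<partial>\<mu>) \<le> C * (t - s)\<^sup>2"
proof -
  \<comment> \<open>For an interval inside \<open>[-R, R]\<close>, the point \<open>z\<close> above
    its left end has height at most \<open>2 * R\<close>, hence modulus at most
    \<open>3 * R\<close>.\<close>
  have R3: "3 * R \<ge> 0" using R by simp
  obtain L where L: "L \<ge> 0" "\<And>z. cmod z \<le> 3 * R \<Longrightarrow> norm (P z) \<le> L"
    "\<And>z w. cmod z \<le> 3 * R \<Longrightarrow> cmod w \<le> 3 * R \<Longrightarrow> norm (P z - P w) \<le> L * cmod (z - w)"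
    "\<And>z. cmod z \<le> 3 * R \<Longrightarrow> norm (Q z) \<le> L"
    "\<And>z w. cmod z \<le> 3 * R \<Longrightarrow> cmod w \<le> 3 * R \<Longrightarrow> norm (Q z - Q w) \<le> L * cmod (z - w)"
    using boundary_matrices_lipschitz[OF R3] by blast
  obtain C1 where C1: "C1 \<ge> 0"
    "\<And>z e. cmod z \<le> 3 * R \<Longrightarrow> \<bar>Im (cdot (adjm (Q z) *v e) (adjm (P z) *v e))\<bar> \<le> C1 * \<bar>Im z\<bar> * (norm e)\<^sup>2"
    using QP_im_bound[OF R3] by blast
  define \<omega> where "\<omega> = (\<integral>t. indicator {-R<..R} t * norm (W t) \<partial>\<mu>)"
  define C where "C = 4 * C1 * (norm e)\<^sup>2 + 4 * L\<^sup>2 * (norm e)\<^sup>2 * \<omega>"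
  have q0: "AE t in \<mu>. q t \<ge> 0" using W_AE_psd by eventually_elim (simp add: q_def qf_nonneg)
  have Pm: "(\<lambda>t::real. adjm (P t)) \<in> borel_measurable borel"
  proof (rule borel_measurable_continuous_onI)
    have "continuous_on UNIV (\<lambda>t::real. P (complex_of_real t))"
      by (rule continuous_on_compose2[of UNIV P UNIV complex_of_real])
        (auto simp: continuous_on_eq_continuous_at P_isCont intro: continuous_on_of_real continuous_on_id)
    thus "continuous_on UNIV (\<lambda>t::real. adjm (P t))"
      by (rule bounded_linear.continuous_on[OF bounded_linear_adjm])
  qed
  have qm: "q \<in> borel_measurable borel"
    unfolding q_def by (intro borel_measurable_qf borel_measurable_mv W_meas Pm) simp
  have "integrable \<mu> (\<lambda>\<tau>. indicator {s<..t} \<tau> * q \<tau>) \<and> (\<integral>\<tau>. indicator {s<..t} \<tau> * q \<tau> \<partial>\<mu>) \<le> C * (t - s)\<^sup>2"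
    if st: "-R \<le> s" "s < t" "t \<le> R" for s t
  proof -
    define y where "y = t - s"
    have y: "y > 0" "y \<le> 2 * R" using st by (auto simp: y_def)
    define z where "z = Complex s y"
    have z: "Im z > 0" "Re z = s" "Im z = y" using y by (auto simp: z_def)
    have zR: "cmod z \<le> 3 * R" using cmod_le[of z] st y by (simp add: z_def abs_if split: if_splits)
    define x where "x = adjm (P z) *v e"
    let ?p = "\<lambda>\<tau>. Im z / (cmod (complex_of_real \<tau> - z))\<^sup>2 * qf (W \<tau>) x"
    \<comment> \<open>Replacing \<open>P \<tau>\<close> by \<open>P z\<close> splits
      \<open>q\<close> into two parts. The first is compared with the Poisson kernel, at least
      \<open>1 / (2 * y)\<close> on the interval; in the second, \<open>\<tau>\<close> and
      \<open>z\<close> are at most \<open>sqrt 2 * y\<close> apart.\<close>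
    let ?b = "\<lambda>\<tau>. 4 * y * ?p \<tau> + 4 * L\<^sup>2 * y\<^sup>2 * (norm e)\<^sup>2 * (indicator {-R<..R} \<tau> * norm (W \<tau>))"
    have bi: "integrable \<mu> ?b"
      by (intro Bochner_Integration.integrable_add integrable_mult_right poisson_estimate(1) norm_W_integrable z)
    have le: "AE \<tau> in \<mu>. indicator {s<..t} \<tau> * q \<tau> \<le> ?b \<tau>"
      using W_AE_psd
    proof eventually_elim
      case (elim \<tau>)
      have pos: "?b \<tau> \<ge> 0"
        using y z qf_nonneg[OF elim, of x] by (intro add_nonneg_nonneg mult_nonneg_nonneg) auto
      show ?case
      proof (cases "\<tau> \<in> {s<..t}")
        case True
        hence \<tau>: "0 < \<tau> - s" "\<tau> - s \<le> y" "\<tau> \<in> {-R<..R}" "\<bar>\<tau>\<bar> \<le> R" using st by (auto simp: y_def)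
        define dd where "dd = (cmod (complex_of_real \<tau> - z))\<^sup>2"
        have dd: "dd = (\<tau> - s)\<^sup>2 + y\<^sup>2" by (simp add: dd_def cmod_power2 z)
        have d2: "dd \<le> 2 * y\<^sup>2" using power_mono[of "\<tau> - s" y 2] \<tau> by (simp add: dd)
        have dp: "dd > 0" using y by (simp add: dd add_nonneg_pos)
        have e1: "adjm (P \<tau>) *v e = x + adjm (P \<tau> - P z) *v e"
          by (simp add: x_def linear_diff[OF bounded_linear.linear[OF bounded_linear_adjm]] mv_simps)
        have "norm (adjm (P \<tau> - P z) *v e) \<le> L * cmod (complex_of_real \<tau> - z) * norm e"
          by (rule order_trans[OF norm_adjm_le mult_right_mono]) (use L(3)[of \<tau> z] zR \<tau> R in auto)
        hence "(norm (adjm (P \<tau> - P z) *v e))\<^sup>2 \<le> (L * cmod (complex_of_real \<tau> - z) * norm e)\<^sup>2"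
          by (intro power_mono) auto
        also have "\<dots> = L\<^sup>2 * (norm e)\<^sup>2 * dd" by (simp add: power_mult_distrib dd_def)
        also have "\<dots> \<le> L\<^sup>2 * (norm e)\<^sup>2 * (2 * y\<^sup>2)" by (intro mult_left_mono d2) simp
        finally have "qf (W \<tau>) (adjm (P \<tau> - P z) *v e) \<le> norm (W \<tau>) * (L\<^sup>2 * (norm e)\<^sup>2 * (2 * y\<^sup>2))"
          using qf_le_norm[of "W \<tau>" "adjm (P \<tau> - P z) *v e"] by (meson mult_left_mono norm_ge_zero order_trans)
        moreover have "q \<tau> \<le> 2 * qf (W \<tau>) x + 2 * qf (W \<tau>) (adjm (P \<tau> - P z) *v e)"
          unfolding q_def e1 by (rule qf_add_le[OF elim])
        moreover have "2 * qf (W \<tau>) x \<le> 4 * y * ?p \<tau>"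
        proof -
          have "1 \<le> 2 * y * (y / dd)" using d2 dp by (simp add: field_simps power2_eq_square)
          hence "1 * qf (W \<tau>) x \<le> 2 * y * (y / dd) * qf (W \<tau>) x"
            by (intro mult_right_mono qf_nonneg[OF elim])
          thus ?thesis by (simp add: z dd_def)
        qed
        ultimately have "q \<tau> \<le> 4 * y * ?p \<tau> + 4 * L\<^sup>2 * y\<^sup>2 * (norm e)\<^sup>2 * norm (W \<tau>)" by (simp add: mult_ac)
        thus ?thesis using True \<tau>(3) by simp
      next
        case False
        thus ?thesis using pos by simp
      qed
    qed
    have qi: "integrable \<mu> (\<lambda>\<tau>. indicator {s<..t} \<tau> * q \<tau>)"
    proof (rule Bochner_Integration.integrable_bound[OF bi])
      show "(\<lambda>\<tau>. indicator {s<..t} \<tau> * q \<tau>) \<in> borel_measurable \<mu>"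
        unfolding mu_measurable by (intro borel_measurable_times qm) simp
      show "AE \<tau> in \<mu>. norm (indicator {s<..t} \<tau> * q \<tau>) \<le> norm (?b \<tau>)"
        using le q0
      proof eventually_elim
        case (elim \<tau>)
        have "0 \<le> indicator {s<..t} \<tau> * q \<tau>" using elim(2) by (simp add: indicator_def)
        thus ?case using elim(1) unfolding real_norm_def by linarith
      qed
    qed
    have "(\<integral>\<tau>. indicator {s<..t} \<tau> * q \<tau> \<partial>\<mu>) \<le> (\<integral>\<tau>. ?b \<tau> \<partial>\<mu>)"
      by (rule integral_mono_AE[OF qi bi le])
    also have "\<dots> = 4 * y * (\<integral>\<tau>. ?p \<tau> \<partial>\<mu>) + 4 * L\<^sup>2 * y\<^sup>2 * (norm e)\<^sup>2 * \<omega>"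
      unfolding \<omega>_def
      by (subst Bochner_Integration.integral_add[OF integrable_mult_right[OF poisson_estimate(1)[OF z(1)]]
            integrable_mult_right[OF norm_W_integrable]])
        (simp only: Bochner_Integration.integral_mult_right_zero)
    also have "\<dots> \<le> 4 * y * (C1 * y * (norm e)\<^sup>2) + 4 * L\<^sup>2 * y\<^sup>2 * (norm e)\<^sup>2 * \<omega>"
    proof (intro add_right_mono mult_left_mono)
      \<comment> \<open>Conjugation by \<open>P z\<close> removes the inverse in \<open>m\<close>
        and leaves a quantity controlled by \<open>QP_im_bound\<close>.\<close>
      have "cdot x (m z *v x) = cdot e (P z *v (m z *v x))" by (simp add: x_def cdot_adjm)
      also have "\<dots> = - cdot (adjm (Q z) *v e) (adjm (P z) *v e)"
        by (simp add: P_m[OF z(1)] cdot_simps x_def cdot_adjm[of e "Q z"])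
      finally have "Im (cdot x (m z *v x)) \<le> \<bar>Im (cdot (adjm (Q z) *v e) (adjm (P z) *v e))\<bar>" by simp
      also have "\<dots> \<le> C1 * y * (norm e)\<^sup>2" using C1(2)[OF zR, of e] z y by simp
      finally show "(\<integral>\<tau>. ?p \<tau> \<partial>\<mu>) \<le> C1 * y * (norm e)\<^sup>2" using poisson_estimate(2)[OF z(1), of x] by linarith
    qed (use y in auto)
    also have "\<dots> = C * (t - s)\<^sup>2" by (simp add: C_def y_def[symmetric] power2_eq_square algebra_simps)
    finally show ?thesis using qi by simp
  qed
  thus ?thesis by blast
qed

lemma W_P_null_vector: "AE t in \<mu>. W t *v (adjm (P (complex_of_real t)) *v e) = 0"
proof -
  define q where "q t = qf (W t) (adjm (P (complex_of_real t)) *v e)" for t :: real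
  have q0: "AE t in \<mu>. q t \<ge> 0" using W_AE_psd by eventually_elim (simp add: q_def qf_nonneg)
  have "AE t in \<mu>. t \<in> {- real N<..real N} \<longrightarrow> q t = 0" for N :: nat
  proof (cases "N = 0")
    case False
    define R where "R = real N"
    have R: "R > 0" using False by (simp add: R_def)
    obtain C where "\<forall>s t. -R \<le> s \<longrightarrow> s < t \<longrightarrow> t \<le> R \<longrightarrow>
       integrable \<mu> (\<lambda>\<tau>. indicator {s<..t} \<tau> * q \<tau>) \<and> (\<integral>\<tau>. indicator {s<..t} \<tau> * q \<tau> \<partial>\<mu>) \<le> C * (t - s)\<^sup>2"
      using qf_P_interval[OF less_imp_le[OF R], of e] unfolding q_def by (elim exE)
    hence C: "\<And>s t. -R \<le> s \<Longrightarrow> s < t \<Longrightarrow> t \<le> R \<Longrightarrow>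
       integrable \<mu> (\<lambda>\<tau>. indicator {s<..t} \<tau> * q \<tau>) \<and> (\<integral>\<tau>. indicator {s<..t} \<tau> * q \<tau> \<partial>\<mu>) \<le> C * (t - s)\<^sup>2"
      by simp
    \<comment> \<open>\<open>qf_P_interval\<close> bounds the increments of this distribution
      function quadratically, so it is constant.\<close>
    define G where "G x = (\<integral>\<tau>. indicator {-R<..x} \<tau> * q \<tau> \<partial>\<mu>)" for x
    have "G R = G (-R)"
    proof (rule quadratic_increment_constant[where f=G and C=C])
      fix s t assume st: "-R \<le> s" "s < t" "t \<le> R"
      have i1: "integrable \<mu> (\<lambda>\<tau>. indicator {s<..t} \<tau> * q \<tau>)" using C[OF st] by simp
      have i0: "integrable \<mu> (\<lambda>\<tau>. indicator {-R<..s} \<tau> * q \<tau>)"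
      proof (cases "s = -R")
        case False
        thus ?thesis using C[of "-R" s] st by simp
      qed simp
      have "(\<lambda>\<tau>. indicator {-R<..t} \<tau> * q \<tau>) = (\<lambda>\<tau>. indicator {-R<..s} \<tau> * q \<tau> + indicator {s<..t} \<tau> * q \<tau>)"
        using st by (auto simp: indicator_def)
      hence "G t = G s + (\<integral>\<tau>. indicator {s<..t} \<tau> * q \<tau> \<partial>\<mu>)"
        unfolding G_def using Bochner_Integration.integral_add[OF i0 i1] by simp
      moreover have "(\<integral>\<tau>. indicator {s<..t} \<tau> * q \<tau> \<partial>\<mu>) \<ge> 0"
        by (rule integral_nonneg_AE) (use q0 in eventually_elim, simp add: indicator_def)
      ultimately show "\<bar>G t - G s\<bar> \<le> C * (t - s)\<^sup>2" using C[OF st] by simp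
    qed (use R in simp)
    hence "(\<integral>\<tau>. indicator {-R<..R} \<tau> * q \<tau> \<partial>\<mu>) = 0" by (simp add: G_def)
    moreover have "AE \<tau> in \<mu>. indicator {-R<..R} \<tau> * q \<tau> \<ge> 0"
      using q0 by eventually_elim (simp add: indicator_def)
    moreover have "integrable \<mu> (\<lambda>\<tau>. indicator {-R<..R} \<tau> * q \<tau>)" using C[of "-R" R] R by simp
    ultimately have "AE \<tau> in \<mu>. indicator {-R<..R} \<tau> * q \<tau> = 0" by (subst (asm) integral_nonneg_eq_0_iff_AE)
    thus ?thesis by eventually_elim (auto simp: R_def[symmetric])
  qed simp
  hence "AE t in \<mu>. \<forall>N::nat. t \<in> {- real N<..real N} \<longrightarrow> q t = 0"
    unfolding AE_all_countable by (rule allI)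
  thus ?thesis using W_AE_psd
  proof eventually_elim
    case (elim t)
    obtain N :: nat where "\<bar>t\<bar> < real N" using reals_Archimedean2 by blast
    hence "t \<in> {- real N<..real N}" by auto
    hence "q t = 0" using elim(1) by blast
    thus ?case unfolding q_def using qf_eq_0_iff[OF elim(2)] by simp
  qed
qed

text \<open>One null set for all \<open>e\<close>: by linearity, finitely many basis vectors
  decide.\<close>

theorem W_P_null: "AE t in \<mu>. \<forall>e. W t *v (adjm (P (complex_of_real t)) *v e) = 0"
proof -
  have "AE t in \<mu>. \<forall>j. W t *v (adjm (P (complex_of_real t)) *v axis j 1) = 0"
    by (rule AE_finite_allI[of UNIV, simplified]) (simp_all add: W_P_null_vector)
  thus ?thesis
  proof eventually_elim
    case (elim t)
    have "norm (W t ** adjm (P (complex_of_real t))) \<le> 0"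
      using norm_matrix_le_columns[of "W t ** adjm (P (complex_of_real t))"] elim
      by (simp add: matrix_vector_mul_assoc)
    thus ?case by (simp add: matrix_vector_mul_assoc)
  qed
qed

end

lemma antilinear_functional_cdot:
  fixes L :: "complex^'m \<Rightarrow> complex"
  assumes add: "\<And>x y. L (x + y) = L x + L y" and scale: "\<And>s x. L (s *s x) = cnj s * L x"
  obtains d where "\<And>c. L c = cdot c d"
proof -
  have L0: "L 0 = 0" using scale[of 0 0] by simp
  have sum: "L (\<Sum>i\<in>I. f i) = (\<Sum>i\<in>I. L (f i))" if "finite I" for I :: "'m set" and f
    using that by induction (simp_all add: add L0)
  have "L c = cdot c (\<chi> i. L (axis i 1))" for c
  proof -
    have "L c = L (\<Sum>i\<in>UNIV. c $ i *s axis i 1)" by (simp only: basis_expansion)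
    also have "\<dots> = (\<Sum>i\<in>UNIV. cnj (c $ i) * L (axis i 1))" by (simp add: sum scale)
    finally show ?thesis by (simp add: cdot_def)
  qed
  thus ?thesis by (rule that)
qed

context weighted_L2
begin

lemma L2_cong_AE:
  assumes f: "f \<in> L2" and g: "g \<in> borel_measurable M" and e: "AE x in M. W x *v g x = W x *v f x"
  shows "g \<in> L2"
proof (rule L2_dominated[OF integrable_qf[OF f] g])
  show "AE x in M. qf (W x) (g x) \<le> qf (W x) (f x)"
    using e W_psd
  proof eventually_elim
    case (elim x)
    have "hform (g x) (W x) (g x) = hform (f x) (W x) (f x)"
      using elim by (simp add: hform_def) (simp add: psd_herm)
    thus ?case by (simp add: qf_def)
  qed
qed

lemma N2_cong_AE:
  assumes "f \<in> L2" "g \<in> L2" "AE x in M. W x *v g x = W x *v f x" shows "N2 g = N2 f"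
  unfolding N2_def by (rule arg_cong[OF ip_cong_AE]) (use assms in auto)

end

context herglotz_problem
begin

section \<open>The isometry on differences of Weyl solutions\<close>

text \<open>Up to terms annihilated by \<open>W\<close>, the transform of the Weyl solution
  \<open>\<psi> w c\<close>.\<close>

definition pole :: "complex \<Rightarrow> complex^'n \<Rightarrow> real \<Rightarrow> complex^'n" where
  "pole w c t = (1 / (complex_of_real t - w)) *s c"

lemma pole_measurable: "pole w c \<in> borel_measurable borel"
  unfolding pole_def by (intro borel_measurable_scale borel_measurable_pole) simp

lemma pole_L2: assumes w: "Im w > 0" shows "pole w c \<in> rho.L2"
  unfolding rho.L2_iff
proof
  show "pole w c \<in> borel_measurable \<mu>" by (simp add: mu_measurable pole_measurable)
  have "integrable \<mu> (\<lambda>t. inverse (Im w) * (Im w / (cmod (complex_of_real t - w))\<^sup>2 * qf (W t) c))"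
    by (intro integrable_mult_right poisson_estimate w)
  moreover have "inverse (Im w) * (Im w / (cmod (complex_of_real t - w))\<^sup>2 * qf (W t) c) = qf (W t) (pole w c t)" for t
    using w by (simp add: pole_def qf_scale norm_divide power_divide)
  ultimately show "integrable \<mu> (\<lambda>t. qf (W t) (pole w c t))" by simp
qed

lemma U_psi_AE: assumes w: "Im w > 0" shows "AE t in \<mu>. W t *v U (\<psi> w c) t = W t *v pole w c t"
proof -
  obtain e where e: "\<And>t. (complex_of_real t - w) *s U (\<psi> w c) t = c + adjm (P t) *v e" using U_psi[OF w] by blast
  show ?thesis using W_P_null
  proof eventually_elim
    case (elim t)
    have n: "complex_of_real t - w \<noteq> 0" using pole_nonzero[of w t] w by simp
    have "(complex_of_real t - w) *s (W t *v U (\<psi> w c) t) = W t *v c"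
      using arg_cong[OF e[of t], of "\<lambda>y. W t *v y"] elim by (simp add: mv_simps)
    hence "W t *v pole w c t = (1 / (complex_of_real t - w)) *s ((complex_of_real t - w) *s (W t *v U (\<psi> w c) t))"
      by (simp only: pole_def matrix_vector_scale)
    also have "\<dots> = W t *v U (\<psi> w c) t"
      unfolding vector_smult_assoc using n by simp
    finally show ?case ..
  qed
qed

lemma U_psi_L2: "Im w > 0 \<Longrightarrow> U (\<psi> w c) \<in> rho.L2"
  by (rule rho.L2_cong_AE[OF pole_L2 _ U_psi_AE]) (simp_all add: mu_measurable U_measurable psi_L2)

lemma ip_psi_rho:
  assumes w: "Im w > 0" and w': "Im w' > 0"
  shows "ip (\<psi> w c) (\<psi> w' c') = cdot c' (B *v c) + rho.ip (U (\<psi> w c)) (U (\<psi> w' c'))"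
proof -
  have "rho.ip (U (\<psi> w c)) (U (\<psi> w' c')) = rho.ip (pole w c) (pole w' c')"
    by (intro rho.ip_cong_AE U_psi_L2 pole_L2 U_psi_AE w w')
  also have "\<dots> = (\<integral>t. 1 / ((complex_of_real t - w) * (complex_of_real t - cnj w')) * cdot c' (W t *v c) \<partial>\<mu>)"
    unfolding ipw_def by (simp add: pole_def hform_simps) (simp add: hform_def mult.commute)
  finally have "(w - cnj w') * ip (\<psi> w c) (\<psi> w' c') = (w - cnj w') * (cdot c' (B *v c) + rho.ip (U (\<psi> w c)) (U (\<psi> w' c')))"
    using ip_psi_psi[OF w w', of c c'] m_difference(2)[OF w w', of c' c] by simp
  moreover have "w - cnj w' \<noteq> 0" using w w' by (auto simp: complex_eq_iff)
  ultimately show ?thesis by simp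
qed

text \<open>A Weyl solution with \<open>c \<noteq> 0\<close> violates the condition at
  \<open>a\<close>; subtracting the one with the same datum at the base point \<open>\<i>\<close>
  restores it. Together with \<open>\<gamma>\<close> this gives a pair in \<open>S\<close>.\<close>

definition \<delta> :: "complex \<Rightarrow> complex^'n \<Rightarrow> real \<Rightarrow> complex^('n + 'n)" where
  "\<delta> w c x = \<psi> w c x - \<psi> \<i> c x"

definition \<gamma> :: "complex \<Rightarrow> complex^'n \<Rightarrow> real \<Rightarrow> complex^('n + 'n)" where
  "\<gamma> w c x = w *s \<psi> w c x - \<i> *s \<psi> \<i> c x"

lemma delta_L2: "\<delta> w c \<in> L2"
  unfolding \<delta>_def[abs_def] by (intro L2_diff psi_L2)

lemma gamma_L2: "\<gamma> w c \<in> L2"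
  unfolding \<gamma>_def[abs_def] by (intro L2_diff L2_scale psi_L2)

lemma delta_S: assumes "Im w > 0" shows "(\<delta> w c, \<gamma> w c) \<in> S"
proof (rule S_I[OF _ gamma_L2])
  show "acsol (\<delta> w c) (\<lambda>x. H x *v \<gamma> w c x)"
    using acsol_diff[OF psi_acsol psi_acsol, of w c \<i> c] by (simp add: \<delta>_def[abs_def] \<gamma>_def mv_simps)
  show "\<alpha> *v \<delta> w c a = 0" by (simp add: \<delta>_def mv_simps psi_a)
  show "\<beta> *v \<delta> w c b = 0" using psi_b[OF assms] psi_b[of \<i>] by (simp add: \<delta>_def mv_simps)
qed

lemma U_delta: "U (\<delta> w c) t = U (\<psi> w c) t - U (\<psi> \<i> c) t"
  unfolding \<delta>_def[abs_def] by (intro U_diff psi_L2)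

lemma U_delta_L2: "Im w > 0 \<Longrightarrow> U (\<delta> w c) \<in> rho.L2"
  using rho.L2_diff[OF U_psi_L2 U_psi_L2[of \<i>]] by (simp add: U_delta[abs_def])

lemma ip_delta_rho:
  assumes w: "Im w > 0" and w': "Im w' > 0"
  shows "rho.ip (U (\<delta> w c)) (U (\<delta> w' c')) = ip (\<delta> w c) (\<delta> w' c')"
proof -
  have i: "Im \<i> > 0" by simp
  note L = U_psi_L2[OF w] U_psi_L2[OF w'] U_psi_L2[OF i]
  have "rho.ip (U (\<delta> w c)) (U (\<delta> w' c')) = rho.ip (U (\<psi> w c)) (U (\<psi> w' c')) - rho.ip (U (\<psi> w c)) (U (\<psi> \<i> c'))
      - (rho.ip (U (\<psi> \<i> c)) (U (\<psi> w' c')) - rho.ip (U (\<psi> \<i> c)) (U (\<psi> \<i> c')))"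
    by (simp add: U_delta[abs_def] rho.ip_diff_left rho.ip_diff_right rho.L2_diff L)
  also have "\<dots> = ip (\<psi> w c) (\<psi> w' c') - ip (\<psi> w c) (\<psi> \<i> c') - (ip (\<psi> \<i> c) (\<psi> w' c') - ip (\<psi> \<i> c) (\<psi> \<i> c'))"
    by (simp add: ip_psi_rho w w')
  also have "\<dots> = ip (\<delta> w c) (\<delta> w' c')"
    by (simp add: \<delta>_def[abs_def] ip_diff_left ip_diff_right L2_diff psi_L2)
  finally show ?thesis .
qed

text \<open>The linear span of the differences; closure under scalars comes from linearity of
  \<open>\<delta>\<close> in \<open>c\<close>.\<close>

inductive_set X0 :: "(real \<Rightarrow> complex^('n + 'n)) set" where
  zero: "(\<lambda>x. 0) \<in> X0"
| step: "f \<in> X0 \<Longrightarrow> Im w > 0 \<Longrightarrow> (\<lambda>x. f x + \<delta> w c x) \<in> X0"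

lemma X0_L2: "f \<in> X0 \<Longrightarrow> f \<in> L2"
  by (induction rule: X0.induct) (auto intro: L2_add delta_L2)

lemma X0_add: "g \<in> X0 \<Longrightarrow> f \<in> X0 \<Longrightarrow> (\<lambda>x. f x + g x) \<in> X0"
proof (induction rule: X0.induct)
  case (step g w c)
  from X0.step[OF step.IH[OF step.prems] step.hyps(2), of c] show ?case by (simp add: add.assoc)
qed simp

lemma X0_scale: "f \<in> X0 \<Longrightarrow> (\<lambda>x. s *s f x) \<in> X0"
proof (induction rule: X0.induct)
  case (step f w c)
  have "s *s \<delta> w c x = \<delta> w (s *s c) x" for x
    by (simp add: \<delta>_def psi_scale vec.scale_right_diff_distrib)
  hence "(\<lambda>x. s *s (f x + \<delta> w c x)) = (\<lambda>x. s *s f x + \<delta> w (s *s c) x)" by (simp add: vec.scale_right_distrib)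
  thus ?case using X0.step[OF step.IH step.hyps(2), of "s *s c"] by simp
qed (simp add: X0.zero)

lemma X0_diff: "f \<in> X0 \<Longrightarrow> g \<in> X0 \<Longrightarrow> (\<lambda>x. f x - g x) \<in> X0"
  using X0_add[OF X0_scale[of g "-1"], of f] by simp

lemma delta_X0: "Im w > 0 \<Longrightarrow> \<delta> w c \<in> X0"
  using X0.step[OF X0.zero, of w c] by simp

lemma X0_domain: "f \<in> X0 \<Longrightarrow> \<exists>g. (f, g) \<in> S"
proof (induction rule: X0.induct)
  case (step f w c)
  thus ?case using S_add[OF _ delta_S] by blast
qed (use zero_in_S in blast)

lemma U_zero: "U (\<lambda>x. 0) t = 0"
  by (rule U_null) (simp_all add: N2_zero)

lemma U_X0_L2: "f \<in> X0 \<Longrightarrow> U f \<in> rho.L2"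
proof (induction rule: X0.induct)
  case zero
  show ?case by (simp add: U_zero[abs_def])
next
  case (step f w c)
  have "U (\<lambda>x. f x + \<delta> w c x) = (\<lambda>t. U f t + U (\<delta> w c) t)"
    by (intro ext U_add X0_L2 step delta_L2)
  thus ?case using rho.L2_add[OF step.IH U_delta_L2[OF step.hyps(2)]] by simp
qed

lemma ip_X0_rho: assumes "f \<in> X0" "g \<in> X0" shows "rho.ip (U f) (U g) = ip f g"
proof -
  have 1: "rho.ip (U (\<delta> w c)) (U g) = ip (\<delta> w c) g" if w: "Im w > 0" for w c
    using assms(2)
  proof (induction rule: X0.induct)
    case zero
    show ?case by (simp add: U_zero[abs_def])
  next
    case (step f w' c')
    have "U (\<lambda>x. f x + \<delta> w' c' x) = (\<lambda>t. U f t + U (\<delta> w' c') t)"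
      by (intro ext U_add X0_L2 step delta_L2)
    thus ?case using step
      by (simp add: rho.ip_add_right ip_add_right U_X0_L2 X0_L2 U_delta_L2 delta_L2 ip_delta_rho w)
  qed
  show ?thesis using assms(1)
  proof (induction rule: X0.induct)
    case zero
    show ?case by (simp add: U_zero[abs_def])
  next
    case (step f w c)
    have "U (\<lambda>x. f x + \<delta> w c x) = (\<lambda>t. U f t + U (\<delta> w c) t)"
      by (intro ext U_add X0_L2 step delta_L2)
    thus ?case using step assms(2)
      by (simp add: rho.ip_add_left ip_add_left U_X0_L2 X0_L2 U_delta_L2 delta_L2 1)
  qed
qed

lemma N2_X0_rho: "f \<in> X0 \<Longrightarrow> rho.N2 (U f) = N2 f"
  by (simp add: rho.N2_def N2_def ip_X0_rho)

lemma N2_X0_diff_rho: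
  assumes "f \<in> X0" "g \<in> X0" shows "rho.N2 (\<lambda>t. U f t - U g t) = N2 (\<lambda>x. f x - g x)"
proof -
  have "U (\<lambda>x. f x - g x) = (\<lambda>t. U f t - U g t)" by (intro ext U_diff X0_L2 assms)
  thus ?thesis using N2_X0_rho[OF X0_diff[OF assms]] by simp
qed

lemma Cauchy_X0_iff:
  assumes "\<And>n. s n \<in> X0" shows "rho.L2_Cauchy (\<lambda>n. U (s n)) \<longleftrightarrow> L2_Cauchy s"
  unfolding rho.L2_Cauchy_def L2_Cauchy_def using assms by (simp add: N2_X0_diff_rho U_X0_L2 X0_L2)

definition X1 :: "(real \<Rightarrow> complex^('n + 'n)) set" where
  "X1 = {h. \<exists>s. (\<forall>n. s n \<in> X0) \<and> L2_lim s h}"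

lemma X1_L2: "h \<in> X1 \<Longrightarrow> h \<in> L2"
  by (auto simp: X1_def L2_lim_def)

text \<open>The isometry makes the transforms Cauchy, and they converge pointwise to the transform
  of the limit, so \<open>L2_lim_fatou\<close> applies.\<close>

lemma U_L2_lim:
  assumes s: "\<And>n. s n \<in> X0" and h: "L2_lim s h" shows "rho.L2_lim (\<lambda>n. U (s n)) (U h)"
proof (rule rho.L2_lim_fatou)
  show "rho.L2_Cauchy (\<lambda>n. U (s n))" using Cauchy_X0_iff[OF s] L2_lim_Cauchy[OF h] by simp
  have "h \<in> L2" using h by (simp add: L2_lim_def)
  thus "U h \<in> borel_measurable \<mu>" by (simp add: mu_measurable U_measurable)
  show "AE x in \<mu>. (\<lambda>n. U (s n) x) \<longlonglongrightarrow> U h x" using U_lim[OF h] by simp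
qed

lemma U_X1_L2: "h \<in> X1 \<Longrightarrow> U h \<in> rho.L2"
  using U_L2_lim by (auto simp: X1_def rho.L2_lim_def)

lemma ip_X1_rho: assumes "f \<in> X1" "g \<in> X1" shows "rho.ip (U f) (U g) = ip f g"
proof -
  \<comment> \<open>Limits are taken in the left argument; the right one is reached by conjugation
    afterwards.\<close>
  have 1: "rho.ip (U h) (U x) = ip h x" if h: "h \<in> X1" and x: "x \<in> X0" for h x
  proof -
    obtain s where s: "\<And>n. s n \<in> X0" "L2_lim s h" using h by (auto simp: X1_def)
    have "(\<lambda>n. rho.ip (U (s n)) (U x)) \<longlonglongrightarrow> rho.ip (U h) (U x)"
      by (rule rho.L2_lim_ip_left[OF U_L2_lim[OF s] U_X0_L2[OF x]])
    moreover have "(\<lambda>n. rho.ip (U (s n)) (U x)) \<longlonglongrightarrow> ip h x"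
      using L2_lim_ip_left[OF s(2) X0_L2[OF x]] by (simp add: ip_X0_rho s(1) x)
    ultimately show ?thesis by (rule LIMSEQ_unique)
  qed
  obtain s where s: "\<And>n. s n \<in> X0" "L2_lim s g" using assms(2) by (auto simp: X1_def)
  have "(\<lambda>n. rho.ip (U (s n)) (U f)) \<longlonglongrightarrow> rho.ip (U g) (U f)"
    by (rule rho.L2_lim_ip_left[OF U_L2_lim[OF s] U_X1_L2[OF assms(1)]])
  moreover have "rho.ip (U (s n)) (U f) = ip (s n) f" for n
  proof -
    have "rho.ip (U (s n)) (U f) = cnj (rho.ip (U f) (U (s n)))"
      by (rule rho.ip_cnj[symmetric]) (intro U_X1_L2 assms U_X0_L2 s)+
    also have "\<dots> = ip (s n) f"
      unfolding 1[OF assms(1) s(1)] by (rule ip_cnj) (intro X1_L2 assms X0_L2 s)+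
    finally show ?thesis .
  qed
  ultimately have "(\<lambda>n. ip (s n) f) \<longlonglongrightarrow> rho.ip (U g) (U f)" by simp
  hence "rho.ip (U g) (U f) = ip g f"
    using LIMSEQ_unique L2_lim_ip_left[OF s(2) X1_L2[OF assms(1)]] by blast
  hence "cnj (rho.ip (U g) (U f)) = cnj (ip g f)" by simp
  thus ?thesis by (simp add: rho.ip_cnj ip_cnj U_X1_L2 X1_L2 assms)
qed

section \<open>The orthogonal complement\<close>

text \<open>The hypothesis says that the functional of \<open>c\<close> which the pair defines on
  Weyl solutions is the same at \<open>w\<close> as at \<open>\<i>\<close>. A vector
  \<open>d\<close> represents it, and \<open>compatible_pair\<close> applies. So
  \<open>(p, q)\<close> lies in \<open>S\<close> up to an error in the multivalued part, which the
  uses below remove by orthogonality.\<close>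

lemma self_adjoint_pair:
  assumes p: "p \<in> L2" and q: "q \<in> L2"
    and pq: "\<And>w c. Im w > 0 \<Longrightarrow> ip q (\<delta> w c) = ip p (\<gamma> w c)"
  obtains k where "(k, q) \<in> S" "(\<lambda>x. 0, \<lambda>x. k x - p x) \<in> S"
proof -
  define L where "L c = ip q (\<psi> \<i> c) - ip p (\<lambda>x. \<i> *s \<psi> \<i> c x)" for c
  have L: "L c = ip q (\<psi> \<i> c) + \<i> * ip p (\<psi> \<i> c)" for c by (simp add: L_def ip_scale_right)
  obtain d where d: "\<And>c. L c = cdot c d"
  proof (rule antilinear_functional_cdot[of L])
    show "L (x + y) = L x + L y" for x y
    proof -
      have "\<psi> \<i> (x + y) = (\<lambda>t. \<psi> \<i> x t + \<psi> \<i> y t)" by (auto simp: psi_add)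
      thus ?thesis by (simp add: L ip_add_right p q psi_L2 algebra_simps)
    qed
    show "L (s *s x) = cnj s * L x" for s x
    proof -
      have "\<psi> \<i> (s *s x) = (\<lambda>t. s *s \<psi> \<i> x t)" by (auto simp: psi_scale)
      thus ?thesis by (simp add: L ip_scale_right algebra_simps)
    qed
  qed blast
  have "ip q (\<psi> w c) - ip p (\<lambda>x. w *s \<psi> w c x) = cdot c d" if "Im w > 0" for w c
  proof -
    have "ip q (\<delta> w c) = ip q (\<psi> w c) - ip q (\<psi> \<i> c)"
      unfolding \<delta>_def[abs_def] by (intro ip_diff_right psi_L2 q)
    moreover have "ip p (\<gamma> w c) = ip p (\<lambda>x. w *s \<psi> w c x) - ip p (\<lambda>x. \<i> *s \<psi> \<i> c x)"
      unfolding \<gamma>_def[abs_def] by (intro ip_diff_right L2_scale psi_L2 p)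
    ultimately show ?thesis using pq[OF that, of c] d[of c] by (simp add: L_def algebra_simps)
  qed
  then obtain k where k: "acsol k (\<lambda>x. H x *v q x)" "k a = - (Jmat *v (adjm \<alpha> *v d))" "\<beta> *v k b = 0"
    "\<And>w c. Im w > 0 \<Longrightarrow> ip (\<lambda>x. k x - p x) (\<psi> w c) = 0"
    using compatible_pair[OF p q] by blast
  show ?thesis
  proof (rule that[of k])
    show "(k, q) \<in> S" by (rule S_I[OF k(1) q]) (simp_all add: k mv_simps)
    show "(\<lambda>x. 0, \<lambda>x. k x - p x) \<in> S"
      by (rule orthogonal_to_psi[OF L2_diff[OF acsol_L2[OF k(1)] p] k(4)])
  qed
qed

lemma S0_orthogonal: assumes "(\<lambda>x. 0, g) \<in> S" "(f, f') \<in> S" shows "ip g f = 0"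
  using S_symmetric[OF assms] by simp

lemma S0_orthogonal_X1: assumes g: "(\<lambda>x. 0, g) \<in> S" and p: "p \<in> X1" shows "ip g p = 0"
proof -
  obtain s where s: "\<And>n. s n \<in> X0" "L2_lim s p" using p by (auto simp: X1_def)
  have gL: "g \<in> L2" using S_L2[OF g] by simp
  have "ip (s n) g = 0" for n
  proof -
    have "ip g (s n) = 0" using X0_domain[OF s(1)] S0_orthogonal[OF g] by blast
    thus ?thesis using ip_cnj[OF gL X0_L2[OF s(1)], of n] by simp
  qed
  hence "(\<lambda>n. 0) \<longlonglongrightarrow> ip p g" using L2_lim_ip_left[OF s(2) gL] by simp
  hence "ip p g = 0" by (simp add: LIMSEQ_const_iff)
  thus ?thesis using ip_cnj[OF X1_L2[OF p] gL] by simp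
qed

text \<open>For \<open>p = 0\<close>, \<open>self_adjoint_pair\<close> gives a \<open>k\<close> in
  the domain that also lies in the multivalued part, hence is orthogonal to itself.\<close>

lemma orthogonal_X0: assumes h: "h \<in> L2" and orth: "\<And>x. x \<in> X0 \<Longrightarrow> ip h x = 0" shows "(\<lambda>x. 0, h) \<in> S"
proof -
  obtain k where k: "(k, h) \<in> S" "(\<lambda>x. 0, \<lambda>x. k x - 0) \<in> S"
    using self_adjoint_pair[OF L2_zero h] orth delta_X0 by auto
  have "ip k k = 0" using S0_orthogonal[OF k(2) k(1)] by simp
  thus ?thesis using S_null[OF k(1) L2_zero _ h] by (simp add: N2_def)
qed

lemma orthogonal_decomposition:
  assumes h: "h \<in> L2" obtains p where "p \<in> X1" "(\<lambda>x. 0, \<lambda>x. h x - p x) \<in> S"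
proof -
  obtain s where s: "\<And>n. s n \<in> X0" "L2_Cauchy s"
    "\<And>p x. L2_lim s p \<Longrightarrow> x \<in> X0 \<Longrightarrow> ip (\<lambda>y. h y - p y) x = 0"
    using minimizing_sequence[of X0 h] X0_L2 X0.zero X0_add X0_scale h by blast
  obtain p where p: "L2_lim s p" using L2_complete[OF s(2)] by blast
  show ?thesis
  proof (rule that[of p])
    show "p \<in> X1" using s(1) p by (auto simp: X1_def)
    hence "p \<in> L2" by (rule X1_L2)
    thus "(\<lambda>x. 0, \<lambda>x. h x - p x) \<in> S" by (intro orthogonal_X0 L2_diff h s(3)[OF p])
  qed
qed

lemma S_U_AE:
  assumes "(f, g) \<in> S" shows "AE t in \<mu>. W t *v U g t = W t *v (complex_of_real t *s U f t)"
proof -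
  obtain e where e: "\<And>t. U g t = complex_of_real t *s U f t - adjm (P t) *v e" using U_S[OF assms] by blast
  show ?thesis using W_P_null by eventually_elim (simp add: e mv_simps)
qed

lemma S0_U_AE: assumes "(\<lambda>x. 0, g) \<in> S" shows "AE t in \<mu>. W t *v U g t = 0"
  using S_U_AE[OF assms] by (simp add: U_zero)

lemma U_decomposition:
  assumes h: "h \<in> L2" and p: "p \<in> X1" "(\<lambda>x. 0, \<lambda>x. h x - p x) \<in> S"
  shows "AE t in \<mu>. W t *v U h t = W t *v U p t"
  using S0_U_AE[OF p(2)] by (simp add: U_diff[OF h X1_L2[OF p(1)]] mv_simps)

lemma U_L2: assumes h: "h \<in> L2" shows "U h \<in> rho.L2"
proof -
  obtain p where p: "p \<in> X1" "(\<lambda>x. 0, \<lambda>x. h x - p x) \<in> S" using orthogonal_decomposition[OF h] by blast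
  show ?thesis
    by (rule rho.L2_cong_AE[OF U_X1_L2[OF p(1)] _ U_decomposition[OF h p]]) (simp add: mu_measurable U_measurable h)
qed

text \<open>The remainder \<open>r\<close> is orthogonal to the domain and to \<open>p\<close>, so
  its squared seminorm is its inner product with \<open>h - f\<close> for every \<open>f\<close> in
  the domain, and \<open>h\<close> is a limit of such \<open>f\<close>.\<close>

lemma domain_component_null:
  assumes h: "h \<in> closD a b H S" and p: "p \<in> X1" "(\<lambda>x. 0, \<lambda>x. h x - p x) \<in> S"
  shows "N2 (\<lambda>x. h x - p x) = 0"
proof (rule ccontr)
  define r where "r = (\<lambda>x. h x - p x)"
  have hL: "h \<in> L2" using h by (simp add: closD_def L2H_eq)
  have pL: "p \<in> L2" by (rule X1_L2[OF p(1)])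
  have rL: "r \<in> L2" unfolding r_def by (intro L2_diff hL pL)
  assume "N2 (\<lambda>x. h x - p x) \<noteq> 0"
  hence rp: "N2 r > 0" using N2_nonneg[OF rL] by (simp add: r_def)
  have "sqrt (N2 r) > 0" using rp by simp
  then obtain f g where fg: "(f, g) \<in> S" "sqrt (N2 (\<lambda>x. h x - f x)) < sqrt (N2 r)"
    using h unfolding closD_def ipH_eq N2_def[symmetric] by blast
  have fL: "f \<in> L2" using S_L2(1)[OF fg(1)] .
  have "ip r r = ip r h - ip r p" unfolding r_def by (intro ip_diff_right hL pL L2_diff)
  also have "\<dots> = ip r (\<lambda>x. h x - f x)"
    using S0_orthogonal[OF p(2) fg(1)] S0_orthogonal_X1[OF p(2,1)]
    by (simp add: ip_diff_right hL fL rL r_def[symmetric])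
  finally have "(cmod (ip r r))\<^sup>2 \<le> N2 r * N2 (\<lambda>x. h x - f x)"
    using ip_cauchy_schwarz[OF rL L2_diff[OF hL fL]] by simp
  hence "N2 r * N2 r \<le> N2 r * N2 (\<lambda>x. h x - f x)"
    by (simp add: N2_eq(1)[OF rL] power2_eq_square)
  hence "N2 r \<le> N2 (\<lambda>x. h x - f x)" using rp by simp
  thus False using fg(2) by simp
qed

lemma X1_closD: "X1 \<subseteq> closD a b H S"
proof
  fix p assume p: "p \<in> X1"
  then obtain s where s: "\<And>n. s n \<in> X0" "L2_lim s p" by (auto simp: X1_def)
  show "p \<in> closD a b H S"
    unfolding closD_def L2H_eq ipH_eq N2_def[symmetric]
  proof (intro CollectI conjI allI impI)
    show "p \<in> L2" by (rule X1_L2[OF p])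
    fix \<epsilon> :: real assume e: "\<epsilon> > 0"
    have "\<forall>\<^sub>F n in sequentially. N2 (\<lambda>x. s n x - p x) < \<epsilon>\<^sup>2"
      using s(2) e unfolding L2_lim_def by (intro order_tendstoD) auto
    then obtain n where "N2 (\<lambda>x. s n x - p x) < \<epsilon>\<^sup>2" by (auto simp: eventually_sequentially)
    hence "N2 (\<lambda>x. p x - s n x) < \<epsilon>\<^sup>2" using N2_diff_commute[of "s n" p] by simp
    hence "sqrt (N2 (\<lambda>x. p x - s n x)) < \<epsilon>" using e by (simp add: real_less_lsqrt)
    thus "\<exists>f g. (f, g) \<in> S \<and> sqrt (N2 (\<lambda>x. p x - f x)) < \<epsilon>" using X0_domain[OF s(1)] by blast
  qed
qed

lemma domain_closD: assumes "(f, g) \<in> S" shows "f \<in> closD a b H S"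
proof -
  have "sqrt (Re (ip (\<lambda>x. f x - f x) (\<lambda>x. f x - f x))) = 0" by simp
  thus ?thesis unfolding closD_def L2H_eq ipH_eq using assms S_L2(1)[OF assms] by force
qed

lemma ip_closD_rho:
  assumes h: "h \<in> closD a b H S" and k: "k \<in> closD a b H S" shows "rho.ip (U h) (U k) = ip h k"
proof -
  have hL: "h \<in> L2" and kL: "k \<in> L2" using h k by (simp_all add: closD_def L2H_eq)
  obtain p where p: "p \<in> X1" "(\<lambda>x. 0, \<lambda>x. h x - p x) \<in> S" using orthogonal_decomposition[OF hL] by blast
  obtain q where q: "q \<in> X1" "(\<lambda>x. 0, \<lambda>x. k x - q x) \<in> S" using orthogonal_decomposition[OF kL] by blast
  note hp = domain_component_null[OF h p] and kq = domain_component_null[OF k q]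
  note pL = X1_L2[OF p(1)] and qL = X1_L2[OF q(1)]
  have "ip h k = ip p q"
    using ip_null_cong_left[OF hL pL kL hp] ip_null_cong_right[OF kL qL pL kq] by simp
  moreover have "rho.ip (U h) (U k) = rho.ip (U p) (U q)"
    by (intro rho.ip_cong_AE U_L2 hL kL pL qL U_decomposition p q)
  ultimately show ?thesis using ip_X1_rho[OF p(1) q(1)] by simp
qed

section \<open>Surjectivity\<close>

lemma eigen_orthogonal:
  fixes s t :: real
  assumes "P s *v c = 0" "P t *v d = 0" "s \<noteq> t"
  shows "ip (\<lambda>x. u x s *v c) (\<lambda>x. u x t *v d) = 0"
proof -
  have "complex_of_real t * ip (\<lambda>x. u x s *v c) (\<lambda>x. u x t *v d) = complex_of_real s * ip (\<lambda>x. u x s *v c) (\<lambda>x. u x t *v d)"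
    using S_symmetric[OF P_eigen_S[OF assms(1)] P_eigen_S[OF assms(2)]] by (simp add: ip_scale_left ip_scale_right)
  thus ?thesis using assms(3) by simp
qed

text \<open>By Bessel's inequality for \<open>\<psi> \<i> d\<close>, whose coefficient along an eigenfunction \<open>u(t) c\<close> is
  \<open>c\<^sup>* d / (t - \<i>)\<close>, there are only countably many eigenvalues.\<close>
lemma eigenvalues_countable: "countable {t :: real. \<exists>c. c \<noteq> 0 \<and> P t *v c = 0}"
proof -
  let ?Z = "{t :: real. \<exists>c. c \<noteq> 0 \<and> P t *v c = 0}"
  have "\<forall>t\<in>?Z. \<exists>c. c \<noteq> 0 \<and> P (complex_of_real t) *v c = 0" by blast
  from bchoice[OF this] obtain c where c: "\<And>t. t \<in> ?Z \<Longrightarrow> c t \<noteq> 0 \<and> P (complex_of_real t) *v c t = 0"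
    by blast
  define e where "e t = (\<lambda>x. u x (complex_of_real t) *v c t)" for t :: real
  have eL: "e t \<in> L2" for t by (simp add: e_def u_L2)
  have epos: "N2 (e t) > 0" if "t \<in> ?Z" for t
    using u_zero[of t "c t"] c[OF that] N2_nonneg[OF eL[of t]] by (fastforce simp: e_def)
  define f where "f j t = (cmod (ip (\<psi> \<i> (axis j 1)) (e t)))\<^sup>2 / N2 (e t)" for j t
  have co: "(complex_of_real t - \<i>) * ip (\<psi> \<i> d) (e t) = cdot (c t) d" if t: "t \<in> ?Z" for t d
  proof -
    obtain y where "\<And>t. (complex_of_real t - \<i>) *s U (\<psi> \<i> d) t = d + adjm (P t) *v y" using U_psi[of \<i> d] by auto
    hence "cdot (c t) ((complex_of_real t - \<i>) *s U (\<psi> \<i> d) t) = cdot (c t) (d + adjm (P t) *v y)" by simp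
    thus ?thesis using c[OF t] by (simp add: cdot_simps U_cdot psi_L2 e_def cdot_adjm left_diff_distrib)
  qed
  have "countable {t \<in> ?Z. f j t \<noteq> 0}" for j
  proof (rule summable_countable_real)
    show "f j summable_on ?Z"
    proof (rule nonneg_bounded_partial_sums_imp_summable_on)
      show "f j t \<ge> 0" if "t \<in> ?Z" for t using epos[OF that] by (simp add: f_def)
      show "\<forall>\<^sub>F T in finite_subsets_at_top ?Z. sum (f j) T \<le> N2 (\<psi> \<i> (axis j 1))"
      proof (rule eventually_finite_subsets_at_top_weakI)
        fix T assume T: "finite T" "T \<subseteq> ?Z"
        show "sum (f j) T \<le> N2 (\<psi> \<i> (axis j 1))"
          unfolding f_def
        proof (rule bessel_inequality[OF T(1) eL psi_L2])
          show "ip (e s) (e t) = 0" if "s \<in> T" "t \<in> T" "s \<noteq> t" for s t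
            unfolding e_def using c[OF subsetD[OF T(2) that(1)]] c[OF subsetD[OF T(2) that(2)]] that(3)
            by (intro eigen_orthogonal) auto
        qed (rule epos[OF subsetD[OF T(2)]])
      qed
    qed
  qed
  hence "countable (\<Union>j. {t \<in> ?Z. f j t \<noteq> 0})" by (intro countable_UN) auto
  moreover have "?Z \<subseteq> (\<Union>j. {t \<in> ?Z. f j t \<noteq> 0})"
  proof
    fix t assume t: "t \<in> ?Z"
    have "\<exists>j. cdot (c t) (axis j 1) \<noteq> 0"
    proof (rule ccontr)
      assume "\<nexists>j. cdot (c t) (axis j 1) \<noteq> 0"
      hence "cdot (axis j 1) (c t) = 0" for j using cnj_cdot[of "c t" "axis j 1"] by simp
      hence "c t = 0" by (simp add: cdot_axis_left vec_eq_iff)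
      thus False using c[OF t] by simp
    qed
    then obtain j where "cdot (c t) (axis j 1) \<noteq> 0" by blast
    hence "ip (\<psi> \<i> (axis j 1)) (e t) \<noteq> 0" using co[OF t, of "axis j 1"] by auto
    hence "f j t \<noteq> 0" using epos[OF t] by (simp add: f_def)
    thus "t \<in> (\<Union>j. {t \<in> ?Z. f j t \<noteq> 0})" using t by blast
  qed
  ultimately show ?thesis using countable_subset by blast
qed

text \<open>Away from the zeros of \<open>P\<close> the adjoint of \<open>P t\<close> is onto, so
  \<open>W_P_null\<close> covers every vector.\<close>

lemma W_regular_point:
  "AE t in \<mu>. t \<notin> {t. \<exists>c. c \<noteq> 0 \<and> P (complex_of_real t) *v c = 0} \<longrightarrow> (\<forall>y. W t *v y = 0)"
  using W_P_null
proof eventually_elim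
  case (elim t)
  show ?case
  proof (intro impI allI)
    fix y assume "t \<notin> {t. \<exists>c. c \<noteq> 0 \<and> P (complex_of_real t) *v c = 0}"
    hence "P t ** matrix_inv (P t) = mat 1" by (intro matrix_inv_right_invertible) blast
    hence "matrix_inv (P t) ** P t = mat 1" by (rule matrix_left_right_inverse1)
    hence "adjm (matrix_inv (P t) ** P t) = mat 1" by simp
    hence "y = adjm (P t) *v (adjm (matrix_inv (P t)) *v y)"
      by (simp add: adjm_mult matrix_vector_mul_assoc)
    thus "W t *v y = 0" using elim by metis
  qed
qed

text \<open>For \<open>w = t0 + \<i> y\<close>, the conjugated kernel of \<open>\<delta> w c\<close>
  is, up to a nonzero constant, \<open>1 / (t + \<i>)\<close> times
  \<open>\<i> y / (t - cnj w)\<close>. The last factor is bounded by 1 and tends to the indicator of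
  \<open>t0\<close> as \<open>y\<close> tends to zero.\<close>

lemma orthogonal_atom:
  fixes t0 :: real
  assumes F: "F \<in> rho.L2" and orth: "\<And>x. x \<in> X0 \<Longrightarrow> rho.ip F (U x) = 0"
  shows "AE t in \<mu>. t = t0 \<longrightarrow> cdot c (W t *v F t) = 0"
proof -
  define \<phi> where "\<phi> t = cdot c (W t *v F t)" for t
  define \<xi> where "\<xi> t = cnj (1 / (complex_of_real t - \<i>)) * \<phi> t" for t
  have i: "Im \<i> > 0" by simp
  have hp: "hform (pole w c t) (W t) (F t) = cnj (1 / (complex_of_real t - w)) * \<phi> t" for w t
    unfolding pole_def hform_simps by (simp add: hform_def \<phi>_def)
  have \<xi>i: "integrable \<mu> \<xi>"
    using rho.integrable_hform[OF F pole_L2[OF i], of c] unfolding hp \<xi>_def[abs_def] .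
  \<comment> \<open>Starting at \<open>1/2\<close> keeps \<open>y n\<close> below 1, so that
    \<open>cnj (w n) + \<i>\<close> is nonzero even for \<open>t0 = 0\<close>.\<close>
  define y where "y n = inverse (real (Suc (Suc n)))" for n
  have y: "y n > 0" "y n < 1" for n by (auto simp: y_def inverse_less_1_iff)
  define w where "w n = Complex t0 (y n)" for n
  have w: "Im (w n) > 0" for n using y by (simp add: w_def)
  define g where "g n t = (\<i> * y n) / (complex_of_real t - cnj (w n))" for n t
  have gb: "cmod (g n t) \<le> 1" for n t
  proof -
    have "\<bar>Im (complex_of_real t - cnj (w n))\<bar> \<le> cmod (complex_of_real t - cnj (w n))" by (rule abs_Im_le_cmod)
    hence "y n \<le> cmod (complex_of_real t - cnj (w n))" using y[of n] by (simp add: w_def)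
    thus ?thesis using y[of n] by (simp add: g_def norm_divide norm_mult divide_le_eq_1)
  qed
  have zero: "(\<integral>t. g n t * \<xi> t \<partial>\<mu>) = 0" for n
  proof -
    have "0 = rho.ip F (U (\<delta> (w n) c))" using orth[OF delta_X0[OF w]] by simp
    also have "\<dots> = rho.ip F (U (\<psi> (w n) c)) - rho.ip F (U (\<psi> \<i> c))"
      unfolding U_delta[abs_def] by (intro rho.ip_diff_right U_psi_L2 w i F)
    also have "\<dots> = rho.ip F (pole (w n) c) - rho.ip F (pole \<i> c)"
      using rho.ip_cong_AE[OF F F U_psi_L2[OF w] pole_L2[OF w] _ U_psi_AE[OF w], of n c]
        rho.ip_cong_AE[OF F F U_psi_L2[OF i] pole_L2[OF i] _ U_psi_AE[OF i], of c] by simp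
    also have "\<dots> = (\<integral>t. hform (pole (w n) c t) (W t) (F t) - hform (pole \<i> c t) (W t) (F t) \<partial>\<mu>)"
      unfolding ipw_def
      by (intro Bochner_Integration.integral_diff[symmetric] rho.integrable_hform F pole_L2 w i)
    also have "\<dots> = (\<integral>t. ((cnj (w n) + \<i>) / (\<i> * y n)) * (g n t * \<xi> t) \<partial>\<mu>)"
    proof (rule Bochner_Integration.integral_cong[OF refl])
      fix t
      have n1: "complex_of_real t - cnj (w n) \<noteq> 0" using pole_nonzero[of "cnj (w n)" t] w[of n] by simp
      have n2: "complex_of_real t + \<i> \<noteq> 0" using pole_nonzero[of "- \<i>" t] by simp
      have "1 / (complex_of_real t - cnj (w n)) - 1 / (complex_of_real t + \<i>) = (cnj (w n) + \<i>) / ((complex_of_real t - cnj (w n)) * (complex_of_real t + \<i>))"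
        using n1 n2 by (simp add: diff_frac_eq)
      also have "\<dots> = ((cnj (w n) + \<i>) / (\<i> * y n)) * (g n t * (1 / (complex_of_real t + \<i>)))"
        using y[of n] by (simp add: g_def)
      finally have "(1 / (complex_of_real t - cnj (w n)) - 1 / (complex_of_real t + \<i>)) * \<phi> t
          = ((cnj (w n) + \<i>) / (\<i> * y n)) * (g n t * (1 / (complex_of_real t + \<i>))) * \<phi> t" by simp
      thus "hform (pole (w n) c t) (W t) (F t) - hform (pole \<i> c t) (W t) (F t) = ((cnj (w n) + \<i>) / (\<i> * y n)) * (g n t * \<xi> t)"
        by (simp only: hp \<xi>_def complex_cnj_divide complex_cnj_diff complex_cnj_complex_of_real complex_cnj_i
            complex_cnj_one diff_minus_eq_add left_diff_distrib mult.assoc)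
    qed
    also have "\<dots> = ((cnj (w n) + \<i>) / (\<i> * y n)) * (\<integral>t. g n t * \<xi> t \<partial>\<mu>)"
      by (rule Bochner_Integration.integral_mult_right_zero)
    finally have "((cnj (w n) + \<i>) / (\<i> * y n)) * (\<integral>t. g n t * \<xi> t \<partial>\<mu>) = 0" by simp
    moreover have "cnj (w n) + \<i> \<noteq> 0" using y[of n] by (auto simp: w_def complex_eq_iff)
    ultimately show ?thesis using y[of n] by simp
  qed
  have gm: "g n \<in> borel_measurable borel" for n
    unfolding g_def by (intro borel_measurable_divide borel_measurable_diff borel_measurable_complex_of_real) auto
  have \<xi>m: "\<xi> \<in> borel_measurable \<mu>" using \<xi>i by (rule borel_measurable_integrable)
  have indm: "(\<lambda>t. indicator {t0} t * \<xi> t) \<in> borel_measurable \<mu>"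
    by (intro borel_measurable_times \<xi>m) (simp add: mu_measurable)
  have "(\<lambda>n. \<integral>t. g n t * \<xi> t \<partial>\<mu>) \<longlonglongrightarrow> (\<integral>t. indicator {t0} t * \<xi> t \<partial>\<mu>)"
  proof (rule integral_dominated_convergence[OF indm _ integrable_norm[OF \<xi>i]])
    show "(\<lambda>t. g n t * \<xi> t) \<in> borel_measurable \<mu>" for n
      by (intro borel_measurable_times \<xi>m) (simp add: mu_measurable gm)
    show "AE t in \<mu>. norm (g n t * \<xi> t) \<le> norm (\<xi> t)" for n
    proof (rule AE_I2)
      fix t show "norm (g n t * \<xi> t) \<le> norm (\<xi> t)"
        unfolding norm_mult using mult_right_mono[OF gb[of n t] norm_ge_zero[of "\<xi> t"]] by simp
    qed
    show "AE t in \<mu>. (\<lambda>n. g n t * \<xi> t) \<longlonglongrightarrow> indicator {t0} t * \<xi> t"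
    proof (rule AE_I2)
      fix t
      have y0: "y \<longlonglongrightarrow> 0" unfolding y_def[abs_def] by (rule LIMSEQ_Suc[OF LIMSEQ_inverse_real_of_nat])
      have wl: "complex_of_real t - cnj (w n) = complex_of_real (t - t0) + \<i> * complex_of_real (y n)" for n
        by (simp add: w_def complex_eq_iff)
      have "(\<lambda>n. g n t) \<longlonglongrightarrow> indicator {t0} t"
      proof (cases "t = t0")
        case True
        have "g n t = 1" for n using y[of n] unfolding g_def wl by (simp add: True)
        thus ?thesis using True by simp
      next
        case False
        have "(\<lambda>n. (\<i> * complex_of_real (y n)) / (complex_of_real (t - t0) + \<i> * complex_of_real (y n)))
            \<longlonglongrightarrow> (\<i> * complex_of_real 0) / (complex_of_real (t - t0) + \<i> * complex_of_real 0)"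
          using False by (intro tendsto_intros y0) simp
        thus ?thesis unfolding g_def wl using False by simp
      qed
      thus "(\<lambda>n. g n t * \<xi> t) \<longlonglongrightarrow> indicator {t0} t * \<xi> t" by (intro tendsto_intros)
    qed
  qed
  hence z: "(\<integral>t. indicator {t0} t * \<xi> t \<partial>\<mu>) = 0" by (simp add: zero LIMSEQ_const_iff)
  have indi: "integrable \<mu> (\<lambda>t. indicator {t0} t * \<xi> t)"
    by (rule Bochner_Integration.integrable_bound[OF \<xi>i indm]) (auto simp: indicator_def)
  \<comment> \<open>Multiplication by \<open>cnj (\<xi> t0)\<close> turns the vanishing integral
    into that of a nonnegative function, which is then zero almost everywhere.\<close>
  have e: "cnj (\<xi> t0) * (indicator {t0} t * \<xi> t) = complex_of_real (indicator {t0} t * (cmod (\<xi> t0))\<^sup>2)" for t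
    unfolding of_real_mult complex_norm_square by (simp add: indicator_def)
  have ri: "integrable \<mu> (\<lambda>t. indicator {t0} t * (cmod (\<xi> t0))\<^sup>2)"
    using integrable_Re[OF integrable_mult_right[OF indi, of "cnj (\<xi> t0)"]] unfolding e by simp
  have "complex_of_real (\<integral>t. indicator {t0} t * (cmod (\<xi> t0))\<^sup>2 \<partial>\<mu>) = (\<integral>t. cnj (\<xi> t0) * (indicator {t0} t * \<xi> t) \<partial>\<mu>)"
    unfolding e by (rule integral_complex_of_real[symmetric])
  also have "\<dots> = 0" using z by (simp only: Bochner_Integration.integral_mult_right_zero mult_zero_right)
  finally have "(\<integral>t. indicator {t0} t * (cmod (\<xi> t0))\<^sup>2 \<partial>\<mu>) = 0" by (simp only: of_real_eq_0_iff)
  hence "AE t in \<mu>. indicator {t0} t * (cmod (\<xi> t0))\<^sup>2 = 0"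
    by (subst (asm) integral_nonneg_eq_0_iff_AE[OF ri]) auto
  thus ?thesis
  proof eventually_elim
    case (elim t)
    have "complex_of_real t0 - \<i> \<noteq> 0" "complex_of_real t0 + \<i> \<noteq> 0"
      using pole_nonzero[of \<i> t0] pole_nonzero[of "- \<i>" t0] by simp_all
    thus ?case using elim by (auto simp: \<xi>_def \<phi>_def)
  qed
qed

text \<open>\<open>orthogonal_atom\<close> treats each of the countably many zeros of
  \<open>P\<close>; elsewhere \<open>W\<close> vanishes.\<close>

lemma orthogonal_range:
  assumes F: "F \<in> rho.L2" and orth: "\<And>x. x \<in> X0 \<Longrightarrow> rho.ip F (U x) = 0"
  shows "AE t in \<mu>. W t *v F t = 0"
proof -
  let ?Z = "{t :: real. \<exists>c. c \<noteq> 0 \<and> P t *v c = 0}"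
  have "AE t in \<mu>. t = t0 \<longrightarrow> W t *v F t = 0" for t0
  proof -
    have "AE t in \<mu>. \<forall>j. t = t0 \<longrightarrow> cdot (axis j 1) (W t *v F t) = 0"
      by (rule AE_finite_allI[of UNIV, simplified]) (simp, rule orthogonal_atom[OF F orth])
    thus ?thesis by eventually_elim (simp add: cdot_axis_left vec_eq_iff)
  qed
  hence "AE t in \<mu>. \<forall>t0\<in>?Z. t = t0 \<longrightarrow> W t *v F t = 0"
    by (subst AE_ball_countable[OF eigenvalues_countable]) blast
  thus ?thesis using W_regular_point by eventually_elim blast
qed

text \<open>A minimizing sequence of transforms for \<open>F\<close> is Cauchy; by the isometry so
  are the preimages, and the transform of their limit is the projection of \<open>F\<close>. The
  residual is orthogonal to the range, hence null.\<close>

lemma U_surjective: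
  assumes F: "F \<in> rho.L2" obtains p where "p \<in> X1" "AE t in \<mu>. W t *v U p t = W t *v F t"
proof -
  have sub: "U ` X0 \<subseteq> rho.L2" using U_X0_L2 by auto
  obtain \<sigma> where \<sigma>: "\<And>n. \<sigma> n \<in> U ` X0" "rho.L2_Cauchy \<sigma>"
    "\<And>p x. rho.L2_lim \<sigma> p \<Longrightarrow> x \<in> U ` X0 \<Longrightarrow> rho.ip (\<lambda>y. F y - p y) x = 0"
  proof (rule rho.minimizing_sequence[OF sub _ _ _ F])
    have "(\<lambda>t. 0) = U (\<lambda>x. 0)" by (simp add: U_zero[abs_def])
    thus "(\<lambda>t. 0) \<in> U ` X0" using X0.zero by blast
  next
    fix f g assume "f \<in> U ` X0" "g \<in> U ` X0"
    then obtain f' g' where fg: "f = U f'" "g = U g'" "f' \<in> X0" "g' \<in> X0" by blast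
    hence "(\<lambda>t. f t + g t) = U (\<lambda>x. f' x + g' x)" by (intro ext) (simp add: U_add X0_L2)
    thus "(\<lambda>t. f t + g t) \<in> U ` X0" using X0_add[OF fg(4,3)] by blast
  next
    fix s f assume "f \<in> U ` X0"
    then obtain f' where f: "f = U f'" "f' \<in> X0" by blast
    hence "(\<lambda>t. s *s f t) = U (\<lambda>x. s *s f' x)" by (intro ext) (simp add: U_scale X0_L2)
    thus "(\<lambda>t. s *s f t) \<in> U ` X0" using X0_scale[OF f(2)] by blast
  qed blast
  have "\<forall>n. \<exists>f. f \<in> X0 \<and> \<sigma> n = U f" using \<sigma>(1) by blast
  then obtain s where s: "\<And>n. s n \<in> X0" "\<And>n. \<sigma> n = U (s n)" by metis
  have \<sigma>s: "\<sigma> = (\<lambda>n. U (s n))" by (rule ext) (rule s(2))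
  have "L2_Cauchy s" using Cauchy_X0_iff[of s, OF s(1)] \<sigma>(2)[unfolded \<sigma>s] by (rule iffD1)
  then obtain p where p: "L2_lim s p" using L2_complete by blast
  have pX: "p \<in> X1" using s(1) p by (auto simp: X1_def)
  have lim: "rho.L2_lim \<sigma> (U p)" unfolding \<sigma>s by (rule U_L2_lim[OF s(1) p])
  have "AE t in \<mu>. W t *v (F t - U p t) = 0"
    by (rule orthogonal_range[OF rho.L2_diff[OF F U_X1_L2[OF pX]]]) (use \<sigma>(3)[OF lim] in blast)
  hence "AE t in \<mu>. W t *v U p t = W t *v F t" by eventually_elim (simp add: mv_simps)
  thus ?thesis by (rule that[OF pX])
qed

end

context herglotz_problem
begin

section \<open>The spectral representation\<close>

text \<open>This identifies \<open>p\<close> as the adjoint transform of \<open>F\<close>. Splitting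
  \<open>k\<close> discards its component in the multivalued part, which \<open>U\<close>
  annihilates and to which \<open>p\<close> is orthogonal.\<close>

lemma adjoint_ip:
  assumes p: "p \<in> X1" and F: "F \<in> rho.L2" and pF: "AE t in \<mu>. W t *v U p t = W t *v F t" and k: "k \<in> L2"
  shows "rho.ip F (U k) = ip p k"
proof -
  obtain q where q: "q \<in> X1" "(\<lambda>x. 0, \<lambda>x. k x - q x) \<in> S" using orthogonal_decomposition[OF k] by blast
  have qL: "q \<in> L2" and pL: "p \<in> L2" by (auto intro: X1_L2 q p)
  have "rho.ip F (U k) = rho.ip (U p) (U q)"
    using pF U_decomposition[OF k q] by (intro rho.ip_cong_AE F U_L2 k qL pL) auto
  also have "\<dots> = ip p q" by (rule ip_X1_rho[OF p q(1)])
  also have "\<dots> = ip p k"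
  proof -
    have "ip (\<lambda>x. k x - q x) p = 0" by (rule S0_orthogonal_X1[OF q(2) p])
    hence "ip p (\<lambda>x. k x - q x) = 0" using ip_cnj[OF L2_diff[OF k qL] pL] by simp
    thus ?thesis by (simp add: ip_diff_right k qL pL)
  qed
  finally show ?thesis .
qed

lemma adjrel_iff: "adjrel a b H \<mu> W U F h \<longleftrightarrow> h \<in> L2 \<and> (\<forall>k\<in>L2. ip h k = rho.ip F (U k))"
  by (simp add: adjrel_def L2H_eq ipH_eq ipR_eq)

text \<open>Testing against \<open>h - p\<close> shows that the adjoint transform is unique up to
  null functions, so it is the preimage given by surjectivity.\<close>

lemma adjrel_transform:
  assumes F: "F \<in> rho.L2" and h: "adjrel a b H \<mu> W U F h"
  shows "AE t in \<mu>. W t *v U h t = W t *v F t"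
proof -
  obtain p where p: "p \<in> X1" "AE t in \<mu>. W t *v U p t = W t *v F t" using U_surjective[OF F] by blast
  have pL: "p \<in> L2" by (rule X1_L2[OF p(1)])
  have hL: "h \<in> L2" and hk: "\<And>k. k \<in> L2 \<Longrightarrow> ip h k = ip p k"
    using h adjoint_ip[OF p(1) F p(2)] by (auto simp: adjrel_iff)
  have "ip (\<lambda>x. h x - p x) (\<lambda>x. h x - p x) = 0"
    using hk[OF L2_diff[OF hL pL]] by (simp add: ip_diff_left hL pL L2_diff)
  hence "U (\<lambda>x. h x - p x) t = 0" for t by (intro U_null L2_diff hL pL) (simp add: N2_def)
  thus ?thesis using p(2) by (simp add: U_diff hL pL)
qed

text \<open>Moving multiplication by \<open>t\<close> across the inner product turns
  \<open>ip p (\<gamma> w c)\<close> into \<open>ip q (\<delta> w c)\<close>. The error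
  \<open>k - p\<close> from \<open>self_adjoint_pair\<close> is in the multivalued part and
  orthogonal to both \<open>k\<close> and \<open>p\<close>.\<close>

lemma transform_multiplication:
  assumes F: "F \<in> rho.L2" and G: "G \<in> rho.L2"
    and p: "p \<in> X1" "AE t in \<mu>. W t *v U p t = W t *v F t"
    and q: "q \<in> X1" "AE t in \<mu>. W t *v U q t = W t *v G t"
    and FG: "AE t in \<mu>. W t *v G t = W t *v (complex_of_real t *s F t)"
  shows "(p, q) \<in> S"
proof -
  have pL: "p \<in> L2" and qL: "q \<in> L2" by (auto intro: X1_L2 p q)
  have "ip q (\<delta> w c) = ip p (\<gamma> w c)" if w: "Im w > 0" for w c
  proof -
    have "ip p (\<gamma> w c) = rho.ip F (U (\<gamma> w c))" by (rule adjoint_ip[OF p(1) F p(2) gamma_L2, symmetric])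
    also have "\<dots> = rho.ip G (U (\<delta> w c))"
      unfolding ipw_def
    proof (rule integral_cong_AE)
      show "AE t in \<mu>. hform (U (\<gamma> w c) t) (W t) (F t) = hform (U (\<delta> w c) t) (W t) (G t)"
        using S_U_AE[OF delta_S[OF w, of c]] FG W_AE_psd
      proof eventually_elim
        case (elim t)
        have "hform (U (\<gamma> w c) t) (W t) (F t) = cdot (W t *v U (\<gamma> w c) t) (F t)"
          by (simp add: hform_def psd_herm[OF elim(3)])
        also have "\<dots> = complex_of_real t * cdot (U (\<delta> w c) t) (W t *v F t)"
          by (simp add: elim(1) mv_simps cdot_simps psd_herm[OF elim(3)])
        also have "\<dots> = hform (U (\<delta> w c) t) (W t) (G t)"
          by (simp add: hform_def elim(2) mv_simps cdot_simps)
        finally show ?case .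
      qed
    qed (intro borel_measurable_hform rho.W_measurable rho.L2_measurable U_L2 gamma_L2 delta_L2 F G)+
    also have "\<dots> = ip q (\<delta> w c)" by (rule adjoint_ip[OF q(1) G q(2) delta_L2])
    finally show ?thesis ..
  qed
  then obtain k where k: "(k, q) \<in> S" "(\<lambda>x. 0, \<lambda>x. k x - p x) \<in> S" using self_adjoint_pair[OF pL qL] by blast
  have kL: "k \<in> L2" using S_L2(1)[OF k(1)] .
  have "ip (\<lambda>x. k x - p x) (\<lambda>x. k x - p x) = ip (\<lambda>x. k x - p x) k - ip (\<lambda>x. k x - p x) p"
    by (intro ip_diff_right kL pL L2_diff)
  also have "\<dots> = 0" using S0_orthogonal[OF k(2,1)] S0_orthogonal_X1[OF k(2) p(1)] by simp
  finally have "N2 (\<lambda>x. k x - p x) = 0" by (simp add: N2_def)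
  thus ?thesis by (rule S_null[OF k(1) pL _ qL]) (simp add: N2_zero)
qed

theorem spectral_representation: "spectral_rep a b H S \<mu> W U"
  unfolding spectral_rep_def
proof (intro conjI ballI allI impI)
  show "U h \<in> L2rho \<mu> W" if "h \<in> L2H a b H" for h
    using U_L2 that by (simp add: L2H_eq L2rho_eq)
next
  fix h h' assume h: "h \<in> L2H a b H" "h' \<in> L2H a b H" "nullH a b H (\<lambda>x. h x - h' x)"
  hence L: "h \<in> L2" "h' \<in> L2" by (simp_all add: L2H_eq)
  have "U (\<lambda>x. h x - h' x) t = 0" for t using h(3) by (intro U_null) (auto simp: nullH_iff)
  thus "eqR \<mu> W (U h) (U h')" using L by (simp add: eqR_AE U_measurable U_diff)
next
  fix h k c assume "h \<in> L2H a b H" "k \<in> L2H a b H"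
  hence L: "h \<in> L2" "k \<in> L2" by (simp_all add: L2H_eq)
  have m: "U (\<lambda>x. c *s h x + k x) \<in> borel_measurable borel" by (intro U_measurable L2_add L2_scale L)
  have e: "U (\<lambda>x. c *s h x + k x) = (\<lambda>t. c *s U h t + U k t)" by (intro ext U_linear L)
  show "eqR \<mu> W (U (\<lambda>x. c *s h x + k x)) (\<lambda>t. c *s U h t + U k t)"
    using m unfolding e by (simp add: eqR_AE)
next
  show "ipR \<mu> W (U h) (U h) = ipH a b H h h" if "h \<in> closD a b H S" for h
    unfolding ipR_eq ipH_eq by (rule ip_closD_rho[OF that that])
next
  fix F assume "F \<in> L2rho \<mu> W"
  hence F: "F \<in> rho.L2" by (simp add: L2rho_eq)
  obtain p where p: "p \<in> X1" "AE t in \<mu>. W t *v U p t = W t *v F t" using U_surjective[OF F] by blast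
  have "F \<in> borel_measurable borel" using rho.L2_measurable[OF F] by (simp add: mu_measurable)
  hence "eqR \<mu> W (U p) F" using p by (simp add: eqR_AE U_measurable X1_L2)
  thus "\<exists>h\<in>closD a b H S. eqR \<mu> W (U h) F" using p(1) X1_closD by blast
next
  fix h assume "h \<in> L2H a b H"
  hence h: "h \<in> L2" by (simp add: L2H_eq)
  show "nullR \<mu> W (U h) \<longleftrightarrow> (\<lambda>x. 0, h) \<in> S"
  proof
    assume n: "nullR \<mu> W (U h)"
    obtain p where p: "p \<in> X1" "(\<lambda>x. 0, \<lambda>x. h x - p x) \<in> S" using orthogonal_decomposition[OF h] by blast
    have pL: "p \<in> L2" by (rule X1_L2[OF p(1)])
    \<comment> \<open>The isometry gives the component \<open>p\<close> the norm of
      \<open>U h\<close>, so it vanishes and only the component in the multivalued part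
      remains.\<close>
    have "N2 p = rho.N2 (U p)" using ip_X1_rho[OF p(1) p(1)] by (simp add: N2_def rho.N2_def)
    also have "\<dots> = rho.N2 (U h)"
      using U_decomposition[OF h p] by (intro rho.N2_cong_AE U_L2 h pL) (auto simp: eq_commute)
    also have "\<dots> = 0" using n by (simp add: nullR_iff)
    finally have "N2 p = 0" .
    hence "N2 (\<lambda>x. (h x - p x) - h x) = 0" using N2_scale[of "-1" p] by simp
    thus "(\<lambda>x. 0, h) \<in> S" by (intro S_null[OF p(2) L2_zero _ h]) (simp_all add: N2_zero)
  next
    assume "(\<lambda>x. 0, h) \<in> S"
    thus "nullR \<mu> W (U h)" using S0_U_AE by (simp add: nullR_AE U_measurable h)
  qed
next
  fix F G assume "F \<in> L2rho \<mu> W" "G \<in> L2rho \<mu> W"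
  hence F: "F \<in> rho.L2" and G: "G \<in> rho.L2" by (simp_all add: L2rho_eq)
  have Fm: "F \<in> borel_measurable borel" and Gm: "G \<in> borel_measurable borel"
    using rho.L2_measurable[OF F] rho.L2_measurable[OF G] by (simp_all add: mu_measurable)
  have tFm: "(\<lambda>t. complex_of_real t *s F t) \<in> borel_measurable borel"
    by (intro borel_measurable_scale borel_measurable_complex_of_real Fm) simp
  show "(\<exists>h g. adjrel a b H \<mu> W U F h \<and> (h, g) \<in> S \<and> eqR \<mu> W (U g) G)
        \<longleftrightarrow> eqR \<mu> W G (\<lambda>t. complex_of_real t *s F t)"
  proof
    assume "\<exists>h g. adjrel a b H \<mu> W U F h \<and> (h, g) \<in> S \<and> eqR \<mu> W (U g) G"
    then obtain h g where hg: "adjrel a b H \<mu> W U F h" "(h, g) \<in> S" "eqR \<mu> W (U g) G" by blast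
    have "AE t in \<mu>. W t *v U g t = W t *v G t"
      using hg(3) S_L2(2)[OF hg(2)] by (simp add: eqR_AE U_measurable Gm)
    hence "AE t in \<mu>. W t *v G t = W t *v (complex_of_real t *s F t)"
      using S_U_AE[OF hg(2)] adjrel_transform[OF F hg(1)]
      by eventually_elim (simp add: mv_simps)
    thus "eqR \<mu> W G (\<lambda>t. complex_of_real t *s F t)" by (simp add: eqR_AE Gm tFm)
  next
    assume "eqR \<mu> W G (\<lambda>t. complex_of_real t *s F t)"
    hence FG: "AE t in \<mu>. W t *v G t = W t *v (complex_of_real t *s F t)" by (simp add: eqR_AE Gm tFm)
    obtain p where p: "p \<in> X1" "AE t in \<mu>. W t *v U p t = W t *v F t" using U_surjective[OF F] by blast
    obtain q where q: "q \<in> X1" "AE t in \<mu>. W t *v U q t = W t *v G t" using U_surjective[OF G] by blast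
    have "adjrel a b H \<mu> W U F p" using adjoint_ip[OF p(1) F p(2)] X1_L2[OF p(1)] by (simp add: adjrel_iff)
    moreover have "(p, q) \<in> S" by (rule transform_multiplication[OF F G p q FG])
    moreover have "eqR \<mu> W (U q) G" using q X1_L2[OF q(1)] by (simp add: eqR_AE U_measurable Gm)
    ultimately show "\<exists>h g. adjrel a b H \<mu> W U F h \<and> (h, g) \<in> S \<and> eqR \<mu> W (U g) G" by blast
  qed
qed

section \<open>Point masses\<close>

lemma rho_mat_form:
  "cdot x (rho_mat \<mu> W {t} *v y) = (\<integral>\<tau>. indicator {t} \<tau> * cdot x (W \<tau> *v y) \<partial>\<mu>)"
proof -
  have "cmod (indicator {t} \<tau>) * (1 + \<tau>\<^sup>2) \<le> 1 + t\<^sup>2" for \<tau> by (auto simp: indicator_def)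
  hence i: "integrable \<mu> (\<lambda>\<tau>. indicator {t} \<tau> * W \<tau> $ i $ j)" for i j
    by (intro rho_integrable) auto
  have "rho_mat \<mu> W {t} = (\<chi> i j. \<integral>\<tau>. indicator {t} \<tau> * W \<tau> $ i $ j \<partial>\<mu>)"
    by (simp add: rho_mat_def set_lebesgue_integral_def scaleR_conv_of_real) (simp add: indicator_def of_bool_def if_distrib cong: if_cong)
  thus ?thesis using rho_integral_form(2)[OF i] by simp
qed

lemma rho_mat_hermitian: "cdot x (rho_mat \<mu> W {t} *v y) = cdot (rho_mat \<mu> W {t} *v x) y"
proof -
  have m: "(\<lambda>\<tau>. indicator {t} \<tau> * cdot x (W \<tau> *v y)) \<in> borel_measurable \<mu>" for x y
    unfolding mu_measurable
    by (intro borel_measurable_times borel_measurable_bilinear[OF bounded_bilinear_cdot] borel_measurable_mv W_meas) auto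
  have "cdot (rho_mat \<mu> W {t} *v x) y = cnj (\<integral>\<tau>. indicator {t} \<tau> * cdot y (W \<tau> *v x) \<partial>\<mu>)"
    by (simp add: rho_mat_form[symmetric] cnj_cdot)
  also have "\<dots> = (\<integral>\<tau>. cnj (indicator {t} \<tau> * cdot y (W \<tau> *v x)) \<partial>\<mu>)"
    by (rule Bochner_Integration.integral_cnj[symmetric])
  also have "\<dots> = (\<integral>\<tau>. indicator {t} \<tau> * cdot x (W \<tau> *v y) \<partial>\<mu>)"
  proof (rule integral_cong_AE)
    show "AE \<tau> in \<mu>. cnj (indicator {t} \<tau> * cdot y (W \<tau> *v x)) = indicator {t} \<tau> * cdot x (W \<tau> *v y)"
      using W_AE_psd by eventually_elim (simp add: indicator_def cnj_cdot psd_herm)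
    show "(\<lambda>\<tau>. cnj (indicator {t} \<tau> * cdot y (W \<tau> *v x))) \<in> borel_measurable \<mu>"
      by (rule measurable_compose[OF m borel_measurable_continuous_onI]) (intro continuous_intros)
  qed (rule m)
  also have "\<dots> = cdot x (rho_mat \<mu> W {t} *v y)" by (rule rho_mat_form[symmetric])
  finally show ?thesis ..
qed

text \<open>The adjoint form of \<open>W_P_null\<close> at a point: the range of the point mass
  consists of coefficient vectors of eigenfunctions.\<close>

lemma P_rho_mat: "P (complex_of_real t) *v (rho_mat \<mu> W {t} *v d) = 0"
proof (subst cdot_eq_zero_iff[symmetric], rule allI)
  fix x
  have "cdot x (P (complex_of_real t) *v (rho_mat \<mu> W {t} *v d)) = cdot (adjm (P (complex_of_real t)) *v x) (rho_mat \<mu> W {t} *v d)"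
    by (rule cdot_adjm)
  also have "\<dots> = (\<integral>\<tau>. indicator {t} \<tau> * cdot (adjm (P (complex_of_real t)) *v x) (W \<tau> *v d) \<partial>\<mu>)"
    by (rule rho_mat_form)
  also have "\<dots> = (\<integral>\<tau>. 0 \<partial>\<mu>)"
  proof (rule integral_cong_AE)
    show "AE \<tau> in \<mu>. indicator {t} \<tau> * cdot (adjm (P (complex_of_real t)) *v x) (W \<tau> *v d) = 0"
      using W_P_null W_AE_psd by eventually_elim (auto simp: indicator_def psd_herm)
    show "(\<lambda>\<tau>. indicator {t} \<tau> * cdot (adjm (P (complex_of_real t)) *v x) (W \<tau> *v d)) \<in> borel_measurable \<mu>"
      unfolding mu_measurable
      by (intro borel_measurable_times borel_measurable_bilinear[OF bounded_bilinear_cdot] borel_measurable_mv W_meas) auto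
  qed simp
  finally show "cdot x (P (complex_of_real t) *v (rho_mat \<mu> W {t} *v d)) = 0" by simp
qed

text \<open>After multiplication by \<open>W\<close>, the transform of an eigenfunction is
  annihilated by \<open>t - \<tau>\<close>. It lives on the atom, and the isometry reduces to a
  finite-dimensional form.\<close>

lemma ip_eigen:
  fixes t :: real
  assumes c: "P t *v c = 0" and d: "P t *v d = 0"
  shows "ip (\<lambda>x. u x t *v c) (\<lambda>x. u x t *v d) =
     cdot (U (\<lambda>x. u x t *v d) t) (rho_mat \<mu> W {t} *v U (\<lambda>x. u x t *v c) t)"
proof -
  let ?f = "\<lambda>x. u x t *v c" and ?g = "\<lambda>x. u x t *v d"
  have sup: "AE \<tau> in \<mu>. \<tau> \<noteq> t \<longrightarrow> W \<tau> *v U (\<lambda>x. u x t *v c) \<tau> = 0" if "P t *v c = 0" for c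
    using S_U_AE[OF P_eigen_S[OF that]]
  proof eventually_elim
    case (elim \<tau>)
    have "(complex_of_real t - complex_of_real \<tau>) *s (W \<tau> *v U (\<lambda>x. u x t *v c) \<tau>) = 0"
      using elim by (simp add: U_scale u_L2 mv_simps vec.scale_left_diff_distrib)
    thus ?case by auto
  qed
  have "ip ?f ?g = rho.ip (U ?f) (U ?g)"
    using ip_closD_rho[OF domain_closD[OF P_eigen_S[OF c]] domain_closD[OF P_eigen_S[OF d]]] by simp
  also have "\<dots> = (\<integral>\<tau>. indicator {t} \<tau> * cdot (U ?g t) (W \<tau> *v U ?f t) \<partial>\<mu>)"
    unfolding ipw_def
  proof (rule integral_cong_AE)
    show "AE \<tau> in \<mu>. hform (U ?g \<tau>) (W \<tau>) (U ?f \<tau>) = indicator {t} \<tau> * cdot (U ?g t) (W \<tau> *v U ?f t)"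
      using sup[OF c] by eventually_elim (auto simp: hform_def indicator_def)
    show "(\<lambda>\<tau>. hform (U ?g \<tau>) (W \<tau>) (U ?f \<tau>)) \<in> borel_measurable \<mu>"
      by (intro borel_measurable_hform rho.W_measurable rho.L2_measurable U_L2 u_L2)
    show "(\<lambda>\<tau>. indicator {t} \<tau> * cdot (U ?g t) (W \<tau> *v U ?f t)) \<in> borel_measurable \<mu>"
      unfolding mu_measurable
      by (intro borel_measurable_times borel_measurable_bilinear[OF bounded_bilinear_cdot] borel_measurable_mv W_meas) auto
  qed
  also have "\<dots> = cdot (U ?g t) (rho_mat \<mu> W {t} *v U ?f t)" by (rule rho_mat_form[symmetric])
  finally show ?thesis .
qed

text \<open>On \<open>ker P(t)\<close>, the point mass inverts the Gram matrix \<open>\<integral> u\<^sup>* H u\<close>.\<close>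
lemma rho_mat_gram:
  fixes t :: real
  assumes c: "P t *v c = 0"
  shows "rho_mat \<mu> W {t} *v U (\<lambda>x. u x t *v c) t = c"
proof -
  \<comment> \<open>Both terms lie in the kernel of \<open>P t\<close>, so the error is itself the
    coefficient of an eigenfunction and can be tested against that one.\<close>
  define y where "y = rho_mat \<mu> W {t} *v U (\<lambda>x. u x t *v c) t - c"
  let ?g = "\<lambda>x. u x t *v y"
  have y: "P t *v y = 0" using P_rho_mat[of t] c by (simp add: y_def mv_simps)
  have "cdot (U ?g t) (rho_mat \<mu> W {t} *v U (\<lambda>x. u x t *v c) t) = ip (\<lambda>x. u x t *v c) ?g"
    by (rule ip_eigen[OF c y, symmetric])
  also have "\<dots> = cnj (ip ?g (\<lambda>x. u x t *v c))" by (rule ip_cnj[symmetric]) (rule u_L2)+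
  also have "\<dots> = cdot (U ?g t) c" by (simp add: U_cdot[OF u_L2, symmetric] cnj_cdot)
  finally have "cdot (U ?g t) y = 0" by (simp add: y_def cdot_simps)
  hence "ip ?g ?g = 0" using U_cdot[OF u_L2, of y t y t] cnj_cdot[of "U ?g t" y] by simp
  hence "y = 0" by (intro u_zero[of t]) (simp add: N2_def)
  thus ?thesis by (simp add: y_def)
qed

text \<open>Membership in \<open>S\<close> provides only some representative that satisfies the
  condition at \<open>b\<close>; definiteness makes it agree with \<open>u\<close> times
  \<open>c\<close> everywhere.\<close>

lemma eigenfunction_P:
  assumes "(\<lambda>x. u x z *v c, \<lambda>x. z *s (u x z *v c)) \<in> S" shows "P z *v c = 0"
proof -
  obtain f0 where f0: "acsol f0 (\<lambda>x. H x *v (z *s (u x z *v c)))" "N2 (\<lambda>x. u x z *v c - f0 x) = 0" "\<beta> *v f0 b = 0"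
    using assms by (auto simp: S_iff)
  have "acsol (\<lambda>x. u x z *v c - f0 x) (\<lambda>x. H x *v 0)"
    using acsol_diff[OF u_acsol f0(1), of z c] by simp
  from acsol_definite[OF this L2_zero N2_zero f0(2), of b] have "u b z *v c = f0 b" using ab by simp
  thus ?thesis using f0(3) by (simp add: P_def matrix_vector_mul_assoc[symmetric])
qed

text \<open>The point mass applied to \<open>d\<close> is the coefficient vector of an
  eigenfunction, hence a combination of the \<open>c k\<close>. Its coefficients are
  \<open>cdot (c k) d\<close>, because the point mass is hermitian and inverts the Gram
  matrix.\<close>

theorem point_mass:
  fixes t :: real and M :: nat and c :: "nat \<Rightarrow> complex^'n"
  assumes eigen: "\<And>k. k < M \<Longrightarrow> (\<lambda>x. u x t *v c k, \<lambda>x. complex_of_real t *s (u x t *v c k)) \<in> S"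
    and orthonormal: "\<And>k l. k < M \<Longrightarrow> l < M \<Longrightarrow> ip (\<lambda>x. u x t *v c k) (\<lambda>x. u x t *v c l) = (if k = l then 1 else 0)"
    and complete: "\<And>f. (f, \<lambda>x. complex_of_real t *s f x) \<in> S \<Longrightarrow>
      \<exists>d::nat \<Rightarrow> complex. nullH a b H (\<lambda>x. f x - (\<Sum>k<M. d k *s (u x t *v c k)))"
  shows "rho_mat \<mu> W {t} = (\<Sum>k<M. outer (c k))"
proof -
  let ?R = "rho_mat \<mu> W {t}"
  have Pc: "P t *v c k = 0" if "k < M" for k using eigenfunction_P[OF eigen[OF that]] .
  have outer: "outer x *v y = cdot x y *s x" for x y :: "complex^'n"
    by (simp add: outer_def matrix_vector_mult_def cdot_def vec_eq_iff sum_distrib_left mult_ac)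
  have "?R *v d = (\<Sum>k<M. outer (c k)) *v d" for d
  proof -
    define r where "r = ?R *v d"
    have Pr: "P t *v r = 0" unfolding r_def by (rule P_rho_mat)
    obtain e :: "nat \<Rightarrow> complex" where e: "nullH a b H (\<lambda>x. u x t *v r - (\<Sum>k<M. e k *s (u x t *v c k)))"
      using complete[OF P_eigen_S[OF Pr]] by blast
    define s where "s = (\<Sum>k<M. e k *s c k)"
    have us: "(\<Sum>k<M. e k *s (u x t *v c k)) = u x t *v s" for x
      by (simp add: s_def matrix_vector_sum mv_simps)
    have "N2 (\<lambda>x. u x t *v (r - s)) = 0" using e by (simp add: nullH_iff us mv_simps)
    hence rs: "r = s" using u_zero[of t "r - s"] by simp
    have ek: "e k = cdot (c k) d" if k: "k < M" for k
    proof -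
      have "ip (\<lambda>x. u x t *v r) (\<lambda>x. u x t *v c k) = (\<Sum>l<M. e l * ip (\<lambda>x. u x t *v c l) (\<lambda>x. u x t *v c k))"
        unfolding rs us[symmetric]
        by (subst ip_sum_left) (auto intro: L2_scale u_L2 simp: ip_scale_left)
      also have "\<dots> = (\<Sum>l<M. if l = k then e l else 0)"
        using orthonormal k by (intro sum.cong) auto
      also have "\<dots> = e k" using k by simp
      finally have "e k = ip (\<lambda>x. u x t *v r) (\<lambda>x. u x t *v c k)" ..
      also have "\<dots> = cnj (ip (\<lambda>x. u x t *v c k) (\<lambda>x. u x t *v r))" by (rule ip_cnj[symmetric]) (rule u_L2)+
      also have "\<dots> = cdot (U (\<lambda>x. u x t *v c k) t) (?R *v d)"
        by (simp add: U_cdot[OF u_L2, symmetric] cnj_cdot r_def)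
      also have "\<dots> = cdot (?R *v U (\<lambda>x. u x t *v c k) t) d" by (rule rho_mat_hermitian)
      finally show ?thesis by (simp add: rho_mat_gram[OF Pc[OF k]])
    qed
    have "(\<Sum>k<M. outer (c k)) *v d = (\<Sum>k<M. outer (c k) *v d)"
      by (induction M) (simp_all add: matrix_vector_mult_add_rdistrib)
    also have "\<dots> = s" unfolding s_def outer using ek by (intro sum.cong) auto
    finally show ?thesis using rs by (simp add: r_def)
  qed
  thus ?thesis by (simp add: matrix_eq)
qed

end

theorem theorem3p4:
  fixes a b :: real
    and H :: "real \<Rightarrow> complex^('n::finite + 'n)^('n + 'n)"
    and \<alpha> \<beta> :: "complex^('n + 'n)^'n"
    and u v :: "real \<Rightarrow> complex \<Rightarrow> complex^'n^('n + 'n)"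
    and A B :: "complex^'n^'n"
    and \<mu> :: "real measure"
    and W :: "real \<Rightarrow> complex^'n^'n"
  assumes ab: "a < b"
    and H_meas: "set_borel_measurable lebesgue {a<..<b} H"
    and H_nonneg: "AE x in lebesgue. x \<in> {a<..<b} \<longrightarrow> psd (H x)"
    and H_L1: "set_integrable lebesgue {a<..<b} H"
    and H_definite: "\<forall>c. (AE x in lebesgue. x \<in> {a<..<b} \<longrightarrow> H x *v c = 0) \<longrightarrow> c = 0"
    and \<alpha>_norm: "\<alpha> ** adjm \<alpha> = mat 1" and \<beta>_norm: "\<beta> ** adjm \<beta> = mat 1"
    and \<alpha>_J: "\<alpha> ** Jmat ** adjm \<alpha> = 0" and \<beta>_J: "\<beta> ** Jmat ** adjm \<beta> = 0"
    and u_sol: "\<forall>z. AC_on a b (\<lambda>x. u x z) \<and>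
                  (AE x in lebesgue. x \<in> {a<..<b} \<longrightarrow>
                     (\<exists>D. ((\<lambda>y. u y z) has_vector_derivative D) (at x) \<and>
                          Jmat ** D = - (z *sm (H x ** u x z)))) \<and>
                  u a z = - (Jmat ** adjm \<alpha>)"
    and v_sol: "\<forall>z. AC_on a b (\<lambda>x. v x z) \<and>
                  (AE x in lebesgue. x \<in> {a<..<b} \<longrightarrow>
                     (\<exists>D. ((\<lambda>y. v y z) has_vector_derivative D) (at x) \<and>
                          Jmat ** D = - (z *sm (H x ** v x z)))) \<and>
                  v a z = adjm \<alpha>"
    and \<mu>_sets: "sets \<mu> = sets borel"
    and W_meas: "W \<in> borel_measurable borel"
    and W_psd: "AE t in \<mu>. psd (W t)"
    and \<rho>_fin: "\<forall>i j. integrable \<mu> (\<lambda>t. W t $ i $ j / complex_of_real (1 + t\<^sup>2))"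
    and A_herm: "adjm A = A"
    and B_psd: "psd B"
    and herglotz: "\<forall>z. Im z > 0 \<longrightarrow>
        - (matrix_inv (\<beta> ** u b z) ** (\<beta> ** v b z)) = A + z *sm B + herg_int \<mu> W z"
  shows "spectral_rep a b H (Srel a b H \<alpha> \<beta>) \<mu> W (Uop a b H u) \<and>
         (\<forall>(t::real) (M::nat) (c::nat \<Rightarrow> complex^'n).
            M \<ge> 1 \<and>
            (\<forall>k<M. ((\<lambda>x. u x (complex_of_real t) *v c k),
                     (\<lambda>x. complex_of_real t *s (u x (complex_of_real t) *v c k))) \<in> Srel a b H \<alpha> \<beta>) \<and>
            (\<forall>k<M. \<forall>l<M. ipH a b H (\<lambda>x. u x (complex_of_real t) *v c k) (\<lambda>x. u x (complex_of_real t) *v c l)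
                           = (if k = l then 1 else 0)) \<and>
            (\<forall>f. (f, (\<lambda>x. complex_of_real t *s f x)) \<in> Srel a b H \<alpha> \<beta> \<longrightarrow>
                 (\<exists>d::nat \<Rightarrow> complex. nullH a b H
                     (\<lambda>x. f x - (\<Sum>k<M. d k *s (u x (complex_of_real t) *v c k)))))
            \<longrightarrow> rho_mat \<mu> W {t} = (\<Sum>k<M. outer (c k)))"
proof -
  interpret bp: boundary_problem a b H \<alpha> \<beta> u v
    by unfold_locales (fact ab H_meas H_nonneg H_L1 H_definite \<alpha>_norm \<beta>_norm \<alpha>_J \<beta>_J u_sol v_sol)+
  interpret herglotz_problem a b H \<alpha> \<beta> u v A B \<mu> W
  proof unfold_locales
    show "bp.m z = A + z *sm B + herg_int \<mu> W z" if "Im z > 0" for z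
      using herglotz that by (simp add: bp.m_def bp.P_def bp.Q_def)
  qed (fact \<mu>_sets W_meas W_psd \<rho>_fin A_herm B_psd)+
  show ?thesis
  proof (intro conjI allI impI spectral_representation)
    fix t :: real and M :: nat and c :: "nat \<Rightarrow> complex^'n"
    assume "M \<ge> 1 \<and>
            (\<forall>k<M. ((\<lambda>x. u x (complex_of_real t) *v c k),
                     (\<lambda>x. complex_of_real t *s (u x (complex_of_real t) *v c k))) \<in> Srel a b H \<alpha> \<beta>) \<and>
            (\<forall>k<M. \<forall>l<M. ipH a b H (\<lambda>x. u x (complex_of_real t) *v c k) (\<lambda>x. u x (complex_of_real t) *v c l)
                           = (if k = l then 1 else 0)) \<and>
            (\<forall>f. (f, (\<lambda>x. complex_of_real t *s f x)) \<in> Srel a b H \<alpha> \<beta> \<longrightarrow>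
                 (\<exists>d::nat \<Rightarrow> complex. nullH a b H
                     (\<lambda>x. f x - (\<Sum>k<M. d k *s (u x (complex_of_real t) *v c k)))))"
    thus "rho_mat \<mu> W {t} = (\<Sum>k<M. outer (c k))"
      by (intro point_mass) (auto simp: bp.ipH_eq)
  qed
qed

end
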